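(* Let $\Phi:\mathcal H\to\mathbb R\cup\{+\infty\}$ be convex, lower semicontinuous, with nonempty effective domain and bounded from below. Let $\Psi:(0,T]\times\mathcal H\to\mathcal H$ satisfy: 1. (Carathéodory) for every $w\in\mathcal H$ the mapping $t\mapsto\Psi(t,w)$ is strongly measurable on $(0,T)$ with values in $\mathcal H$, and there exists $\mathfrak L>0$ such that for almost every $t\in(0,T)$ and every $w_1,w_2\in\mathcal H$, $\|\Psi(t,w_1)-\Psi(t,w_2)\|\le\mathfrak L\|w_1-w_2\|$; 2. (Integrability) there is $w_0\in L^2_\alpha(0,T;\mathcal H)$ for which $t\mapsto\Psi(t,w_0(t))$ belongs to $L^2_\alpha(0,T;\mathcal H)$. Let $u_0\in D(\Phi)$ and $f\in L^2_\alpha(0,T;\mathcal H)$. Then there is a unique energy solution $u$ of $$D_c^\alpha u(t)+\partial\Phi(u(t))+\Psi(t,u(t))\ni f(t),\quad t\in(0,T],\qquad u(0)=u_0.$$ Moreover, this solution satisfies $\|D_c^\alpha u\|_{L^2_\alpha(0,T;\mathcal H)}\le C$, where the constant $C$ depends only on the problem data $\alpha,T,u_0,f,\Phi$ and $\Psi$.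
   Context: Setting: $T\in(0,\infty)$, $\alpha\in(0,1)$, $\mathcal H$ is a separable real Hilbert space with norm $\|\cdot\|$. $D(\Phi)=\{w\in\mathcal H:\Phi(w)<+\infty\}$, $\partial\Phi(w)=\{\xi:\langle\xi,v-w\rangle\le\Phi(v)-\Phi(w)\ \forall v\in\mathcal H\}$. $\|w\|_{L^p_\alpha(0,T;\mathcal H)}=\sup_{t\in[0,T]}\big(\int_0^t(t-s)^{\alpha-1}\|w(s)\|^p\,ds\big)^{1/p}$, and $L^p_\alpha(0,T;\mathcal H)$ is the space of (strongly measurable) functions for which this is finite. Generalized Caputo derivative: for $w\in L^1_{loc}([0,T);\mathcal H)$ with initial value $w_0\in\mathcal H$, $D_c^\alpha w$ is the distributional derivative on $(-\infty,T)$ of the function equal to $\frac1{\Gamma(1-\alpha)}\int_0^t(t-s)^{-\alpha}(w(s)-w_0)\,ds$ for $t\ge0$ and $0$ for $t<0$; if $\lim_{t\downarrow0}\frac1t\int_0^t\|w(s)-w(0)\|ds=0$ for some $w(0)\in\mathcal H$, then $w_0=w(0)$. Energy solution of the perturbed problem: $u\in L^2(0,T;\mathcal H)$ such that (i) $\lim_{t\downarrow0}\frac1t\int_0^t\|u(s)-u_0\|^2ds=0$; (ii) $D_c^\alpha u\in L^2(0,T;\mathcal H)$; (iii) $D_c^\alpha u(t)+\partial\Phi(u(t))+\Psi(t,u(t))\ni f(t)$ for almost every $t\in(0,T)$. *)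

theory Defs
  imports "HOL-Analysis.Analysis"
begin

text \<open>
  A separable real Hilbert space is a type of sort
  \<open>{real_inner, banach, second_countable_topology}\<close>. Functions on an interval are total functions
  on \<^typ>\<open>real\<close> whose values outside that interval are irrelevant. As the target is separable,
  strong measurability on \<open>(0,T)\<close> is measurability with respect to
  \<^term>\<open>lebesgue_on {0<..<T}\<close>, and the vector-valued integrals below are Bochner integrals.
\<close>

subsection \<open>Convex analysis\<close>

definition effective_domain :: "('a \<Rightarrow> ereal) \<Rightarrow> 'a set" where
  "effective_domain \<Phi> = {w. \<Phi> w < \<infinity>}"

text \<open>No \<open>\<infinity> - \<infinity>\<close> can arise on the right-hand side for functionals not taking the value \<open>-\<infinity>\<close>.\<close>

definition ereal_convex :: "('a::real_vector \<Rightarrow> ereal) \<Rightarrow> bool" where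
  "ereal_convex \<Phi> \<longleftrightarrow>
     (\<forall>x y. \<forall>a\<ge>0. \<forall>b\<ge>0. a + b = 1 \<longrightarrow>
        \<Phi> (a *\<^sub>R x + b *\<^sub>R y) \<le> ereal a * \<Phi> x + ereal b * \<Phi> y)"

definition lower_semicontinuous :: "('a::topological_space \<Rightarrow> ereal) \<Rightarrow> bool" where
  "lower_semicontinuous \<Phi> \<longleftrightarrow> (\<forall>w. \<Phi> w \<le> Liminf (nhds w) \<Phi>)"

text \<open>In \<^typ>\<open>ereal\<close>, \<open>\<infinity> - \<infinity> = \<infinity>\<close> and \<open>r - \<infinity> = -\<infinity>\<close> for real \<open>r\<close>. So for \<open>\<Phi>\<close> with
  nonempty effective domain the subdifferential is empty outside that domain, as it should be.\<close>

definition subdifferential :: "('a::real_inner \<Rightarrow> ereal) \<Rightarrow> 'a \<Rightarrow> 'a set" where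
  "subdifferential \<Phi> w = {\<xi>. \<forall>v. ereal (inner \<xi> (v - w)) \<le> \<Phi> v - \<Phi> w}"

subsection \<open>Function spaces\<close>

text \<open>Only used with \<open>a > 0\<close>.\<close>

definition ennreal_powr :: "ennreal \<Rightarrow> real \<Rightarrow> ennreal" where
  "ennreal_powr x a = (if x = top then top else ennreal (enn2real x powr a))"

definition Lp_alpha_norm :: "real \<Rightarrow> real \<Rightarrow> real \<Rightarrow> (real \<Rightarrow> 'a::real_normed_vector) \<Rightarrow> ennreal" where
  "Lp_alpha_norm p \<alpha> T w =
     (SUP t\<in>{0..T}. ennreal_powr
        (\<integral>\<^sup>+ s\<in>{0..t}. ennreal ((t - s) powr (\<alpha> - 1) * norm (w s) powr p) \<partial>lebesgue) (1 / p))"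

definition Lp_alpha :: "real \<Rightarrow> real \<Rightarrow> real \<Rightarrow> (real \<Rightarrow> 'a::real_normed_vector) set" where
  "Lp_alpha p \<alpha> T =
     {w. w \<in> borel_measurable (lebesgue_on {0<..<T}) \<and> Lp_alpha_norm p \<alpha> T w < \<infinity>}"

definition L2_space :: "real \<Rightarrow> (real \<Rightarrow> 'a::real_normed_vector) set" where
  "L2_space T =
     {w. w \<in> borel_measurable (lebesgue_on {0<..<T}) \<and>
         integrable (lebesgue_on {0<..<T}) (\<lambda>t. (norm (w t))\<^sup>2)}"

definition locally_integrable ::
  "real set \<Rightarrow> (real \<Rightarrow> 'a::{banach, second_countable_topology}) \<Rightarrow> bool" where
  "locally_integrable S w \<longleftrightarrow> (\<forall>K. compact K \<and> K \<subseteq> S \<longrightarrow> set_integrable lebesgue K w)"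

subsection \<open>The generalized Caputo derivative\<close>

definition test_functions :: "real \<Rightarrow> (real \<Rightarrow> real) set" where
  "test_functions T =
     {\<phi>. (\<forall>n. (deriv ^^ n) \<phi> differentiable_on UNIV) \<and>
         compact (closure (support_on UNIV \<phi>)) \<and> closure (support_on UNIV \<phi>) \<subseteq> {..<T}}"

text \<open>\<open>G\<close> represents the distributional derivative of \<open>F\<close> on \<open>(-\<infinity>,T)\<close>.\<close>

definition has_distributional_derivative ::
  "real \<Rightarrow> (real \<Rightarrow> 'a::{banach, second_countable_topology}) \<Rightarrow> (real \<Rightarrow> 'a) \<Rightarrow> bool" where
  "has_distributional_derivative T F G \<longleftrightarrow>
     locally_integrable {..<T} F \<and> locally_integrable {..<T} G \<and>
     (\<forall>\<phi>\<in>test_functions T.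
        - (LINT t:{..<T}|lebesgue. deriv \<phi> t *\<^sub>R F t) = (LINT t:{..<T}|lebesgue. \<phi> t *\<^sub>R G t))"

definition caputo_primitive ::
  "real \<Rightarrow> (real \<Rightarrow> 'a::{banach, second_countable_topology}) \<Rightarrow> 'a \<Rightarrow> real \<Rightarrow> 'a" where
  "caputo_primitive \<alpha> w w0 t =
     (if t < 0 then 0
      else (1 / Gamma (1 - \<alpha>)) *\<^sub>R
             (LINT s:{0..t}|lebesgue. (t - s) powr (- \<alpha>) *\<^sub>R (w s - w0)))"

text \<open>\<open>D\<^sub>c\<^sup>\<alpha> w\<close>, taken with initial value \<open>w0\<close>, is a distribution on \<open>(-\<infinity>,T)\<close> vanishing for
  \<open>t < 0\<close>; it is a function \<open>g\<close> on \<open>(0,T)\<close> if it is represented by the extension of \<open>g\<close> by zero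
  (in particular it has no atom at \<open>0\<close>). Such a \<open>g\<close> is determined almost everywhere on \<open>(0,T)\<close>.\<close>

definition has_caputo_derivative ::
  "real \<Rightarrow> real \<Rightarrow> (real \<Rightarrow> 'a::{banach, second_countable_topology}) \<Rightarrow> 'a \<Rightarrow> (real \<Rightarrow> 'a) \<Rightarrow> bool"
  where
  "has_caputo_derivative \<alpha> T w w0 g \<longleftrightarrow>
     locally_integrable {0..<T} w \<and>
     has_distributional_derivative T (caputo_primitive \<alpha> w w0) (\<lambda>t. if t < 0 then 0 else g t)"

subsection \<open>Energy solutions\<close>

text \<open>The first limit forces the initial value in the Caputo derivative of \<open>u\<close> to be \<open>u0\<close>.\<close>

definition energy_solution ::
  "real \<Rightarrow> real \<Rightarrow> ('a::{real_inner, banach, second_countable_topology} \<Rightarrow> ereal) \<Rightarrow>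
   (real \<Rightarrow> 'a \<Rightarrow> 'a) \<Rightarrow> (real \<Rightarrow> 'a) \<Rightarrow> 'a \<Rightarrow> (real \<Rightarrow> 'a) \<Rightarrow> bool" where
  "energy_solution \<alpha> T \<Phi> \<Psi> f u0 u \<longleftrightarrow>
     u \<in> L2_space T \<and>
     ((\<lambda>t. (1 / t) * (LINT s:{0..t}|lebesgue. (norm (u s - u0))\<^sup>2)) \<longlongrightarrow> 0) (at_right 0) \<and>
     (\<exists>g. has_caputo_derivative \<alpha> T u u0 g \<and> g \<in> L2_space T \<and>
          (AE t in lebesgue_on {0<..<T}.
             \<exists>\<xi>\<in>subdifferential \<Phi> (u t). g t + \<xi> + \<Psi> t (u t) = f t))"

subsection \<open>Hypotheses on the perturbation\<close>

definition caratheodory_lipschitz ::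
  "real \<Rightarrow> (real \<Rightarrow> 'a::real_normed_vector \<Rightarrow> 'a) \<Rightarrow> bool" where
  "caratheodory_lipschitz T \<Psi> \<longleftrightarrow>
     (\<forall>w. (\<lambda>t. \<Psi> t w) \<in> borel_measurable (lebesgue_on {0<..<T})) \<and>
     (\<exists>L>0. AE t in lebesgue_on {0<..<T}.
        \<forall>w1 w2. norm (\<Psi> t w1 - \<Psi> t w2) \<le> L * norm (w1 - w2))"

end

(*
  Write kappa for the kernel t^(alpha-1)/Gamma(alpha). Functions u with Caputo derivative g are exactly
  u = u0 + kappa * g (Abel inversion), so the problem becomes g(t) + xi(t) = Theta(t, u(t)) with xi(t) in the
  subdifferential of Phi at u(t) and Theta(t, x) = f(t) - Psi(t, x). Replacing the subdifferential by its Yosida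
  approximations gives Lipschitz Volterra equations. The inequality

    F(u(t)) - F(u0) <= (kappa * <g, grad F(u)>)(t)    (F convex with Lipschitz gradient),

  applied to Moreau envelopes of Phi, bounds kappa * |g|^2 uniformly, which is the claimed estimate; applied to
  |.|^2 / 2 and differences of solutions, it shows that the approximations converge uniformly. Midpoint-closed sets
  of approximate derivatives, minimized in norm, then yield an almost everywhere convergent sequence of derivatives,
  and the inclusion survives by lower semicontinuity. The same inequality applied to the difference of two energy
  solutions, integrated against exp(-mu t) with mu large, gives uniqueness.
*)
theory Submission
  imports Defs
begin

section \<open>Convolution\<close>

text \<open>A fractional derivative obeys no chain rule, which is the obstacle to energy estimates.
  An inequality survives because the Marchaud form of the derivative is an integral of differences
  w(s) - w(r) against a positive kernel, and convexity applies to each difference; truncating the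
  singularity of that kernel keeps every integral finite. Writing u - u0 as kappa * g from the start
  turns the problem into one about causal convolutions on the whole line of functions supported in
  (0,T), where associativity of kernels is Tonelli's theorem. The exponential exp(mu s) is an
  eigenfunction of convolution with kappa, with eigenvalue mu^(-alpha). A large mu therefore makes
  the Volterra and Gronwall arguments contract over the whole interval at once, and mu = 1/t gives
  the bound e t^alpha for the convolution of kappa with 1. The energy kappa * |g|^2 is bounded at
  every time t; up to the factor Gamma(alpha) this is the square of the norm of L^2_alpha, so the
  claimed estimate is the one that also drives the limit passage.\<close>

definition nconv :: "(real \<Rightarrow> real) \<Rightarrow> (real \<Rightarrow> ennreal) \<Rightarrow> real \<Rightarrow> ennreal" where
  "nconv k h t = (\<integral>\<^sup>+ s. ennreal (k (t - s)) * h s \<partial>lborel)"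

text \<open>Where the integrand is not integrable the Bochner integral is 0, so this is total;
  finiteness of \<open>nconv\<close> applied to the norm decides integrability for nonnegative
  kernels.\<close>

definition conv ::
  "(real \<Rightarrow> real) \<Rightarrow> (real \<Rightarrow> 'a::{banach, second_countable_topology}) \<Rightarrow> real \<Rightarrow> 'a" where
  "conv k h t = (LINT s|lborel. k (t - s) *\<^sub>R h s)"

lemma nconv_measurable [measurable]:
  assumes [measurable]: "k \<in> borel_measurable borel" "h \<in> borel_measurable borel"
  shows "nconv k h \<in> borel_measurable borel"
  unfolding nconv_def by measurable

lemma conv_measurable [measurable]:
  fixes h :: "real \<Rightarrow> 'a::{banach, second_countable_topology}"
  assumes [measurable]: "k \<in> borel_measurable borel" "h \<in> borel_measurable borel"
  shows "conv k h \<in> borel_measurable borel"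
  unfolding conv_def by measurable

lemma nconv_mono: "(\<And>s. h s \<le> h' s) \<Longrightarrow> nconv k h t \<le> nconv k h' t"
  unfolding nconv_def by (intro nn_integral_mono mult_left_mono) auto

lemma nconv_mono_AE: "AE s in lborel. h s \<le> h' s \<Longrightarrow> nconv k h t \<le> nconv k h' t"
  unfolding nconv_def by (rule nn_integral_mono_AE) (auto elim!: eventually_mono intro: mult_left_mono)

lemma nconv_add:
  assumes [measurable]: "k \<in> borel_measurable borel" "h \<in> borel_measurable borel" "h' \<in> borel_measurable borel"
  shows "nconv k (\<lambda>s. h s + h' s) t = nconv k h t + nconv k h' t"
  unfolding nconv_def by (simp add: distrib_left nn_integral_add)

lemma nconv_cmult:
  assumes [measurable]: "k \<in> borel_measurable borel" "h \<in> borel_measurable borel"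
  shows "nconv k (\<lambda>s. c * h s) t = c * nconv k h t"
  unfolding nconv_def by (simp add: nn_integral_cmult[symmetric] mult.left_commute)

text \<open>Tonelli's theorem and translation invariance. The product of the kernels enters only
  through its values \<open>c\<close>, so one lemma serves both the Beta identity and the truncated
  kernel.\<close>

lemma nconv_assoc:
  assumes [measurable]: "a \<in> borel_measurable borel" "b \<in> borel_measurable borel"
      "c \<in> borel_measurable borel" "h \<in> borel_measurable borel"
    and c: "\<And>x. nconv a (\<lambda>s. ennreal (b s)) x = ennreal (c x)"
  shows "nconv a (nconv b h) t = nconv c h t"
proof -
  have "nconv a (nconv b h) t
      = (\<integral>\<^sup>+ s. (\<integral>\<^sup>+ r. ennreal (a (t - s)) * (ennreal (b (s - r)) * h r) \<partial>lborel) \<partial>lborel)"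
    unfolding nconv_def by (simp add: nn_integral_cmult)
  also have "\<dots> = (\<integral>\<^sup>+ r. (\<integral>\<^sup>+ s. ennreal (a (t - s)) * (ennreal (b (s - r)) * h r) \<partial>lborel) \<partial>lborel)"
    by (rule lborel_pair.Fubini') measurable
  also have "\<dots> = (\<integral>\<^sup>+ r. ennreal (c (t - r)) * h r \<partial>lborel)"
  proof (rule nn_integral_cong)
    fix r
    have "(\<integral>\<^sup>+ s. ennreal (a (t - s)) * (ennreal (b (s - r)) * h r) \<partial>lborel)
       = (\<integral>\<^sup>+ s. ennreal (a (t - s)) * ennreal (b (s - r)) \<partial>lborel) * h r"
      by (simp add: nn_integral_multc[symmetric] mult.assoc)
    also have "(\<integral>\<^sup>+ s. ennreal (a (t - s)) * ennreal (b (s - r)) \<partial>lborel)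
       = (\<integral>\<^sup>+ s. ennreal (a (t - r - s)) * ennreal (b s) \<partial>lborel)"
      by (subst nn_integral_real_affine[where c = 1 and t = r]) (auto simp: algebra_simps)
    also have "\<dots> = ennreal (c (t - r))"
      using c[of "t - r"] by (simp add: nconv_def)
    finally show "(\<integral>\<^sup>+ s. ennreal (a (t - s)) * (ennreal (b (s - r)) * h r) \<partial>lborel)
       = ennreal (c (t - r)) * h r" .
  qed
  finally show ?thesis by (simp add: nconv_def)
qed

lemma nconv_commute:
  assumes [measurable]: "a \<in> borel_measurable borel" "b \<in> borel_measurable borel"
  shows "nconv a (\<lambda>s. ennreal (b s)) t = nconv b (\<lambda>s. ennreal (a s)) t"
  unfolding nconv_def
  by (subst nn_integral_real_affine[where c = "-1" and t = t]) (auto simp: algebra_simps)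

lemma integrable_conv_iff:
  fixes h :: "real \<Rightarrow> 'a::{banach, second_countable_topology}"
  assumes [measurable]: "k \<in> borel_measurable borel" "h \<in> borel_measurable borel"
    and "\<And>x. 0 \<le> k x"
  shows "integrable lborel (\<lambda>s. k (t - s) *\<^sub>R h s) \<longleftrightarrow> nconv k (\<lambda>s. ennreal (norm (h s))) t < \<infinity>"
  using assms(3) unfolding integrable_iff_bounded nconv_def by (simp add: ennreal_mult)

lemma norm_conv_le:
  fixes h :: "real \<Rightarrow> 'a::{banach, second_countable_topology}"
  assumes [measurable]: "k \<in> borel_measurable borel" "h \<in> borel_measurable borel"
    and "\<And>x. 0 \<le> k x"
  shows "ennreal (norm (conv k h t)) \<le> nconv k (\<lambda>s. ennreal (norm (h s))) t"
proof (cases "integrable lborel (\<lambda>s. k (t - s) *\<^sub>R h s)")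
  case True
  then have "ennreal (norm (conv k h t)) \<le> (\<integral>\<^sup>+ s. ennreal (norm (k (t - s) *\<^sub>R h s)) \<partial>lborel)"
    unfolding conv_def by (rule integral_norm_bound_ennreal)
  then show ?thesis using assms(3) by (simp add: nconv_def ennreal_mult)
next
  \<comment> \<open>Without integrability the left side is 0 by the convention for the Bochner
    integral.\<close>
  case False
  then show ?thesis by (simp add: conv_def not_integrable_integral_eq)
qed

text \<open>Since all kernels are nonnegative, \<open>nconv_assoc\<close> reduces the integrability
  that Fubini's theorem asks for to finiteness of one convolution at the single point
  \<open>t\<close>. The inner convolution may fail to converge at other points.\<close>

lemma conv_assoc:
  fixes h :: "real \<Rightarrow> 'a::{banach, second_countable_topology}"
  assumes [measurable]: "a \<in> borel_measurable borel" "b \<in> borel_measurable borel"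
      "c \<in> borel_measurable borel" "h \<in> borel_measurable borel"
    and nn: "\<And>x. 0 \<le> a x" "\<And>x. 0 \<le> b x" "\<And>x. 0 \<le> c x"
    and c: "\<And>x. nconv a (\<lambda>s. ennreal (b s)) x = ennreal (c x)"
    and fin: "nconv c (\<lambda>s. ennreal (norm (h s))) t < \<infinity>"
  shows "conv a (conv b h) t = conv c h t"
proof -
  have int: "integrable (lborel \<Otimes>\<^sub>M lborel) (\<lambda>(s, r). (a (t - s) * b (s - r)) *\<^sub>R h r)"
  proof (rule integrableI_bounded)
    have "(\<integral>\<^sup>+ p. ennreal (norm (case p of (s, r) \<Rightarrow> (a (t - s) * b (s - r)) *\<^sub>R h r)) \<partial>(lborel \<Otimes>\<^sub>M lborel))
      = (\<integral>\<^sup>+ s. \<integral>\<^sup>+ r. ennreal (norm ((a (t - s) * b (s - r)) *\<^sub>R h r)) \<partial>lborel \<partial>lborel)"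
      by (subst lborel.nn_integral_fst[symmetric]) auto
    also have "\<dots> = nconv a (nconv b (\<lambda>s. ennreal (norm (h s)))) t"
      unfolding nconv_def using nn
      by (simp add: nn_integral_cmult[symmetric] ennreal_mult mult.assoc)
    also have "\<dots> = nconv c (\<lambda>s. ennreal (norm (h s))) t"
      by (rule nconv_assoc) (use c in auto)
    finally show "(\<integral>\<^sup>+ p. ennreal (norm (case p of (s, r) \<Rightarrow> (a (t - s) * b (s - r)) *\<^sub>R h r))
        \<partial>(lborel \<Otimes>\<^sub>M lborel)) < \<infinity>" using fin by simp
  qed measurable
  have "conv a (conv b h) t = (LINT s|lborel. LINT r|lborel. (a (t - s) * b (s - r)) *\<^sub>R h r)"
    unfolding conv_def
    by (simp flip: scaleR_scaleR)
  also have "\<dots> = (LINT r|lborel. LINT s|lborel. (a (t - s) * b (s - r)) *\<^sub>R h r)"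
    by (rule lborel_pair.Fubini_integral[symmetric]) (rule int)
  also have "\<dots> = (LINT r|lborel. c (t - r) *\<^sub>R h r)"
  proof (rule Bochner_Integration.integral_cong)
    fix r
    have "(\<integral>\<^sup>+ s. ennreal (a (t - s) * b (s - r)) \<partial>lborel)
       = (\<integral>\<^sup>+ s. ennreal (a (t - r - s)) * ennreal (b s) \<partial>lborel)"
      by (subst nn_integral_real_affine[where c = 1 and t = r]) (auto simp: algebra_simps nn ennreal_mult)
    also have "\<dots> = ennreal (c (t - r))"
      using c[of "t - r"] by (simp add: nconv_def)
    finally have "has_bochner_integral lborel (\<lambda>s. a (t - s) * b (s - r)) (c (t - r))"
      by (intro has_bochner_integral_nn_integral) (auto simp: nn)
    then show "(LINT s|lborel. (a (t - s) * b (s - r)) *\<^sub>R h r) = c (t - r) *\<^sub>R h r"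
      by (intro has_bochner_integral_integral_eq has_bochner_integral_scaleR_left)
  qed simp
  finally show ?thesis by (simp add: conv_def)
qed

text \<open>The fractional kernel has infinite integral over the line, so the first factor keeps the
  indicator of a set carrying \<open>h\<close>.\<close>

lemma nconv_Cauchy_Schwarz:
  assumes [measurable]: "k \<in> borel_measurable borel" "h \<in> borel_measurable borel" "S \<in> sets borel"
    and k: "\<And>x. 0 \<le> k x" and supp: "\<And>s. s \<notin> S \<Longrightarrow> h s = 0"
  shows "(nconv k h t)\<^sup>2 \<le> nconv k (indicator S) t * nconv k (\<lambda>s. (h s)\<^sup>2) t"
proof -
  have sq: "(ennreal (sqrt (k x)))\<^sup>2 = ennreal (k x)" for x
    using k by (simp add: ennreal_power)
  have "nconv k h t = (\<integral>\<^sup>+ s. (ennreal (sqrt (k (t - s))) * indicator S s) * (ennreal (sqrt (k (t - s))) * h s) \<partial>lborel)"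
    unfolding nconv_def
  proof (rule nn_integral_cong)
    fix s
    show "ennreal (k (t - s)) * h s = (ennreal (sqrt (k (t - s))) * indicator S s) * (ennreal (sqrt (k (t - s))) * h s)"
      using sq[of "t - s"] supp[of s] by (auto simp: power2_eq_square mult_ac split: split_indicator)
  qed
  then have "(nconv k h t)\<^sup>2 \<le> (\<integral>\<^sup>+ s. (ennreal (sqrt (k (t - s))) * indicator S s)\<^sup>2 \<partial>lborel)
      * (\<integral>\<^sup>+ s. (ennreal (sqrt (k (t - s))) * h s)\<^sup>2 \<partial>lborel)"
    by (simp only:) (rule Cauchy_Schwarz_nn_integral; measurable)
  also have "\<dots> = nconv k (indicator S) t * nconv k (\<lambda>s. (h s)\<^sup>2) t"
    unfolding nconv_def power_mult_distrib sq
    by (intro arg_cong2[where f = "(*)"] nn_integral_cong) (auto split: split_indicator)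
  finally show ?thesis .
qed

section \<open>Continuity of translations\<close>

text \<open>Stated with sequences of shifts, the form in which dominated convergence applies. It is
  needed to pass to the limit in pairings of a merely bounded function with translates of an
  integrable one.\<close>

definition L1_translation_continuous :: "(real \<Rightarrow> 'a::{banach, second_countable_topology}) \<Rightarrow> bool" where
  "L1_translation_continuous f \<longleftrightarrow>
     (\<forall>d::nat \<Rightarrow> real. d \<longlonglongrightarrow> 0 \<longrightarrow> (\<lambda>n. LINT x|lborel. norm (f (d n + x) - f x)) \<longlonglongrightarrow> 0)"

lemma integrable_translate:
  fixes f :: "real \<Rightarrow> 'a::{banach, second_countable_topology}"
  shows "integrable lborel f \<Longrightarrow> integrable lborel (\<lambda>x. f (t + x))"
  using lborel_integrable_real_affine[of f 1 t] by simp

lemma integral_translate: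
  fixes f :: "real \<Rightarrow> 'a::{banach, second_countable_topology}"
  shows "(LINT x|lborel. f (t + x)) = (LINT x|lborel. f x)"
  using lborel_integral_real_affine[of 1 f t] by simp

text \<open>The error of the approximation and its translate have the same integral; together with
  the approximant's own modulus this makes three terms, each below r / 3.\<close>

lemma L1_translation_continuous_approx:
  fixes f :: "real \<Rightarrow> 'a::{banach, second_countable_topology}"
  assumes f: "integrable lborel f"
    and approx: "\<And>e. 0 < e \<Longrightarrow>
      \<exists>g. integrable lborel g \<and> L1_translation_continuous g \<and> (LINT x|lborel. norm (f x - g x)) < e"
  shows "L1_translation_continuous f"
  unfolding L1_translation_continuous_def
proof (intro allI impI LIMSEQ_I)
  fix d :: "nat \<Rightarrow> real" and r :: real
  assume d: "d \<longlonglongrightarrow> 0" and r: "0 < r"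
  obtain g where g: "integrable lborel g" "L1_translation_continuous g"
      "(LINT x|lborel. norm (f x - g x)) < r / 3"
    using approx[of "r / 3"] r by auto
  obtain N where N: "\<And>n. n \<ge> N \<Longrightarrow> norm ((LINT x|lborel. norm (g (d n + x) - g x)) - 0) < r / 3"
    using LIMSEQ_D[OF g(2)[unfolded L1_translation_continuous_def, rule_format, OF d], of "r / 3"] r by auto
  have "(LINT x|lborel. norm (f (d n + x) - f x)) < r" if "n \<ge> N" for n
  proof -
    have fg: "integrable lborel (\<lambda>x. norm (f x - g x))" using f g by auto
    have i1: "integrable lborel (\<lambda>x. norm (g (d n + x) - g x))"
      using g by (intro integrable_norm Bochner_Integration.integrable_diff integrable_translate)
    have i2: "integrable lborel (\<lambda>x. norm (f (d n + x) - g (d n + x)))"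
      using integrable_translate[OF fg] .
    have "(LINT x|lborel. norm (f (d n + x) - f x))
        \<le> (LINT x|lborel. norm (f (d n + x) - g (d n + x)) + norm (g (d n + x) - g x) + norm (f x - g x))"
    proof (rule integral_mono)
      show "integrable lborel (\<lambda>x. norm (f (d n + x) - f x))"
        using f by (intro integrable_norm Bochner_Integration.integrable_diff integrable_translate)
      show "norm (f (d n + x) - f x)
          \<le> norm (f (d n + x) - g (d n + x)) + norm (g (d n + x) - g x) + norm (f x - g x)" for x
        using norm_triangle_ineq[of "f (d n + x) - g (d n + x)" "g (d n + x) - g x"]
          norm_triangle_ineq4[of "f (d n + x) - g x" "f x - g x"] by simp
    qed (use fg i1 i2 in auto)
    also have "\<dots> = (LINT x|lborel. norm (f (d n + x) - g (d n + x)))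
        + (LINT x|lborel. norm (g (d n + x) - g x)) + (LINT x|lborel. norm (f x - g x))"
      using fg i1 i2 by simp
    also have "(LINT x|lborel. norm (f (d n + x) - g (d n + x))) = (LINT x|lborel. norm (f x - g x))"
      by (rule integral_translate)
    also have "\<dots> + (LINT x|lborel. norm (g (d n + x) - g x)) + (LINT x|lborel. norm (f x - g x)) < r"
      using g(3) N[OF that] by (simp add: abs_less_iff)
    finally show ?thesis .
  qed
  then show "\<exists>N. \<forall>n\<ge>N. norm ((LINT x|lborel. norm (f (d n + x) - f x)) - 0) < r"
    by (intro exI[of _ N]) (auto simp: abs_of_nonneg)
qed

text \<open>Openness keeps the translates of a point of \<open>U\<close> in \<open>U\<close>
  eventually, so one half of the symmetric difference shrinks by dominated convergence. The other
  half has the same measure, because translation preserves the measure of \<open>U\<close>.\<close>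

lemma L1_translation_continuous_indicator_open:
  fixes U :: "real set"
  assumes U: "open U" "emeasure lborel U < \<infinity>"
  shows "L1_translation_continuous (\<lambda>x. indicator U x *\<^sub>R c)"
  unfolding L1_translation_continuous_def
proof (intro allI impI)
  fix d :: "nat \<Rightarrow> real"
  assume d: "d \<longlonglongrightarrow> 0"
  let ?u = "\<lambda>x. indicator U x :: real"
  have [measurable]: "U \<in> sets borel" using U by simp
  have int: "integrable lborel ?u" using U by (simp add: integrable_indicator_iff)
  have intd: "integrable lborel (\<lambda>x. ?u (d n + x))" for n by (rule integrable_translate[OF int])
  have int2: "integrable lborel (\<lambda>x. ?u x * (1 - ?u (d n + x)))" for n
    by (rule Bochner_Integration.integrable_bound[OF int]) (auto split: split_indicator)
  have lim: "(\<lambda>n. LINT x|lborel. ?u x * (1 - ?u (d n + x))) \<longlonglongrightarrow> (LINT x|(lborel::real measure). (0::real))"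
  proof (rule integral_dominated_convergence[where w = ?u])
    show "AE x in lborel. (\<lambda>n. ?u x * (1 - ?u (d n + x))) \<longlonglongrightarrow> 0"
    proof (rule AE_I2)
      fix x :: real
      show "(\<lambda>n. ?u x * (1 - ?u (d n + x))) \<longlonglongrightarrow> 0"
      proof (cases "x \<in> U")
        case True
        have "(\<lambda>n. d n + x) \<longlonglongrightarrow> x" using tendsto_add[OF d tendsto_const[of x]] by simp
        then have "\<forall>\<^sub>F n in sequentially. d n + x \<in> U"
          using U(1) True by (rule topological_tendstoD)
        then show ?thesis by (intro tendsto_eventually) (erule eventually_mono, simp)
      qed simp
    qed
  qed (use int in \<open>auto split: split_indicator\<close>)
  have "(LINT x|lborel. norm (?u (d n + x) *\<^sub>R c - ?u x *\<^sub>R c))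
      = norm c * (2 * (LINT x|lborel. ?u x * (1 - ?u (d n + x))))" for n
  proof -
    \<comment> \<open>For values u, u' in {0,1} one has |u' - u| = 2 u (1 - u') + (u' - u), and the
      last bracket integrates to 0.\<close>
    have "(LINT x|lborel. norm (?u (d n + x) *\<^sub>R c - ?u x *\<^sub>R c))
      = (LINT x|lborel. norm c * (2 * (?u x * (1 - ?u (d n + x))) + (?u (d n + x) - ?u x)))"
      by (intro Bochner_Integration.integral_cong) (auto split: split_indicator)
    also have "\<dots> = norm c * (2 * (LINT x|lborel. ?u x * (1 - ?u (d n + x)))
        + ((LINT x|lborel. ?u (d n + x)) - (LINT x|lborel. ?u x)))"
      using int intd int2 by (simp del: indicator_simps)
    also have "(LINT x|lborel. ?u (d n + x)) = (LINT x|lborel. ?u x)"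
      by (rule integral_translate)
    finally show ?thesis by simp
  qed
  then show "(\<lambda>n. LINT x|lborel. norm (?u (d n + x) *\<^sub>R c - ?u x *\<^sub>R c)) \<longlonglongrightarrow> 0"
    using tendsto_mult_left[OF tendsto_mult_left[OF lim, of 2], of "norm c"] by simp
qed

theorem L1_translation_continuous:
  fixes f :: "real \<Rightarrow> 'a::{banach, second_countable_topology}"
  assumes "integrable lborel f"
  shows "L1_translation_continuous f"
  using assms
proof (induction f rule: integrable_induct)
  case (base A c)
  then have [measurable]: "A \<in> sets borel" and fin: "emeasure lborel A < \<infinity>" by simp_all
  show ?case
  proof (rule L1_translation_continuous_approx)
    show "integrable lborel (\<lambda>x. indicator A x *\<^sub>R c)"
      using fin by (intro integrable_scaleR_left) (simp add: integrable_indicator_iff)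
    fix e :: real assume e: "0 < e"
    \<comment> \<open>The summand 1 covers c = 0. Outer regularity with error \<open>e'\<close>
      replaces the Borel set by an open one.\<close>
    define e' where "e' = e / (norm c + 1)"
    have e': "0 < e'" using e by (simp add: e'_def add_nonneg_pos)
    have "A \<in> sets lebesgue" by simp
    then obtain U where U: "open U" "A \<subseteq> U" "U - A \<in> lmeasurable" "emeasure lebesgue (U - A) < ennreal e'"
      using e' by (rule sets_lebesgue_outer_open)
    have [measurable]: "U \<in> sets borel" using U by simp
    have UA: "emeasure lborel (U - A) < ennreal e'" using U(4) by simp
    have "emeasure lborel U \<le> emeasure lborel A + emeasure lborel (U - A)"
      using emeasure_subadditive[of A lborel "U - A"] U(2) by (simp add: Un_absorb1)
    also have "\<dots> < \<infinity>" using fin UA by (auto simp: less_top[symmetric] intro: order.strict_trans)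
    finally have Ufin: "emeasure lborel U < \<infinity>" .
    have "(LINT x|lborel. norm (indicator A x *\<^sub>R c - indicator U x *\<^sub>R c))
        = (LINT x|lborel. norm c * indicator (U - A) x)"
      using U(2) by (intro Bochner_Integration.integral_cong) (auto split: split_indicator)
    also have "\<dots> = norm c * measure lborel (U - A)" by simp
    also have "\<dots> \<le> norm c * e'"
      using UA e' by (intro mult_left_mono) (auto simp: measure_def intro!: enn2real_leI)
    also have "\<dots> < e" using e by (simp add: e'_def divide_simps) (smt (verit) mult_less_cancel_left2 mult.commute distrib_left norm_ge_zero)
    finally show "\<exists>g. integrable lborel g \<and> L1_translation_continuous g
        \<and> (LINT x|lborel. norm (indicator A x *\<^sub>R c - g x)) < e"
      using L1_translation_continuous_indicator_open[OF U(1) Ufin, of c] Ufin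
      by (intro exI[of _ "\<lambda>x. indicator U x *\<^sub>R c"])
        (auto intro!: integrable_scaleR_left simp: integrable_indicator_iff)
  qed
next
  case (add f g)
  show ?case
    unfolding L1_translation_continuous_def
  proof (intro allI impI)
    fix d :: "nat \<Rightarrow> real"
    assume d: "d \<longlonglongrightarrow> 0"
    have i1: "integrable lborel (\<lambda>x. norm (g (d n + x) - g x))" for n
      using add by (intro integrable_norm Bochner_Integration.integrable_diff integrable_translate)
    have i2: "integrable lborel (\<lambda>x. norm (f (d n + x) - f x))" for n
      using add by (intro integrable_norm Bochner_Integration.integrable_diff integrable_translate)
    have "(\<lambda>n. (LINT x|lborel. norm (f (d n + x) - f x)) + (LINT x|lborel. norm (g (d n + x) - g x))) \<longlonglongrightarrow> 0 + 0"
      using add.IH d unfolding L1_translation_continuous_def by (intro tendsto_add) blast+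
    then have lim0: "(\<lambda>n. (LINT x|lborel. norm (f (d n + x) - f x)) + (LINT x|lborel. norm (g (d n + x) - g x))) \<longlonglongrightarrow> 0"
      by simp
    show "(\<lambda>n. LINT x|lborel. norm (f (d n + x) + g (d n + x) - (f x + g x))) \<longlonglongrightarrow> 0"
    proof (rule Lim_null_comparison[OF _ lim0])
      show "\<forall>\<^sub>F n in sequentially. norm (LINT x|lborel. norm (f (d n + x) + g (d n + x) - (f x + g x)))
          \<le> (LINT x|lborel. norm (f (d n + x) - f x)) + (LINT x|lborel. norm (g (d n + x) - g x))"
      proof (intro always_eventually allI)
        fix n
        have "(LINT x|lborel. norm (f (d n + x) + g (d n + x) - (f x + g x)))
            \<le> (LINT x|lborel. norm (f (d n + x) - f x) + norm (g (d n + x) - g x))"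
          using i1 i2 add
          by (intro integral_mono integrable_norm Bochner_Integration.integrable_diff
              Bochner_Integration.integrable_add integrable_translate)
            (metis add_diff_add norm_triangle_ineq)+
        then show "norm (LINT x|lborel. norm (f (d n + x) + g (d n + x) - (f x + g x)))
          \<le> (LINT x|lborel. norm (f (d n + x) - f x)) + (LINT x|lborel. norm (g (d n + x) - g x))"
          using i1 i2 by simp
      qed
    qed
  qed
next
  case (lim f s)
  show ?case
  proof (rule L1_translation_continuous_approx[OF lim.hyps(4)])
    fix e :: real assume e: "0 < e"
    have "(\<lambda>i. LINT x|lborel. norm (f x - s i x)) \<longlonglongrightarrow> (LINT x|(lborel::real measure). (0::real))"
    proof (rule integral_dominated_convergence[where w = "\<lambda>x. 3 * norm (f x)"])
      show "AE x in lborel. (\<lambda>i. norm (f x - s i x)) \<longlonglongrightarrow> 0"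
      proof (rule AE_I2)
        fix x :: real
        have "(\<lambda>i. f x - s i x) \<longlonglongrightarrow> f x - f x"
          by (intro tendsto_diff tendsto_const lim.hyps(2)) simp
        from tendsto_norm[OF this] show "(\<lambda>i. norm (f x - s i x)) \<longlonglongrightarrow> 0" by simp
      qed
      show "AE x in lborel. norm (norm (f x - s i x)) \<le> 3 * norm (f x)" for i
      proof (rule AE_I2)
        fix x :: real
        show "norm (norm (f x - s i x)) \<le> 3 * norm (f x)"
          using lim.hyps(3)[of x i] norm_triangle_ineq4[of "f x" "s i x"] by simp
      qed
    qed (use lim.hyps in auto)
    then have "\<forall>\<^sub>F i in sequentially. (LINT x|lborel. norm (f x - s i x)) < e"
      using e by (auto dest: order_tendstoD(2))
    then obtain i where "(LINT x|lborel. norm (f x - s i x)) < e"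
      by (auto dest: eventually_happens)
    then show "\<exists>g. integrable lborel g \<and> L1_translation_continuous g \<and> (LINT x|lborel. norm (f x - g x)) < e"
      using lim by blast
  qed
qed

section \<open>The fractional kernel\<close>

text \<open>The cutoff at 0 makes convolution over the line causal, so functions vanishing for
  negative times need no explicit interval of integration. \<open>kern 1\<close> is the Heaviside
  function.\<close>

definition kern :: "real \<Rightarrow> real \<Rightarrow> real" where
  "kern a t = (if 0 < t then t powr (a - 1) / Gamma a else 0)"

lemma kern_measurable [measurable]: "kern a \<in> borel_measurable borel"
  unfolding kern_def[abs_def] by measurable

lemma kern_nonneg [simp]: "0 < a \<Longrightarrow> 0 \<le> kern a t"
  by (simp add: kern_def)

lemma kern_eq_0 [simp]: "t \<le> 0 \<Longrightarrow> kern a t = 0"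
  by (simp add: kern_def)

lemma kern_antimono: "0 < a \<Longrightarrow> a \<le> 1 \<Longrightarrow> 0 < s \<Longrightarrow> s \<le> t \<Longrightarrow> kern a t \<le> kern a s"
  unfolding kern_def by (auto intro!: divide_right_mono powr_mono2')

lemma ennreal_exp_add: "ennreal (exp (x + y)) = ennreal (exp x) * ennreal (exp y)"
  by (simp add: exp_add ennreal_mult)

text \<open>Euler's integral for the Gamma function after the scaling t -> \<mu> t.\<close>

lemma kern_Laplace:
  assumes a: "0 < a" and \<mu>: "0 < \<mu>"
  shows "(\<integral>\<^sup>+ r. ennreal (exp (- \<mu> * r)) * ennreal (kern a r) \<partial>lborel) = ennreal (\<mu> powr (- a))"
proof -
  let ?f = "\<lambda>t. ennreal (indicator {0..} t * t powr (a - 1) / exp t)"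
  have G: "0 < Gamma a" using a by (rule Gamma_real_pos)
  have "ennreal (Gamma a) = (\<integral>\<^sup>+ t. ?f t \<partial>lborel)"
    by (rule Gamma_conv_nn_integral_real[OF a])
  also have "\<dots> = ennreal \<bar>\<mu>\<bar> * (\<integral>\<^sup>+ t. ?f (0 + \<mu> * t) \<partial>lborel)"
    using \<mu> by (intro nn_integral_real_affine) auto
  also have "(\<integral>\<^sup>+ t. ?f (0 + \<mu> * t) \<partial>lborel)
      = (\<integral>\<^sup>+ t. ennreal (\<mu> powr (a - 1) * Gamma a) * (ennreal (exp (- \<mu> * t)) * ennreal (kern a t)) \<partial>lborel)"
  proof (rule nn_integral_cong)
    fix t
    show "?f (0 + \<mu> * t) = ennreal (\<mu> powr (a - 1) * Gamma a) * (ennreal (exp (- \<mu> * t)) * ennreal (kern a t))"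
    proof (cases "0 < t")
      case True
      then have "indicator {0..} (\<mu> * t) * (\<mu> * t) powr (a - 1) / exp (\<mu> * t)
          = \<mu> powr (a - 1) * Gamma a * (exp (- \<mu> * t) * kern a t)"
        using \<mu> G by (simp add: kern_def powr_mult exp_minus divide_inverse)
      then show ?thesis using \<mu> G a by (simp add: ennreal_mult)
    next
      case False
      then have "t = 0 \<or> \<mu> * t < 0" using \<mu> by (auto simp: mult_less_0_iff)
      then show ?thesis using False by auto
    qed
  qed
  also have "\<dots> = ennreal (\<mu> powr (a - 1) * Gamma a)
      * (\<integral>\<^sup>+ t. ennreal (exp (- \<mu> * t)) * ennreal (kern a t) \<partial>lborel)"
    by (rule nn_integral_cmult) measurable
  also have "ennreal \<bar>\<mu>\<bar> * \<dots> = ennreal (\<mu> powr a * Gamma a)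
      * (\<integral>\<^sup>+ t. ennreal (exp (- \<mu> * t)) * ennreal (kern a t) \<partial>lborel)"
    using \<mu> G by (simp add: mult.assoc[symmetric] ennreal_mult[symmetric] powr_diff)
  finally have eq: "ennreal (Gamma a) = ennreal (\<mu> powr a * Gamma a)
      * (\<integral>\<^sup>+ t. ennreal (exp (- \<mu> * t)) * ennreal (kern a t) \<partial>lborel)" (is "_ = _ * ?I") .
  have "?I = ennreal (\<mu> powr (- a) / Gamma a) * (ennreal (\<mu> powr a * Gamma a) * ?I)"
    using \<mu> G by (simp add: mult.assoc[symmetric] ennreal_mult[symmetric] powr_minus)
  also have "\<dots> = ennreal (\<mu> powr (- a))"
    using eq[symmetric] G by (simp add: ennreal_mult[symmetric])
  finally show ?thesis .
qed

text \<open>Exponentials are eigenfunctions of convolution, with the Laplace transform of the kernel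
  as eigenvalue. It tends to 0 as \<mu> grows, which is the source of the contractions
  below.\<close>

lemma nconv_kern_exp:
  assumes a: "0 < a" and \<mu>: "0 < \<mu>"
  shows "nconv (kern a) (\<lambda>s. ennreal (exp (\<mu> * s))) t = ennreal (\<mu> powr (- a)) * ennreal (exp (\<mu> * t))"
proof -
  have "nconv (kern a) (\<lambda>s. ennreal (exp (\<mu> * s))) t
      = (\<integral>\<^sup>+ r. ennreal (exp (- \<mu> * r)) * ennreal (kern a r) * ennreal (exp (\<mu> * t)) \<partial>lborel)"
    unfolding nconv_def
  proof (subst nn_integral_real_affine[where c = "-1" and t = t], goal_cases)
    case 3
    have "ennreal (exp (\<mu> * (t + - 1 * r))) = ennreal (exp (- \<mu> * r)) * ennreal (exp (\<mu> * t))" for r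
      by (simp add: ennreal_exp_add[symmetric] algebra_simps)
    then show ?case by (simp add: mult_ac)
  qed auto
  also have "\<dots> = ennreal (\<mu> powr (- a)) * ennreal (exp (\<mu> * t))"
    using kern_Laplace[OF a \<mu>] by (subst nn_integral_multc) (auto simp: mult.assoc)
  finally show ?thesis .
qed

text \<open>The transposed form: a Laplace transform turns the convolution into a factor. It gives
  integral bounds where no pointwise bound is available.\<close>

lemma nn_integral_exp_nconv_kern:
  assumes a: "0 < a" and \<mu>: "0 < \<mu>" and [measurable]: "h \<in> borel_measurable borel"
  shows "(\<integral>\<^sup>+ t. ennreal (exp (- \<mu> * t)) * nconv (kern a) h t \<partial>lborel)
    = ennreal (\<mu> powr (- a)) * (\<integral>\<^sup>+ s. ennreal (exp (- \<mu> * s)) * h s \<partial>lborel)"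
proof -
  have "(\<integral>\<^sup>+ t. ennreal (exp (- \<mu> * t)) * nconv (kern a) h t \<partial>lborel)
     = (\<integral>\<^sup>+ t. (\<integral>\<^sup>+ s. ennreal (exp (- \<mu> * t)) * (ennreal (kern a (t - s)) * h s) \<partial>lborel) \<partial>lborel)"
    unfolding nconv_def by (simp add: nn_integral_cmult)
  also have "\<dots> = (\<integral>\<^sup>+ s. (\<integral>\<^sup>+ t. ennreal (exp (- \<mu> * t)) * (ennreal (kern a (t - s)) * h s) \<partial>lborel) \<partial>lborel)"
    by (rule lborel_pair.Fubini') measurable
  also have "\<dots> = (\<integral>\<^sup>+ s. ennreal (\<mu> powr (- a)) * (ennreal (exp (- \<mu> * s)) * h s) \<partial>lborel)"
  proof (rule nn_integral_cong)
    fix s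
    have "(\<integral>\<^sup>+ t. ennreal (exp (- \<mu> * t)) * (ennreal (kern a (t - s)) * h s) \<partial>lborel)
      = (\<integral>\<^sup>+ t. ennreal (exp (- \<mu> * t)) * ennreal (kern a t) * (ennreal (exp (- \<mu> * s)) * h s) \<partial>lborel)"
    proof (subst nn_integral_real_affine[where c = 1 and t = s], goal_cases)
      case 3
      have "ennreal (exp (- \<mu> * (s + 1 * t))) = ennreal (exp (- \<mu> * t)) * ennreal (exp (- \<mu> * s))" for t
        by (simp add: ennreal_exp_add[symmetric] algebra_simps)
      then show ?case by (simp add: mult_ac)
    qed auto
    also have "\<dots> = ennreal (\<mu> powr (- a)) * (ennreal (exp (- \<mu> * s)) * h s)"
      using kern_Laplace[OF a \<mu>] by (subst nn_integral_multc) auto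
    finally show "(\<integral>\<^sup>+ t. ennreal (exp (- \<mu> * t)) * (ennreal (kern a (t - s)) * h s) \<partial>lborel)
      = ennreal (\<mu> powr (- a)) * (ennreal (exp (- \<mu> * s)) * h s)" .
  qed
  also have "\<dots> = ennreal (\<mu> powr (- a)) * (\<integral>\<^sup>+ s. ennreal (exp (- \<mu> * s)) * h s \<partial>lborel)"
    by (rule nn_integral_cmult) measurable
  finally show ?thesis .
qed

lemma AE_nconv_kern_finite_weighted:
  assumes a: "0 < a" and [measurable]: "h \<in> borel_measurable borel"
    and fin: "(\<integral>\<^sup>+ s. ennreal (exp (- 1 * s)) * h s \<partial>lborel) < \<infinity>"
  shows "AE t in lborel. nconv (kern a) h t < \<infinity>"
proof -
  have "(\<integral>\<^sup>+ t. ennreal (exp (- 1 * t)) * nconv (kern a) h t \<partial>lborel)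
    = ennreal (1 powr (- a)) * (\<integral>\<^sup>+ s. ennreal (exp (- 1 * s)) * h s \<partial>lborel)"
    by (rule nn_integral_exp_nconv_kern) (use a in auto)
  also have "\<dots> < \<infinity>" using fin by simp
  finally have "AE t in lborel. ennreal (exp (- 1 * t)) * nconv (kern a) h t \<noteq> \<infinity>"
    by (intro nn_integral_noteq_infinite) auto
  then show ?thesis
    by eventually_elim (auto simp: ennreal_mult_eq_top_iff less_top)
qed

lemma nn_integral_exp_le:
  assumes supp: "\<And>s. s \<le> 0 \<Longrightarrow> h s = 0" and \<mu>: "0 \<le> \<mu>"
  shows "(\<integral>\<^sup>+ s. ennreal (exp (- \<mu> * s)) * h s \<partial>lborel) \<le> (\<integral>\<^sup>+ s. h s \<partial>lborel)"
proof (rule nn_integral_mono)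
  fix s
  show "ennreal (exp (- \<mu> * s)) * h s \<le> h s"
  proof (cases "s \<le> 0")
    case False
    then have "ennreal (exp (- \<mu> * s)) * h s \<le> 1 * h s" using \<mu> by (intro mult_right_mono) auto
    then show ?thesis by simp
  qed (simp add: supp)
qed

lemma AE_nconv_kern_finite:
  assumes a: "0 < a" and h: "h \<in> borel_measurable borel"
    and supp: "\<And>s. s \<le> 0 \<Longrightarrow> h s = 0" and fin: "(\<integral>\<^sup>+ s. h s \<partial>lborel) < \<infinity>"
  shows "AE t in lborel. nconv (kern a) h t < \<infinity>"
  by (rule AE_nconv_kern_finite_weighted[OF a h le_less_trans[OF nn_integral_exp_le fin]]) (use supp in auto)

text \<open>Up to the cutoff the indicator lies below exp(s / t), so the eigenvalue identity with
  \<mu> = 1 / t applies. Exact evaluation would give t^a / Gamma(a + 1); the constant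
  \<open>exp 1\<close> that recurs below originates here.\<close>

lemma nconv_kern_indicator_le:
  assumes a: "0 < a" and t: "0 < t"
  shows "nconv (kern a) (indicator {0<..}) t \<le> ennreal (exp 1 * t powr a)"
proof -
  have "nconv (kern a) (indicator {0<..}) t \<le> nconv (kern a) (\<lambda>s. ennreal (exp ((1 / t) * s))) t"
    using t by (intro nconv_mono) (auto split: split_indicator)
  also have "\<dots> = ennreal (exp 1 * t powr a)"
    using nconv_kern_exp[OF a, of "1 / t" t] t
    by (simp add: ennreal_mult[symmetric] powr_divide powr_minus mult.commute)
  finally show ?thesis .
qed

lemma nconv_kern_eq_0: "(\<And>s. s \<le> 0 \<Longrightarrow> h s = 0) \<Longrightarrow> t \<le> 0 \<Longrightarrow> nconv (kern a) h t = 0"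
  unfolding nconv_def
proof -
  assume h: "\<And>s. s \<le> 0 \<Longrightarrow> h s = 0" and t: "t \<le> 0"
  have z: "ennreal (kern a (t - s)) * h s = 0" for s
    using h[of s] t by (cases "s \<le> 0") auto
  then show "(\<integral>\<^sup>+ s. ennreal (kern a (t - s)) * h s \<partial>lborel) = 0" unfolding z by simp
qed

lemma conv_kern_eq_0: "(\<And>s. s \<le> 0 \<Longrightarrow> h s = 0) \<Longrightarrow> t \<le> 0 \<Longrightarrow> conv (kern a) h t = 0"
  unfolding conv_def
proof (rule integral_eq_zero_AE, rule AE_I2)
  fix s :: real
  assume h: "\<And>s. s \<le> 0 \<Longrightarrow> h s = 0" and t: "t \<le> 0"
  show "kern a (t - s) *\<^sub>R h s = 0"
    using h[of s] t by (cases "s \<le> 0") auto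
qed

text \<open>After T the kernel only decreases at each point of the support. Hence bounds at times up
  to T, which is all that the norm provides, extend to later times.\<close>

lemma nconv_kern_le_right:
  assumes a: "0 < a" "a \<le> 1" and supp: "\<And>s. s \<notin> {0<..<T} \<Longrightarrow> h s = 0" and t: "T \<le> t"
  shows "nconv (kern a) h t \<le> nconv (kern a) h T"
  unfolding nconv_def
proof (rule nn_integral_mono)
  fix s
  show "ennreal (kern a (t - s)) * h s \<le> ennreal (kern a (T - s)) * h s"
    using supp[of s] kern_antimono[OF a, of "T - s" "t - s"] t
    by (cases "s \<in> {0<..<T}") (auto intro!: mult_right_mono ennreal_leI)
qed

lemma nconv_kern_Ioo_le:
  assumes a: "0 < a" "a \<le> 1" and T: "0 < T"
  shows "nconv (kern a) (indicator {0<..<T}) t \<le> ennreal (exp 1 * T powr a)"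
proof -
  consider "t \<le> 0" | "0 < t" "t \<le> T" | "T \<le> t" by linarith
  then show ?thesis
  proof cases
    case 1
    then have "nconv (kern a) (indicator {0<..<T}) t = 0" by (intro nconv_kern_eq_0) auto
    then show ?thesis by simp
  next
    case 2
    have "nconv (kern a) (indicator {0<..<T}) t \<le> nconv (kern a) (indicator {0<..}) t"
      by (rule nconv_mono) (auto split: split_indicator)
    also have "\<dots> \<le> ennreal (exp 1 * t powr a)" by (rule nconv_kern_indicator_le) (use a 2 in auto)
    also have "\<dots> \<le> ennreal (exp 1 * T powr a)"
      using 2 a by (intro ennreal_leI mult_left_mono powr_mono2) auto
    finally show ?thesis .
  next
    case 3
    have "nconv (kern a) (indicator {0<..<T}) t \<le> nconv (kern a) (indicator {0<..<T}) T"
      by (rule nconv_kern_le_right) (use a 3 in auto)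
    also have "\<dots> \<le> nconv (kern a) (indicator {0<..}) T"
      by (rule nconv_mono) (auto split: split_indicator)
    also have "\<dots> \<le> ennreal (exp 1 * T powr a)" by (rule nconv_kern_indicator_le) (use a T in auto)
    finally show ?thesis .
  qed
qed

text \<open>The substitution s = t x leads to the Beta integral B(a, 1 - a) = Gamma(a) Gamma(1 - a),
  and the powers of t cancel. This is Abel inversion at the level of kernels.\<close>

lemma nconv_kern_conjugate:
  assumes a: "0 < a" "a < 1"
  shows "nconv (kern (1 - a)) (\<lambda>s. ennreal (kern a s)) t = ennreal (kern 1 t)"
proof (cases "0 < t")
  case False
  then have "nconv (kern (1 - a)) (\<lambda>s. ennreal (kern a s)) t = 0" by (intro nconv_kern_eq_0) auto
  then show ?thesis using False by simp
next
  case t: True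
  have G: "0 < Gamma a" "0 < Gamma (1 - a)" using a by auto
  let ?b = "\<lambda>x::real. x powr (a - 1) * (1 - x) powr ((1 - a) - 1)"
  have "(?b has_integral Beta a (1 - a)) {0..1}"
    using a by (intro has_integral_Beta_real) auto
  then have "(\<integral>\<^sup>+ x. ennreal (indicator {0..1} x * ?b x) \<partial>lborel) = ennreal (Beta a (1 - a))"
    by (intro nn_integral_has_integral_lebesgue) auto
  then have B: "(\<integral>\<^sup>+ x. ennreal (indicator {0..1} x * ?b x) \<partial>lborel) = ennreal (Gamma a * Gamma (1 - a))"
    by (simp add: Beta_def)
  have "nconv (kern (1 - a)) (\<lambda>s. ennreal (kern a s)) t
      = ennreal \<bar>t\<bar> * (\<integral>\<^sup>+ x. ennreal (kern (1 - a) (t - (0 + t * x))) * ennreal (kern a (0 + t * x)) \<partial>lborel)"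
    unfolding nconv_def using t by (intro nn_integral_real_affine) auto
  also have "(\<integral>\<^sup>+ x. ennreal (kern (1 - a) (t - (0 + t * x))) * ennreal (kern a (0 + t * x)) \<partial>lborel)
     = (\<integral>\<^sup>+ x. ennreal (1 / (t * (Gamma a * Gamma (1 - a)))) * ennreal (indicator {0..1} x * ?b x) \<partial>lborel)"
  proof (intro nn_integral_cong_AE AE_I[where N = "{0, 1}"] subsetI)
    fix x
    assume x: "x \<in> {x \<in> space lborel. ennreal (kern (1 - a) (t - (0 + t * x))) * ennreal (kern a (0 + t * x))
      \<noteq> ennreal (1 / (t * (Gamma a * Gamma (1 - a)))) * ennreal (indicator {0..1} x * ?b x)}"
    show "x \<in> {0, 1}"
    proof (rule ccontr)
      assume n: "x \<notin> {0, 1}"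
      have "ennreal (kern (1 - a) (t - (0 + t * x))) * ennreal (kern a (0 + t * x))
        = ennreal (1 / (t * (Gamma a * Gamma (1 - a)))) * ennreal (indicator {0..1} x * ?b x)"
      proof (cases "x \<in> {0<..<1}")
        case True
        have "kern (1 - a) (t - t * x) = (t * (1 - x)) powr (- a) / Gamma (1 - a)"
          using t True by (simp add: kern_def algebra_simps)
        moreover have "kern a (t * x) = (t * x) powr (a - 1) / Gamma a"
          using t True by (simp add: kern_def)
        moreover have "t powr (- a) * t powr (a - 1) = 1 / t"
          using t by (simp only: powr_add[symmetric]) (simp add: powr_neg_one)
        ultimately show ?thesis using t True G
          by (simp add: ennreal_mult[symmetric] powr_mult) (simp add: field_simps)
      next
        case False
        with n have "x < 0 \<or> 1 < x" by auto
        then have "kern (1 - a) (t - t * x) = 0 \<or> kern a (t * x) = 0"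
          using t by (auto simp: kern_def mult_less_0_iff zero_less_mult_iff)
        then show ?thesis using \<open>x < 0 \<or> 1 < x\<close> by auto
      qed
      then show False using x by blast
    qed
  qed (auto simp: emeasure_lborel_countable)
  also have "\<dots> = ennreal (1 / (t * (Gamma a * Gamma (1 - a)))) * ennreal (Gamma a * Gamma (1 - a))"
    using B by (subst nn_integral_cmult) auto
  also have "ennreal \<bar>t\<bar> * \<dots> = ennreal (kern 1 t)"
    using t G by (simp add: ennreal_mult[symmetric] kern_def)
  finally show ?thesis .
qed

section \<open>The fractional chain inequality\<close>

text \<open>Up to the factor \<open>1 / \<Gamma>(1 - a)\<close>, the operator \<open>w \<mapsto> \<epsilon>\<^sup>-\<^sup>a w - trunc_kern a \<epsilon> * w\<close> is the Marchaud
  derivative with its singular integral truncated at \<open>\<epsilon>\<close>. Applied to \<open>kern a * g\<close> it gives \<open>eta a \<epsilon> * g\<close>,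
  and \<open>eta a \<epsilon>\<close> is a positive approximate identity (up to a constant). As \<open>trunc_kern\<close> is nonnegative, the
  gradient inequality of a convex function passes through the operator.\<close>

definition trunc_kern :: "real \<Rightarrow> real \<Rightarrow> real \<Rightarrow> real" where
  "trunc_kern a \<epsilon> r = (if \<epsilon> < r then a * r powr (- a - 1) else 0)"

definition eta :: "real \<Rightarrow> real \<Rightarrow> real \<Rightarrow> real" where
  "eta a \<epsilon> t = (if 0 < t then \<epsilon> powr (- a) * (t powr a - max 0 (t - \<epsilon>) powr a) / (t * Gamma a) else 0)"

lemma trunc_kern_measurable [measurable]: "trunc_kern a \<epsilon> \<in> borel_measurable borel"
  unfolding trunc_kern_def[abs_def] by measurable

lemma eta_measurable [measurable]: "eta a \<epsilon> \<in> borel_measurable borel"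
  unfolding eta_def[abs_def] by measurable

lemma trunc_kern_nonneg: "0 < a \<Longrightarrow> 0 \<le> trunc_kern a \<epsilon> r"
  by (simp add: trunc_kern_def)

lemma eta_nonneg: "0 < a \<Longrightarrow> 0 < \<epsilon> \<Longrightarrow> 0 \<le> eta a \<epsilon> t"
  unfolding eta_def by (auto intro!: divide_nonneg_nonneg mult_nonneg_nonneg powr_mono2)

lemma eta_le_kern: "0 < a \<Longrightarrow> 0 < \<epsilon> \<Longrightarrow> eta a \<epsilon> t \<le> \<epsilon> powr (- a) * kern a t"
proof (cases "0 < t")
  case True
  assume a: "0 < a" "0 < \<epsilon>"
  have "eta a \<epsilon> t \<le> \<epsilon> powr (- a) * (t powr a) / (t * Gamma a)"
    unfolding eta_def using True a
    by (auto intro!: divide_right_mono mult_left_mono)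
  also have "\<dots> = \<epsilon> powr (- a) * kern a t"
    using True by (simp add: kern_def powr_diff)
  finally show ?thesis .
qed (simp add: eta_def)

text \<open>The function \<open>eta a \<epsilon>\<close> is a fixed profile rescaled to width
  \<epsilon>, which is what makes it an approximate identity.\<close>

lemma eta_scale:
  assumes "0 < a" "0 < \<epsilon>"
  shows "\<epsilon> * eta a \<epsilon> (\<epsilon> * r) = eta a 1 r"
proof (cases "0 < r")
  case True
  have m: "max 0 (\<epsilon> * r - \<epsilon>) = \<epsilon> * max 0 (r - 1)"
    using assms by (simp add: max_mult_distrib_left algebra_simps)
  have "\<epsilon> * eta a \<epsilon> (\<epsilon> * r)
      = \<epsilon> * (\<epsilon> powr (- a) * ((\<epsilon> * r) powr a - (\<epsilon> * max 0 (r - 1)) powr a) / (\<epsilon> * r * Gamma a))"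
    using assms True by (simp add: eta_def m)
  also have "\<dots> = (\<epsilon> powr (- a) * \<epsilon> powr a) * (r powr a - max 0 (r - 1) powr a) / (r * Gamma a)"
    using assms True by (simp add: powr_mult) (simp add: algebra_simps)
  also have "\<epsilon> powr (- a) * \<epsilon> powr a = 1"
    using assms by (simp add: powr_add[symmetric])
  finally show ?thesis using True by (simp add: eta_def)
next
  case False
  then have "\<not> 0 < \<epsilon> * r" using assms by (auto simp: zero_less_mult_iff)
  then show ?thesis using False by (simp add: eta_def)
qed

text \<open>The mass of the kernel is the coefficient of w in the truncated operator; hence that
  operator is the integral over r of \<open>trunc_kern\<close> at s - r times the difference w s - w
  r.\<close>

lemma nn_integral_trunc_kern:
  assumes a: "0 < a" and \<epsilon>: "0 < \<epsilon>"
  shows "(\<integral>\<^sup>+ r. ennreal (trunc_kern a \<epsilon> r) \<partial>lborel) = ennreal (\<epsilon> powr (- a))"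
proof -
  have "(\<integral>\<^sup>+ r. ennreal (trunc_kern a \<epsilon> r) \<partial>lborel)
      = (\<integral>\<^sup>+ r. ennreal (a * r powr (- a - 1)) * indicator {\<epsilon>..} r \<partial>lborel)"
  proof (intro nn_integral_cong_AE AE_I[where N = "{\<epsilon>}"])
    show "{x \<in> space lborel. ennreal (trunc_kern a \<epsilon> x)
        \<noteq> ennreal (a * x powr (- a - 1)) * indicator {\<epsilon>..} x} \<subseteq> {\<epsilon>}"
      by (auto simp: trunc_kern_def split: split_indicator if_splits)
  qed auto
  also have "\<dots> = ennreal (0 - (- (\<epsilon> powr (- a))))"
  proof (rule nn_integral_FTC_atLeast[where F = "\<lambda>r. - (r powr (- a))"])
    fix x assume "\<epsilon> \<le> x"
    then show "((\<lambda>r. - (r powr (- a))) has_real_derivative a * x powr (- a - 1)) (at x)"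
      using \<epsilon> by (auto intro!: derivative_eq_intros)
  next
    have "((\<lambda>r::real. - (r powr (- a))) \<longlongrightarrow> - 0) at_top"
      using a by (intro tendsto_minus tendsto_neg_powr filterlim_ident) auto
    then show "((\<lambda>r::real. - (r powr (- a))) \<longlongrightarrow> 0) at_top" by simp
  qed (use a in auto)
  finally show ?thesis by simp
qed

text \<open>The integrand has the explicit antiderivative s^a (t - s)^(-a) / (t Gamma(a)), and the
  right side is its value at t - \<epsilon>. The identity says that the truncated operator inverts
  convolution with \<open>kern a\<close> up to smoothing by \<open>eta\<close>.\<close>

lemma nconv_trunc_kern_kern:
  assumes a: "0 < a" "a < 1" and \<epsilon>: "0 < \<epsilon>"
  shows "nconv (trunc_kern a \<epsilon>) (\<lambda>s. ennreal (kern a s)) t = ennreal (\<epsilon> powr (- a) * kern a t - eta a \<epsilon> t)"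
proof (cases "\<epsilon> < t")
  \<comment> \<open>For t \<le> \<epsilon> the two supports do not meet, and the right side cancels
    exactly.\<close>
  case False
  have z: "ennreal (trunc_kern a \<epsilon> (t - s)) * ennreal (kern a s) = 0" for s
    using False by (cases "s \<le> 0") (auto simp: trunc_kern_def)
  then have "nconv (trunc_kern a \<epsilon>) (\<lambda>s. ennreal (kern a s)) t = 0" by (simp only: nconv_def z) simp
  moreover have "\<epsilon> powr (- a) * kern a t - eta a \<epsilon> t = 0"
    using False by (auto simp: kern_def eta_def powr_diff)
  ultimately show ?thesis by simp
next
  case True
  have G: "0 < Gamma a" using a by simp
  have t: "0 < t" using True \<epsilon> by simp
  define f where "f = (\<lambda>s. a * (t - s) powr (- a - 1) * (s powr (a - 1) / Gamma a))"
  define F where "F = (\<lambda>s. s powr a * (t - s) powr (- a) / (t * Gamma a))"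
  have dF: "(F has_real_derivative f s) (at s)" if s: "0 < s" "s < t" for s
  proof -
    have "(F has_real_derivative
        ((a * s powr (a - 1)) * (t - s) powr (- a) + s powr a * ((- a) * (t - s) powr (- a - 1) * (- 1))) / (t * Gamma a)) (at s)"
      unfolding F_def using s t G by (auto intro!: derivative_eq_intros)
    moreover have "(t - s) powr (- a) = (t - s) * (t - s) powr (- a - 1)"
      using s by (simp add: powr_diff)
    moreover have "s powr a = s * s powr (a - 1)"
      using s by (simp add: powr_diff)
    ultimately show ?thesis using t G
      by (simp add: f_def) (simp add: field_simps)
  qed
  have lim0: "(F \<longlongrightarrow> 0) (at_right 0)"
  proof -
    have "((\<lambda>s. s powr a) \<longlongrightarrow> 0) (at_right 0)"
      using a tendsto_powr[of "\<lambda>s. s" 0 "at_right (0::real)" "\<lambda>_. a" a] eventually_at_right_less[of "0::real"]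
      by (auto intro!: tendsto_eq_intros elim!: eventually_mono intro: tendsto_ident_at)
    moreover have "((\<lambda>s. (t - s) powr (- a) / (t * Gamma a)) \<longlongrightarrow> (t - 0) powr (- a) / (t * Gamma a)) (at_right 0)"
      using t G by (intro tendsto_intros) auto
    ultimately have "((\<lambda>s. s powr a * ((t - s) powr (- a) / (t * Gamma a))) \<longlongrightarrow> 0 * ((t - 0) powr (- a) / (t * Gamma a))) (at_right 0)"
      by (rule tendsto_mult)
    then show ?thesis by (simp add: F_def)
  qed
  have lim1: "(F \<longlongrightarrow> F (t - \<epsilon>)) (at_left (t - \<epsilon>))"
    using DERIV_isCont[OF dF[of "t - \<epsilon>"]] True \<epsilon> by (auto simp: isCont_def intro: filterlim_at_split[THEN iffD1, THEN conjunct1])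
  have cont: "isCont f s" if "0 < s" "s < t" for s
    unfolding f_def using that G by (intro continuous_intros) auto
  have nn: "0 \<le> f s" for s using a by (simp add: f_def)
  note FTC = interval_integral_FTC_nonneg[of "ereal 0" "ereal (t - \<epsilon>)" F f 0 "F (t - \<epsilon>)"]
  have si: "set_integrable lborel {0<..<t - \<epsilon>} f"
    and iv: "(LBINT x=ereal 0..ereal (t - \<epsilon>). f x) = F (t - \<epsilon>) - 0"
    using FTC[OF _ dF cont] True \<epsilon> lim0 lim1 nn
    by (auto simp: ereal_tendsto_simps[unfolded comp_def] comp_def zero_ereal_def)
  have "nconv (trunc_kern a \<epsilon>) (\<lambda>s. ennreal (kern a s)) t = (\<integral>\<^sup>+ s. ennreal (indicator {0<..<t - \<epsilon>} s *\<^sub>R f s) \<partial>lborel)"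
    unfolding nconv_def
  proof (rule nn_integral_cong)
    fix s
    show "ennreal (trunc_kern a \<epsilon> (t - s)) * ennreal (kern a s) = ennreal (indicator {0<..<t - \<epsilon>} s *\<^sub>R f s)"
      using a by (auto simp: trunc_kern_def kern_def f_def ennreal_mult[symmetric] split: split_indicator)
  qed
  also have "\<dots> = ennreal (LINT s|lborel. indicator {0<..<t - \<epsilon>} s *\<^sub>R f s)"
    using si nn by (intro nn_integral_eq_integral) (auto simp: set_integrable_def)
  also have "(LINT s|lborel. indicator {0<..<t - \<epsilon>} s *\<^sub>R f s) = F (t - \<epsilon>)"
    using iv True by (simp add: interval_lebesgue_integral_def set_lebesgue_integral_def)
  also have "F (t - \<epsilon>) = \<epsilon> powr (- a) * kern a t - eta a \<epsilon> t"
    using True t \<epsilon> G by (simp add: F_def kern_def eta_def powr_diff) (simp add: field_simps)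
  finally show ?thesis .
qed

text \<open>Near 0 the profile is at most \<open>kern a\<close>. For r \<ge> 1 the difference r^a -
  (r - 1)^a is at most r^(a - 1), so the profile is at most a multiple of r^(a - 2), integrable at
  infinity as a < 1.\<close>

lemma nn_integral_eta_finite:
  assumes a: "0 < a" "a < 1"
  shows "(\<integral>\<^sup>+ r. ennreal (eta a 1 r) \<partial>lborel) < \<infinity>"
proof -
  have G: "0 < Gamma a" using a by simp
  have le: "ennreal (eta a 1 r) \<le> ennreal (exp 1) * (ennreal (exp (- 1 * r)) * ennreal (kern a r))
      + ennreal (1 / Gamma a) * (ennreal (r powr (a - 2)) * indicator {1..} r)" for r
  proof (cases "r < 1")
    case True
    have "eta a 1 r \<le> 1 * kern a r" using eta_le_kern[of a 1 r] a by simp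
    also have "\<dots> \<le> (exp 1 * exp (- 1 * r)) * kern a r"
      using True a by (intro mult_right_mono) (auto simp: exp_add[symmetric])
    finally have "ennreal (eta a 1 r) \<le> ennreal (exp 1) * (ennreal (exp (- 1 * r)) * ennreal (kern a r))"
      using a by (simp add: ennreal_mult[symmetric] mult.assoc ennreal_leI)
    then show ?thesis by (simp add: add_increasing2)
  next
    case False
    then have r: "1 \<le> r" by simp
    \<comment> \<open>A number in [0,1] does not decrease when raised to a power below 1.\<close>
    have "1 - 1 / r \<le> (1 - 1 / r) powr a"
      using powr_mono'[of a 1 "1 - 1 / r"] a r by simp
    then have "r powr a * (1 - (1 - 1 / r) powr a) \<le> r powr a * (1 / r)"
      by (intro mult_left_mono) auto
    moreover have "(r * (1 - 1 / r)) powr a = r powr a * (1 - 1 / r) powr a"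
      by (rule powr_mult)
    ultimately have "r powr a - (r * (1 - 1 / r)) powr a \<le> r powr a * (1 / r)"
      by (simp add: right_diff_distrib)
    moreover have "r * (1 - 1 / r) = max 0 (r - 1)" using r by (simp add: algebra_simps)
    ultimately have num: "r powr a - max 0 (r - 1) powr a \<le> r powr a * (1 / r)" by metis
    have "eta a 1 r = (r powr a - max 0 (r - 1) powr a) / (r * Gamma a)"
      using r by (simp add: eta_def)
    also have "\<dots> \<le> (r powr a * (1 / r)) / (r * Gamma a)"
      using r G by (intro divide_right_mono num) simp
    also have "\<dots> = 1 / Gamma a * r powr (a - 2)"
      using r by (simp add: powr_diff power2_eq_square)
    finally have "ennreal (eta a 1 r) \<le> ennreal (1 / Gamma a) * (ennreal (r powr (a - 2)) * indicator {1..} r)"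
      using r G by (simp add: ennreal_mult[symmetric] ennreal_leI)
    then show ?thesis by (simp add: add_increasing)
  qed
  have "(\<integral>\<^sup>+ r. ennreal (r powr (a - 2)) * indicator {1..} r \<partial>lborel) = ennreal (0 - 1 powr (a - 1) / (a - 1))"
  proof (rule nn_integral_FTC_atLeast[where F = "\<lambda>r. r powr (a - 1) / (a - 1)"])
    fix x :: real assume "1 \<le> x"
    then show "((\<lambda>r. r powr (a - 1) / (a - 1)) has_real_derivative x powr (a - 2)) (at x)"
      using a by (auto intro!: derivative_eq_intros)
  next
    have "((\<lambda>r::real. r powr (a - 1) / (a - 1)) \<longlongrightarrow> 0 / (a - 1)) at_top"
      using a by (intro tendsto_divide tendsto_neg_powr filterlim_ident tendsto_const) auto
    then show "((\<lambda>r::real. r powr (a - 1) / (a - 1)) \<longlongrightarrow> 0) at_top" by simp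
  qed auto
  then have fin: "(\<integral>\<^sup>+ r. ennreal (r powr (a - 2)) * indicator {1..} r \<partial>lborel) < \<infinity>" by simp
  have "(\<integral>\<^sup>+ r. ennreal (eta a 1 r) \<partial>lborel)
    \<le> (\<integral>\<^sup>+ r. ennreal (exp 1) * (ennreal (exp (- 1 * r)) * ennreal (kern a r))
      + ennreal (1 / Gamma a) * (ennreal (r powr (a - 2)) * indicator {1..} r) \<partial>lborel)"
    by (intro nn_integral_mono le)
  also have "\<dots> = ennreal (exp 1) * (\<integral>\<^sup>+ r. ennreal (exp (- 1 * r)) * ennreal (kern a r) \<partial>lborel)
      + ennreal (1 / Gamma a) * (\<integral>\<^sup>+ r. ennreal (r powr (a - 2)) * indicator {1..} r \<partial>lborel)"
    by (subst nn_integral_add) (auto simp: nn_integral_cmult)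
  also have "\<dots> < \<infinity>"
    using fin kern_Laplace[of a 1] a by (simp add: ennreal_mult_less_top)
  finally show ?thesis .
qed

lemma integrable_eta: "0 < a \<Longrightarrow> a < 1 \<Longrightarrow> integrable lborel (eta a 1)"
  using nn_integral_eta_finite[of a] eta_nonneg[of a 1] by (simp add: integrable_iff_bounded)

text \<open>On (0,1) the profile is r^(a - 1) / Gamma(a), hence positive. Only the sign of the mass
  matters, because it is cancelled at the end of the chain inequality.\<close>

lemma integral_eta_pos:
  assumes a: "0 < a" "a < 1"
  shows "0 < (LINT r|lborel. eta a 1 r)"
proof -
  have nn: "0 \<le> (LINT r|lborel. eta a 1 r)" using a by (simp add: eta_nonneg)
  have "(LINT r|lborel. eta a 1 r) \<noteq> 0"
  proof
    assume "(LINT r|lborel. eta a 1 r) = 0"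
    then have "AE r in lborel. eta a 1 r = 0"
      using integral_nonneg_eq_0_iff_AE[OF integrable_eta[OF a]] eta_nonneg[of a 1] a by simp
    then have "AE r in lborel. r \<notin> {0<..<1::real}"
    proof eventually_elim
      case (elim r)
      moreover have "Gamma a \<noteq> 0" using Gamma_real_pos[OF a(1)] by (rule less_imp_neq[THEN not_sym])
      ultimately show ?case by (auto simp: eta_def max_def split: if_splits)
    qed
    then have "{0<..<1::real} \<in> null_sets lborel"
      by (subst AE_iff_null_sets) auto
    then show False by (simp add: null_sets_def)
  qed
  with nn show ?thesis by simp
qed

section \<open>Continuity of fractional integrals of bounded functions\<close>

lemma nconv_kern_indicator_finite:
  assumes "0 < a"
  shows "nconv (kern a) (indicator {0<..}) t < \<infinity>"
proof (cases "0 < t")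
  case True
  have "nconv (kern a) (indicator {0<..}) t \<le> ennreal (exp 1 * t powr a)"
    by (rule nconv_kern_indicator_le) (use assms True in auto)
  also have "\<dots> < \<infinity>" by simp
  finally show ?thesis .
next
  case False
  then have "nconv (kern a) (indicator {0<..}) t = 0" by (intro nconv_kern_eq_0) auto
  then show ?thesis by simp
qed

lemma integrable_kern_bounded:
  fixes h :: "real \<Rightarrow> 'a::{banach, second_countable_topology}"
  assumes a: "0 < a" and [measurable]: "h \<in> borel_measurable borel"
    and supp: "\<And>s. s \<le> 0 \<Longrightarrow> h s = 0" and bound: "\<And>s. norm (h s) \<le> M"
  shows "integrable lborel (\<lambda>s. kern a (t - s) *\<^sub>R h s)"
proof -
  have "0 \<le> M" using bound[of 0] norm_ge_zero order_trans by blast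
  have "nconv (kern a) (\<lambda>s. ennreal (norm (h s))) t \<le> nconv (kern a) (\<lambda>s. ennreal M * indicator {0<..} s) t"
    by (rule nconv_mono) (use supp bound \<open>0 \<le> M\<close> in \<open>auto split: split_indicator intro: ennreal_leI\<close>)
  also have "\<dots> = ennreal M * nconv (kern a) (indicator {0<..}) t"
    by (rule nconv_cmult) auto
  also have "\<dots> < \<infinity>"
    using nconv_kern_indicator_finite[OF a] by (simp add: ennreal_mult_less_top)
  finally show ?thesis using a by (subst integrable_conv_iff) auto
qed

lemma integrable_kern_truncated:
  assumes a: "0 < a"
  shows "integrable lborel (\<lambda>x. kern a x * indicator {..<R} x)"
proof -
  have "(\<integral>\<^sup>+ x. ennreal (norm (kern a x * indicator {..<R} x)) \<partial>lborel)
      \<le> (\<integral>\<^sup>+ x. ennreal (exp R) * (ennreal (exp (- 1 * x)) * ennreal (kern a x)) \<partial>lborel)"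
  proof (rule nn_integral_mono)
    fix x
    have "kern a x * indicator {..<R} x \<le> kern a x * (exp R * exp (- 1 * x))"
      using a by (intro mult_left_mono) (auto simp: exp_add[symmetric] split: split_indicator)
    then show "ennreal (norm (kern a x * indicator {..<R} x)) \<le> ennreal (exp R) * (ennreal (exp (- 1 * x)) * ennreal (kern a x))"
      using a by (simp add: ennreal_mult[symmetric] ennreal_leI mult_ac)
  qed
  also have "\<dots> < \<infinity>"
    using kern_Laplace[of a 1] a by (subst nn_integral_cmult) (auto simp: ennreal_mult_less_top)
  finally show ?thesis by (simp add: integrable_iff_bounded)
qed

text \<open>A bounded function is paired with translates of the kernel, so continuity of
  translations in L^1 applies once the kernel is truncated to be integrable. As h vanishes for s
  \<le> 0, the truncation is invisible.\<close>

lemma conv_kern_tendsto: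
  fixes h :: "real \<Rightarrow> 'a::{banach, second_countable_topology}"
  assumes a: "0 < a" and h[measurable]: "h \<in> borel_measurable borel"
    and supp: "\<And>s. s \<le> 0 \<Longrightarrow> h s = 0" and bound: "\<And>s. norm (h s) \<le> M"
    and d: "d \<longlonglongrightarrow> (0::real)"
  shows "(\<lambda>n. conv (kern a) h (d n + t)) \<longlonglongrightarrow> conv (kern a) h t"
proof -
  obtain B where B: "\<And>n. norm (d n) \<le> B"
    using convergent_imp_Bseq[OF convergentI[OF d]] by (auto simp: Bseq_def)
  \<comment> \<open>B bounds the shifts, so the cutoff lies beyond every argument d n + t - s with s
    > 0.\<close>
  define K where "K = (\<lambda>x. kern a x * indicator {..<\<bar>t\<bar> + B + 1} x)"
  have K: "integrable lborel K" unfolding K_def by (rule integrable_kern_truncated[OF a])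
  have M: "0 \<le> M" using bound[of 0] norm_ge_zero order_trans by blast
  have lim: "(\<lambda>n. M * (LINT x|lborel. norm (K (d n + x) - K x))) \<longlonglongrightarrow> M * 0"
    using L1_translation_continuous[OF K] d unfolding L1_translation_continuous_def
    by (intro tendsto_mult_left) blast
  have "norm (conv (kern a) h (d n + t) - conv (kern a) h t) \<le> M * (LINT x|lborel. norm (K (d n + x) - K x))" for n
  proof -
    have eq: "(kern a (d n + t - s) - kern a (t - s)) *\<^sub>R h s = (K (d n + (t - s)) - K (t - s)) *\<^sub>R h s" for s
      using B[of n] supp[of s] by (cases "s \<le> 0") (auto simp: K_def algebra_simps abs_le_iff split: split_indicator)
    have i0: "integrable lborel (\<lambda>x. norm (K (d n + x) - K x))"
      using K by (intro integrable_norm Bochner_Integration.integrable_diff integrable_translate)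
    have i1: "integrable lborel (\<lambda>s. norm (K (d n + (t - s)) - K (t - s)))"
      using lborel_integrable_real_affine[OF i0, of "-1" t] by simp
    have "conv (kern a) h (d n + t) - conv (kern a) h t
        = (LINT s|lborel. kern a (d n + t - s) *\<^sub>R h s - kern a (t - s) *\<^sub>R h s)"
      unfolding conv_def
      by (rule Bochner_Integration.integral_diff[symmetric]) (rule integrable_kern_bounded[OF a h supp bound], assumption)+
    also have "\<dots> = (LINT s|lborel. (K (d n + (t - s)) - K (t - s)) *\<^sub>R h s)"
      by (simp only: scaleR_diff_left[symmetric] eq)
    also have "norm \<dots> \<le> (LINT s|lborel. norm (K (d n + (t - s)) - K (t - s)) * M)"
    proof (rule Bochner_Integration.integral_norm_bound_integral)
      show "integrable lborel (\<lambda>s. (K (d n + (t - s)) - K (t - s)) *\<^sub>R h s)"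
        by (rule Bochner_Integration.integrable_bound[OF integrable_mult_right[OF i1, of M]])
          (use bound M in \<open>auto simp: K_def mult.commute intro!: mult_right_mono\<close>)
      show "integrable lborel (\<lambda>s. norm (K (d n + (t - s)) - K (t - s)) * M)"
        using i1 by (rule integrable_mult_left)
      show "norm ((K (d n + (t - s)) - K (t - s)) *\<^sub>R h s) \<le> norm (K (d n + (t - s)) - K (t - s)) * M" for s
        using bound[of s] by (simp add: mult_left_mono)
    qed
    also have "\<dots> = M * (LINT x|lborel. norm (K (d n + x) - K x))"
      using lborel_integral_real_affine[of "-1" "\<lambda>x. norm (K (d n + x) - K x)" t] by simp
    finally show ?thesis .
  qed
  then have "\<forall>n. norm (conv (kern a) h (d n + t) - conv (kern a) h t) \<le> M * (LINT x|lborel. norm (K (d n + x) - K x))"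
    by blast
  then have "(\<lambda>n. conv (kern a) h (d n + t) - conv (kern a) h t) \<longlonglongrightarrow> 0"
    by (rule Lim_null_comparison[OF always_eventually lim[unfolded mult_zero_right]])
  then show ?thesis by (simp add: LIM_zero_cancel)
qed

lemma norm_conv_kern_bounded:
  fixes h :: "real \<Rightarrow> 'a::{banach, second_countable_topology}"
  assumes a: "0 < a" "a \<le> 1" and T: "0 < T" and [measurable]: "h \<in> borel_measurable borel"
    and supp: "\<And>s. s \<notin> {0<..<T} \<Longrightarrow> h s = 0" and bound: "\<And>s. norm (h s) \<le> M"
  shows "norm (conv (kern a) h t) \<le> M * (exp 1 * T powr a)"
proof -
  have M: "0 \<le> M" using bound[of 0] norm_ge_zero order_trans by blast
  have "ennreal (norm (conv (kern a) h t)) \<le> nconv (kern a) (\<lambda>s. ennreal (norm (h s))) t"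
    by (rule norm_conv_le) (use a in auto)
  also have "\<dots> \<le> nconv (kern a) (\<lambda>s. ennreal M * indicator {0<..<T} s) t"
  proof (rule nconv_mono)
    fix s show "ennreal (norm (h s)) \<le> ennreal M * indicator {0<..<T} s"
      using supp[of s] bound[of s] M by (cases "s \<in> {0<..<T}") (auto intro: ennreal_leI)
  qed
  also have "\<dots> = ennreal M * nconv (kern a) (indicator {0<..<T}) t"
    by (rule nconv_cmult) auto
  also have "\<dots> \<le> ennreal M * ennreal (exp 1 * T powr a)"
    by (intro mult_left_mono nconv_kern_Ioo_le a T) auto
  finally show ?thesis using M by (simp add: ennreal_mult[symmetric])
qed

lemma Lipschitz_tendsto:
  fixes A :: "'a::real_normed_vector \<Rightarrow> 'b::real_normed_vector"
  assumes Lip: "\<And>x y. norm (A x - A y) \<le> \<Lambda> * norm (x - y)" and X: "X \<longlonglongrightarrow> x"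
  shows "(\<lambda>n::nat. A (X n)) \<longlonglongrightarrow> A x"
proof -
  have "(\<lambda>n. \<Lambda> * norm (X n - x)) \<longlonglongrightarrow> \<Lambda> * norm (x - x)"
    by (intro tendsto_intros X)
  then have lim: "(\<lambda>n. \<Lambda> * norm (X n - x)) \<longlonglongrightarrow> 0" by simp
  have "(\<lambda>n. A (X n) - A x) \<longlonglongrightarrow> 0"
    by (rule Lim_null_comparison[OF always_eventually lim]) (rule allI, rule Lip)
  then show ?thesis by (simp add: LIM_zero_cancel)
qed

text \<open>The gradient inequality at x bounds F (X n) from below, the one at X n bounds it from
  above, and both bounds tend to F x.\<close>

lemma convex_gradient_tendsto:
  fixes A :: "'a::real_inner \<Rightarrow> 'a" and F :: "'a \<Rightarrow> real"
  assumes grad: "\<And>x y. F x + inner (A x) (y - x) \<le> F y"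
    and Lip: "\<And>x y. norm (A x - A y) \<le> \<Lambda> * norm (x - y)" and X: "X \<longlonglongrightarrow> x"
  shows "(\<lambda>n::nat. F (X n)) \<longlonglongrightarrow> F x"
proof -
  have "(\<lambda>n. F x + inner (A x) (X n - x)) \<longlonglongrightarrow> F x + inner (A x) (x - x)"
    by (intro tendsto_intros X)
  moreover have "(\<lambda>n. F x - inner (A (X n)) (x - X n)) \<longlonglongrightarrow> F x - inner (A x) (x - x)"
    by (intro tendsto_intros X Lipschitz_tendsto[of A, OF Lip])
  moreover have "F (X n) \<le> F x - inner (A (X n)) (x - X n)" for n
    using grad[of "X n" x] by simp
  ultimately show ?thesis
    using grad[of x]
    by (intro tendsto_sandwich[of "\<lambda>n. F x + inner (A x) (X n - x)" "\<lambda>n. F (X n)" sequentially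
      "\<lambda>n. F x - inner (A (X n)) (x - X n)" "F x"]) auto
qed

section \<open>The chain inequality for bounded g\<close>

context
  fixes a T M \<Lambda> :: real and g :: "real \<Rightarrow> 'a::{real_inner, banach, second_countable_topology}"
    and A :: "'a \<Rightarrow> 'a" and F :: "'a \<Rightarrow> real" and u0 :: 'a
  assumes a: "0 < a" "a < 1" and T: "0 < T"
    and g_meas [measurable]: "g \<in> borel_measurable borel"
    and g_supp: "\<And>s. s \<notin> {0<..<T} \<Longrightarrow> g s = 0" and g_bound: "\<And>s. norm (g s) \<le> M"
    and grad: "\<And>x y. F x + inner (A x) (y - x) \<le> F y"
    and Lip: "\<And>x y. norm (A x - A y) \<le> \<Lambda> * norm (x - y)" and Lip_nonneg: "0 \<le> \<Lambda>"
begin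

private definition "w = conv (kern a) g"
private definition "\<phi> s = F (u0 + w s) - F u0"
text \<open>This is the truncated Marchaud derivative of w, seen from the side of g; as \<epsilon>
  tends to 0 it stands for g times the mass of \<open>eta\<close>.\<close>

private definition "q \<epsilon> = conv (eta a \<epsilon>) g"
private definition "W = M * (exp 1 * T powr a)"

private lemma M_nonneg: "0 \<le> M"
  using g_bound[of 0] norm_ge_zero order_trans by blast

private lemma w_meas [measurable]: "w \<in> borel_measurable borel"
  unfolding w_def by measurable

private lemma q_meas [measurable]: "q \<epsilon> \<in> borel_measurable borel"
  unfolding q_def by measurable

private lemma w_bound: "norm (w s) \<le> W"
  unfolding w_def W_def by (rule norm_conv_kern_bounded) (use a T g_supp g_bound in auto)

private lemma w_eq_0: "s \<le> 0 \<Longrightarrow> w s = 0"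
  unfolding w_def by (rule conv_kern_eq_0) (use g_supp in auto)

private definition "B = norm (A u0) + \<Lambda> * W"
private definition "Au s = A (u0 + w s)"

private lemma W_nonneg: "0 \<le> W"
  using w_bound[of 0] norm_ge_zero order_trans by blast

private lemma Au_bound: "norm (Au s) \<le> B"
proof -
  have "norm (Au s) \<le> norm (A u0) + norm (A (u0 + w s) - A u0)"
    unfolding Au_def by (metis add.commute diff_add_cancel norm_triangle_ineq)
  also have "\<dots> \<le> norm (A u0) + \<Lambda> * W"
    using Lip[of "u0 + w s" u0] mult_left_mono[OF w_bound[of s] Lip_nonneg] by simp
  finally show ?thesis by (simp add: B_def)
qed

private lemma B_nonneg: "0 \<le> B"
  using Au_bound[of 0] norm_ge_zero order_trans by blast

private lemma Au_meas [measurable]: "Au \<in> borel_measurable borel"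
proof -
  have "continuous_on UNIV A" by (rule continuous_on_sequentiallyI) (rule Lipschitz_tendsto[OF Lip])
  then have [measurable]: "A \<in> borel_measurable borel" by (rule borel_measurable_continuous_onI)
  show ?thesis unfolding Au_def by measurable
qed

private lemma phi_meas [measurable]: "\<phi> \<in> borel_measurable borel"
proof -
  have "continuous_on UNIV F" by (rule continuous_on_sequentiallyI) (rule convex_gradient_tendsto[OF grad Lip])
  then have [measurable]: "F \<in> borel_measurable borel" by (rule borel_measurable_continuous_onI)
  show ?thesis unfolding \<phi>_def by measurable
qed

private lemma phi_bound: "norm (\<phi> s) \<le> B * W"
proof -
  have "- (norm (A u0) * norm (w s)) \<le> inner (A u0) (w s)"
    using Cauchy_Schwarz_ineq2[of "A u0" "w s"] by simp
  moreover have "norm (A u0) * norm (w s) \<le> B * W"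
    using w_bound[of s] W_nonneg B_nonneg Lip_nonneg by (intro mult_mono) (auto simp: B_def)
  moreover have "inner (A u0) (w s) \<le> \<phi> s" using grad[of u0 "u0 + w s"] by (simp add: \<phi>_def)
  moreover have "\<phi> s \<le> inner (Au s) (w s)" using grad[of "u0 + w s" u0] by (simp add: \<phi>_def Au_def)
  moreover have "inner (Au s) (w s) \<le> B * W"
    using norm_cauchy_schwarz[of "Au s" "w s"] mult_mono[OF Au_bound[of s] w_bound[of s] B_nonneg norm_ge_zero]
    by linarith
  ultimately show ?thesis by (simp add: abs_le_iff)
qed

private lemma phi_eq_0: "s \<le> 0 \<Longrightarrow> \<phi> s = 0"
  by (simp add: \<phi>_def w_eq_0)

private lemma
  assumes \<epsilon>: "0 < \<epsilon>"
  shows integrable_trunc_kern: "integrable lborel (\<lambda>r. trunc_kern a \<epsilon> (s - r))"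
    and integral_trunc_kern: "(LINT r|lborel. trunc_kern a \<epsilon> (s - r)) = \<epsilon> powr (- a)"
proof -
  have "has_bochner_integral lborel (trunc_kern a \<epsilon>) (\<epsilon> powr (- a))"
    using a \<epsilon> nn_integral_trunc_kern[of a \<epsilon>] trunc_kern_nonneg[of a]
    by (intro has_bochner_integral_nn_integral) auto
  then have "has_bochner_integral lborel (\<lambda>r. trunc_kern a \<epsilon> (s - r)) (\<epsilon> powr (- a))"
    using lborel_has_bochner_integral_real_affine_iff[of "-1" "trunc_kern a \<epsilon>" "\<epsilon> powr (- a)" s] by simp
  then show "integrable lborel (\<lambda>r. trunc_kern a \<epsilon> (s - r))"
    "(LINT r|lborel. trunc_kern a \<epsilon> (s - r)) = \<epsilon> powr (- a)"
    by (auto simp: has_bochner_integral_iff)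
qed

private lemma integrable_trunc_kern_scaleR:
  fixes h :: "real \<Rightarrow> 'b::{banach, second_countable_topology}"
  assumes \<epsilon>: "0 < \<epsilon>" and [measurable]: "h \<in> borel_measurable borel" and h: "\<And>s. norm (h s) \<le> C"
  shows "integrable lborel (\<lambda>r. trunc_kern a \<epsilon> (s - r) *\<^sub>R h r)"
proof (rule Bochner_Integration.integrable_bound)
  show "integrable lborel (\<lambda>r. trunc_kern a \<epsilon> (s - r) * C)"
    by (rule integrable_mult_left[OF integrable_trunc_kern[OF \<epsilon>]])
  show "AE r in lborel. norm (trunc_kern a \<epsilon> (s - r) *\<^sub>R h r) \<le> norm (trunc_kern a \<epsilon> (s - r) * C)"
  proof (rule AE_I2)
    fix r
    have "norm (h r) \<le> \<bar>C\<bar>" using h[of r] by linarith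
    then show "norm (trunc_kern a \<epsilon> (s - r) *\<^sub>R h r) \<le> norm (trunc_kern a \<epsilon> (s - r) * C)"
      by (simp add: abs_mult mult_left_mono)
  qed
qed measurable

private lemma norm_conv_trunc_kern_le:
  fixes h :: "real \<Rightarrow> 'b::{banach, second_countable_topology}"
  assumes \<epsilon>: "0 < \<epsilon>" and [measurable]: "h \<in> borel_measurable borel" and h: "\<And>s. norm (h s) \<le> C"
  shows "norm (conv (trunc_kern a \<epsilon>) h s) \<le> \<epsilon> powr (- a) * C"
proof -
  have "norm (conv (trunc_kern a \<epsilon>) h s) \<le> (LINT r|lborel. trunc_kern a \<epsilon> (s - r) * C)"
    unfolding conv_def
  proof (rule Bochner_Integration.integral_norm_bound_integral)
    show "norm (trunc_kern a \<epsilon> (s - r) *\<^sub>R h r) \<le> trunc_kern a \<epsilon> (s - r) * C" for r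
      using h[of r] a trunc_kern_nonneg[of a \<epsilon> "s - r"] by (simp add: mult_left_mono)
    show "integrable lborel (\<lambda>r. trunc_kern a \<epsilon> (s - r) * C)"
      by (rule integrable_mult_left[OF integrable_trunc_kern[OF \<epsilon>]])
  qed (rule integrable_trunc_kern_scaleR[OF \<epsilon> assms(2) h])
  also have "\<dots> = \<epsilon> powr (- a) * C" using integral_trunc_kern[OF \<epsilon>] by simp
  finally show ?thesis .
qed

private lemma integrable_eta_scaleR:
  fixes h :: "real \<Rightarrow> 'b::{banach, second_countable_topology}"
  assumes \<epsilon>: "0 < \<epsilon>" and [measurable]: "h \<in> borel_measurable borel"
    and h: "\<And>s. s \<le> 0 \<Longrightarrow> h s = 0" "\<And>s. norm (h s) \<le> C"
  shows "integrable lborel (\<lambda>r. eta a \<epsilon> (s - r) *\<^sub>R h r)"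
proof (rule Bochner_Integration.integrable_bound)
  show "integrable lborel (\<lambda>r. (\<epsilon> powr (- a)) *\<^sub>R (kern a (s - r) *\<^sub>R h r))"
    by (intro integrable_scaleR_right integrable_kern_bounded[where M = C]) (use a h in auto)
  show "AE r in lborel. norm (eta a \<epsilon> (s - r) *\<^sub>R h r) \<le> norm ((\<epsilon> powr (- a)) *\<^sub>R (kern a (s - r) *\<^sub>R h r))"
  proof (rule AE_I2)
    fix r
    have "eta a \<epsilon> (s - r) * norm (h r) \<le> (\<epsilon> powr (- a) * kern a (s - r)) * norm (h r)"
      by (rule mult_right_mono[OF eta_le_kern]) (use a \<epsilon> in auto)
    then show "norm (eta a \<epsilon> (s - r) *\<^sub>R h r) \<le> norm ((\<epsilon> powr (- a)) *\<^sub>R (kern a (s - r) *\<^sub>R h r))"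
      using eta_nonneg[of a \<epsilon> "s - r"] a \<epsilon> by (simp add: mult.assoc)
  qed
qed measurable

private lemma conv_difference_kern:
  fixes h :: "real \<Rightarrow> 'b::{banach, second_countable_topology}"
  assumes \<epsilon>: "0 < \<epsilon>" and [measurable]: "h \<in> borel_measurable borel"
    and h: "\<And>s. s \<le> 0 \<Longrightarrow> h s = 0" "\<And>s. norm (h s) \<le> C"
  shows "conv (\<lambda>x. \<epsilon> powr (- a) * kern a x - eta a \<epsilon> x) h s
      = \<epsilon> powr (- a) *\<^sub>R conv (kern a) h s - conv (eta a \<epsilon>) h s" (is ?eq)
    and "nconv (\<lambda>x. \<epsilon> powr (- a) * kern a x - eta a \<epsilon> x) (\<lambda>s. ennreal (norm (h s))) s < \<infinity>" (is ?fin)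
proof -
  have i1: "integrable lborel (\<lambda>r. (\<epsilon> powr (- a)) *\<^sub>R (kern a (s - r) *\<^sub>R h r))"
    by (intro integrable_scaleR_right integrable_kern_bounded[where M = C]) (use a h in auto)
  have i2: "integrable lborel (\<lambda>r. eta a \<epsilon> (s - r) *\<^sub>R h r)"
    by (rule integrable_eta_scaleR[OF \<epsilon> assms(2) h])
  have eq: "(\<epsilon> powr (- a) * kern a (s - r) - eta a \<epsilon> (s - r)) *\<^sub>R h r
     = (\<epsilon> powr (- a)) *\<^sub>R (kern a (s - r) *\<^sub>R h r) - eta a \<epsilon> (s - r) *\<^sub>R h r" for r
    by (simp add: scaleR_diff_left)
  show ?eq
    by (simp only: conv_def eq Bochner_Integration.integral_diff[OF i1 i2] Bochner_Integration.integral_scaleR_right)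
  have "integrable lborel (\<lambda>r. (\<epsilon> powr (- a) * kern a (s - r) - eta a \<epsilon> (s - r)) *\<^sub>R h r)"
    unfolding eq using i1 i2 by simp
  then show ?fin
    using eta_le_kern[of a \<epsilon>] a \<epsilon>
    by (subst integrable_conv_iff[symmetric]) auto
qed

text \<open>Associativity and \<open>nconv_trunc_kern_kern\<close>: applying the truncated operator
  to w amounts to smoothing g by \<open>eta\<close>.\<close>

private lemma q_eq:
  assumes \<epsilon>: "0 < \<epsilon>"
  shows "q \<epsilon> s = \<epsilon> powr (- a) *\<^sub>R w s - conv (trunc_kern a \<epsilon>) w s"
proof -
  have g: "\<And>s. s \<le> 0 \<Longrightarrow> g s = 0" using g_supp by auto
  note D = conv_difference_kern[OF \<epsilon> g_meas g g_bound, of s]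
  have "conv (trunc_kern a \<epsilon>) (conv (kern a) g) s = conv (\<lambda>x. \<epsilon> powr (- a) * kern a x - eta a \<epsilon> x) g s"
    by (rule conv_assoc[OF _ _ _ _ _ _ _ nconv_trunc_kern_kern D(2)])
      (use a \<epsilon> trunc_kern_nonneg eta_le_kern in auto)
  then show ?thesis using D(1) by (simp add: q_def w_def)
qed

text \<open>The bound blows up as \<epsilon> tends to 0; it serves integrability at fixed
  \<epsilon>.\<close>

private lemma q_bound:
  assumes \<epsilon>: "0 < \<epsilon>"
  shows "norm (q \<epsilon> s) \<le> 2 * (\<epsilon> powr (- a) * W)"
proof -
  have "norm (q \<epsilon> s) \<le> norm (\<epsilon> powr (- a) *\<^sub>R w s) + norm (conv (trunc_kern a \<epsilon>) w s)"
    unfolding q_eq[OF \<epsilon>] by (rule norm_triangle_ineq4)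
  moreover have "norm (\<epsilon> powr (- a) *\<^sub>R w s) \<le> \<epsilon> powr (- a) * W"
    using mult_left_mono[OF w_bound[of s] powr_ge_zero, of \<epsilon> "- a"] by (simp only: norm_scaleR abs_of_nonneg powr_ge_zero)
  moreover have "norm (conv (trunc_kern a \<epsilon>) w s) \<le> \<epsilon> powr (- a) * W"
    by (rule norm_conv_trunc_kern_le[OF \<epsilon> w_meas w_bound])
  ultimately show ?thesis by linarith
qed

private lemma q_eq_0: "s \<le> 0 \<Longrightarrow> q \<epsilon> s = 0"
  unfolding q_def conv_def
proof (rule integral_eq_zero_AE, rule AE_I2)
  fix r assume "s \<le> 0"
  then show "eta a \<epsilon> (s - r) *\<^sub>R g r = 0"
    using g_supp[of r] by (cases "r \<le> 0") (auto simp: eta_def)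
qed

text \<open>The left side integrates \<phi> s - \<phi> r against the kernel. Convexity bounds each
  difference by the inner product of w s - w r with the gradient at s, which does not depend on r
  and leaves the integral; positivity of the kernel keeps the direction.\<close>

private lemma difference_inequality:
  assumes \<epsilon>: "0 < \<epsilon>"
  shows "\<epsilon> powr (- a) * \<phi> s - conv (trunc_kern a \<epsilon>) \<phi> s \<le> inner (q \<epsilon> s) (Au s)"
proof -
  let ?k = "\<lambda>r. trunc_kern a \<epsilon> (s - r)"
  note i0 = integrable_trunc_kern[OF \<epsilon>, of s] and I0 = integral_trunc_kern[OF \<epsilon>, of s]
  note iw = integrable_trunc_kern_scaleR[OF \<epsilon> w_meas w_bound, of s]
  note ip = integrable_trunc_kern_scaleR[OF \<epsilon> phi_meas phi_bound, of s]
  have "\<epsilon> powr (- a) * \<phi> s - conv (trunc_kern a \<epsilon>) \<phi> s = (LINT r|lborel. ?k r * \<phi> s - ?k r *\<^sub>R \<phi> r)"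
    using i0 I0 ip by (simp add: conv_def)
  also have "\<dots> \<le> (LINT r|lborel. inner (?k r *\<^sub>R w s - ?k r *\<^sub>R w r) (Au s))"
  proof (rule integral_mono)
    show "integrable lborel (\<lambda>r. ?k r * \<phi> s - ?k r *\<^sub>R \<phi> r)" using i0 ip by simp
    show "integrable lborel (\<lambda>r. inner (?k r *\<^sub>R w s - ?k r *\<^sub>R w r) (Au s))"
      using i0 iw by (intro integrable_inner_left Bochner_Integration.integrable_diff integrable_scaleR_left) auto
    fix r
    have "\<phi> s - \<phi> r \<le> inner (w s - w r) (Au s)"
      using grad[of "u0 + w s" "u0 + w r"]
      by (simp add: \<phi>_def Au_def inner_commute inner_diff_right inner_diff_left)
    then have "?k r * (\<phi> s - \<phi> r) \<le> ?k r * inner (w s - w r) (Au s)"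
      using a trunc_kern_nonneg by (intro mult_left_mono) auto
    then show "?k r * \<phi> s - ?k r *\<^sub>R \<phi> r \<le> inner (?k r *\<^sub>R w s - ?k r *\<^sub>R w r) (Au s)"
      by (simp add: algebra_simps inner_diff_left)
  qed
  also have "\<dots> = inner (LINT r|lborel. ?k r *\<^sub>R w s - ?k r *\<^sub>R w r) (Au s)"
    using i0 iw by (intro integral_inner_left Bochner_Integration.integrable_diff integrable_scaleR_left) auto
  also have "(LINT r|lborel. ?k r *\<^sub>R w s - ?k r *\<^sub>R w r) = q \<epsilon> s"
    using i0 I0 iw by (simp add: q_eq[OF \<epsilon>] conv_def)
  finally show ?thesis .
qed

text \<open>Convolving the difference inequality with the nonnegative \<open>kern a\<close> undoes
  the truncated operator on the left and leaves \<phi> smoothed by \<open>eta\<close>.\<close>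

private lemma regularized_inequality:
  assumes \<epsilon>: "0 < \<epsilon>"
  shows "conv (eta a \<epsilon>) \<phi> t \<le> conv (kern a) (\<lambda>s. inner (q \<epsilon> s) (Au s)) t"
proof -
  note D = conv_difference_kern[OF \<epsilon> phi_meas phi_eq_0 phi_bound, of t]
  have cm[measurable]: "conv (trunc_kern a \<epsilon>) \<phi> \<in> borel_measurable borel" by measurable
  have c0: "conv (trunc_kern a \<epsilon>) \<phi> s = 0" if "s \<le> 0" for s
    unfolding conv_def
  proof (rule integral_eq_zero_AE, rule AE_I2)
    fix r show "trunc_kern a \<epsilon> (s - r) *\<^sub>R \<phi> r = 0"
      using that \<epsilon> phi_eq_0[of r] by (cases "r \<le> 0") (auto simp: trunc_kern_def)
  qed
  have i1: "integrable lborel (\<lambda>s. kern a (t - s) *\<^sub>R \<phi> s)"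
    by (rule integrable_kern_bounded[OF a(1) phi_meas phi_eq_0 phi_bound])
  have i2: "integrable lborel (\<lambda>s. kern a (t - s) *\<^sub>R conv (trunc_kern a \<epsilon>) \<phi> s)"
    by (rule integrable_kern_bounded[OF a(1) cm c0 norm_conv_trunc_kern_le[OF \<epsilon> phi_meas phi_bound]])
  have i3: "integrable lborel (\<lambda>s. kern a (t - s) *\<^sub>R inner (q \<epsilon> s) (Au s))"
  proof (rule integrable_kern_bounded[OF a(1), where M = "2 * (\<epsilon> powr (- a) * W) * B"])
    show "norm (inner (q \<epsilon> s) (Au s)) \<le> 2 * (\<epsilon> powr (- a) * W) * B" for s
      using Cauchy_Schwarz_ineq2[of "q \<epsilon> s" "Au s"] mult_mono[OF q_bound[OF \<epsilon>, of s] Au_bound[of s]] W_nonneg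
      by auto
  qed (auto simp: q_eq_0)
  have "conv (kern a) (conv (trunc_kern a \<epsilon>) \<phi>) t = conv (\<lambda>x. \<epsilon> powr (- a) * kern a x - eta a \<epsilon> x) \<phi> t"
  proof (rule conv_assoc[OF _ _ _ _ _ _ _ _ D(2)])
    show "nconv (kern a) (\<lambda>s. ennreal (trunc_kern a \<epsilon> s)) x = ennreal (\<epsilon> powr (- a) * kern a x - eta a \<epsilon> x)" for x
      using nconv_trunc_kern_kern[OF a \<epsilon>, of x] nconv_commute[of "kern a" "trunc_kern a \<epsilon>" x] by simp
  qed (use a \<epsilon> trunc_kern_nonneg eta_le_kern in auto)
  then have "conv (eta a \<epsilon>) \<phi> t = \<epsilon> powr (- a) * conv (kern a) \<phi> t - conv (kern a) (conv (trunc_kern a \<epsilon>) \<phi>) t"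
    using D(1) by simp
  also have "\<dots> = (LINT s|lborel. \<epsilon> powr (- a) * (kern a (t - s) *\<^sub>R \<phi> s) - kern a (t - s) *\<^sub>R conv (trunc_kern a \<epsilon>) \<phi> s)"
    unfolding conv_def[of "kern a"] using i1 i2 by simp
  also have "\<dots> \<le> (LINT s|lborel. kern a (t - s) *\<^sub>R inner (q \<epsilon> s) (Au s))"
  proof (rule integral_mono)
    fix s
    have "kern a (t - s) * (\<epsilon> powr (- a) * \<phi> s - conv (trunc_kern a \<epsilon>) \<phi> s) \<le> kern a (t - s) * inner (q \<epsilon> s) (Au s)"
      by (intro mult_left_mono difference_inequality \<epsilon>) (use a in auto)
    then show "\<epsilon> powr (- a) * (kern a (t - s) *\<^sub>R \<phi> s) - kern a (t - s) *\<^sub>R conv (trunc_kern a \<epsilon>) \<phi> s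
        \<le> kern a (t - s) *\<^sub>R inner (q \<epsilon> s) (Au s)"
      by (simp add: algebra_simps)
  qed (use i1 i2 i3 in auto)
  finally show ?thesis by (simp add: conv_def)
qed

text \<open>Moves all dependence on \<epsilon> into the argument of h, ready for dominated
  convergence.\<close>

private lemma conv_eta_rescale:
  fixes h :: "real \<Rightarrow> 'b::{banach, second_countable_topology}"
  assumes \<epsilon>: "0 < \<epsilon>"
  shows "conv (eta a \<epsilon>) h s = (LINT r|lborel. eta a 1 r *\<^sub>R h (s - \<epsilon> * r))"
proof -
  have "conv (eta a \<epsilon>) h s = \<bar>- \<epsilon>\<bar> *\<^sub>R (LINT r|lborel. eta a \<epsilon> (s - (s + (- \<epsilon>) * r)) *\<^sub>R h (s + (- \<epsilon>) * r))"
    unfolding conv_def using \<epsilon> by (intro lborel_integral_real_affine) auto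
  also have "\<dots> = (LINT r|lborel. (\<epsilon> * eta a \<epsilon> (\<epsilon> * r)) *\<^sub>R h (s - \<epsilon> * r))"
    using \<epsilon> by (simp flip: scaleR_scaleR)
  finally show ?thesis using eta_scale[OF a(1) \<epsilon>] by simp
qed

text \<open>The weight that is paired with q and with g at time t. The indicator makes it integrable
  over the line and changes no pairing, since both partners vanish for s \<le> 0.\<close>

private definition "v t s = (indicator {0<..} s * kern a (t - s)) *\<^sub>R Au s"

private lemma v_meas [measurable]: "v t \<in> borel_measurable borel"
  unfolding v_def[abs_def] by measurable

private lemma v_integrable: "integrable lborel (v t)"
proof -
  have "integrable lborel (\<lambda>s. kern a (t - s) *\<^sub>R (indicator {0<..} s *\<^sub>R Au s))"
    by (rule integrable_kern_bounded[where M = B]) (use a Au_bound B_nonneg in \<open>auto split: split_indicator\<close>)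
  then show ?thesis by (simp add: v_def[abs_def] mult.commute)
qed

private lemma conv_inner_v:
  assumes "\<And>s. s \<le> 0 \<Longrightarrow> p s = 0"
  shows "conv (kern a) (\<lambda>s. inner (p s) (Au s)) t = (LINT s|lborel. inner (p s) (v t s))"
  unfolding conv_def v_def using assms
  by (intro Bochner_Integration.integral_cong) (auto split: split_indicator)

text \<open>Fubini's theorem moves the shift \<epsilon> r from g onto v. Then boundedness of g
  suffices, and the limit rests on continuity of translations of the integrable v.\<close>

private lemma rhs_rescale:
  assumes \<epsilon>: "0 < \<epsilon>"
  shows "conv (kern a) (\<lambda>s. inner (q \<epsilon> s) (Au s)) t
     = (LINT r|lborel. eta a 1 r * (LINT s|lborel. inner (g s) (v t (\<epsilon> * r + s))))"
proof -
  have int: "integrable (lborel \<Otimes>\<^sub>M lborel) (\<lambda>(s, r). eta a 1 r * inner (g (s - \<epsilon> * r)) (v t s))"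
  proof (rule integrableI_bounded)
    have "(\<integral>\<^sup>+ p. ennreal (norm (case p of (s, r) \<Rightarrow> eta a 1 r * inner (g (s - \<epsilon> * r)) (v t s))) \<partial>(lborel \<Otimes>\<^sub>M lborel))
      \<le> (\<integral>\<^sup>+ p. (case p of (s, r) \<Rightarrow> ennreal (eta a 1 r) * (ennreal M * ennreal (norm (v t s)))) \<partial>(lborel \<Otimes>\<^sub>M lborel))"
    proof (intro nn_integral_mono, clarify)
      fix s r
      have "\<bar>inner (g (s - \<epsilon> * r)) (v t s)\<bar> \<le> M * norm (v t s)"
        using Cauchy_Schwarz_ineq2[of "g (s - \<epsilon> * r)" "v t s"] mult_right_mono[OF g_bound[of "s - \<epsilon> * r"], of "norm (v t s)"]
        by simp
      then have "norm (eta a 1 r * inner (g (s - \<epsilon> * r)) (v t s)) \<le> eta a 1 r * (M * norm (v t s))"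
        using eta_nonneg[of a 1 r] a by (simp add: abs_mult mult_left_mono)
      then show "ennreal (norm (eta a 1 r * inner (g (s - \<epsilon> * r)) (v t s))) \<le> ennreal (eta a 1 r) * (ennreal M * ennreal (norm (v t s)))"
        using eta_nonneg[of a 1 r] a M_nonneg by (simp add: ennreal_mult[symmetric] ennreal_leI)
    qed
    also have "\<dots> = (\<integral>\<^sup>+ s. \<integral>\<^sup>+ r. ennreal (eta a 1 r) * (ennreal M * ennreal (norm (v t s))) \<partial>lborel \<partial>lborel)"
      by (subst lborel.nn_integral_fst[symmetric]) auto
    also have "\<dots> = (\<integral>\<^sup>+ r. ennreal (eta a 1 r) \<partial>lborel) * (ennreal M * (\<integral>\<^sup>+ s. ennreal (norm (v t s)) \<partial>lborel))"
      by (simp add: nn_integral_multc nn_integral_cmult)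
    also have "\<dots> < \<infinity>"
      using nn_integral_eta_finite[OF a] v_integrable[of t] by (simp add: ennreal_mult_less_top integrable_iff_bounded)
    finally show "(\<integral>\<^sup>+ p. ennreal (norm (case p of (s, r) \<Rightarrow> eta a 1 r * inner (g (s - \<epsilon> * r)) (v t s))) \<partial>(lborel \<Otimes>\<^sub>M lborel)) < \<infinity>" .
  qed measurable
  have "conv (kern a) (\<lambda>s. inner (q \<epsilon> s) (Au s)) t = (LINT s|lborel. inner (q \<epsilon> s) (v t s))"
    by (rule conv_inner_v) (rule q_eq_0)
  also have "\<dots> = (LINT s|lborel. LINT r|lborel. eta a 1 r * inner (g (s - \<epsilon> * r)) (v t s))"
  proof (rule Bochner_Integration.integral_cong[OF refl])
    fix s
    have "integrable lborel (\<lambda>r. eta a 1 r *\<^sub>R g (s - \<epsilon> * r))"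
    proof (rule Bochner_Integration.integrable_bound[OF integrable_mult_left[OF integrable_eta[OF a], of M]])
      show "AE r in lborel. norm (eta a 1 r *\<^sub>R g (s - \<epsilon> * r)) \<le> norm (eta a 1 r * M)"
        using g_bound M_nonneg by (intro AE_I2) (simp add: abs_mult mult_left_mono)
    qed measurable
    then have "(LINT r|lborel. inner (eta a 1 r *\<^sub>R g (s - \<epsilon> * r)) (v t s)) = inner (q \<epsilon> s) (v t s)"
      unfolding q_def conv_eta_rescale[OF \<epsilon>] by (intro integral_inner_left)
    then show "inner (q \<epsilon> s) (v t s) = (LINT r|lborel. eta a 1 r * inner (g (s - \<epsilon> * r)) (v t s))" by simp
  qed
  also have "\<dots> = (LINT r|lborel. LINT s|lborel. eta a 1 r * inner (g (s - \<epsilon> * r)) (v t s))"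
    by (rule lborel_pair.Fubini_integral[symmetric]) (rule int)
  also have "\<dots> = (LINT r|lborel. eta a 1 r * (LINT s|lborel. inner (g s) (v t (\<epsilon> * r + s))))"
  proof (rule Bochner_Integration.integral_cong[OF refl])
    fix r
    have "(LINT s|lborel. inner (g s) (v t (\<epsilon> * r + s))) = (LINT s|lborel. inner (g (s - \<epsilon> * r)) (v t s))"
      using integral_translate[of "\<lambda>s. inner (g (s - \<epsilon> * r)) (v t s)" "\<epsilon> * r"] by simp
    then show "(LINT s|lborel. eta a 1 r * inner (g (s - \<epsilon> * r)) (v t s))
        = eta a 1 r * (LINT s|lborel. inner (g s) (v t (\<epsilon> * r + s)))" by simp
  qed
  finally show ?thesis .
qed

private lemma e_tendsto: "(\<lambda>n. 1 / real (Suc n) * r) \<longlonglongrightarrow> 0"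
  using tendsto_mult_left_zero[OF LIMSEQ_Suc[OF lim_1_over_n]] by simp

text \<open>Continuity of w and F gives pointwise convergence under the integral; \<phi> is bounded,
  so a multiple of the profile dominates.\<close>

private lemma lhs_limit:
  "(\<lambda>n. conv (eta a (1 / real (Suc n))) \<phi> t) \<longlonglongrightarrow> (LINT r|lborel. eta a 1 r) * \<phi> t"
proof -
  have "(\<lambda>n. LINT r|lborel. eta a 1 r *\<^sub>R \<phi> (t - 1 / real (Suc n) * r)) \<longlonglongrightarrow> (LINT r|lborel. eta a 1 r *\<^sub>R \<phi> t)"
  proof (rule integral_dominated_convergence[where w = "\<lambda>r. eta a 1 r * (B * W)"])
    show "AE r in lborel. (\<lambda>n. eta a 1 r *\<^sub>R \<phi> (t - 1 / real (Suc n) * r)) \<longlonglongrightarrow> eta a 1 r *\<^sub>R \<phi> t"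
    proof (rule AE_I2)
      fix r
      have d: "(\<lambda>n. - (1 / real (Suc n) * r)) \<longlonglongrightarrow> 0"
        using tendsto_minus[OF e_tendsto[of r]] by simp
      have "(\<lambda>n. w (- (1 / real (Suc n) * r) + t)) \<longlonglongrightarrow> w t"
        unfolding w_def by (rule conv_kern_tendsto[OF a(1) g_meas _ g_bound d]) (use g_supp in auto)
      then have "(\<lambda>n. F (u0 + w (t - 1 / real (Suc n) * r))) \<longlonglongrightarrow> F (u0 + w t)"
        by (intro convex_gradient_tendsto[OF grad Lip] tendsto_add tendsto_const) simp
      then show "(\<lambda>n. eta a 1 r *\<^sub>R \<phi> (t - 1 / real (Suc n) * r)) \<longlonglongrightarrow> eta a 1 r *\<^sub>R \<phi> t"
        unfolding \<phi>_def by (intro tendsto_intros)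
    qed
    show "AE r in lborel. norm (eta a 1 r *\<^sub>R \<phi> (t - 1 / real (Suc n) * r)) \<le> eta a 1 r * (B * W)" for n
      using phi_bound eta_nonneg[of a 1] a by (intro AE_I2) (simp add: abs_mult mult_left_mono)
    show "integrable lborel (\<lambda>r. eta a 1 r * (B * W))"
      by (rule integrable_mult_left[OF integrable_eta[OF a]])
  qed measurable
  then show ?thesis by (simp add: conv_eta_rescale del: of_nat_Suc)
qed

private lemma rhs_limit:
  "(\<lambda>n. conv (kern a) (\<lambda>s. inner (q (1 / real (Suc n)) s) (Au s)) t)
     \<longlonglongrightarrow> (LINT r|lborel. eta a 1 r) * conv (kern a) (\<lambda>s. inner (g s) (Au s)) t"
proof -
  let ?H = "\<lambda>d. LINT s|lborel. inner (g s) (v t (d + s))"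
  have iv: "integrable lborel (\<lambda>s. v t (d + s))" for d
    by (rule integrable_translate[OF v_integrable])
  have ig: "integrable lborel (\<lambda>s. inner (g s) (f s))" if f: "integrable lborel f" for f
  proof (rule Bochner_Integration.integrable_bound[OF integrable_mult_right[OF integrable_norm[OF f], of M]])
    show "AE s in lborel. norm (inner (g s) (f s)) \<le> norm (M * norm (f s))"
    proof (rule AE_I2)
      fix s
      show "norm (inner (g s) (f s)) \<le> norm (M * norm (f s))"
        using Cauchy_Schwarz_ineq2[of "g s" "f s"] mult_right_mono[OF g_bound[of s], of "norm (f s)"] M_nonneg by simp
    qed
  qed (use borel_measurable_integrable[OF f] in measurable)
  have bd: "\<bar>LINT s|lborel. inner (g s) (f s)\<bar> \<le> M * (LINT s|lborel. norm (f s))" if f: "integrable lborel f" for f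
  proof -
    have "norm (LINT s|lborel. inner (g s) (f s)) \<le> (LINT s|lborel. M * norm (f s))"
    proof (rule Bochner_Integration.integral_norm_bound_integral)
      fix s show "norm (inner (g s) (f s)) \<le> M * norm (f s)"
        using Cauchy_Schwarz_ineq2[of "g s" "f s"] mult_right_mono[OF g_bound[of s], of "norm (f s)"] by simp
    qed (use f ig in auto)
    then show ?thesis by simp
  qed
  \<comment> \<open>The pairing H is continuous in the shift: g is bounded and the translates of v
    converge in L^1.\<close>
  have Hlim: "(\<lambda>n. ?H (d n)) \<longlonglongrightarrow> ?H 0" if d: "d \<longlonglongrightarrow> 0" for d :: "nat \<Rightarrow> real"
  proof -
    have lim: "(\<lambda>n. M * (LINT s|lborel. norm (v t (d n + s) - v t s))) \<longlonglongrightarrow> 0"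
      using L1_translation_continuous[OF v_integrable[of t]] d unfolding L1_translation_continuous_def
      by (intro tendsto_mult_right_zero) blast
    have "\<bar>?H (d n) - ?H 0\<bar> \<le> M * (LINT s|lborel. norm (v t (d n + s) - v t s))" for n
    proof -
      have "?H (d n) - ?H 0 = (LINT s|lborel. inner (g s) (v t (d n + s)) - inner (g s) (v t s))"
        using ig[OF iv] ig[OF v_integrable] by simp
      also have "\<dots> = (LINT s|lborel. inner (g s) (v t (d n + s) - v t s))"
        by (simp add: inner_diff_right)
      finally show ?thesis
        using bd[OF Bochner_Integration.integrable_diff[OF iv[of "d n"] v_integrable[of t]]] by simp
    qed
    then have "\<forall>n. norm (?H (d n) - ?H 0) \<le> M * (LINT s|lborel. norm (v t (d n + s) - v t s))" by simp
    then have "(\<lambda>n. ?H (d n) - ?H 0) \<longlonglongrightarrow> 0" by (rule Lim_null_comparison[OF always_eventually lim])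
    then show ?thesis by (rule LIM_zero_cancel)
  qed
  have Hbd: "\<bar>?H d\<bar> \<le> M * (LINT s|lborel. norm (v t s))" for d
    using bd[OF iv[of d]] integral_translate[of "\<lambda>s. norm (v t s)" d] by simp
  have "(\<lambda>n. LINT r|lborel. eta a 1 r * ?H (1 / real (Suc n) * r)) \<longlonglongrightarrow> (LINT r|lborel. eta a 1 r * ?H 0)"
  proof (rule integral_dominated_convergence[where w = "\<lambda>r. eta a 1 r * (M * (LINT s|lborel. norm (v t s)))"])
    show "AE r in lborel. (\<lambda>n. eta a 1 r * ?H (1 / real (Suc n) * r)) \<longlonglongrightarrow> eta a 1 r * ?H 0"
      by (intro AE_I2 tendsto_mult_left Hlim e_tendsto)
    show "AE r in lborel. norm (eta a 1 r * ?H (1 / real (Suc n) * r)) \<le> eta a 1 r * (M * (LINT s|lborel. norm (v t s)))" for n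
      using Hbd eta_nonneg[of a 1] a by (intro AE_I2) (simp add: abs_mult mult_left_mono)
    show "integrable lborel (\<lambda>r. eta a 1 r * (M * (LINT s|lborel. norm (v t s))))"
      by (rule integrable_mult_left[OF integrable_eta[OF a]])
  qed measurable
  moreover have "?H 0 = conv (kern a) (\<lambda>s. inner (g s) (Au s)) t"
    using conv_inner_v[of g t] g_supp by simp
  ultimately show ?thesis by (simp add: rhs_rescale del: of_nat_Suc)
qed

text \<open>Both sides of the regularized inequality tend to the desired terms times the same
  positive mass of \<open>eta\<close>, which cancels.\<close>

lemma fractional_chain_bounded:
  "F (u0 + conv (kern a) g t) - F u0 \<le> conv (kern a) (\<lambda>s. inner (g s) (A (u0 + conv (kern a) g s))) t"
proof -
  have "(LINT r|lborel. eta a 1 r) * \<phi> t \<le> (LINT r|lborel. eta a 1 r) * conv (kern a) (\<lambda>s. inner (g s) (Au s)) t"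
    by (rule LIMSEQ_le[OF lhs_limit rhs_limit]) (auto intro!: exI[of _ 0] regularized_inequality simp del: of_nat_Suc)
  then show ?thesis
    using integral_eta_pos[OF a] by (simp add: \<phi>_def Au_def w_def)
qed

end

section \<open>Extension of the chain inequality to unbounded g\<close>

lemma nconv_kern_square_le:
  assumes a: "0 < a" "a \<le> 1" and T: "0 < T" and [measurable]: "h \<in> borel_measurable borel"
    and supp: "\<And>s. s \<notin> {0<..<T} \<Longrightarrow> h s = 0"
  shows "(nconv (kern a) h t)\<^sup>2 \<le> ennreal (exp 1 * T powr a) * nconv (kern a) (\<lambda>s. (h s)\<^sup>2) t"
proof -
  have "(nconv (kern a) h t)\<^sup>2 \<le> nconv (kern a) (indicator {0<..<T}) t * nconv (kern a) (\<lambda>s. (h s)\<^sup>2) t"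
    by (rule nconv_Cauchy_Schwarz) (use a supp in auto)
  also have "\<dots> \<le> ennreal (exp 1 * T powr a) * nconv (kern a) (\<lambda>s. (h s)\<^sup>2) t"
    by (intro mult_right_mono nconv_kern_Ioo_le a T) auto
  finally show ?thesis .
qed

lemma conv_truncation_tendsto:
  fixes g :: "real \<Rightarrow> 'a::{banach, second_countable_topology}"
  assumes [measurable]: "k \<in> borel_measurable borel" "g \<in> borel_measurable borel"
    and k: "\<And>x. 0 \<le> k x" and fin: "nconv k (\<lambda>s. ennreal (norm (g s))) t < \<infinity>"
  shows "(\<lambda>n::nat. conv k (\<lambda>s. if norm (g s) \<le> real n then g s else 0) t) \<longlonglongrightarrow> conv k g t"
  unfolding conv_def
proof (rule integral_dominated_convergence[where w = "\<lambda>s. norm (k (t - s) *\<^sub>R g s)"])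
  show "integrable lborel (\<lambda>s. norm (k (t - s) *\<^sub>R g s))"
    using fin k by (intro integrable_norm) (subst integrable_conv_iff, auto)
  show "AE s in lborel. (\<lambda>n. k (t - s) *\<^sub>R (if norm (g s) \<le> real n then g s else 0)) \<longlonglongrightarrow> k (t - s) *\<^sub>R g s"
  proof (rule AE_I2)
    fix s
    obtain N :: nat where N: "norm (g s) \<le> real N" using real_arch_simple by blast
    have "\<forall>\<^sub>F n in sequentially. k (t - s) *\<^sub>R (if norm (g s) \<le> real n then g s else 0) = k (t - s) *\<^sub>R g s"
      using eventually_ge_at_top[of N] by eventually_elim (use N in auto)
    then show "(\<lambda>n. k (t - s) *\<^sub>R (if norm (g s) \<le> real n then g s else 0)) \<longlonglongrightarrow> k (t - s) *\<^sub>R g s"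
      by (rule tendsto_eventually)
  qed
  show "AE s in lborel. norm (k (t - s) *\<^sub>R (if norm (g s) \<le> real n then g s else 0)) \<le> norm (k (t - s) *\<^sub>R g s)" for n
    by (intro AE_I2) auto
qed measurable

text \<open>Both finiteness conditions concern the single time t, because a g that is merely
  square-integrable satisfies them only for almost every t. Truncating the values of g reduces to
  the bounded case, and the second condition controls the convolution of g inside the
  integral.\<close>

theorem fractional_chain:
  fixes g :: "real \<Rightarrow> 'a::{real_inner, banach, second_countable_topology}"
    and A :: "'a \<Rightarrow> 'a" and F :: "'a \<Rightarrow> real" and u0 :: 'a
  assumes a: "0 < a" "a < 1" and T: "0 < T"
    and g_meas [measurable]: "g \<in> borel_measurable borel"
    and g_supp: "\<And>s. s \<notin> {0<..<T} \<Longrightarrow> g s = 0"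
    and grad: "\<And>x y. F x + inner (A x) (y - x) \<le> F y"
    and Lip: "\<And>x y. norm (A x - A y) \<le> \<Lambda> * norm (x - y)" and Lip_nonneg: "0 \<le> \<Lambda>"
    and fin1: "nconv (kern a) (\<lambda>s. (ennreal (norm (g s)))\<^sup>2) t < \<infinity>"
    and fin2: "nconv (kern a) (nconv (kern a) (\<lambda>s. (ennreal (norm (g s)))\<^sup>2)) t < \<infinity>"
  shows "integrable lborel (\<lambda>s. kern a (t - s) *\<^sub>R inner (g s) (A (u0 + conv (kern a) g s)))" (is ?int)
    and "F (u0 + conv (kern a) g t) - F u0 \<le> conv (kern a) (\<lambda>s. inner (g s) (A (u0 + conv (kern a) g s))) t" (is ?le)
proof -
  define c where "c = exp 1 * T powr a"
  define N where "N = nconv (kern a) (\<lambda>s. ennreal (norm (g s)))"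
  have [measurable]: "N \<in> borel_measurable borel" unfolding N_def by measurable
  have sq: "(N s)\<^sup>2 \<le> ennreal c * nconv (kern a) (\<lambda>s. (ennreal (norm (g s)))\<^sup>2) s" for s
    unfolding N_def c_def by (rule nconv_kern_square_le) (use a T g_supp in auto)
  have N_fin: "N s < \<infinity>" if "nconv (kern a) (\<lambda>s. (ennreal (norm (g s)))\<^sup>2) s < \<infinity>" for s
  proof -
    have "(N s)\<^sup>2 < \<infinity>" using sq[of s] that by (auto simp: ennreal_mult_less_top intro: le_less_trans)
    then show ?thesis by (auto simp: power2_eq_square ennreal_mult_less_top less_top[symmetric] ennreal_mult_eq_top_iff)
  qed
  define gn where "gn = (\<lambda>(n::nat) s. if norm (g s) \<le> real n then g s else 0)"
  have [measurable]: "gn n \<in> borel_measurable borel" for n unfolding gn_def by measurable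
  have gn_le: "norm (gn n s) \<le> norm (g s)" for n s by (simp add: gn_def)
  have gn_supp: "s \<notin> {0<..<T} \<Longrightarrow> gn n s = 0" for n s by (simp add: gn_def g_supp)
  have gn_bound: "norm (gn n s) \<le> real n" for n s by (simp add: gn_def)
  let ?w = "conv (kern a) g" and ?wn = "\<lambda>n. conv (kern a) (gn n)"
  have wn_lim: "(\<lambda>n. ?wn n s) \<longlonglongrightarrow> ?w s" if "N s < \<infinity>" for s
    unfolding gn_def by (rule conv_truncation_tendsto) (use that a in \<open>auto simp: N_def\<close>)
  have [measurable]: "A \<in> borel_measurable borel"
    by (rule borel_measurable_continuous_onI, rule continuous_on_sequentiallyI, rule Lipschitz_tendsto[OF Lip])
  \<comment> \<open>A finite integral forces a finite integrand almost everywhere, and the kernel is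
    positive for s < t.\<close>
  have AEfin: "AE s in lborel. s < t \<longrightarrow> N s < \<infinity>"
  proof -
    have "AE s in lborel. ennreal (kern a (t - s)) * nconv (kern a) (\<lambda>s. (ennreal (norm (g s)))\<^sup>2) s \<noteq> \<infinity>"
      using fin2 by (intro nn_integral_noteq_infinite) (auto simp: nconv_def[of _ "nconv _ _"])
    then show ?thesis
    proof eventually_elim
      case (elim s)
      have "s < t \<Longrightarrow> kern a (t - s) > 0" using a Gamma_real_pos[OF a(1)] by (simp add: kern_def)
      then show ?case using elim N_fin[of s] by (auto simp: ennreal_mult_eq_top_iff less_top)
    qed
  qed
  \<comment> \<open>The dominating function. The Lipschitz bound gives norm (A (u0 + y)) \<le> norm
    (A u0) + \<Lambda> N, and the product of norm (g s) and N s is at most the sum of their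
    squares.\<close>
  define D where "D = (\<lambda>s. norm (A u0) * norm (g s) + \<Lambda> * ((norm (g s))\<^sup>2 + (enn2real (N s))\<^sup>2))"
  have D_nn: "0 \<le> D s" for s using Lip_nonneg by (simp add: D_def)
  have i1: "integrable lborel (\<lambda>s. kern a (t - s) *\<^sub>R norm (g s))"
    using N_fin[OF fin1] a by (subst integrable_conv_iff) (auto simp: N_def)
  have i2: "integrable lborel (\<lambda>s. kern a (t - s) *\<^sub>R (norm (g s))\<^sup>2)"
    using fin1 a by (subst integrable_conv_iff) (auto simp: ennreal_power)
  have i3: "integrable lborel (\<lambda>s. kern a (t - s) *\<^sub>R (enn2real (N s))\<^sup>2)"
  proof (subst integrable_conv_iff)
    have "nconv (kern a) (\<lambda>s. ennreal (norm ((enn2real (N s))\<^sup>2))) t \<le> nconv (kern a) (\<lambda>s. (N s)\<^sup>2) t"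
    proof (rule nconv_mono)
      fix s show "ennreal (norm ((enn2real (N s))\<^sup>2)) \<le> (N s)\<^sup>2"
        by (cases "N s") (auto simp: ennreal_power)
    qed
    also have "\<dots> \<le> nconv (kern a) (\<lambda>s. ennreal c * nconv (kern a) (\<lambda>s. (ennreal (norm (g s)))\<^sup>2) s) t"
      by (rule nconv_mono) (rule sq)
    also have "\<dots> = ennreal c * nconv (kern a) (nconv (kern a) (\<lambda>s. (ennreal (norm (g s)))\<^sup>2)) t"
      by (rule nconv_cmult) measurable
    also have "\<dots> < \<infinity>" using fin2 by (simp add: ennreal_mult_less_top)
    finally show "nconv (kern a) (\<lambda>s. ennreal (norm ((enn2real (N s))\<^sup>2))) t < \<infinity>" .
  qed (use a in auto)
  have iD: "integrable lborel (\<lambda>s. kern a (t - s) * D s)"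
  proof -
    have "(\<lambda>s. kern a (t - s) * D s) = (\<lambda>s. norm (A u0) * (kern a (t - s) *\<^sub>R norm (g s))
        + \<Lambda> * (kern a (t - s) *\<^sub>R (norm (g s))\<^sup>2 + kern a (t - s) *\<^sub>R (enn2real (N s))\<^sup>2))"
      by (auto simp: D_def algebra_simps)
    then show ?thesis using i1 i2 i3 by simp
  qed
  have dom: "norm (kern a (t - s) *\<^sub>R inner h (A (u0 + y))) \<le> kern a (t - s) * D s"
    if h: "norm h \<le> norm (g s)" and y: "s < t \<Longrightarrow> norm y \<le> enn2real (N s)" for h y s
  proof (cases "s < t")
    case True
    let ?n = "enn2real (N s)"
    have "norm (A (u0 + y)) \<le> norm (A u0) + norm (A (u0 + y) - A u0)"
      by (metis add.commute diff_add_cancel norm_triangle_ineq)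
    also have "\<dots> \<le> norm (A u0) + \<Lambda> * ?n"
      using Lip[of "u0 + y" u0] mult_left_mono[OF y[OF True] Lip_nonneg] by simp
    finally have Ab: "norm (A (u0 + y)) \<le> norm (A u0) + \<Lambda> * ?n" .
    have "\<bar>inner h (A (u0 + y))\<bar> \<le> norm h * norm (A (u0 + y))" by (rule Cauchy_Schwarz_ineq2)
    also have "\<dots> \<le> norm (g s) * (norm (A u0) + \<Lambda> * ?n)"
      using h Ab by (intro mult_mono) auto
    also have "\<dots> = norm (A u0) * norm (g s) + \<Lambda> * (norm (g s) * ?n)" by (simp add: algebra_simps)
    also have "\<dots> \<le> D s"
    proof -
      have "2 * (norm (g s) * ?n) \<le> (norm (g s))\<^sup>2 + ?n\<^sup>2"
        using sum_squares_bound[of "norm (g s)" ?n] by (simp add: mult.assoc)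
      moreover have "0 \<le> norm (g s) * ?n" by simp
      ultimately have "norm (g s) * ?n \<le> (norm (g s))\<^sup>2 + ?n\<^sup>2" by linarith
      then show ?thesis unfolding D_def using Lip_nonneg by (intro add_left_mono mult_left_mono)
    qed
    finally show ?thesis using a by (simp add: abs_mult mult_left_mono)
  qed simp
  have AEw: "AE s in lborel. s < t \<longrightarrow> norm (?w s) \<le> enn2real (N s) \<and> (\<forall>n. norm (?wn n s) \<le> enn2real (N s)) \<and> (\<lambda>n. ?wn n s) \<longlonglongrightarrow> ?w s"
    using AEfin
  proof eventually_elim
    case (elim s)
    have le: "norm (conv (kern a) h s) \<le> enn2real (N s)"
      if hm[measurable]: "h \<in> borel_measurable borel" and h: "\<And>s. norm (h s) \<le> norm (g s)" and "s < t" for h :: "real \<Rightarrow> 'a"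
    proof -
      have "ennreal (norm (conv (kern a) h s)) \<le> nconv (kern a) (\<lambda>s. ennreal (norm (h s))) s"
        by (rule norm_conv_le) (use a in auto)
      also have "\<dots> \<le> N s" unfolding N_def by (rule nconv_mono) (simp add: h ennreal_leI)
      finally show ?thesis using elim \<open>s < t\<close>
        by (cases "N s") auto
    qed
    show ?case using le[of g] le[OF _ gn_le] wn_lim[of s] elim by auto
  qed
  show ?int
  proof (rule Bochner_Integration.integrable_bound[OF iD])
    show "AE s in lborel. norm (kern a (t - s) *\<^sub>R inner (g s) (A (u0 + ?w s))) \<le> norm (kern a (t - s) * D s)"
      using AEw
    proof eventually_elim
      case (elim s)
      then show ?case using dom[of "g s" s "?w s"] by auto
    qed
  qed measurable
  have conv_inner: "conv (kern a) (\<lambda>s. inner (p s) (q s)) t = (LINT s|lborel. kern a (t - s) *\<^sub>R inner (p s) (q s))"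
    for p q :: "real \<Rightarrow> 'a" by (simp add: conv_def)
  have rhs: "(\<lambda>n. conv (kern a) (\<lambda>s. inner (gn n s) (A (u0 + ?wn n s))) t) \<longlonglongrightarrow> conv (kern a) (\<lambda>s. inner (g s) (A (u0 + ?w s))) t"
    unfolding conv_inner
  proof (rule integral_dominated_convergence[OF _ _ iD])
    show "AE s in lborel. norm (kern a (t - s) *\<^sub>R inner (gn n s) (A (u0 + ?wn n s))) \<le> kern a (t - s) * D s" for n
      using AEw
    proof eventually_elim
      case (elim s)
      then show ?case using dom[of "gn n s" s "?wn n s"] gn_le[of n s] by auto
    qed
    show "AE s in lborel. (\<lambda>n. kern a (t - s) *\<^sub>R inner (gn n s) (A (u0 + ?wn n s)))
        \<longlonglongrightarrow> kern a (t - s) *\<^sub>R inner (g s) (A (u0 + ?w s))"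
      using AEw
    proof eventually_elim
      case (elim s)
      show ?case
      proof (cases "s < t")
        case True
        obtain N :: nat where N: "norm (g s) \<le> real N" using real_arch_simple by blast
        have "\<forall>\<^sub>F n in sequentially. gn n s = g s"
          using eventually_ge_at_top[of N] by eventually_elim (use N in \<open>auto simp: gn_def\<close>)
        then have "(\<lambda>n. gn n s) \<longlonglongrightarrow> g s" by (rule tendsto_eventually)
        moreover have "(\<lambda>n. A (u0 + ?wn n s)) \<longlonglongrightarrow> A (u0 + ?w s)"
          using elim True by (intro Lipschitz_tendsto[of A, OF Lip] tendsto_add tendsto_const) auto
        ultimately show ?thesis by (intro tendsto_intros)
      qed simp
    qed
  qed measurable
  have lhs: "(\<lambda>n. F (u0 + ?wn n t) - F u0) \<longlonglongrightarrow> F (u0 + ?w t) - F u0"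
    by (intro tendsto_diff tendsto_const convex_gradient_tendsto[OF grad Lip] tendsto_add wn_lim N_fin fin1)
  show ?le
  proof (rule LIMSEQ_le[OF lhs rhs], intro exI allI impI)
    fix n :: nat
    show "F (u0 + ?wn n t) - F u0 \<le> conv (kern a) (\<lambda>s. inner (gn n s) (A (u0 + ?wn n s))) t"
      by (rule fractional_chain_bounded[OF a T _ gn_supp gn_bound grad Lip Lip_nonneg]) auto
  qed
qed

section \<open>Yosida approximation\<close>

lemma lower_semicontinuous_limit:
  assumes lsc: "lower_semicontinuous \<Phi>" and y: "y \<longlonglongrightarrow> z" and b: "b \<longlonglongrightarrow> c"
    and le: "\<And>n::nat. \<Phi> (y n) \<le> ereal (b n)"
  shows "\<Phi> z \<le> ereal c"
proof (rule ccontr)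
  assume "\<not> \<Phi> z \<le> ereal c"
  then obtain c' where c': "ereal c < ereal c'" "ereal c' < \<Phi> z"
    using ereal_dense2[of "ereal c" "\<Phi> z"] by (auto simp: not_le)
  have "\<Phi> z \<le> Liminf (nhds z) \<Phi>" using lsc by (simp add: lower_semicontinuous_def)
  then have "\<forall>\<^sub>F w in nhds z. ereal c' < \<Phi> w" using c'(2) by (auto simp: le_Liminf_iff)
  then have "\<forall>\<^sub>F n in sequentially. ereal c' < \<Phi> (y n)" using y unfolding filterlim_iff by blast
  then have "\<forall>\<^sub>F n in sequentially. c' \<le> b n"
    by eventually_elim (use le in \<open>meson less_ereal.simps(1) less_imp_le order_less_le_trans\<close>)
  then have "c' \<le> c" by (intro tendsto_lowerbound[OF b]) auto
  then show False using c'(1) by simp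
qed

text \<open>The lower bound is a parameter because it enters the constant of the energy
  estimate.\<close>

locale convex_functional =
  fixes \<Phi> :: "'a::{real_inner, banach} \<Rightarrow> ereal" and m :: real
  assumes not_MInf: "\<And>w. \<Phi> w \<noteq> -\<infinity>" and convex: "ereal_convex \<Phi>"
    and lsc: "lower_semicontinuous \<Phi>" and proper: "effective_domain \<Phi> \<noteq> {}"
    and lower_bound: "\<And>w. ereal m \<le> \<Phi> w"
begin

lemma subdifferentialD:
  assumes "\<xi> \<in> subdifferential \<Phi> w"
  shows "\<Phi> w \<noteq> \<infinity>" and "\<Phi> w + ereal (inner \<xi> (v - w)) \<le> \<Phi> v"
proof -
  \<comment> \<open>Testing the subgradient inequality at a point of the effective domain excludes
    \<Phi> w = \<infinity>, where the right side would be -\<infinity>.\<close>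
  obtain v0 where v0: "\<Phi> v0 < \<infinity>" using proper by (auto simp: effective_domain_def)
  have le: "ereal (inner \<xi> (v - w)) \<le> \<Phi> v - \<Phi> w" for v
    using assms by (simp add: subdifferential_def)
  show fin: "\<Phi> w \<noteq> \<infinity>"
    using le[of v0] v0 not_MInf[of v0] by (cases "\<Phi> v0") auto
  then obtain p where "\<Phi> w = ereal p" using not_MInf[of w] by (cases "\<Phi> w") auto
  then show "\<Phi> w + ereal (inner \<xi> (v - w)) \<le> \<Phi> v"
    using le[of v] not_MInf[of v] by (cases "\<Phi> v") auto
qed

lemma subdifferentialI:
  assumes "\<Phi> w = ereal p" "\<And>v q. \<Phi> v = ereal q \<Longrightarrow> inner \<xi> (v - w) \<le> q - p"
  shows "\<xi> \<in> subdifferential \<Phi> w"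
  unfolding subdifferential_def
proof (intro CollectI allI)
  fix v show "ereal (inner \<xi> (v - w)) \<le> \<Phi> v - \<Phi> w"
    using assms(1) assms(2)[of v] not_MInf[of v] by (cases "\<Phi> v") auto
qed

lemma subdifferential_monotone:
  assumes "\<xi> \<in> subdifferential \<Phi> x" "\<zeta> \<in> subdifferential \<Phi> y"
  shows "0 \<le> inner (\<xi> - \<zeta>) (x - y)"
proof -
  obtain p q where pq: "\<Phi> x = ereal p" "\<Phi> y = ereal q"
    using subdifferentialD(1)[OF assms(1)] subdifferentialD(1)[OF assms(2)] not_MInf
    by (metis ereal_cases)
  have "p + inner \<xi> (y - x) \<le> q" "q + inner \<zeta> (x - y) \<le> p"
    using subdifferentialD(2)[OF assms(1), of y] subdifferentialD(2)[OF assms(2), of x] pq by auto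
  then show ?thesis by (simp add: inner_diff_left inner_diff_right)
qed

lemma convex_real:
  assumes "\<Phi> x = ereal p" "\<Phi> y = ereal q" "0 \<le> s" "s \<le> 1"
  shows "\<Phi> ((1 - s) *\<^sub>R x + s *\<^sub>R y) \<le> ereal ((1 - s) * p + s * q)"
proof -
  have "\<Phi> ((1 - s) *\<^sub>R x + s *\<^sub>R y) \<le> ereal (1 - s) * \<Phi> x + ereal s * \<Phi> y"
    using convex assms(3,4) unfolding ereal_convex_def by auto
  then show ?thesis using assms by simp
qed

text \<open>The direct method with the parallelogram identity in place of compactness: comparison
  with midpoints makes a minimizing sequence Cauchy. Quantifying over real numbers q above \<Phi> v
  keeps the arithmetic real.\<close>

lemma minimizer_exists:
  assumes \<mu>: "0 < \<mu>"
  obtains z p where "\<Phi> z = ereal p" "\<And>v q. \<Phi> v \<le> ereal q \<Longrightarrow> p + (norm (x - z))\<^sup>2 / (2 * \<mu>) \<le> q + (norm (x - v))\<^sup>2 / (2 * \<mu>)"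
proof -
  define S where "S = {q + (norm (x - v))\<^sup>2 / (2 * \<mu>) |q v. \<Phi> v \<le> ereal q}"
  define D where "D = Inf S"
  obtain v0 where "\<Phi> v0 < \<infinity>" using proper by (auto simp: effective_domain_def)
  then obtain q0 where "\<Phi> v0 = ereal q0" using not_MInf[of v0] by (cases "\<Phi> v0") auto
  then have "q0 + (norm (x - v0))\<^sup>2 / (2 * \<mu>) \<in> S"
    unfolding S_def by (intro CollectI exI[of _ q0] exI[of _ v0]) auto
  then have ne: "S \<noteq> {}" by auto
  have bdd: "bdd_below S"
  proof (rule bdd_belowI[of _ m])
    fix s assume "s \<in> S"
    then obtain q v where s: "s = q + (norm (x - v))\<^sup>2 / (2 * \<mu>)" "\<Phi> v \<le> ereal q" by (auto simp: S_def)
    have "ereal m \<le> ereal q" using lower_bound[of v] s(2) by (rule order_trans)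
    then have "m \<le> q" by simp
    moreover have "0 \<le> (norm (x - v))\<^sup>2 / (2 * \<mu>)" using \<mu> by simp
    ultimately show "m \<le> s" using s(1) by linarith
  qed
  have D_le: "D \<le> q + (norm (x - v))\<^sup>2 / (2 * \<mu>)" if "\<Phi> v \<le> ereal q" for q v
    unfolding D_def using bdd that by (intro cInf_lower) (auto simp: S_def)
  have "\<exists>q v. \<Phi> v \<le> ereal q \<and> q + (norm (x - v))\<^sup>2 / (2 * \<mu>) < D + 1 / real (Suc n)" for n
  proof -
    have "Inf S < D + 1 / real (Suc n)" by (simp add: D_def)
    then show ?thesis using cInf_less_iff[OF ne bdd] by (auto simp: S_def)
  qed
  then obtain q y where qy: "\<And>n. \<Phi> (y n) \<le> ereal (q n)"
      "\<And>n. q n + (norm (x - y n))\<^sup>2 / (2 * \<mu>) < D + 1 / real (Suc n)"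
    by metis
  have qq: "\<exists>p. \<Phi> (y n) = ereal p \<and> p \<le> q n" for n
    using qy(1)[of n] not_MInf[of "y n"] by (cases "\<Phi> (y n)") auto
  \<comment> \<open>The midpoint competes with the infimum, and its squared distance to x falls
    short of the average by a quarter of the squared distance between y n and y k.\<close>
  have mid: "(norm (y n - y k))\<^sup>2 \<le> 4 * \<mu> * (1 / real (Suc n) + 1 / real (Suc k))" for n k
  proof -
    obtain pn pk where p: "\<Phi> (y n) = ereal pn" "pn \<le> q n" "\<Phi> (y k) = ereal pk" "pk \<le> q k"
      using qq by metis
    define z where "z = (1 - 1 / 2) *\<^sub>R y n + (1 / 2) *\<^sub>R y k"
    have "\<Phi> z \<le> ereal ((1 - 1 / 2) * pn + 1 / 2 * pk)"
      unfolding z_def by (rule convex_real) (use p in auto)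
    then have "D \<le> ((1 - 1 / 2) * pn + 1 / 2 * pk) + (norm (x - z))\<^sup>2 / (2 * \<mu>)" by (rule D_le)
    moreover have "(norm (x - z))\<^sup>2 = (norm (x - y n))\<^sup>2 / 2 + (norm (x - y k))\<^sup>2 / 2 - (norm (y n - y k))\<^sup>2 / 4"
      unfolding z_def power2_norm_eq_inner
      by (simp add: inner_diff_left inner_diff_right inner_add_left inner_add_right inner_commute algebra_simps
        add_divide_distrib diff_divide_distrib)
    ultimately have main: "D \<le> q n / 2 + q k / 2 + ((norm (x - y n))\<^sup>2 / 2 + (norm (x - y k))\<^sup>2 / 2 - (norm (y n - y k))\<^sup>2 / 4) / (2 * \<mu>)"
      using p by simp
    have "E / (8 * \<mu>) \<le> (qn + b / (2 * \<mu>)) / 2 + (qk + c / (2 * \<mu>)) / 2 - D"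
      if "D \<le> qn / 2 + qk / 2 + (b / 2 + c / 2 - E / 4) / (2 * \<mu>)" for E b c qn qk
      using that by (simp add: add_divide_distrib diff_divide_distrib)
    from this[OF main] have "(norm (y n - y k))\<^sup>2 / (8 * \<mu>)
        \<le> (q n + (norm (x - y n))\<^sup>2 / (2 * \<mu>)) / 2 + (q k + (norm (x - y k))\<^sup>2 / (2 * \<mu>)) / 2 - D" .
    also have "\<dots> \<le> (1 / real (Suc n) + 1 / real (Suc k)) / 2"
    proof -
      have "A / 2 + B / 2 - D \<le> (r + r') / 2" if "A < D + r" "B < D + r'" for A B r r'
        using that by (simp add: field_simps)
      then show ?thesis using qy(2) by blast
    qed
    finally show ?thesis using \<mu> by (simp add: field_simps del: of_nat_Suc)
  qed
  have "Cauchy y"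
  proof (rule CauchyI)
    fix e :: real assume e: "0 < e"
    then have "0 < e\<^sup>2 / (8 * \<mu>)" using \<mu> by simp
    then obtain N where N: "1 / real (Suc N) < e\<^sup>2 / (8 * \<mu>)" using nat_approx_posE by blast
    have "norm (y n - y k) < e" if "N \<le> n" "N \<le> k" for n k
    proof -
      have "1 / real (Suc n) \<le> 1 / real (Suc N)" "1 / real (Suc k) \<le> 1 / real (Suc N)"
        using that by (auto simp: frac_le)
      then have "4 * \<mu> * (1 / real (Suc n) + 1 / real (Suc k)) \<le> 4 * \<mu> * (2 * (1 / real (Suc N)))"
        using \<mu> by (intro mult_left_mono) auto
      also have "\<dots> < 4 * \<mu> * (2 * (e\<^sup>2 / (8 * \<mu>)))"
        using N \<mu> by (intro mult_strict_left_mono) auto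
      also have "\<dots> = e\<^sup>2" using \<mu> by simp
      finally have "(norm (y n - y k))\<^sup>2 < e\<^sup>2" using mid[of n k] by linarith
      then show ?thesis using e by (simp add: power2_less_imp_less)
    qed
    then show "\<exists>M. \<forall>m\<ge>M. \<forall>n\<ge>M. norm (y m - y n) < e" by blast
  qed
  then obtain z where z: "y \<longlonglongrightarrow> z" by (auto simp: Cauchy_convergent_iff convergent_def)
  have "\<Phi> z \<le> ereal (D - (norm (x - z))\<^sup>2 / (2 * \<mu>))"
  proof (rule lower_semicontinuous_limit[OF lsc z])
    show "(\<lambda>n. D + 1 / real (Suc n) - (norm (x - y n))\<^sup>2 / (2 * \<mu>)) \<longlonglongrightarrow> D - (norm (x - z))\<^sup>2 / (2 * \<mu>)"
    proof -
      have "(\<lambda>n. D + 1 / real (Suc n) - (norm (x - y n))\<^sup>2 / (2 * \<mu>)) \<longlonglongrightarrow> D + 0 - (norm (x - z))\<^sup>2 / (2 * \<mu>)"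
        using \<mu> by (intro tendsto_intros z LIMSEQ_Suc[OF lim_1_over_n]) auto
      then show ?thesis by simp
    qed
    show "\<Phi> (y n) \<le> ereal (D + 1 / real (Suc n) - (norm (x - y n))\<^sup>2 / (2 * \<mu>))" for n
      by (rule order_trans[OF qy(1)]) (use qy(2)[of n] in simp)
  qed
  moreover obtain p where p: "\<Phi> z = ereal p" using calculation not_MInf[of z] by (cases "\<Phi> z") auto
  ultimately have "p + (norm (x - z))\<^sup>2 / (2 * \<mu>) \<le> D" by simp
  then show ?thesis using that[OF p] D_le by force
qed

text \<open>The minimizer z is compared with z + s (v - z); dividing by s and letting s tend to 0
  leaves the first variation of the quadratic term, which is the claimed subgradient.\<close>

lemma resolvent_exists:
  assumes \<mu>: "0 < \<mu>"
  shows "\<exists>z. (1 / \<mu>) *\<^sub>R (x - z) \<in> subdifferential \<Phi> z"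
proof -
  obtain z p where p: "\<Phi> z = ereal p"
    and min: "\<And>v q. \<Phi> v \<le> ereal q \<Longrightarrow> p + (norm (x - z))\<^sup>2 / (2 * \<mu>) \<le> q + (norm (x - v))\<^sup>2 / (2 * \<mu>)"
    using minimizer_exists[OF \<mu>, of x] by metis
  have "(1 / \<mu>) *\<^sub>R (x - z) \<in> subdifferential \<Phi> z"
  proof (rule subdifferentialI[OF p])
    fix v q assume q: "\<Phi> v = ereal q"
    let ?K = "(norm (v - z))\<^sup>2 / (2 * \<mu>)"
    have le: "inner ((1 / \<mu>) *\<^sub>R (x - z)) (v - z) \<le> q - p + s * ?K" if s: "0 < s" "s \<le> 1" for s
    proof -
      have "\<Phi> ((1 - s) *\<^sub>R z + s *\<^sub>R v) \<le> ereal ((1 - s) * p + s * q)"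
        by (rule convex_real) (use p q s in auto)
      from min[OF this] have "p + (norm (x - z))\<^sup>2 / (2 * \<mu>)
          \<le> (1 - s) * p + s * q + (norm (x - ((1 - s) *\<^sub>R z + s *\<^sub>R v)))\<^sup>2 / (2 * \<mu>)" .
      moreover have "x - ((1 - s) *\<^sub>R z + s *\<^sub>R v) = (x - z) - s *\<^sub>R (v - z)"
        by (simp add: algebra_simps)
      moreover have "(norm ((x - z) - s *\<^sub>R (v - z)))\<^sup>2
          = (norm (x - z))\<^sup>2 - 2 * s * inner (x - z) (v - z) + s\<^sup>2 * (norm (v - z))\<^sup>2"
        unfolding power2_norm_eq_inner inner_diff_left[of "x - z"] inner_diff_right[of _ "x - z"]
        by (simp add: inner_commute[of "v - z" "x - z"] power2_eq_square)
      ultimately have main: "p + (norm (x - z))\<^sup>2 / (2 * \<mu>) \<le> (1 - s) * p + s * q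
          + ((norm (x - z))\<^sup>2 - 2 * s * inner (x - z) (v - z) + s\<^sup>2 * (norm (v - z))\<^sup>2) / (2 * \<mu>)" by metis
      have "0 \<le> s * (q - p) + (- 2 * s * I + s\<^sup>2 * V) / (2 * \<mu>)"
        if "p + N / (2 * \<mu>) \<le> (1 - s) * p + s * q + (N - 2 * s * I + s\<^sup>2 * V) / (2 * \<mu>)" for N I V
        using that by (simp add: add_divide_distrib diff_divide_distrib algebra_simps)
      from this[OF main]
      have "0 \<le> s * (q - p) + (- 2 * s * inner (x - z) (v - z) + s\<^sup>2 * (norm (v - z))\<^sup>2) / (2 * \<mu>)" .
      also have "\<dots> = s * (q - p + s * ?K - inner ((1 / \<mu>) *\<^sub>R (x - z)) (v - z))"
      proof -
        have "inner ((1 / \<mu>) *\<^sub>R (x - z)) (v - z) = inner (x - z) (v - z) / \<mu>"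
          by (simp only: inner_scaleR_left) simp
        then show ?thesis using \<mu> by (simp add: field_simps power2_eq_square)
      qed
      finally show ?thesis using s by (simp add: zero_le_mult_iff)
    qed
    have "((\<lambda>s. q - p + s * ?K) \<longlongrightarrow> q - p + 0 * ?K) (at_right 0)"
      by (intro tendsto_intros)
    moreover have "\<forall>\<^sub>F s in at_right 0. inner ((1 / \<mu>) *\<^sub>R (x - z)) (v - z) \<le> q - p + s * ?K"
      by (rule eventually_mono[OF eventually_at_right_real[OF zero_less_one]], rule le) auto
    ultimately show "inner ((1 / \<mu>) *\<^sub>R (x - z)) (v - z) \<le> q - p"
      using tendsto_lowerbound[of "\<lambda>s. q - p + s * ?K" "q - p + 0 * ?K" "at_right 0"] by simp
  qed
  then show ?thesis by blast
qed

text \<open>With J the resolvent, A x is (x - J x) / \<mu> and F is the Moreau envelope.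
  Monotonicity of the subdifferential at the points J x and J y gives the Lipschitz bound, and the
  gradient inequality holds with slack \<mu> / 2 times the squared norm of A y - A x.\<close>

lemma Yosida_approximation:
  assumes \<mu>: "0 < \<mu>"
  obtains A :: "'a \<Rightarrow> 'a" and F :: "'a \<Rightarrow> real" where
    "\<And>x. A x \<in> subdifferential \<Phi> (x - \<mu> *\<^sub>R A x)"
    "\<And>x y. norm (A x - A y) \<le> (1 / \<mu>) * norm (x - y)"
    "\<And>x y. F x + inner (A x) (y - x) \<le> F y"
    "\<And>x. m \<le> F x" "\<And>x. ereal (F x) \<le> \<Phi> x"
proof -
  obtain J where J: "\<And>x. (1 / \<mu>) *\<^sub>R (x - J x) \<in> subdifferential \<Phi> (J x)"
    using resolvent_exists[OF \<mu>] by metis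
  define A where "A x = (1 / \<mu>) *\<^sub>R (x - J x)" for x
  have J_eq: "J x = x - \<mu> *\<^sub>R A x" for x using \<mu> by (simp add: A_def)
  have sub: "A x \<in> subdifferential \<Phi> (x - \<mu> *\<^sub>R A x)" for x
    using J[of x] unfolding A_def[symmetric] unfolding J_eq .
  define P where "P x = real_of_ereal (\<Phi> (x - \<mu> *\<^sub>R A x))" for x
  have P: "\<Phi> (x - \<mu> *\<^sub>R A x) = ereal (P x)" for x
    using subdifferentialD(1)[OF sub[of x]] not_MInf[of "x - \<mu> *\<^sub>R A x"]
    by (cases "\<Phi> (x - \<mu> *\<^sub>R A x)") (auto simp: P_def)
  \<comment> \<open>As x - J x = \<mu> A x, the second term is the quadratic penalty of the
    minimization problem at its minimizer.\<close>
  define F where "F x = P x + \<mu> / 2 * (norm (A x))\<^sup>2" for x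
  have mono: "0 \<le> inner (A x - A y) ((x - \<mu> *\<^sub>R A x) - (y - \<mu> *\<^sub>R A y))" for x y
    by (rule subdifferential_monotone[OF sub sub])
  show ?thesis
  proof (rule that[of A F])
    show "A x \<in> subdifferential \<Phi> (x - \<mu> *\<^sub>R A x)" for x by (rule sub)
    show "norm (A x - A y) \<le> (1 / \<mu>) * norm (x - y)" for x y
    proof -
      have "\<mu> * (norm (A x - A y))\<^sup>2 \<le> inner (A x - A y) (x - y)"
        using mono[of x y] unfolding power2_norm_eq_inner
        by (simp add: inner_diff_left inner_diff_right algebra_simps)
      also have "\<dots> \<le> norm (A x - A y) * norm (x - y)" by (rule norm_cauchy_schwarz)
      finally have "norm (A x - A y) * (\<mu> * norm (A x - A y)) \<le> norm (A x - A y) * norm (x - y)"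
        by (simp add: power2_eq_square algebra_simps)
      then have "\<mu> * norm (A x - A y) \<le> norm (x - y)"
        by (cases "A x = A y") auto
      then show ?thesis using \<mu> by (simp add: field_simps)
    qed
    show "F x + inner (A x) (y - x) \<le> F y" for x y
    proof -
      have "P x + inner (A x) ((y - \<mu> *\<^sub>R A y) - (x - \<mu> *\<^sub>R A x)) \<le> P y"
        using subdifferentialD(2)[OF sub[of x], of "y - \<mu> *\<^sub>R A y"] by (simp add: P)
      moreover have "0 \<le> \<mu> / 2 * (norm (A y - A x))\<^sup>2" using \<mu> by simp
      ultimately show ?thesis
        unfolding F_def power2_norm_eq_inner
        by (simp add: inner_diff_left inner_diff_right inner_commute algebra_simps)
    qed
    show "m \<le> F x" for x
    proof -
      have "m \<le> P x" using lower_bound[of "x - \<mu> *\<^sub>R A x"] by (simp add: P)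
      moreover have "0 \<le> \<mu> / 2 * (norm (A x))\<^sup>2" using \<mu> by simp
      ultimately show ?thesis unfolding F_def by linarith
    qed
    show "ereal (F x) \<le> \<Phi> x" for x
    proof -
      have "ereal (P x + inner (A x) (\<mu> *\<^sub>R A x)) \<le> \<Phi> x"
        using subdifferentialD(2)[OF sub[of x], of x] by (simp add: P)
      moreover have "F x \<le> P x + inner (A x) (\<mu> *\<^sub>R A x)"
        unfolding F_def power2_norm_eq_inner using \<mu> by simp
      ultimately show ?thesis by (meson ereal_less_eq(3) order_trans)
    qed
  qed
qed

end

section \<open>Fractional Gronwall inequality and Volterra equations\<close>

lemma conv_diff:
  fixes g h :: "real \<Rightarrow> 'a::{banach, second_countable_topology}"
  assumes [measurable]: "k \<in> borel_measurable borel" "g \<in> borel_measurable borel" "h \<in> borel_measurable borel"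
    and k: "\<And>x. 0 \<le> k x"
    and fin: "nconv k (\<lambda>s. ennreal (norm (g s))) t < \<infinity>" "nconv k (\<lambda>s. ennreal (norm (h s))) t < \<infinity>"
  shows "conv k (\<lambda>s. g s - h s) t = conv k g t - conv k h t"
proof -
  have "integrable lborel (\<lambda>s. k (t - s) *\<^sub>R g s)" "integrable lborel (\<lambda>s. k (t - s) *\<^sub>R h s)"
    using fin by (auto simp: integrable_conv_iff k)
  then show ?thesis unfolding conv_def scaleR_diff_right by (rule Bochner_Integration.integral_diff)
qed

text \<open>Along a simple function the composition is a countable case split; the Lipschitz
  condition carries measurability to the pointwise limit.\<close>

lemma borel_measurable_Caratheodory:
  fixes G :: "real \<Rightarrow> 'a::{real_normed_vector, second_countable_topology} \<Rightarrow> 'a"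
  assumes G: "\<And>x. (\<lambda>t. G t x) \<in> borel_measurable borel"
    and Lip: "\<And>t x y. norm (G t x - G t y) \<le> \<Lambda> * norm (x - y)"
    and u: "u \<in> borel_measurable borel"
  shows "(\<lambda>t. G t (u t)) \<in> borel_measurable borel"
proof -
  obtain s where s: "\<And>i. simple_function borel (s i)" "\<And>t. (\<lambda>i. s i t) \<longlonglongrightarrow> u t"
    using borel_measurable_implies_sequence_metric[OF u, of 0] by auto
  have meas: "(\<lambda>t. G t (s i t)) \<in> borel_measurable borel" for i
  proof (rule measurable_compose_countable'[where f = "\<lambda>x t. G t x" and I = "range (s i)"])
    show "s i \<in> borel \<rightarrow>\<^sub>M count_space (range (s i))"
      using simple_functionD(2)[OF s(1)[of i]] by (auto simp: measurable_count_space_eq2_countable measurable_def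
        intro!: measurable_count_space_eq2[THEN iffD2] simp: simple_functionD(1)[OF s(1)[of i], simplified])
    show "countable (range (s i))"
      using simple_functionD(1)[OF s(1)[of i]] by (simp add: countable_finite)
  qed (rule G)
  show ?thesis
  proof (rule borel_measurable_LIMSEQ_metric[OF meas])
    show "(\<lambda>i. G t (s i t)) \<longlonglongrightarrow> G t (u t)" for t
      by (rule Lipschitz_tendsto[of "G t", OF Lip s(2)])
  qed
qed

text \<open>Supplies the exponential weight under which D times the kernel contracts by 1/2. For the
  chosen \<mu> the power \<mu>^(-a) is 1 / (2 D + 1), and the summand 1 allows D = 0.\<close>

lemma exists_exponent:
  assumes a: "0 < a" and D: "0 \<le> D"
  shows "\<exists>\<mu>>0. D * \<mu> powr (- a) \<le> (1/2::real)"
proof (intro exI[of _ "(2 * D + 1) powr (1 / a)"] conjI)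
  show "0 < (2 * D + 1) powr (1 / a)" using D by simp
  have "((2 * D + 1) powr (1 / a)) powr (- a) = (2 * D + 1) powr (- 1)" using a by (simp add: powr_powr)
  also have "\<dots> = 1 / (2 * D + 1)" using D by (simp add: powr_neg_one)
  finally have eq: "((2 * D + 1) powr (1 / a)) powr (- a) = 1 / (2 * D + 1)" .
  show "D * ((2 * D + 1) powr (1 / a)) powr (- a) \<le> 1 / 2" unfolding eq using D by (simp add: field_simps)
qed

lemma nconv_kern_le_exp:
  assumes a: "0 < a" and \<mu>: "0 < \<mu>" and M: "0 \<le> M"
    and y: "\<And>s. h s \<le> ennreal (M * exp (\<mu> * s))"
  shows "nconv (kern a) h t \<le> ennreal (M * \<mu> powr (- a) * exp (\<mu> * t))"
proof -
  have "nconv (kern a) h t \<le> nconv (kern a) (\<lambda>s. ennreal M * ennreal (exp (\<mu> * s))) t"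
    by (rule nconv_mono) (use y M in \<open>simp add: ennreal_mult\<close>)
  also have "\<dots> = ennreal M * nconv (kern a) (\<lambda>s. ennreal (exp (\<mu> * s))) t"
    by (rule nconv_cmult) measurable
  also have "\<dots> = ennreal (M * \<mu> powr (- a) * exp (\<mu> * t))"
    using nconv_kern_exp[OF a \<mu>] M by (simp add: ennreal_mult mult.assoc)
  finally show ?thesis .
qed

text \<open>In the supremum M of exp(-\<mu> t) y t the convolution costs at most M / 2, so M \<le> C
  + M / 2. The a priori bound K makes M finite, as this absorption requires, and leaves no trace in
  the conclusion; that is what yields estimates uniform in the approximation.\<close>

lemma fractional_Gronwall:
  assumes a: "0 < a" and \<mu>: "0 < \<mu>" "D * \<mu> powr (- a) \<le> 1 / 2"
    and C: "0 \<le> C" and D: "0 \<le> D" and T: "0 < T"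
    and y: "\<And>t. 0 \<le> y t" and bdd: "\<And>t. t \<in> {0<..<T} \<Longrightarrow> y t \<le> K"
    and le: "\<And>t. t \<in> {0<..<T} \<Longrightarrow>
      ennreal (y t) \<le> ennreal C + ennreal D * nconv (kern a) (\<lambda>s. ennreal (y s) * indicator {0<..<T} s) t"
    and t: "t \<in> {0<..<T}"
  shows "y t \<le> 2 * C * exp (\<mu> * T)"
proof -
  define M where "M = (SUP t\<in>{0<..<T}. exp (- \<mu> * t) * y t)"
  have bddM: "bdd_above ((\<lambda>t. exp (- \<mu> * t) * y t) ` {0<..<T})"
  proof (rule bdd_aboveI2)
    fix t assume t: "t \<in> {0<..<T}"
    have "exp (- \<mu> * t) * y t \<le> 1 * K" using t \<mu> y[of t] bdd[OF t] by (intro mult_mono) auto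
    then show "exp (- \<mu> * t) * y t \<le> K" by simp
  qed
  have yM: "y t \<le> M * exp (\<mu> * t)" if "t \<in> {0<..<T}" for t
  proof -
    have "exp (- \<mu> * t) * y t \<le> M" unfolding M_def by (rule cSUP_upper[OF that bddM])
    then have "exp (- \<mu> * t) * y t * exp (\<mu> * t) \<le> M * exp (\<mu> * t)" by (rule mult_right_mono) simp
    moreover have "exp (- \<mu> * t) * y t * exp (\<mu> * t) = y t" by (simp add: exp_minus)
    ultimately show ?thesis by metis
  qed
  have M: "0 \<le> M"
  proof -
    have "0 \<le> M * exp (\<mu> * t)" using yM[OF t] y[of t] by (rule order_trans[rotated])
    then show ?thesis by (simp add: zero_le_mult_iff)
  qed
  have "exp (- \<mu> * t) * y t \<le> C + M / 2" if t: "t \<in> {0<..<T}" for t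
  proof -
    have "nconv (kern a) (\<lambda>s. ennreal (y s) * indicator {0<..<T} s) t \<le> ennreal (M * \<mu> powr (- a) * exp (\<mu> * t))"
      by (rule nconv_kern_le_exp[OF a \<mu>(1) M]) (auto simp: yM intro!: ennreal_leI split: split_indicator)
    then have "ennreal (y t) \<le> ennreal C + ennreal D * ennreal (M * \<mu> powr (- a) * exp (\<mu> * t))"
      by (intro order_trans[OF le[OF t]] add_left_mono mult_left_mono) auto
    then have "y t \<le> C + D * (M * \<mu> powr (- a) * exp (\<mu> * t))"
      using C D M by (simp add: ennreal_mult[symmetric] ennreal_plus[symmetric] del: ennreal_plus)
    also have "D * (M * \<mu> powr (- a) * exp (\<mu> * t)) = (D * \<mu> powr (- a)) * (M * exp (\<mu> * t))" by simp
    also have "\<dots> \<le> 1 / 2 * (M * exp (\<mu> * t))"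
      by (rule mult_right_mono[OF \<mu>(2)]) (use M in auto)
    finally have "exp (- \<mu> * t) * y t \<le> exp (- \<mu> * t) * (C + 1 / 2 * (M * exp (\<mu> * t)))"
      by (intro mult_left_mono) auto
    also have "\<dots> = exp (- \<mu> * t) * C + M / 2" by (simp add: algebra_simps exp_minus)
    also have "\<dots> \<le> 1 * C + M / 2" using t \<mu> C by (intro add_right_mono mult_right_mono) auto
    finally show ?thesis by simp
  qed
  then have "M \<le> C + M / 2" unfolding M_def using T by (intro cSUP_least) auto
  then have "M \<le> 2 * C" by simp
  have "y t \<le> M * exp (\<mu> * t)" by (rule yM[OF t])
  also have "\<dots> \<le> 2 * C * exp (\<mu> * T)" using \<open>M \<le> 2 * C\<close> M C t \<mu> by (intro mult_mono) auto
  finally show ?thesis .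
qed

text \<open>Picard iteration in the supremum norm with weight exp(-\<mu> t), for which the map
  halves distances over the whole interval at once.\<close>

lemma Volterra_solution_exists:
  fixes G :: "real \<Rightarrow> 'a::{banach, second_countable_topology} \<Rightarrow> 'a"
  assumes a: "0 < a" and \<Lambda>: "0 \<le> \<Lambda>"
    and G: "\<And>x. (\<lambda>t. G t x) \<in> borel_measurable borel"
    and Lip: "\<And>t x y. norm (G t x - G t y) \<le> \<Lambda> * norm (x - y)"
    and supp: "\<And>t x. t \<notin> {0<..<T} \<Longrightarrow> G t x = 0"
    and K: "\<And>t. nconv (kern a) (\<lambda>s. ennreal (norm (G s u0))) t \<le> ennreal K"
  shows "\<exists>u R. u \<in> borel_measurable borel \<and> (\<forall>t. u t = u0 + conv (kern a) (\<lambda>s. G s (u s)) t)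
    \<and> (\<forall>t\<in>{0<..<T}. norm (u t - u0) \<le> R)"
proof -
  obtain \<mu> where \<mu>: "0 < \<mu>" "\<Lambda> * \<mu> powr (- a) \<le> 1 / 2" using exists_exponent[OF a \<Lambda>] by blast
  define K' where "K' = max K 0"
  have K': "nconv (kern a) (\<lambda>s. ennreal (norm (G s u0))) t \<le> ennreal K'" "0 \<le> K'" for t
    using K[of t] by (auto simp: K'_def intro: order_trans ennreal_leI)
  define P where "P u t = u0 + conv (kern a) (\<lambda>s. G s (u s)) t" for u t
  \<comment> \<open>The weighted ball of radius 2 K' is invariant: \<open>P\<close> moves u0 by at
    most K' and halves distances, and K' + 2 K' / 2 = 2 K'.\<close>
  define ok where "ok u \<longleftrightarrow> u \<in> borel_measurable borel \<and> (\<forall>t. norm (u t - u0) \<le> 2 * K' * exp (\<mu> * t))" for u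
  have meas: "(\<lambda>s. G s (u s)) \<in> borel_measurable borel" if "u \<in> borel_measurable borel" for u
    by (rule borel_measurable_Caratheodory[OF G Lip that])
  have Gdiff: "nconv (kern a) (\<lambda>s. ennreal (norm (G s (u s) - G s (v s)))) t \<le> ennreal (M / 2 * exp (\<mu> * t))"
    if uv: "\<And>s. norm (u s - v s) \<le> M * exp (\<mu> * s)" and M: "0 \<le> M" for u v t M
  proof -
    have "norm (G s (u s) - G s (v s)) \<le> (\<Lambda> * M) * exp (\<mu> * s)" for s
      using Lip[of s "u s" "v s"] mult_left_mono[OF uv[of s] \<Lambda>] by simp
    then have "nconv (kern a) (\<lambda>s. ennreal (norm (G s (u s) - G s (v s)))) t \<le> ennreal ((\<Lambda> * M) * \<mu> powr (- a) * exp (\<mu> * t))"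
      using M \<Lambda> by (intro nconv_kern_le_exp[OF a \<mu>(1)] ennreal_leI) auto
    also have "\<dots> \<le> ennreal (M / 2 * exp (\<mu> * t))"
    proof (rule ennreal_leI)
      have "(\<Lambda> * \<mu> powr (- a)) * (M * exp (\<mu> * t)) \<le> 1 / 2 * (M * exp (\<mu> * t))"
        by (rule mult_right_mono[OF \<mu>(2)]) (use M in auto)
      then show "(\<Lambda> * M) * \<mu> powr (- a) * exp (\<mu> * t) \<le> M / 2 * exp (\<mu> * t)" by (simp add: algebra_simps)
    qed
    finally show ?thesis .
  qed
  have fin: "nconv (kern a) (\<lambda>s. ennreal (norm (G s (u s)))) t < \<infinity>" if "ok u" for u t
  proof -
    have [measurable]: "(\<lambda>s. G s (u s)) \<in> borel_measurable borel" "(\<lambda>s. G s u0) \<in> borel_measurable borel"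
      using meas[of u] G[of u0] that by (auto simp: ok_def)
    have "nconv (kern a) (\<lambda>s. ennreal (norm (G s (u s)))) t
        \<le> nconv (kern a) (\<lambda>s. ennreal (norm (G s (u s) - G s u0)) + ennreal (norm (G s u0))) t"
    proof (rule nconv_mono)
      fix s
      have "norm (G s (u s)) \<le> norm (G s (u s) - G s u0) + norm (G s u0)"
        by (metis diff_add_cancel norm_triangle_ineq)
      then show "ennreal (norm (G s (u s))) \<le> ennreal (norm (G s (u s) - G s u0)) + ennreal (norm (G s u0))"
        by (simp add: ennreal_plus[symmetric] ennreal_leI del: ennreal_plus)
    qed
    also have "\<dots> = nconv (kern a) (\<lambda>s. ennreal (norm (G s (u s) - G s u0))) t + nconv (kern a) (\<lambda>s. ennreal (norm (G s u0))) t"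
      by (rule nconv_add) measurable
    also have "\<dots> \<le> ennreal (2 * K' / 2 * exp (\<mu> * t)) + ennreal K'"
      by (intro add_mono Gdiff K') (use that K' in \<open>auto simp: ok_def\<close>)
    also have "\<dots> < \<infinity>" by simp
    finally show ?thesis .
  qed
  have contr: "norm (P u t - P v t) \<le> M / 2 * exp (\<mu> * t)"
    if ok: "ok u" "ok v" and uv: "\<And>s. norm (u s - v s) \<le> M * exp (\<mu> * s)" and M: "0 \<le> M" for u v t M
  proof -
    have [measurable]: "(\<lambda>s. G s (u s)) \<in> borel_measurable borel" "(\<lambda>s. G s (v s)) \<in> borel_measurable borel"
      using meas ok by (auto simp: ok_def)
    have "P u t - P v t = conv (kern a) (\<lambda>s. G s (u s) - G s (v s)) t"
      unfolding P_def using fin[OF ok(1), of t] fin[OF ok(2), of t] a by (subst conv_diff) auto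
    moreover have "ennreal (norm (conv (kern a) (\<lambda>s. G s (u s) - G s (v s)) t)) \<le> ennreal (M / 2 * exp (\<mu> * t))"
      by (rule order_trans[OF norm_conv_le Gdiff[OF uv M]]) (use a in auto)
    ultimately show ?thesis using M by simp
  qed
  have P_meas: "P u \<in> borel_measurable borel" if "ok u" for u
  proof -
    have [measurable]: "(\<lambda>s. G s (u s)) \<in> borel_measurable borel" using meas that by (auto simp: ok_def)
    show ?thesis unfolding P_def[abs_def] by measurable
  qed
  have ok0: "ok (\<lambda>_. u0)" using K' by (simp add: ok_def)
  have P0: "norm (P (\<lambda>_. u0) t - u0) \<le> K' * exp (\<mu> * t)" for t
  proof (cases "t \<le> 0")
    case True
    then have "conv (kern a) (\<lambda>s. G s u0) t = 0" by (intro conv_kern_eq_0) (auto simp: supp)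
    then show ?thesis using K' by (simp add: P_def)
  next
    case False
    have "ennreal (norm (conv (kern a) (\<lambda>s. G s u0) t)) \<le> ennreal K'"
      by (rule order_trans[OF norm_conv_le K'(1)]) (use a G in auto)
    then have "norm (P (\<lambda>_. u0) t - u0) \<le> K'" using K' by (simp add: P_def)
    also have "\<dots> \<le> K' * exp (\<mu> * t)" using False \<mu> K'(2) mult_left_mono[of 1 "exp (\<mu> * t)" K'] by simp
    finally show ?thesis .
  qed
  have okP: "ok (P u)" if u: "ok u" for u
    unfolding ok_def
  proof (intro conjI allI)
    fix t
    have "norm (P u t - P (\<lambda>_. u0) t) \<le> 2 * K' / 2 * exp (\<mu> * t)"
      by (rule contr[OF u ok0]) (use u K' in \<open>auto simp: ok_def\<close>)
    moreover have "norm (P u t - u0) \<le> norm (P u t - P (\<lambda>_. u0) t) + norm (P (\<lambda>_. u0) t - u0)"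
      by (metis add_diff_cancel_right' diff_add_cancel diff_diff_eq2 norm_triangle_ineq add_diff_eq)
    ultimately show "norm (P u t - u0) \<le> 2 * K' * exp (\<mu> * t)" using P0[of t] by simp
  qed (rule P_meas[OF u])
  define x where "x n = (P ^^ n) (\<lambda>_. u0)" for n
  have okx: "ok (x n)" for n by (induction n) (auto simp: x_def ok0 okP)
  have xS: "x (Suc n) = P (x n)" for n by (simp add: x_def)
  have dist: "norm (x (n + j) t - x n t) \<le> 2 * K' / 2 ^ n * exp (\<mu> * t)" for n j t
  proof (induction n arbitrary: t)
    case 0
    show ?case using okx[of j] by (simp add: ok_def x_def)
  next
    case (Suc n)
    have "norm (P (x (n + j)) t - P (x n) t) \<le> (2 * K' / 2 ^ n) / 2 * exp (\<mu> * t)"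
      by (rule contr[OF okx okx Suc]) (use K' in auto)
    then show ?case by (simp add: xS)
  qed
  have "\<exists>z. (\<lambda>n. x n t) \<longlonglongrightarrow> z" for t
  proof -
    have "Cauchy (\<lambda>n. x n t)"
    proof (rule CauchyI')
      fix e :: real assume e: "0 < e"
      have "(\<lambda>n. 2 * K' * exp (\<mu> * t) * (1 / 2) ^ n) \<longlonglongrightarrow> 2 * K' * exp (\<mu> * t) * 0"
        by (intro tendsto_mult_left LIMSEQ_power_zero) auto
      then have "\<forall>\<^sub>F n in sequentially. 2 * K' * exp (\<mu> * t) * (1 / 2) ^ n < e"
        using e by (auto dest: order_tendstoD(2))
      then obtain N where N: "\<And>n. n \<ge> N \<Longrightarrow> 2 * K' * exp (\<mu> * t) * (1 / 2) ^ n < e"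
        by (auto simp: eventually_sequentially)
      show "\<exists>M. \<forall>m\<ge>M. \<forall>n>m. dist (x m t) (x n t) < e"
      proof (intro exI[of _ N] allI impI)
        fix m n assume "N \<le> m" "m < n"
        then have "norm (x n t - x m t) \<le> 2 * K' * exp (\<mu> * t) * (1 / 2) ^ m"
          using dist[of m "n - m" t] by (simp add: power_divide mult_ac)
        then show "dist (x m t) (x n t) < e" using N[OF \<open>N \<le> m\<close>] by (simp add: dist_norm norm_minus_commute)
      qed
    qed
    then show ?thesis by (auto simp: Cauchy_convergent_iff convergent_def)
  qed
  then obtain u where u: "\<And>t. (\<lambda>n. x n t) \<longlonglongrightarrow> u t" by metis
  have u_x: "norm (u t - x n t) \<le> 2 * K' / 2 ^ n * exp (\<mu> * t)" for n t
  proof (rule tendsto_upperbound)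
    show "(\<lambda>j. norm (x (j + n) t - x n t)) \<longlonglongrightarrow> norm (u t - x n t)"
      by (intro tendsto_intros LIMSEQ_ignore_initial_segment u)
    show "\<forall>\<^sub>F j in sequentially. norm (x (j + n) t - x n t) \<le> 2 * K' / 2 ^ n * exp (\<mu> * t)"
      using dist[of n _ t] by (intro always_eventually allI) (simp add: add.commute)
  qed simp
  have u_meas: "u \<in> borel_measurable borel"
    by (rule borel_measurable_LIMSEQ_metric[OF _ u]) (use okx in \<open>simp add: ok_def\<close>)
  have oku: "ok u"
    using u_x[of _ 0] u_meas by (auto simp: ok_def x_def)
  have "P u t = u t" for t
  proof -
    have bd: "norm (P u t - x (Suc n) t) \<le> (2 * K' * exp (\<mu> * t)) * (1 / 2) ^ Suc n" for n
      using contr[OF oku okx[of n] u_x, of t] K'(2) by (simp add: xS power_divide mult_ac)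
    have lim: "(\<lambda>n. (2 * K' * exp (\<mu> * t)) * (1 / 2) ^ Suc n) \<longlonglongrightarrow> 0"
      by (intro tendsto_mult_right_zero LIMSEQ_Suc[OF LIMSEQ_power_zero]) auto
    have "(\<lambda>n. P u t - x (Suc n) t) \<longlonglongrightarrow> 0"
      by (rule Lim_null_comparison[OF always_eventually lim]) (rule allI, rule bd)
    moreover have "(\<lambda>n. P u t - x (Suc n) t) \<longlonglongrightarrow> P u t - u t"
      by (intro tendsto_intros LIMSEQ_Suc u)
    ultimately have "0 = P u t - u t" by (rule LIMSEQ_unique)
    then show ?thesis by simp
  qed
  moreover have "norm (u t - u0) \<le> 2 * K' * exp (\<mu> * T)" if "t \<in> {0<..<T}" for t
  proof -
    have "norm (u t - u0) \<le> 2 * K' * exp (\<mu> * t)" using oku by (simp add: ok_def)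
    also have "\<dots> \<le> 2 * K' * exp (\<mu> * T)" using that \<mu> K'(2) by (intro mult_left_mono) auto
    finally show ?thesis .
  qed
  ultimately show ?thesis using u_meas by (intro exI[of _ u] exI[of _ "2 * K' * exp (\<mu> * T)"]) (auto simp: P_def)
qed

section \<open>Regularized problems\<close>

text \<open>The kernel is nonnegative, so dropping the negative part of p only increases the
  integral; \<open>ennreal\<close> does this by sending negative reals to 0.\<close>

lemma conv_le_nconv:
  fixes p :: "real \<Rightarrow> real" and q :: "real \<Rightarrow> ennreal"
  assumes [measurable]: "k \<in> borel_measurable borel" "p \<in> borel_measurable borel"
    and int: "integrable lborel (\<lambda>s. k (t - s) *\<^sub>R p s)"
    and k: "\<And>x. 0 \<le> k x" and pq: "\<And>s. ennreal (p s) \<le> q s"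
  shows "ennreal (conv k p t) \<le> nconv k q t"
proof -
  have "conv k p t \<le> enn2real (\<integral>\<^sup>+ s. ennreal (k (t - s) *\<^sub>R p s) \<partial>lborel)"
    unfolding conv_def real_lebesgue_integral_def[OF int] by simp
  then have "ennreal (conv k p t) \<le> ennreal (enn2real (\<integral>\<^sup>+ s. ennreal (k (t - s) *\<^sub>R p s) \<partial>lborel))"
    by (rule ennreal_leI)
  also have "\<dots> \<le> (\<integral>\<^sup>+ s. ennreal (k (t - s) *\<^sub>R p s) \<partial>lborel)"
    by (simp add: ennreal_enn2real_if)
  also have "\<dots> \<le> nconv k q t"
    unfolding nconv_def
  proof (rule nn_integral_mono)
    fix s
    have "ennreal (k (t - s) *\<^sub>R p s) \<le> ennreal (k (t - s)) * ennreal (p s)"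
      using k[of "t - s"] by (simp add: ennreal_mult')
    also have "\<dots> \<le> ennreal (k (t - s)) * q s" by (rule mult_left_mono[OF pq]) simp
    finally show "ennreal (k (t - s) *\<^sub>R p s) \<le> ennreal (k (t - s)) * q s" .
  qed
  finally show ?thesis .
qed

text \<open>Cauchy-Schwarz. This is how the energy of a derivative controls the distance of the
  solution from its initial value.\<close>

lemma norm_conv_kern_square_le:
  fixes h :: "real \<Rightarrow> 'a::{banach, second_countable_topology}"
  assumes a: "0 < a" "a \<le> 1" and T: "0 < T" and [measurable]: "h \<in> borel_measurable borel"
    and supp: "\<And>s. s \<notin> {0<..<T} \<Longrightarrow> h s = 0"
  shows "ennreal ((norm (conv (kern a) h t))\<^sup>2) \<le> ennreal (exp 1 * T powr a) * nconv (kern a) (\<lambda>s. ennreal ((norm (h s))\<^sup>2)) t"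
proof -
  have "ennreal ((norm (conv (kern a) h t))\<^sup>2) \<le> (nconv (kern a) (\<lambda>s. ennreal (norm (h s))) t)\<^sup>2"
    using norm_conv_le[of "kern a" h t] a by (simp add: ennreal_power[symmetric] power_mono)
  also have "\<dots> \<le> ennreal (exp 1 * T powr a) * nconv (kern a) (\<lambda>s. (ennreal (norm (h s)))\<^sup>2) t"
    by (rule nconv_kern_square_le) (use a T supp in auto)
  finally show ?thesis by (simp add: ennreal_power)
qed

lemma norm_add_square_le:
  fixes x y :: "'a::real_inner"
  shows "(norm (x + y))\<^sup>2 \<le> 2 * (norm x)\<^sup>2 + 2 * (norm y)\<^sup>2"
proof -
  have "0 \<le> (norm (x - y))\<^sup>2" by simp
  then show ?thesis unfolding power2_norm_eq_inner
    by (simp add: inner_diff_left inner_diff_right inner_add_left inner_add_right inner_commute)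
qed

lemma norm_diff_square_le:
  fixes x y :: "'a::real_inner"
  shows "(norm (x - y))\<^sup>2 \<le> 2 * (norm x)\<^sup>2 + 2 * (norm y)\<^sup>2"
  using norm_add_square_le[of x "- y"] by simp

text \<open>Here \<Theta> t x stands for f(t) - \<Psi>(t, x), made Borel in t, cut off outside (0,T)
  and Lipschitz at every time. The bound B at u0 collects the integrability hypotheses on f and
  \<Psi>.\<close>

locale gradient_flow = convex_functional \<Phi> m
  for \<Phi> :: "'a::{real_inner, banach, second_countable_topology} \<Rightarrow> ereal" and m :: real +
  fixes \<alpha> T L B \<phi>0 :: real and u0 :: 'a and \<Theta> :: "real \<Rightarrow> 'a \<Rightarrow> 'a"
  assumes \<alpha>: "0 < \<alpha>" "\<alpha> < 1" and T: "0 < T" and L: "0 \<le> L" and B: "0 \<le> B"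
    and \<phi>0: "\<Phi> u0 = ereal \<phi>0"
    and \<Theta>_meas: "\<And>x. (\<lambda>t. \<Theta> t x) \<in> borel_measurable borel"
    and \<Theta>_supp: "\<And>t x. t \<notin> {0<..<T} \<Longrightarrow> \<Theta> t x = 0"
    and \<Theta>_Lip: "\<And>t x y. norm (\<Theta> t x - \<Theta> t y) \<le> L * norm (x - y)"
    and \<Theta>_bound: "\<And>t. nconv (kern \<alpha>) (\<lambda>s. ennreal ((norm (\<Theta> s u0))\<^sup>2)) t \<le> ennreal B"
begin

definition "c = exp 1 * T powr \<alpha>"

abbreviation "\<kappa> \<equiv> kern \<alpha>"

abbreviation "I \<equiv> {0<..<T}"

lemma c_nonneg: "0 \<le> c" by (simp add: c_def)

lemma m_le: "m \<le> \<phi>0" using lower_bound[of u0] \<phi>0 by simp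

lemma \<Theta>_comp_meas: "u \<in> borel_measurable borel \<Longrightarrow> (\<lambda>t. \<Theta> t (u t)) \<in> borel_measurable borel"
  by (rule borel_measurable_Caratheodory[OF \<Theta>_meas \<Theta>_Lip])

text \<open>With N the energy \<open>\<kappa>\<close> * |g|^2, \<open>C0\<close> and
  \<open>D0\<close> are the coefficients of the inequality N \<le> C0 + D0 (\<open>\<kappa>\<close>
  * N). \<open>C1\<close> arises by inserting the resulting Gronwall bound 2 C0 exp(\<mu>0 T) into
  the right side.\<close>

definition "C0 = 2 * (\<phi>0 - m) + 2 * B"

definition "D0 = 2 * L\<^sup>2 * c"

text \<open>Chosen once from the data of the locale, so that \<open>C1\<close> does not depend on
  the Yosida parameter.\<close>

definition "\<mu>0 = (SOME \<mu>. 0 < \<mu> \<and> D0 * \<mu> powr (- \<alpha>) \<le> 1 / 2)"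

lemma D0_nonneg: "0 \<le> D0" using c_nonneg by (simp add: D0_def)

lemma \<mu>0: "0 < \<mu>0" "D0 * \<mu>0 powr (- \<alpha>) \<le> 1 / 2"
  using someI_ex[of "\<lambda>\<mu>. 0 < \<mu> \<and> D0 * \<mu> powr (- \<alpha>) \<le> 1 / 2"] exists_exponent[OF \<alpha>(1) D0_nonneg]
  unfolding \<mu>0_def by blast+

definition "C1 = C0 + D0 * (2 * C0 * exp (\<mu>0 * T) * c)"

lemma C0_nonneg: "0 \<le> C0" using m_le B by (simp add: C0_def)

lemma C1_nonneg: "0 \<le> C1" using C0_nonneg D0_nonneg c_nonneg by (simp add: C1_def)

lemma nconv_bounded_on_I:
  assumes "\<And>s. s \<in> I \<Longrightarrow> y s \<le> ennreal K"
  shows "nconv \<kappa> (\<lambda>s. y s * indicator I s) t \<le> ennreal K * ennreal c"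
proof -
  have "nconv \<kappa> (\<lambda>s. y s * indicator I s) t \<le> nconv \<kappa> (\<lambda>s. ennreal K * indicator I s) t"
    by (rule nconv_mono) (use assms in \<open>auto split: split_indicator\<close>)
  also have "\<dots> = ennreal K * nconv \<kappa> (indicator I) t" by (rule nconv_cmult) auto
  also have "\<dots> \<le> ennreal K * ennreal c"
    unfolding c_def by (intro mult_left_mono nconv_kern_Ioo_le) (use \<alpha> T in auto)
  finally show ?thesis .
qed

text \<open>The inclusion says that \<open>\<xi> t\<close> is the Yosida approximation of \<open>\<partial>\<Phi>\<close> with parameter \<open>\<mu>\<close> at \<open>u t\<close>.\<close>

definition regularized_solution :: "real \<Rightarrow> (real \<Rightarrow> 'a) \<Rightarrow> (real \<Rightarrow> 'a) \<Rightarrow> (real \<Rightarrow> 'a) \<Rightarrow> bool" where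
  "regularized_solution \<mu> u g \<xi> \<longleftrightarrow>
     u \<in> borel_measurable borel \<and> g \<in> borel_measurable borel \<and> \<xi> \<in> borel_measurable borel \<and>
     (\<forall>t. u t = u0 + conv \<kappa> g t) \<and> (\<forall>t. t \<notin> I \<longrightarrow> g t = 0 \<and> \<xi> t = 0) \<and>
     (\<forall>t\<in>I. g t + \<xi> t = \<Theta> t (u t) \<and> \<xi> t \<in> subdifferential \<Phi> (u t - \<mu> *\<^sub>R \<xi> t)) \<and>
     (\<forall>t. nconv \<kappa> (\<lambda>s. ennreal ((norm (g s))\<^sup>2)) t \<le> ennreal C1)"

lemma norm_\<Theta>_square_le:
  "(norm (\<Theta> t x))\<^sup>2 \<le> 2 * (norm (\<Theta> t u0))\<^sup>2 + 2 * L\<^sup>2 * (norm (x - u0))\<^sup>2"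
proof -
  have "(norm (\<Theta> t x))\<^sup>2 \<le> 2 * (norm (\<Theta> t u0))\<^sup>2 + 2 * (norm (\<Theta> t x - \<Theta> t u0))\<^sup>2"
    using norm_add_square_le[of "\<Theta> t u0" "\<Theta> t x - \<Theta> t u0"] by simp
  moreover have "(norm (\<Theta> t x - \<Theta> t u0))\<^sup>2 \<le> (L * norm (x - u0))\<^sup>2"
    by (rule power_mono[OF \<Theta>_Lip]) simp
  ultimately show ?thesis by (simp add: power_mult_distrib)
qed

text \<open>The majorant y is left open: the existence proof below first uses a constant, from a
  crude bound on u, and then the energy itself.\<close>

lemma nconv_\<Theta>_le:
  assumes u[measurable]: "u \<in> borel_measurable borel" and [measurable]: "y \<in> borel_measurable borel"
    and y: "\<And>s. s \<in> I \<Longrightarrow> ennreal ((norm (u s - u0))\<^sup>2) \<le> ennreal c * y s"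
  shows "nconv \<kappa> (\<lambda>s. ennreal ((norm (\<Theta> s (u s)))\<^sup>2)) t
    \<le> ennreal (2 * B) + ennreal D0 * nconv \<kappa> (\<lambda>s. y s * indicator I s) t"
proof -
  have [measurable]: "(\<lambda>s. \<Theta> s u0) \<in> borel_measurable borel" by (rule \<Theta>_meas)
  have "ennreal ((norm (\<Theta> s (u s)))\<^sup>2) \<le> ennreal 2 * ennreal ((norm (\<Theta> s u0))\<^sup>2) + ennreal D0 * (y s * indicator I s)" for s
  proof (cases "s \<in> I")
    case True
    have "ennreal ((norm (\<Theta> s (u s)))\<^sup>2) \<le> ennreal (2 * (norm (\<Theta> s u0))\<^sup>2 + 2 * L\<^sup>2 * (norm (u s - u0))\<^sup>2)"
      by (rule ennreal_leI[OF norm_\<Theta>_square_le])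
    also have "\<dots> = ennreal 2 * ennreal ((norm (\<Theta> s u0))\<^sup>2) + ennreal (2 * L\<^sup>2) * ennreal ((norm (u s - u0))\<^sup>2)"
      by (simp add: ennreal_mult)
    also have "\<dots> \<le> ennreal 2 * ennreal ((norm (\<Theta> s u0))\<^sup>2) + ennreal (2 * L\<^sup>2) * (ennreal c * y s)"
      by (intro add_left_mono mult_left_mono y True) auto
    also have "ennreal (2 * L\<^sup>2) * (ennreal c * y s) = ennreal D0 * (y s * indicator I s)"
      using True c_nonneg by (simp add: D0_def ennreal_mult mult.assoc)
    finally show ?thesis .
  qed (simp add: \<Theta>_supp)
  then have "nconv \<kappa> (\<lambda>s. ennreal ((norm (\<Theta> s (u s)))\<^sup>2)) t
      \<le> nconv \<kappa> (\<lambda>s. ennreal 2 * ennreal ((norm (\<Theta> s u0))\<^sup>2) + ennreal D0 * (y s * indicator I s)) t"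
    by (rule nconv_mono)
  also have "\<dots> = nconv \<kappa> (\<lambda>s. ennreal 2 * ennreal ((norm (\<Theta> s u0))\<^sup>2)) t + nconv \<kappa> (\<lambda>s. ennreal D0 * (y s * indicator I s)) t"
    by (rule nconv_add) measurable
  also have "\<dots> = ennreal 2 * nconv \<kappa> (\<lambda>s. ennreal ((norm (\<Theta> s u0))\<^sup>2)) t + ennreal D0 * nconv \<kappa> (\<lambda>s. y s * indicator I s) t"
    by (intro arg_cong2[where f = "(+)"] nconv_cmult) measurable
  also have "\<dots> \<le> ennreal 2 * ennreal B + ennreal D0 * nconv \<kappa> (\<lambda>s. y s * indicator I s) t"
    by (intro add_right_mono mult_left_mono \<Theta>_bound) auto
  finally show ?thesis using B by (simp add: ennreal_mult)
qed

text \<open>Supplies the second finiteness condition of \<open>fractional_chain\<close> at every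
  time.\<close>

lemma nconv_nconv_finite:
  assumes [measurable]: "h \<in> borel_measurable borel" and h: "\<And>s. s \<le> 0 \<Longrightarrow> h s = 0"
    and K: "\<And>t. nconv \<kappa> h t \<le> ennreal K"
  shows "nconv \<kappa> (nconv \<kappa> h) t < \<infinity>"
proof -
  have "nconv \<kappa> (nconv \<kappa> h) t \<le> nconv \<kappa> (\<lambda>s. ennreal K * indicator {0<..} s) t"
    by (rule nconv_mono) (use K nconv_kern_eq_0[of h] h in \<open>auto split: split_indicator simp: not_less\<close>)
  also have "\<dots> = ennreal K * nconv \<kappa> (indicator {0<..}) t"
    by (rule nconv_cmult) auto
  also have "\<dots> < \<infinity>" using nconv_kern_indicator_finite[OF \<alpha>(1)] by (simp add: ennreal_mult_less_top)
  finally show ?thesis .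
qed

text \<open>The Volterra solution comes with bounds that depend on \<mu>. They make the energy
  finite, so that the energy inequality and Gronwall's inequality can replace them by
  \<open>C1\<close>.\<close>

lemma regularized_solution_exists:
  assumes \<mu>: "0 < \<mu>"
  shows "\<exists>u g \<xi>. regularized_solution \<mu> u g \<xi>"
proof -
  obtain A F where A_sub: "\<And>x. A x \<in> subdifferential \<Phi> (x - \<mu> *\<^sub>R A x)"
    and A_Lip: "\<And>x y. norm (A x - A y) \<le> (1 / \<mu>) * norm (x - y)"
    and grad: "\<And>x y. F x + inner (A x) (y - x) \<le> F y"
    and F: "\<And>x. m \<le> F x" "\<And>x. ereal (F x) \<le> \<Phi> x"
    using Yosida_approximation[OF \<mu>] by blast
  have A_meas [measurable]: "A \<in> borel_measurable borel"
    by (rule borel_measurable_continuous_onI, rule continuous_on_sequentiallyI, rule Lipschitz_tendsto[OF A_Lip])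
  have [measurable]: "(\<lambda>s. \<Theta> s x) \<in> borel_measurable borel" for x by (rule \<Theta>_meas)
  define G where "G t x = indicator I t *\<^sub>R (\<Theta> t x - A x)" for t x
  have G_meas: "(\<lambda>t. G t x) \<in> borel_measurable borel" for x unfolding G_def by measurable
  have G_Lip: "norm (G t x - G t y) \<le> (L + 1 / \<mu>) * norm (x - y)" for t x y
  proof (cases "t \<in> I")
    case True
    have "norm (G t x - G t y) = norm ((\<Theta> t x - \<Theta> t y) - (A x - A y))"
      using True by (simp add: G_def algebra_simps)
    also have "\<dots> \<le> norm (\<Theta> t x - \<Theta> t y) + norm (A x - A y)" by (rule norm_triangle_ineq4)
    also have "\<dots> \<le> L * norm (x - y) + (1 / \<mu>) * norm (x - y)" by (intro add_mono \<Theta>_Lip A_Lip)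
    finally show ?thesis by (simp add: algebra_simps)
  next
    case False
    then show ?thesis using L \<mu> by (simp add: G_def)
  qed
  have G_K: "nconv \<kappa> (\<lambda>s. ennreal (norm (G s u0))) t \<le> ennreal ((1 + norm (A u0)) * c + B)" for t
  proof -
    have "nconv \<kappa> (\<lambda>s. ennreal (norm (G s u0))) t
        \<le> nconv \<kappa> (\<lambda>s. ennreal (1 + norm (A u0)) * indicator I s + ennreal ((norm (\<Theta> s u0))\<^sup>2)) t"
    proof (rule nconv_mono)
      fix s
      show "ennreal (norm (G s u0)) \<le> ennreal (1 + norm (A u0)) * indicator I s + ennreal ((norm (\<Theta> s u0))\<^sup>2)"
      proof (cases "s \<in> I")
        case True
        have "norm (\<Theta> s u0) \<le> 1 + (norm (\<Theta> s u0))\<^sup>2"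
          using sum_squares_bound[of 1 "norm (\<Theta> s u0)"] by (simp add: power2_eq_square) (smt (verit) norm_ge_zero)
        then have "norm (G s u0) \<le> (1 + norm (A u0)) + (norm (\<Theta> s u0))\<^sup>2"
          using True norm_triangle_ineq4[of "\<Theta> s u0" "A u0"] by (simp add: G_def)
        then show ?thesis using True by (simp add: ennreal_plus[symmetric] ennreal_leI del: ennreal_plus)
      qed (simp add: G_def)
    qed
    also have "\<dots> = nconv \<kappa> (\<lambda>s. ennreal (1 + norm (A u0)) * indicator I s) t + nconv \<kappa> (\<lambda>s. ennreal ((norm (\<Theta> s u0))\<^sup>2)) t"
      by (rule nconv_add) measurable
    also have "\<dots> \<le> ennreal (1 + norm (A u0)) * ennreal c + ennreal B"
      by (intro add_mono nconv_bounded_on_I \<Theta>_bound) simp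
    also have "\<dots> = ennreal ((1 + norm (A u0)) * c + B)"
      using c_nonneg B by (simp add: ennreal_mult[symmetric] ennreal_plus[symmetric] del: ennreal_plus)
    finally show ?thesis .
  qed
  obtain u R where u_meas [measurable]: "u \<in> borel_measurable borel"
    and u_eq: "\<And>t. u t = u0 + conv \<kappa> (\<lambda>s. G s (u s)) t" and u_R: "\<And>t. t \<in> I \<Longrightarrow> norm (u t - u0) \<le> R"
  proof -
    have "\<exists>u R. u \<in> borel_measurable borel \<and> (\<forall>t. u t = u0 + conv \<kappa> (\<lambda>s. G s (u s)) t)
        \<and> (\<forall>t\<in>I. norm (u t - u0) \<le> R)"
      by (rule Volterra_solution_exists[OF \<alpha>(1) _ G_meas G_Lip _ G_K]) (use L \<mu> in \<open>auto simp: G_def\<close>)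
    then show ?thesis using that by blast
  qed
  define g where "g s = G s (u s)" for s
  define \<xi> where "\<xi> s = indicator I s *\<^sub>R A (u s)" for s
  have g_meas [measurable]: "g \<in> borel_measurable borel"
    unfolding g_def[abs_def] by (rule borel_measurable_Caratheodory[OF G_meas G_Lip u_meas])
  have [measurable]: "\<xi> \<in> borel_measurable borel" unfolding \<xi>_def[abs_def] by measurable
  have \<Theta>u_meas [measurable]: "(\<lambda>s. \<Theta> s (u s)) \<in> borel_measurable borel" by (rule \<Theta>_comp_meas[OF u_meas])
  have g_supp: "s \<notin> I \<Longrightarrow> g s = 0" for s by (simp add: g_def G_def)
  have u_g: "u t = u0 + conv \<kappa> g t" for t using u_eq[of t] by (simp add: g_def[abs_def])
  have g_eq: "s \<in> I \<Longrightarrow> g s = \<Theta> s (u s) - A (u s)" for s by (simp add: g_def G_def)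
  define N where "N = nconv \<kappa> (\<lambda>s. ennreal ((norm (g s))\<^sup>2))"
  have [measurable]: "N \<in> borel_measurable borel" unfolding N_def by measurable
  \<comment> \<open>This crude bound depends on \<mu> through the Lipschitz constant 1 / \<mu> of A;
    what counts is that it is finite.\<close>
  define K where "K = 2 * (2 * B + D0 * (R\<^sup>2 / c * c)) + 2 * ((norm (A u0) + R / \<mu>)\<^sup>2 * c)"
  have u_sq: "ennreal ((norm (u s - u0))\<^sup>2) \<le> ennreal c * N s" for s
    using norm_conv_kern_square_le[of \<alpha> T g s] \<alpha> T g_supp by (simp add: u_g N_def c_def)
  have c_pos: "0 < c" using T by (simp add: c_def)
  have \<Theta>u_fin: "nconv \<kappa> (\<lambda>s. ennreal ((norm (\<Theta> s (u s)))\<^sup>2)) t \<le> ennreal (2 * B + D0 * (R\<^sup>2 / c * c))" for t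
  proof -
    \<comment> \<open>The constant R^2 / c takes the place of y, so that c y = R^2 bounds the
      squared distance from u0.\<close>
    have "nconv \<kappa> (\<lambda>s. ennreal ((norm (\<Theta> s (u s)))\<^sup>2)) t
      \<le> ennreal (2 * B) + ennreal D0 * nconv \<kappa> (\<lambda>s. ennreal (R\<^sup>2 / c) * indicator I s) t"
    proof (rule nconv_\<Theta>_le)
      fix s assume "s \<in> I"
      then have "(norm (u s - u0))\<^sup>2 \<le> R\<^sup>2" by (intro power_mono u_R) auto
      then show "ennreal ((norm (u s - u0))\<^sup>2) \<le> ennreal c * ennreal (R\<^sup>2 / c)"
        using c_pos by (simp add: ennreal_mult[symmetric] ennreal_leI)
    qed measurable
    also have "\<dots> \<le> ennreal (2 * B) + ennreal D0 * (ennreal (R\<^sup>2 / c) * ennreal c)"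
      by (intro add_left_mono mult_left_mono nconv_bounded_on_I) auto
    also have "\<dots> = ennreal (2 * B + D0 * (R\<^sup>2 / c * c))"
      using B D0_nonneg c_pos by (simp add: ennreal_mult[symmetric] ennreal_plus[symmetric] del: ennreal_plus)
    finally show ?thesis .
  qed
  have N_K: "N t \<le> ennreal K" for t
  proof -
    have "N t \<le> nconv \<kappa> (\<lambda>s. ennreal 2 * ennreal ((norm (\<Theta> s (u s)))\<^sup>2)
        + ennreal 2 * (ennreal ((norm (A u0) + R / \<mu>)\<^sup>2) * indicator I s)) t"
      unfolding N_def
    proof (rule nconv_mono)
      fix s
      show "ennreal ((norm (g s))\<^sup>2) \<le> ennreal 2 * ennreal ((norm (\<Theta> s (u s)))\<^sup>2)
        + ennreal 2 * (ennreal ((norm (A u0) + R / \<mu>)\<^sup>2) * indicator I s)"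
      proof (cases "s \<in> I")
        case True
        have "norm (A (u s)) \<le> norm (A u0) + norm (A (u s) - A u0)"
          by (metis add.commute diff_add_cancel norm_triangle_ineq)
        also have "\<dots> \<le> norm (A u0) + (1 / \<mu>) * R"
        proof -
          have "(1 / \<mu>) * norm (u s - u0) \<le> (1 / \<mu>) * R"
            by (rule mult_left_mono[OF u_R[OF True]]) (use \<mu> in simp)
          then show ?thesis using A_Lip[of "u s" u0] by linarith
        qed
        finally have "(norm (A (u s)))\<^sup>2 \<le> (norm (A u0) + R / \<mu>)\<^sup>2" by (intro power_mono) auto
        then have "(norm (g s))\<^sup>2 \<le> 2 * (norm (\<Theta> s (u s)))\<^sup>2 + 2 * (norm (A u0) + R / \<mu>)\<^sup>2"
          using norm_diff_square_le[of "\<Theta> s (u s)" "A (u s)"] by (simp add: g_eq[OF True])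
        then have "ennreal ((norm (g s))\<^sup>2) \<le> ennreal (2 * (norm (\<Theta> s (u s)))\<^sup>2 + 2 * (norm (A u0) + R / \<mu>)\<^sup>2)"
          by (rule ennreal_leI)
        then show ?thesis using True by (simp add: ennreal_mult)
      qed (simp add: g_supp)
    qed
    also have "\<dots> = ennreal 2 * nconv \<kappa> (\<lambda>s. ennreal ((norm (\<Theta> s (u s)))\<^sup>2)) t
        + ennreal 2 * nconv \<kappa> (\<lambda>s. ennreal ((norm (A u0) + R / \<mu>)\<^sup>2) * indicator I s) t"
      by (subst nconv_add) (auto simp: nconv_cmult)
    also have "\<dots> \<le> ennreal 2 * ennreal (2 * B + D0 * (R\<^sup>2 / c * c)) + ennreal 2 * (ennreal ((norm (A u0) + R / \<mu>)\<^sup>2) * ennreal c)"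
      by (intro add_mono mult_left_mono nconv_bounded_on_I \<Theta>u_fin) auto
    also have "\<dots> = ennreal K"
      using B D0_nonneg c_pos by (simp add: K_def ennreal_mult[symmetric] ennreal_plus[symmetric] del: ennreal_plus ennreal_numeral)
    finally show ?thesis .
  qed
  have N_fin: "N t < \<infinity>" for t using N_K[of t] by (auto intro: le_less_trans)
  have NN: "nconv \<kappa> N t < \<infinity>" for t
    unfolding N_def by (rule nconv_nconv_finite) (use g_supp N_K in \<open>auto simp: N_def\<close>)
  \<comment> \<open>Since A u = \<Theta> - g, completing the square bounds the inner product of g
    and A u plus |g|^2 / 2 by |\<Theta>|^2 / 2. The chain inequality bounds the convolution of that
    inner product from below by F (u t) - F u0, hence by m - \<phi>0.\<close>
  have energy: "N t \<le> ennreal C0 + ennreal D0 * nconv \<kappa> (\<lambda>s. N s * indicator I s) t" for t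
  proof -
    \<comment> \<open>The factor 1/2 of Young's inequality, kept symbolic and removed by doubling at
      the end.\<close>
    define h :: real where "h = 1 / 2"
    have h: "0 \<le> h" "2 * h = 1" by (simp_all add: h_def)
    have two_h: "ennreal 2 * (ennreal h * X) = X" for X
    proof -
      have "ennreal 2 * ennreal h = ennreal (2 * h)" by (rule ennreal_mult[symmetric]) (use h in auto)
      then show ?thesis unfolding h(2) by (simp only: mult.assoc[symmetric] ennreal_1 mult_1)
    qed
    let ?p = "\<lambda>s. inner (g s) (A (u s))" and ?q = "\<lambda>s. h * (norm (g s))\<^sup>2"
    have fin1: "nconv \<kappa> (\<lambda>s. (ennreal (norm (g s)))\<^sup>2) t < \<infinity>"
      and fin2: "nconv \<kappa> (nconv \<kappa> (\<lambda>s. (ennreal (norm (g s)))\<^sup>2)) t < \<infinity>"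
      using N_fin[of t] NN[of t] by (simp_all add: N_def ennreal_power)
    have chain: "integrable lborel (\<lambda>s. \<kappa> (t - s) *\<^sub>R ?p s)" "F (u t) - F u0 \<le> conv \<kappa> ?p t"
      using fractional_chain[OF \<alpha> T g_meas g_supp grad A_Lip _ fin1 fin2, of u0] \<mu>
      by (simp_all add: u_g[symmetric])
    have q_le: "h * x \<le> x" if "0 \<le> x" for x using that by (simp add: h_def)
    have iq: "integrable lborel (\<lambda>s. \<kappa> (t - s) *\<^sub>R ?q s)"
    proof (subst integrable_conv_iff)
      have "nconv \<kappa> (\<lambda>s. ennreal (norm (?q s))) t \<le> N t"
        unfolding N_def by (rule nconv_mono) (use h q_le in \<open>auto intro!: ennreal_leI simp: abs_mult\<close>)
      then show "nconv \<kappa> (\<lambda>s. ennreal (norm (?q s))) t < \<infinity>" using N_fin[of t] by (rule le_less_trans)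
    qed (use \<alpha> in auto)
    have sum: "conv \<kappa> (\<lambda>s. ?p s + ?q s) t = conv \<kappa> ?p t + conv \<kappa> ?q t"
      unfolding conv_def scaleR_add_right by (rule Bochner_Integration.integral_add[OF chain(1) iq])
    have Nq: "N t = ennreal (2 * conv \<kappa> ?q t)"
    proof -
      have "ennreal (conv \<kappa> ?q t) = (\<integral>\<^sup>+ s. ennreal (\<kappa> (t - s) *\<^sub>R ?q s) \<partial>lborel)"
        unfolding conv_def using \<alpha> h by (intro nn_integral_eq_integral[symmetric] iq) auto
      also have "\<dots> = nconv \<kappa> (\<lambda>s. ennreal h * ennreal ((norm (g s))\<^sup>2)) t"
        unfolding nconv_def using \<alpha> by (intro nn_integral_cong) (simp add: ennreal_mult[symmetric] h)
      also have "\<dots> = ennreal h * N t" unfolding N_def by (rule nconv_cmult) measurable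
      finally have "ennreal 2 * ennreal (conv \<kappa> ?q t) = N t" using two_h[of "N t"] by argo
      then show ?thesis using ennreal_mult'[of 2 "conv \<kappa> ?q t"] by argo
    qed
    have "ennreal (conv \<kappa> (\<lambda>s. ?p s + ?q s) t) \<le> nconv \<kappa> (\<lambda>s. ennreal h * ennreal ((norm (\<Theta> s (u s)))\<^sup>2)) t"
    proof (rule conv_le_nconv)
      show "integrable lborel (\<lambda>s. \<kappa> (t - s) *\<^sub>R (?p s + ?q s))"
        unfolding scaleR_add_right by (rule Bochner_Integration.integrable_add[OF chain(1) iq])
      fix s
      have "?p s + ?q s \<le> h * (norm (\<Theta> s (u s)))\<^sup>2"
      proof (cases "s \<in> I")
        case True
        have "0 \<le> (norm (g s - \<Theta> s (u s)))\<^sup>2" by simp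
        then have "inner (g s) (\<Theta> s (u s)) - inner (g s) (g s) / 2 \<le> 1 / 2 * inner (\<Theta> s (u s)) (\<Theta> s (u s))"
          unfolding power2_norm_eq_inner by (simp add: inner_diff_left inner_diff_right inner_commute)
        moreover have "A (u s) = \<Theta> s (u s) - g s" using g_eq[OF True] by simp
        ultimately show ?thesis unfolding power2_norm_eq_inner h_def by (simp add: inner_diff_right)
      qed (simp add: g_supp h)
      then show "ennreal (?p s + ?q s) \<le> ennreal h * ennreal ((norm (\<Theta> s (u s)))\<^sup>2)"
        using h by (simp add: ennreal_mult[symmetric] ennreal_leI)
    qed (use \<alpha> in auto)
    also have "\<dots> = ennreal h * nconv \<kappa> (\<lambda>s. ennreal ((norm (\<Theta> s (u s)))\<^sup>2)) t"
      by (rule nconv_cmult) measurable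
    also have "\<dots> \<le> ennreal h * (ennreal (2 * B) + ennreal D0 * nconv \<kappa> (\<lambda>s. N s * indicator I s) t)"
      by (intro mult_left_mono nconv_\<Theta>_le) (auto intro: u_sq)
    finally have "ennreal 2 * ennreal (conv \<kappa> (\<lambda>s. ?p s + ?q s) t)
        \<le> ennreal 2 * (ennreal h * (ennreal (2 * B) + ennreal D0 * nconv \<kappa> (\<lambda>s. N s * indicator I s) t))"
      by (rule mult_left_mono) simp
    then have le: "ennreal (2 * conv \<kappa> (\<lambda>s. ?p s + ?q s) t)
        \<le> ennreal (2 * B) + ennreal D0 * nconv \<kappa> (\<lambda>s. N s * indicator I s) t"
      unfolding two_h by (subst ennreal_mult') simp_all
    have "F u0 \<le> \<phi>0" using F(2)[of u0] \<phi>0 by simp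
    then have "2 * conv \<kappa> ?q t \<le> 2 * (\<phi>0 - m) + 2 * conv \<kappa> (\<lambda>s. ?p s + ?q s) t"
      using chain(2) F(1)[of "u t"] sum by simp
    then have "N t \<le> ennreal (2 * (\<phi>0 - m) + 2 * conv \<kappa> (\<lambda>s. ?p s + ?q s) t)"
      unfolding Nq by (rule ennreal_leI)
    also have "\<dots> \<le> ennreal (2 * (\<phi>0 - m)) + ennreal (2 * conv \<kappa> (\<lambda>s. ?p s + ?q s) t)"
      using m_le by (cases "0 \<le> conv \<kappa> (\<lambda>s. ?p s + ?q s) t")
        (auto simp: ennreal_plus[symmetric] ennreal_neg ennreal_leI simp del: ennreal_plus)
    also have "\<dots> \<le> ennreal (2 * (\<phi>0 - m)) + (ennreal (2 * B) + ennreal D0 * nconv \<kappa> (\<lambda>s. N s * indicator I s) t)"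
      by (rule add_left_mono[OF le])
    also have "\<dots> = ennreal C0 + ennreal D0 * nconv \<kappa> (\<lambda>s. N s * indicator I s) t"
      using m_le B by (simp add: C0_def ennreal_plus[symmetric] add.assoc[symmetric] del: ennreal_plus)
    finally show ?thesis .
  qed
  have N_enn: "ennreal (enn2real (N t)) = N t" for t using N_fin[of t] by simp
  have Gr: "N t \<le> ennreal (2 * C0 * exp (\<mu>0 * T))" if "t \<in> I" for t
  proof -
    have "enn2real (N t) \<le> 2 * C0 * exp (\<mu>0 * T)"
    proof (rule fractional_Gronwall[OF \<alpha>(1) \<mu>0 C0_nonneg D0_nonneg T _ _ _ that])
      show "enn2real (N t) \<le> \<bar>K\<bar>" for t
        using N_K[of t] by (intro enn2real_leI) (auto intro: order_trans ennreal_leI)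
      show "ennreal (enn2real (N t)) \<le> ennreal C0 + ennreal D0 * nconv \<kappa> (\<lambda>s. ennreal (enn2real (N s)) * indicator I s) t" for t
        unfolding N_enn by (rule energy)
    qed auto
    then have "ennreal (enn2real (N t)) \<le> ennreal (2 * C0 * exp (\<mu>0 * T))" by (rule ennreal_leI)
    then show ?thesis by (simp only: N_enn)
  qed
  \<comment> \<open>Gronwall's inequality covers (0,T); the energy inequality holds at every real
    time and extends the bound.\<close>
  have NC1: "N t \<le> ennreal C1" for t
  proof -
    have "N t \<le> ennreal C0 + ennreal D0 * (ennreal (2 * C0 * exp (\<mu>0 * T)) * ennreal c)"
      by (rule order_trans[OF energy]) (intro add_left_mono mult_left_mono nconv_bounded_on_I Gr, auto)
    also have "\<dots> = ennreal C1"
      using C0_nonneg D0_nonneg c_nonneg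
      by (simp add: C1_def ennreal_mult[symmetric] ennreal_plus[symmetric] del: ennreal_plus)
    finally show ?thesis .
  qed
  have "regularized_solution \<mu> u g \<xi>"
    unfolding regularized_solution_def
    using u_g g_supp A_sub NC1 g_eq by (auto simp: \<xi>_def N_def)
  then show ?thesis by blast
qed

end

section \<open>Comparison of two regularized solutions\<close>

context gradient_flow
begin

text \<open>This bounds \<open>\<kappa>\<close> * |\<xi>|^2 through \<xi> = \<Theta> - g.
  \<open>C3\<close> then gives the rate at which regularized solutions approach each other.\<close>

definition "C2 = 2 * (2 * B + D0 * (C1 * c)) + 2 * C1"

definition "\<mu>1 = (SOME \<mu>. 0 < \<mu> \<and> (2 * L) * \<mu> powr (- \<alpha>) \<le> 1 / 2)"

definition "C3 = 4 * C2 * exp (\<mu>1 * T)"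

lemma \<mu>1: "0 < \<mu>1" "(2 * L) * \<mu>1 powr (- \<alpha>) \<le> 1 / 2"
  using someI_ex[of "\<lambda>\<mu>. 0 < \<mu> \<and> (2 * L) * \<mu> powr (- \<alpha>) \<le> 1 / 2"] exists_exponent[OF \<alpha>(1), of "2 * L"] L
  unfolding \<mu>1_def by auto

lemma C2_nonneg: "0 \<le> C2"
  using B D0_nonneg C1_nonneg c_nonneg by (simp add: C2_def)

lemma C3_nonneg: "0 \<le> C3"
  using C2_nonneg by (simp add: C3_def)

lemma regularized_solution_bounds:
  assumes "regularized_solution \<mu> u g \<xi>"
  shows "ennreal ((norm (u t - u0))\<^sup>2) \<le> ennreal c * nconv \<kappa> (\<lambda>s. ennreal ((norm (g s))\<^sup>2)) t"
    and "nconv \<kappa> (\<lambda>s. ennreal ((norm (\<xi> s))\<^sup>2)) t \<le> ennreal C2"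
proof -
  have [measurable]: "u \<in> borel_measurable borel" "g \<in> borel_measurable borel" "\<xi> \<in> borel_measurable borel"
    and u: "\<And>t. u t = u0 + conv \<kappa> g t" and supp: "\<And>t. t \<notin> I \<Longrightarrow> g t = 0" "\<And>t. t \<notin> I \<Longrightarrow> \<xi> t = 0"
    and eq: "\<And>t. t \<in> I \<Longrightarrow> g t + \<xi> t = \<Theta> t (u t)"
    and gC1: "\<And>t. nconv \<kappa> (\<lambda>s. ennreal ((norm (g s))\<^sup>2)) t \<le> ennreal C1"
    using assms unfolding regularized_solution_def by auto
  have [measurable]: "(\<lambda>s. \<Theta> s (u s)) \<in> borel_measurable borel" by (rule \<Theta>_comp_meas) measurable
  show sq: "ennreal ((norm (u t - u0))\<^sup>2) \<le> ennreal c * nconv \<kappa> (\<lambda>s. ennreal ((norm (g s))\<^sup>2)) t" for t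
    using norm_conv_kern_square_le[of \<alpha> T g t] \<alpha> T supp(1) by (simp add: u c_def)
  let ?N = "nconv \<kappa> (\<lambda>s. ennreal ((norm (g s))\<^sup>2))"
  have "nconv \<kappa> (\<lambda>s. ennreal ((norm (\<xi> s))\<^sup>2)) t
      \<le> nconv \<kappa> (\<lambda>s. ennreal 2 * ennreal ((norm (\<Theta> s (u s)))\<^sup>2) + ennreal 2 * ennreal ((norm (g s))\<^sup>2)) t"
  proof (rule nconv_mono)
    fix s
    show "ennreal ((norm (\<xi> s))\<^sup>2) \<le> ennreal 2 * ennreal ((norm (\<Theta> s (u s)))\<^sup>2) + ennreal 2 * ennreal ((norm (g s))\<^sup>2)"
    proof (cases "s \<in> I")
      case True
      then have "\<xi> s = \<Theta> s (u s) - g s" using eq[of s] by (simp add: algebra_simps)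
      then have "ennreal ((norm (\<xi> s))\<^sup>2) \<le> ennreal (2 * (norm (\<Theta> s (u s)))\<^sup>2 + 2 * (norm (g s))\<^sup>2)"
        using norm_diff_square_le[of "\<Theta> s (u s)" "g s"] by (intro ennreal_leI) simp
      then show ?thesis by (simp add: ennreal_mult)
    qed (simp add: supp)
  qed
  also have "\<dots> = ennreal 2 * nconv \<kappa> (\<lambda>s. ennreal ((norm (\<Theta> s (u s)))\<^sup>2)) t + ennreal 2 * ?N t"
    by (subst nconv_add) (auto simp: nconv_cmult)
  also have "nconv \<kappa> (\<lambda>s. ennreal ((norm (\<Theta> s (u s)))\<^sup>2)) t
      \<le> ennreal (2 * B) + ennreal D0 * nconv \<kappa> (\<lambda>s. ?N s * indicator I s) t"
    by (rule nconv_\<Theta>_le) (auto intro: sq)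
  also have "\<dots> \<le> ennreal (2 * B) + ennreal D0 * (ennreal C1 * ennreal c)"
    by (intro add_left_mono mult_left_mono nconv_bounded_on_I gC1) auto
  finally have "nconv \<kappa> (\<lambda>s. ennreal ((norm (\<xi> s))\<^sup>2)) t
    \<le> ennreal 2 * (ennreal (2 * B) + ennreal D0 * (ennreal C1 * ennreal c)) + ennreal 2 * ?N t"
    by (meson add_right_mono mult_left_mono zero_le)
  also have "\<dots> \<le> ennreal 2 * (ennreal (2 * B) + ennreal D0 * (ennreal C1 * ennreal c)) + ennreal 2 * ennreal C1"
    by (intro add_left_mono mult_left_mono gC1) auto
  also have "\<dots> = ennreal C2"
    using B D0_nonneg C1_nonneg c_nonneg
    by (simp add: C2_def ennreal_mult[symmetric] ennreal_plus[symmetric] del: ennreal_plus ennreal_numeral)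
  finally show "nconv \<kappa> (\<lambda>s. ennreal ((norm (\<xi> s))\<^sup>2)) t \<le> ennreal C2" .
qed

text \<open>Monotonicity is available at the resolvent points u - \<mu> \<xi> and v - \<nu> \<zeta>.
  Correcting for the shift, the inner product of \<xi> - \<zeta> with u - v is at least -(\<mu> +
  \<nu>) (|\<xi>|^2 + |\<zeta>|^2) / 2, whose convolution with the kernel is controlled by
  \<open>C2\<close>. The chain inequality for |x|^2 / 2 and Gronwall's inequality finish the
  argument.\<close>

lemma regularized_solution_difference:
  assumes u: "regularized_solution \<mu> u g \<xi>" and v: "regularized_solution \<nu> v h \<zeta>"
    and \<mu>: "0 < \<mu>" and \<nu>: "0 < \<nu>" and t: "t \<in> I"
  shows "(norm (u t - v t))\<^sup>2 \<le> C3 * (\<mu> + \<nu>)"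
proof -
  have [measurable]: "u \<in> borel_measurable borel" "g \<in> borel_measurable borel" "\<xi> \<in> borel_measurable borel"
    "v \<in> borel_measurable borel" "h \<in> borel_measurable borel" "\<zeta> \<in> borel_measurable borel"
    and u_eq: "\<And>t. u t = u0 + conv \<kappa> g t" and v_eq: "\<And>t. v t = u0 + conv \<kappa> h t"
    and supp: "\<And>t. t \<notin> I \<Longrightarrow> g t = 0" "\<And>t. t \<notin> I \<Longrightarrow> h t = 0"
    and eq: "\<And>t. t \<in> I \<Longrightarrow> g t + \<xi> t = \<Theta> t (u t)" "\<And>t. t \<in> I \<Longrightarrow> h t + \<zeta> t = \<Theta> t (v t)"
    and sub: "\<And>t. t \<in> I \<Longrightarrow> \<xi> t \<in> subdifferential \<Phi> (u t - \<mu> *\<^sub>R \<xi> t)"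
      "\<And>t. t \<in> I \<Longrightarrow> \<zeta> t \<in> subdifferential \<Phi> (v t - \<nu> *\<^sub>R \<zeta> t)"
    and C1: "\<And>t. nconv \<kappa> (\<lambda>s. ennreal ((norm (g s))\<^sup>2)) t \<le> ennreal C1"
      "\<And>t. nconv \<kappa> (\<lambda>s. ennreal ((norm (h s))\<^sup>2)) t \<le> ennreal C1"
    using u v unfolding regularized_solution_def by auto
  define p where "p s = g s - h s" for s
  have [measurable]: "p \<in> borel_measurable borel" unfolding p_def[abs_def] by measurable
  have p_supp: "s \<notin> I \<Longrightarrow> p s = 0" for s by (simp add: p_def supp)
  have fin: "nconv \<kappa> (\<lambda>s. ennreal (norm (f s))) t < \<infinity>"
    if [measurable]: "f \<in> borel_measurable borel" and "\<And>s. s \<notin> I \<Longrightarrow> f s = 0"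
      and "nconv \<kappa> (\<lambda>s. ennreal ((norm (f s))\<^sup>2)) t \<le> ennreal C1" for f :: "real \<Rightarrow> 'a" and t
  proof -
    have "(nconv \<kappa> (\<lambda>s. ennreal (norm (f s))) t)\<^sup>2 \<le> ennreal c * nconv \<kappa> (\<lambda>s. (ennreal (norm (f s)))\<^sup>2) t"
      unfolding c_def by (rule nconv_kern_square_le) (use \<alpha> T that in auto)
    also have "\<dots> \<le> ennreal c * ennreal C1"
      using that(3) by (intro mult_left_mono) (auto simp: ennreal_power)
    also have "\<dots> < \<infinity>" by (simp add: ennreal_mult_less_top)
    finally show ?thesis
      by (auto simp: power2_eq_square ennreal_mult_less_top less_top[symmetric] ennreal_mult_eq_top_iff)
  qed
  have w: "u t - v t = conv \<kappa> p t" for t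
    unfolding p_def[abs_def] using fin[of g t] fin[of h t] supp C1 \<alpha> by (subst conv_diff) (auto simp: u_eq v_eq)
  have pC1: "nconv \<kappa> (\<lambda>s. ennreal ((norm (p s))\<^sup>2)) t \<le> ennreal (4 * C1)" for t
  proof -
    have "nconv \<kappa> (\<lambda>s. ennreal ((norm (p s))\<^sup>2)) t
      \<le> nconv \<kappa> (\<lambda>s. ennreal 2 * ennreal ((norm (g s))\<^sup>2) + ennreal 2 * ennreal ((norm (h s))\<^sup>2)) t"
    proof (rule nconv_mono)
      fix s
      have "ennreal ((norm (p s))\<^sup>2) \<le> ennreal (2 * (norm (g s))\<^sup>2 + 2 * (norm (h s))\<^sup>2)"
        unfolding p_def by (rule ennreal_leI[OF norm_diff_square_le])
      then show "ennreal ((norm (p s))\<^sup>2) \<le> ennreal 2 * ennreal ((norm (g s))\<^sup>2) + ennreal 2 * ennreal ((norm (h s))\<^sup>2)"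
        by (simp add: ennreal_mult)
    qed
    also have "\<dots> = ennreal 2 * nconv \<kappa> (\<lambda>s. ennreal ((norm (g s))\<^sup>2)) t + ennreal 2 * nconv \<kappa> (\<lambda>s. ennreal ((norm (h s))\<^sup>2)) t"
      by (subst nconv_add) (auto simp: nconv_cmult)
    also have "\<dots> \<le> ennreal 2 * ennreal C1 + ennreal 2 * ennreal C1"
      by (intro add_mono mult_left_mono C1) auto
    also have "\<dots> = ennreal (4 * C1)"
      using C1_nonneg by (simp add: ennreal_mult[symmetric] ennreal_plus[symmetric] del: ennreal_plus ennreal_numeral)
    finally show ?thesis .
  qed
  let ?w = "\<lambda>s. u s - v s"
  define y where "y t = (norm (?w t))\<^sup>2" for t
  have y_meas [measurable]: "y \<in> borel_measurable borel" unfolding y_def[abs_def] by measurable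
  have y_bdd: "y t \<le> c * (4 * C1)" for t
  proof -
    have "ennreal (y t) \<le> ennreal c * nconv \<kappa> (\<lambda>s. ennreal ((norm (p s))\<^sup>2)) t"
      using norm_conv_kern_square_le[of \<alpha> T p t] \<alpha> T p_supp by (simp add: y_def w c_def)
    also have "\<dots> \<le> ennreal c * ennreal (4 * C1)" by (intro mult_left_mono pC1) simp
    finally show ?thesis using c_nonneg C1_nonneg by (simp add: ennreal_mult[symmetric])
  qed
  define M where "M = \<mu> + \<nu>"
  have M: "0 < M" using \<mu> \<nu> by (simp add: M_def)
  have ineq: "ennreal (y t) \<le> ennreal (2 * (M * C2)) + ennreal (2 * L) * nconv \<kappa> (\<lambda>s. ennreal (y s) * indicator I s) t" for t
  proof -
    have fin1: "nconv \<kappa> (\<lambda>s. (ennreal (norm (p s)))\<^sup>2) t < \<infinity>"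
      using pC1[of t] by (auto simp: ennreal_power intro: le_less_trans)
    have fin2: "nconv \<kappa> (nconv \<kappa> (\<lambda>s. (ennreal (norm (p s)))\<^sup>2)) t < \<infinity>"
      by (rule nconv_nconv_finite) (use pC1 p_supp in \<open>auto simp: ennreal_power\<close>)
    have grad: "(norm x)\<^sup>2 / 2 + inner x (y - x) \<le> (norm y)\<^sup>2 / 2" for x y :: 'a
    proof -
      have "0 \<le> (norm (y - x))\<^sup>2" by simp
      then show ?thesis unfolding power2_norm_eq_inner
        by (simp add: inner_diff_left inner_diff_right inner_commute)
    qed
    have chain: "integrable lborel (\<lambda>s. \<kappa> (t - s) *\<^sub>R inner (p s) (?w s))" "y t / 2 \<le> conv \<kappa> (\<lambda>s. inner (p s) (?w s)) t"
      using fractional_chain[OF \<alpha> T _ p_supp, where F = "\<lambda>x. (norm x)\<^sup>2 / 2" and A = "\<lambda>x. x" and \<Lambda> = 1 and t = t and ?u0.0 = 0] grad fin1 fin2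
      by (simp_all add: w y_def)
    have "ennreal (conv \<kappa> (\<lambda>s. inner (p s) (?w s)) t)
      \<le> nconv \<kappa> (\<lambda>s. ennreal (M / 2) * (ennreal ((norm (\<xi> s))\<^sup>2) + ennreal ((norm (\<zeta> s))\<^sup>2)) + ennreal L * (ennreal (y s) * indicator I s)) t"
    proof (rule conv_le_nconv[OF _ _ chain(1)])
      fix s
      show "ennreal (inner (p s) (?w s)) \<le> ennreal (M / 2) * (ennreal ((norm (\<xi> s))\<^sup>2) + ennreal ((norm (\<zeta> s))\<^sup>2)) + ennreal L * (ennreal (y s) * indicator I s)"
      proof (cases "s \<in> I")
        case True
        have p_eq: "p s = (\<Theta> s (u s) - \<Theta> s (v s)) - (\<xi> s - \<zeta> s)"
          by (simp add: p_def eq(1)[OF True, symmetric] eq(2)[OF True, symmetric])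
        have "inner (\<Theta> s (u s) - \<Theta> s (v s)) (?w s) \<le> norm (\<Theta> s (u s) - \<Theta> s (v s)) * norm (?w s)"
          by (rule norm_cauchy_schwarz)
        also have "\<dots> \<le> (L * norm (?w s)) * norm (?w s)" by (intro mult_right_mono \<Theta>_Lip) simp
        finally have 1: "inner (\<Theta> s (u s) - \<Theta> s (v s)) (?w s) \<le> L * y s" by (simp add: y_def power2_eq_square)
        have "0 \<le> inner (\<xi> s - \<zeta> s) ((u s - \<mu> *\<^sub>R \<xi> s) - (v s - \<nu> *\<^sub>R \<zeta> s))"
          by (rule subdifferential_monotone[OF sub(1)[OF True] sub(2)[OF True]])
        also have "\<dots> = inner (\<xi> s - \<zeta> s) (?w s) - inner (\<xi> s - \<zeta> s) (\<mu> *\<^sub>R \<xi> s - \<nu> *\<^sub>R \<zeta> s)"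
          by (simp add: inner_diff_right algebra_simps)
        finally have 2: "inner (\<xi> s - \<zeta> s) (\<mu> *\<^sub>R \<xi> s - \<nu> *\<^sub>R \<zeta> s) \<le> inner (\<xi> s - \<zeta> s) (?w s)" by simp
        have 3: "inner (\<xi> s - \<zeta> s) (\<mu> *\<^sub>R \<xi> s - \<nu> *\<^sub>R \<zeta> s) = \<mu> * inner (\<xi> s) (\<xi> s) + \<nu> * inner (\<zeta> s) (\<zeta> s) - M * inner (\<xi> s) (\<zeta> s)"
          by (simp add: M_def inner_diff_right inner_diff_left inner_commute algebra_simps)
        have "0 \<le> (norm (\<xi> s - \<zeta> s))\<^sup>2" by simp
        then have "inner (\<xi> s) (\<zeta> s) \<le> ((norm (\<xi> s))\<^sup>2 + (norm (\<zeta> s))\<^sup>2) / 2"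
          unfolding power2_norm_eq_inner by (simp add: inner_diff_right inner_diff_left inner_commute)
        then have "M * inner (\<xi> s) (\<zeta> s) \<le> M * (((norm (\<xi> s))\<^sup>2 + (norm (\<zeta> s))\<^sup>2) / 2)"
          using M by (intro mult_left_mono) auto
        moreover have "0 \<le> \<mu> * inner (\<xi> s) (\<xi> s)" "0 \<le> \<nu> * inner (\<zeta> s) (\<zeta> s)" using \<mu> \<nu> by auto
        moreover have "inner (p s) (?w s) = inner (\<Theta> s (u s) - \<Theta> s (v s)) (?w s) - inner (\<xi> s - \<zeta> s) (?w s)"
          unfolding p_eq by (rule inner_diff_left)
        ultimately have "inner (p s) (?w s) \<le> M * (((norm (\<xi> s))\<^sup>2 + (norm (\<zeta> s))\<^sup>2) / 2) + L * y s"
          using 1 2 3 by linarith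
        then have "ennreal (inner (p s) (?w s)) \<le> ennreal (M / 2 * ((norm (\<xi> s))\<^sup>2 + (norm (\<zeta> s))\<^sup>2) + L * y s)"
          by (intro ennreal_leI) simp
        also have "\<dots> = ennreal (M / 2) * (ennreal ((norm (\<xi> s))\<^sup>2) + ennreal ((norm (\<zeta> s))\<^sup>2)) + ennreal L * ennreal (y s)"
          using M L by (simp add: y_def ennreal_mult[symmetric] ennreal_plus[symmetric] del: ennreal_plus)
        finally show ?thesis using True by simp
      qed (simp add: p_supp)
    qed (use \<alpha> in auto)
    also have "\<dots> = ennreal (M / 2) * (nconv \<kappa> (\<lambda>s. ennreal ((norm (\<xi> s))\<^sup>2)) t + nconv \<kappa> (\<lambda>s. ennreal ((norm (\<zeta> s))\<^sup>2)) t)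
        + ennreal L * nconv \<kappa> (\<lambda>s. ennreal (y s) * indicator I s) t"
      by (subst nconv_add) (auto simp: nconv_cmult nconv_add)
    also have "\<dots> \<le> ennreal (M / 2) * (ennreal C2 + ennreal C2) + ennreal L * nconv \<kappa> (\<lambda>s. ennreal (y s) * indicator I s) t"
      by (intro add_right_mono mult_left_mono add_mono regularized_solution_bounds(2)[OF u] regularized_solution_bounds(2)[OF v]) auto
    finally have "ennreal 2 * ennreal (conv \<kappa> (\<lambda>s. inner (p s) (?w s)) t)
        \<le> ennreal 2 * (ennreal (M / 2) * (ennreal C2 + ennreal C2) + ennreal L * nconv \<kappa> (\<lambda>s. ennreal (y s) * indicator I s) t)"
      by (rule mult_left_mono) simp
    moreover have "ennreal (y t) \<le> ennreal 2 * ennreal (conv \<kappa> (\<lambda>s. inner (p s) (?w s)) t)"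
      using chain(2) by (subst ennreal_mult'[symmetric]) (auto intro: ennreal_leI)
    moreover have "ennreal 2 * (ennreal (M / 2) * (ennreal C2 + ennreal C2) + ennreal L * nconv \<kappa> (\<lambda>s. ennreal (y s) * indicator I s) t)
      = ennreal (2 * (M * C2)) + ennreal (2 * L) * nconv \<kappa> (\<lambda>s. ennreal (y s) * indicator I s) t"
    proof -
      have "ennreal 2 * (ennreal (M / 2) * (ennreal C2 + ennreal C2)) = ennreal (2 * (M / 2 * (C2 + C2)))"
        using M C2_nonneg by (simp add: ennreal_mult[symmetric] ennreal_plus[symmetric] del: ennreal_plus ennreal_numeral)
      moreover have "ennreal 2 * (ennreal L * X) = ennreal (2 * L) * X" for X
        using L by (subst ennreal_mult) (auto simp: mult.assoc)
      ultimately show ?thesis by (simp add: distrib_left del: ennreal_numeral)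
    qed
    ultimately show ?thesis by simp
  qed
  \<comment> \<open>Gronwall doubles the constant 2 (\<mu> + \<nu>) C2, whence the factor 4 in
    \<open>C3\<close>.\<close>
  have "y t \<le> 2 * (2 * (M * C2)) * exp (\<mu>1 * T)"
    by (rule fractional_Gronwall[OF \<alpha>(1) \<mu>1 _ _ T _ y_bdd ineq t]) (use M C2_nonneg L in \<open>auto simp: y_def\<close>)
  then show ?thesis by (simp add: y_def C3_def M_def mult_ac)
qed

end

section \<open>Passage to the limit\<close>

text \<open>A strong substitute for weak compactness: elements of \<open>Q n\<close> of nearly minimal norm form a Cauchy sequence
  in \<open>L\<^sup>2\<close> by the parallelogram identity.\<close>

lemma midpoint_closed_sets_limit:
  fixes Q :: "nat \<Rightarrow> (real \<Rightarrow> 'a::{real_inner, banach, second_countable_topology}) set"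
  assumes T: "0 < T" and ne: "\<And>n. Q n \<noteq> {}" and dec: "\<And>n. Q (Suc n) \<subseteq> Q n"
    and meas: "\<And>n G. G \<in> Q n \<Longrightarrow> G \<in> borel_measurable borel"
    and supp: "\<And>n G s. G \<in> Q n \<Longrightarrow> s \<notin> {0<..<T} \<Longrightarrow> G s = 0"
    and bound: "\<And>n G. G \<in> Q n \<Longrightarrow> (\<integral>\<^sup>+ s. ennreal ((norm (G s))\<^sup>2) \<partial>lborel) \<le> ennreal K"
    and mid: "\<And>n G G'. G \<in> Q n \<Longrightarrow> G' \<in> Q n \<Longrightarrow> (\<lambda>s. (1 / 2) *\<^sub>R (G s + G' s)) \<in> Q n"
  obtains G g H where "\<And>n. G n \<in> Q n" "g \<in> borel_measurable borel" "\<And>s. s \<notin> {0<..<T} \<Longrightarrow> g s = 0"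
    "H \<in> borel_measurable borel" "\<And>s. s \<notin> {0<..<T} \<Longrightarrow> H s = 0" "(\<integral>\<^sup>+ s. H s \<partial>lborel) < \<infinity>"
    "AE s in lborel. (\<lambda>n. G n s) \<longlonglongrightarrow> g s" "\<And>n s. ennreal (norm (G n s)) \<le> H s"
proof -
  have decN: "Q n \<subseteq> Q k" if "k \<le> n" for k n using dec that by (rule lift_Suc_antimono_le)
  have int: "integrable lborel (\<lambda>s. (norm (G s))\<^sup>2)" if "G \<in> Q n" for G n
  proof (rule integrableI_bounded)
    have "(\<integral>\<^sup>+ s. ennreal (norm ((norm (G s))\<^sup>2)) \<partial>lborel) \<le> ennreal K" using bound[OF that] by simp
    also have "\<dots> < \<infinity>" by simp
    finally show "(\<integral>\<^sup>+ s. ennreal (norm ((norm (G s))\<^sup>2)) \<partial>lborel) < \<infinity>" .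
  qed (use meas[OF that] in measurable)
  define E where "E G = (LINT s|lborel. (norm (G s))\<^sup>2)" for G :: "real \<Rightarrow> 'a"
  have E_nn: "0 \<le> E G" for G by (simp add: E_def)
  have E_K: "E G \<le> \<bar>K\<bar>" if "G \<in> Q n" for G n
  proof -
    have "ennreal (E G) \<le> ennreal K"
      using bound[OF that] nn_integral_eq_integral[OF int[OF that]] by (simp add: E_def)
    then show ?thesis using E_nn[of G] by (cases "0 \<le> K") (auto simp: ennreal_neg ennreal_eq_0_iff)
  qed
  \<comment> \<open>The sets shrink, so these infima increase; they stay below |K| and approach
    their supremum \<open>D\<close>.\<close>
  define d where "d n = (INF G\<in>Q n. E G)" for n
  have bddE: "bdd_below (E ` Q n)" for n by (rule bdd_belowI2[of _ 0]) (rule E_nn)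
  have d_le: "d n \<le> E G" if "G \<in> Q n" for n G unfolding d_def by (rule cINF_lower[OF bddE that])
  have d_K: "d n \<le> \<bar>K\<bar>" for n using ne[of n] d_le E_K by (meson all_not_in_conv order_trans)
  define D where "D = (SUP n. d n)"
  have bddd: "bdd_above (range d)" by (rule bdd_aboveI2) (rule d_K)
  have d_D: "d n \<le> D" for n unfolding D_def by (rule cSUP_upper[OF UNIV_I bddd])
  have d_mono: "d k \<le> d n" if "k \<le> n" for k n
    unfolding d_def by (rule cINF_superset_mono[OF ne bddE decN[OF that]]) simp
  define e where "e k = (1 / 8 :: real) ^ k" for k :: nat
  have e: "0 < e k" for k by (simp add: e_def)
  have eS: "e (Suc k) \<le> e k" for k by (simp add: e_def)
  have "\<exists>N\<ge>k. D - e k < d N" for k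
  proof -
    have "D - e k < D" using e[of k] by simp
    then obtain N where "D - e k < d N" unfolding D_def using less_cSUP_iff[OF UNIV_not_empty bddd] by auto
    then have "D - e k < d (max N k)" using d_mono[of N "max N k"] by simp
    then show ?thesis by (intro exI[of _ "max N k"]) auto
  qed
  then obtain N where N: "\<And>k. k \<le> N k" "\<And>k. D - e k < d (N k)" by metis
  have "\<exists>G\<in>Q (N k). E G < d (N k) + e k" for k
  proof -
    have "(INF G\<in>Q (N k). E G) < d (N k) + e k" using e[of k] by (simp add: d_def)
    then show ?thesis using cINF_less_iff[OF ne bddE] by auto
  qed
  then obtain G where G: "\<And>k. G k \<in> Q (N k)" "\<And>k. E (G k) < d (N k) + e k" by metis
  have [measurable]: "G k \<in> borel_measurable borel" for k using meas[OF G(1)] .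
  \<comment> \<open>The midpoint lies in the larger of the two sets, so its energy is at least D - e
    k, while both endpoints have energy below D + e k.\<close>
  have close: "(LINT s|lborel. (norm (G (Suc k) s - G k s))\<^sup>2) \<le> 8 * e k" for k
  proof -
    let ?A = "\<lambda>s. (1 / 2) *\<^sub>R (G (Suc k) s + G k s)"
    let ?M = "min (N k) (N (Suc k))"
    have Q: "G k \<in> Q ?M" "G (Suc k) \<in> Q ?M" using G(1) decN[of ?M] by (meson min.cobounded1 min.cobounded2 subsetD)+
    have A: "?A \<in> Q ?M" by (rule mid[OF Q(2) Q(1)])
    have "D - e k \<le> d ?M"
      using eS[of k] N(2)[of k] N(2)[of "Suc k"] by (auto simp: min_def)
    then have EA: "D - e k \<le> E ?A" using d_le[OF A] by simp
    have par: "(norm (x - y))\<^sup>2 = 2 * (norm x)\<^sup>2 + 2 * (norm y)\<^sup>2 - 4 * (norm ((1 / 2) *\<^sub>R (x + y)))\<^sup>2" for x y :: 'a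
      unfolding power2_norm_eq_inner by (simp add: inner_add_left inner_add_right inner_diff_left inner_diff_right inner_commute
        add_divide_distrib)
    have "(LINT s|lborel. (norm (G (Suc k) s - G k s))\<^sup>2) = 2 * E (G (Suc k)) + 2 * E (G k) - 4 * E ?A"
      unfolding par E_def using int[OF Q(1)] int[OF Q(2)] int[OF A] by simp
    also have "\<dots> \<le> 8 * e k"
      using EA G(2)[of k] G(2)[of "Suc k"] d_D[of "N k"] d_D[of "N (Suc k)"] eS[of k] by linarith
    finally show ?thesis .
  qed
  \<comment> \<open>A telescoping majorant with finite integral: where it is finite the sequence
    converges, and it dominates every term.\<close>
  define H where "H s = ennreal (norm (G 0 s)) + (\<Sum>k. ennreal (norm (G (Suc k) s - G k s)))" for s
  have [measurable]: "H \<in> borel_measurable borel" unfolding H_def[abs_def] by measurable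
  have suppG: "s \<notin> {0<..<T} \<Longrightarrow> G k s = 0" for s k by (rule supp[OF G(1)])
  \<comment> \<open>Young's inequality with parameter r, integrated over the bounded support; it is
    applied with r = 2^(-k).\<close>
  have L1: "(\<integral>\<^sup>+ s. ennreal (norm (f s)) \<partial>lborel) \<le> ennreal (r * T + X / r)"
    if r: "0 < r" and f: "integrable lborel (\<lambda>s. (norm (f s))\<^sup>2)" "\<And>s. s \<notin> {0<..<T} \<Longrightarrow> f s = 0"
      and X: "(LINT s|lborel. (norm (f s))\<^sup>2) \<le> X" for f :: "real \<Rightarrow> 'a" and r X
  proof -
    have pt: "norm (f s) \<le> r * indicator {0<..<T} s + (norm (f s))\<^sup>2 / r" for s
    proof (cases "s \<in> {0<..<T}")
      case True
      have "2 * (norm (f s) * r) \<le> (norm (f s))\<^sup>2 + r\<^sup>2"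
        using sum_squares_bound[of "norm (f s)" r] by (simp add: mult.assoc)
      moreover have "0 \<le> norm (f s) * r" using r by simp
      ultimately have "norm (f s) * r \<le> (norm (f s))\<^sup>2 + r\<^sup>2" by linarith
      then have "norm (f s) \<le> ((norm (f s))\<^sup>2 + r\<^sup>2) / r" using r by (simp only: pos_le_divide_eq)
      also have "\<dots> = r + (norm (f s))\<^sup>2 / r" using r by (simp add: add_divide_distrib power2_eq_square)
      finally have "norm (f s) \<le> r + (norm (f s))\<^sup>2 / r" .
      then show ?thesis using True by simp
    qed (simp add: f(2))
    have ii: "integrable lborel (\<lambda>s. r * indicator {0<..<T} s :: real)"
      using T by (intro integrable_mult_right) (simp add: integrable_indicator_iff)
    have iq: "integrable lborel (\<lambda>s. (norm (f s))\<^sup>2 / r)"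
      using f(1) by simp
    have "(\<integral>\<^sup>+ s. ennreal (norm (f s)) \<partial>lborel) \<le> (\<integral>\<^sup>+ s. ennreal (r * indicator {0<..<T} s + (norm (f s))\<^sup>2 / r) \<partial>lborel)"
      by (intro nn_integral_mono ennreal_leI pt)
    also have "\<dots> = ennreal (LINT s|lborel. r * indicator {0<..<T} s + (norm (f s))\<^sup>2 / r)"
      using r by (intro nn_integral_eq_integral Bochner_Integration.integrable_add ii iq) auto
    also have "(LINT s|lborel. r * indicator {0<..<T} s + (norm (f s))\<^sup>2 / r) = r * T + (LINT s|lborel. (norm (f s))\<^sup>2) / r"
      using T by (subst Bochner_Integration.integral_add[OF ii iq]) simp
    finally show ?thesis using X r
      by (elim order_trans) (intro ennreal_leI add_left_mono divide_right_mono, auto)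
  qed
  have intd: "integrable lborel (\<lambda>s. (norm (G (Suc k) s - G k s))\<^sup>2)" for k
  proof (rule Bochner_Integration.integrable_bound)
    show "integrable lborel (\<lambda>s. 2 * (norm (G (Suc k) s))\<^sup>2 + 2 * (norm (G k s))\<^sup>2)"
      using int[OF G(1)] by auto
    show "AE s in lborel. norm ((norm (G (Suc k) s - G k s))\<^sup>2) \<le> norm (2 * (norm (G (Suc k) s))\<^sup>2 + 2 * (norm (G k s))\<^sup>2)"
      using norm_diff_square_le by (intro AE_I2) simp
  qed measurable
  have Hfin: "(\<integral>\<^sup>+ s. H s \<partial>lborel) < \<infinity>"
  proof -
    have "(\<integral>\<^sup>+ s. ennreal (norm (G 0 s)) \<partial>lborel) \<le> ennreal (1 * T + E (G 0) / 1)"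
      by (rule L1) (use int[OF G(1)] in \<open>auto simp: E_def suppG\<close>)
    also have "\<dots> < \<infinity>" by (simp only: infinity_ennreal_def ennreal_less_top)
    finally have 0: "(\<integral>\<^sup>+ s. ennreal (norm (G 0 s)) \<partial>lborel) < \<infinity>" .
    have k: "(\<integral>\<^sup>+ s. ennreal (norm (G (Suc k) s - G k s)) \<partial>lborel) \<le> ennreal ((T + 8) * (1 / 2) ^ k)" for k
    proof -
      have "(\<integral>\<^sup>+ s. ennreal (norm (G (Suc k) s - G k s)) \<partial>lborel) \<le> ennreal ((1 / 2) ^ k * T + 8 * e k / (1 / 2) ^ k)"
        by (rule L1[OF _ intd _ close]) (simp_all add: suppG)
      also have "\<dots> \<le> ennreal ((T + 8) * (1 / 2) ^ k)"
      proof (rule ennreal_leI)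
        have "e k / (1 / 2) ^ k = (1 / 4) ^ k" by (simp add: e_def power_divide[symmetric])
        also have "\<dots> \<le> (1 / 2) ^ k" by (rule power_mono) auto
        finally have "8 * (e k / (1 / 2) ^ k) \<le> 8 * (1 / 2) ^ k" by simp
        then show "(1 / 2) ^ k * T + 8 * e k / (1 / 2) ^ k \<le> (T + 8) * (1 / 2) ^ k"
          by (simp add: distrib_right mult.commute)
      qed
      finally show ?thesis .
    qed
    have "(\<integral>\<^sup>+ s. (\<Sum>k. ennreal (norm (G (Suc k) s - G k s))) \<partial>lborel) = (\<Sum>k. \<integral>\<^sup>+ s. ennreal (norm (G (Suc k) s - G k s)) \<partial>lborel)"
      by (rule nn_integral_suminf) measurable
    also have "\<dots> \<le> (\<Sum>k. ennreal ((T + 8) * (1 / 2) ^ k))" by (intro suminf_le k) auto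
    also have "\<dots> < \<infinity>"
      using T by (subst suminf_ennreal2) (auto intro!: summable_mult summable_geometric)
    finally show ?thesis using 0 unfolding H_def by (subst nn_integral_add) auto
  qed
  have telescope: "G n s = G 0 s + (\<Sum>k<n. G (Suc k) s - G k s)" for n s
    by (simp add: sum_lessThan_telescope[of "\<lambda>k. G k s"])
  have GH: "ennreal (norm (G n s)) \<le> H s" for n s
  proof -
    have "norm (G n s) \<le> norm (G 0 s) + (\<Sum>k<n. norm (G (Suc k) s - G k s))"
      using telescope[of n s] norm_triangle_ineq[of "G 0 s" "\<Sum>k<n. G (Suc k) s - G k s"]
        norm_sum[of "\<lambda>k. G (Suc k) s - G k s" "{..<n}"] by simp
    then have "ennreal (norm (G n s)) \<le> ennreal (norm (G 0 s)) + (\<Sum>k<n. ennreal (norm (G (Suc k) s - G k s)))"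
      by (subst sum_ennreal) (auto simp: ennreal_plus[symmetric] sum_nonneg ennreal_leI simp del: ennreal_plus)
    also have "\<dots> \<le> H s" unfolding H_def by (intro add_left_mono sum_le_suminf) auto
    finally show ?thesis .
  qed
  define g where "g s = lim (\<lambda>n. G n s)" for s
  have conv: "AE s in lborel. (\<lambda>n. G n s) \<longlonglongrightarrow> g s"
  proof -
    have "AE s in lborel. H s \<noteq> \<infinity>" using Hfin by (intro nn_integral_noteq_infinite) auto
    then show ?thesis
    proof eventually_elim
      case (elim s)
      then have "(\<Sum>k. ennreal (norm (G (Suc k) s - G k s))) \<noteq> top" by (auto simp: H_def)
      then have "summable (\<lambda>k. norm (G (Suc k) s - G k s))" by (intro summable_suminf_not_top) auto
      then have "summable (\<lambda>k. G (Suc k) s - G k s)" by (rule summable_norm_cancel)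
      then have "(\<lambda>n. G 0 s + (\<Sum>k<n. G (Suc k) s - G k s)) \<longlonglongrightarrow> G 0 s + (\<Sum>k. G (Suc k) s - G k s)"
        by (intro tendsto_add tendsto_const summable_LIMSEQ)
      then have "convergent (\<lambda>n. G n s)" unfolding telescope[symmetric] by (rule convergentI)
      then show ?case unfolding g_def by (rule convergent_LIMSEQ_iff[THEN iffD1])
    qed
  qed
  show ?thesis
  proof (rule that)
    show "G n \<in> Q n" for n using G(1)[of n] decN[OF N(1)[of n]] by auto
    show "g \<in> borel_measurable borel" unfolding g_def[abs_def] by measurable
    show "g s = 0" if "s \<notin> {0<..<T}" for s using that by (simp add: g_def suppG)
    show "H \<in> borel_measurable borel" by measurable
    show "H s = 0" if "s \<notin> {0<..<T}" for s using that by (simp add: H_def suppG)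
  qed (rule Hfin conv GH)+
qed

lemma ennreal_average:
  assumes "0 \<le> x" "0 \<le> y"
  shows "ennreal ((x + y) / 2) = ennreal (1 / 2) * ennreal x + ennreal (1 / 2) * ennreal y"
proof -
  have "ennreal ((x + y) / 2) = ennreal (1 / 2 * x + 1 / 2 * y)" by (simp add: add_divide_distrib)
  also have "\<dots> = ennreal (1 / 2 * x) + ennreal (1 / 2 * y)" by (rule ennreal_plus) (use assms in auto)
  also have "ennreal (1 / 2 * x) = ennreal (1 / 2) * ennreal x" by (rule ennreal_mult) (use assms in auto)
  also have "ennreal (1 / 2 * y) = ennreal (1 / 2) * ennreal y" by (rule ennreal_mult) (use assms in auto)
  finally show ?thesis .
qed

section \<open>Approximate derivatives and their averages\<close>

context gradient_flow
begin

text \<open>The conditions on \<open>G\<close> are stable under midpoints, unlike membership in \<open>\<partial>\<Phi>\<close>. They say that \<open>u0 + \<kappa> * G\<close> is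
  close to the uniform limit \<open>U\<close> and that \<open>\<Theta> t (U t) - G t\<close> is a subgradient of \<open>\<Phi>\<close> near \<open>U t\<close> up to an
  error \<open>E t\<close> of small integral.\<close>

definition approximants :: "(real \<Rightarrow> 'a) \<Rightarrow> nat \<Rightarrow> (real \<Rightarrow> 'a) set" where
  "approximants U n = {G. G \<in> borel_measurable borel \<and> (\<forall>t. t \<notin> I \<longrightarrow> G t = 0) \<and>
     (\<forall>t. nconv \<kappa> (\<lambda>s. ennreal ((norm (G s))\<^sup>2)) t \<le> ennreal C1) \<and>
     (\<forall>t\<in>I. norm (u0 + conv \<kappa> G t - U t) \<le> (1 / 2) ^ n) \<and>
     (\<exists>V E. V \<in> borel_measurable borel \<and> E \<in> borel_measurable borel \<and> (\<forall>t. 0 \<le> E t) \<and>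
        (\<integral>\<^sup>+ t. ennreal (E t) * indicator I t \<partial>lborel) \<le> ennreal ((1 / 2) ^ n) \<and>
        (\<forall>t\<in>I. (norm (V t - U t))\<^sup>2 \<le> E t \<and>
           (\<forall>v q. \<Phi> v \<le> ereal q \<longrightarrow>
              \<Phi> (V t) \<le> ereal (q - inner (\<Theta> t (U t) - G t) (v - U t) + E t * (1 + norm (v - U t))))))}"

lemma approximants_decreasing: "approximants U (Suc n) \<subseteq> approximants U n"
proof
  fix G assume G: "G \<in> approximants U (Suc n)"
  have le: "(1 / 2 :: real) ^ Suc n \<le> (1 / 2) ^ n" by simp
  obtain V E where VE: "V \<in> borel_measurable borel" "E \<in> borel_measurable borel" "\<forall>t. 0 \<le> E t"
    and int: "(\<integral>\<^sup>+ t. ennreal (E t) * indicator I t \<partial>lborel) \<le> ennreal ((1 / 2) ^ Suc n)"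
    and rest: "\<forall>t\<in>I. (norm (V t - U t))\<^sup>2 \<le> E t \<and>
           (\<forall>v q. \<Phi> v \<le> ereal q \<longrightarrow>
              \<Phi> (V t) \<le> ereal (q - inner (\<Theta> t (U t) - G t) (v - U t) + E t * (1 + norm (v - U t))))"
    using G unfolding approximants_def by blast
  have int': "(\<integral>\<^sup>+ t. ennreal (E t) * indicator I t \<partial>lborel) \<le> ennreal ((1 / 2) ^ n)"
    by (rule order_trans[OF int ennreal_leI[OF le]])
  have near: "\<forall>t\<in>I. norm (u0 + conv \<kappa> G t - U t) \<le> (1 / 2) ^ n"
    using G le order_trans unfolding approximants_def by blast
  have "G \<in> borel_measurable borel" "\<forall>t. t \<notin> I \<longrightarrow> G t = 0"
    "\<forall>t. nconv \<kappa> (\<lambda>s. ennreal ((norm (G s))\<^sup>2)) t \<le> ennreal C1"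
    using G unfolding approximants_def by blast+
  then show "G \<in> approximants U n"
    using near VE int' rest unfolding approximants_def by blast
qed

lemma nconv_norm_finite:
  fixes f :: "real \<Rightarrow> 'a"
  assumes [measurable]: "f \<in> borel_measurable borel" and "\<And>s. s \<notin> I \<Longrightarrow> f s = 0"
    and "nconv \<kappa> (\<lambda>s. ennreal ((norm (f s))\<^sup>2)) t \<le> ennreal K"
  shows "nconv \<kappa> (\<lambda>s. ennreal (norm (f s))) t < \<infinity>"
proof -
  have "(nconv \<kappa> (\<lambda>s. ennreal (norm (f s))) t)\<^sup>2 \<le> ennreal c * nconv \<kappa> (\<lambda>s. (ennreal (norm (f s)))\<^sup>2) t"
    unfolding c_def by (rule nconv_kern_square_le) (use \<alpha> T assms in auto)
  also have "\<dots> \<le> ennreal c * ennreal K"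
    using assms(3) by (intro mult_left_mono) (auto simp: ennreal_power)
  also have "\<dots> < \<infinity>" by (simp add: ennreal_mult_less_top)
  finally show ?thesis
    by (auto simp: power2_eq_square ennreal_mult_less_top less_top[symmetric] ennreal_mult_eq_top_iff)
qed

lemma norm_midpoint_square_le:
  fixes x y :: "'b::real_inner"
  shows "(norm ((1 / 2) *\<^sub>R (x + y)))\<^sup>2 \<le> ((norm x)\<^sup>2 + (norm y)\<^sup>2) / 2"
  using norm_add_square_le[of x y] by (simp add: power_divide)

text \<open>For fixed v the relaxed subgradient inequality is affine in G and E, and \<Phi> is
  convex in V; the remaining conditions are convex too. So G, V and E can be averaged
  together.\<close>

lemma approximants_midpoint:
  assumes G: "G \<in> approximants U n" and G': "G' \<in> approximants U n"
  shows "(\<lambda>s. (1 / 2) *\<^sub>R (G s + G' s)) \<in> approximants U n"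
proof -
  let ?M = "\<lambda>s. (1 / 2) *\<^sub>R (G s + G' s)"
  have [measurable]: "G \<in> borel_measurable borel" "G' \<in> borel_measurable borel"
    and supp: "\<And>t. t \<notin> I \<Longrightarrow> G t = 0" "\<And>t. t \<notin> I \<Longrightarrow> G' t = 0"
    and bd: "\<And>t. nconv \<kappa> (\<lambda>s. ennreal ((norm (G s))\<^sup>2)) t \<le> ennreal C1"
      "\<And>t. nconv \<kappa> (\<lambda>s. ennreal ((norm (G' s))\<^sup>2)) t \<le> ennreal C1"
    and near: "\<And>t. t \<in> I \<Longrightarrow> norm (u0 + conv \<kappa> G t - U t) \<le> (1 / 2) ^ n"
      "\<And>t. t \<in> I \<Longrightarrow> norm (u0 + conv \<kappa> G' t - U t) \<le> (1 / 2) ^ n"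
    using G G' by (auto simp: approximants_def)
  obtain V E where [measurable]: "V \<in> borel_measurable borel" "E \<in> borel_measurable borel"
    and E: "\<And>t. 0 \<le> E t" "(\<integral>\<^sup>+ t. ennreal (E t) * indicator I t \<partial>lborel) \<le> ennreal ((1 / 2) ^ n)"
    and V: "\<And>t. t \<in> I \<Longrightarrow> (norm (V t - U t))\<^sup>2 \<le> E t"
      "\<And>t v q. t \<in> I \<Longrightarrow> \<Phi> v \<le> ereal q \<Longrightarrow>
         \<Phi> (V t) \<le> ereal (q - inner (\<Theta> t (U t) - G t) (v - U t) + E t * (1 + norm (v - U t)))"
    using G unfolding approximants_def by blast
  obtain V' E' where [measurable]: "V' \<in> borel_measurable borel" "E' \<in> borel_measurable borel"
    and E': "\<And>t. 0 \<le> E' t" "(\<integral>\<^sup>+ t. ennreal (E' t) * indicator I t \<partial>lborel) \<le> ennreal ((1 / 2) ^ n)"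
    and V': "\<And>t. t \<in> I \<Longrightarrow> (norm (V' t - U t))\<^sup>2 \<le> E' t"
      "\<And>t v q. t \<in> I \<Longrightarrow> \<Phi> v \<le> ereal q \<Longrightarrow>
         \<Phi> (V' t) \<le> ereal (q - inner (\<Theta> t (U t) - G' t) (v - U t) + E' t * (1 + norm (v - U t)))"
    using G' unfolding approximants_def by blast
  have half: "ennreal (1 / 2) * ennreal X + ennreal (1 / 2) * ennreal X = ennreal X" if "0 \<le> X" for X
    using ennreal_average[OF that that] by simp
  have m1: "nconv \<kappa> (\<lambda>s. ennreal ((norm (?M s))\<^sup>2)) t \<le> ennreal C1" for t
  proof -
    have "nconv \<kappa> (\<lambda>s. ennreal ((norm (?M s))\<^sup>2)) t
        \<le> nconv \<kappa> (\<lambda>s. ennreal (1 / 2) * ennreal ((norm (G s))\<^sup>2) + ennreal (1 / 2) * ennreal ((norm (G' s))\<^sup>2)) t"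
    proof (rule nconv_mono)
      fix s
      have "ennreal ((norm (?M s))\<^sup>2) \<le> ennreal (((norm (G s))\<^sup>2 + (norm (G' s))\<^sup>2) / 2)"
        by (rule ennreal_leI[OF norm_midpoint_square_le])
      also have "\<dots> = ennreal (1 / 2) * ennreal ((norm (G s))\<^sup>2) + ennreal (1 / 2) * ennreal ((norm (G' s))\<^sup>2)"
        by (rule ennreal_average) auto
      finally show "ennreal ((norm (?M s))\<^sup>2) \<le> ennreal (1 / 2) * ennreal ((norm (G s))\<^sup>2) + ennreal (1 / 2) * ennreal ((norm (G' s))\<^sup>2)" .
    qed
    also have "\<dots> = nconv \<kappa> (\<lambda>s. ennreal (1 / 2) * ennreal ((norm (G s))\<^sup>2)) t + nconv \<kappa> (\<lambda>s. ennreal (1 / 2) * ennreal ((norm (G' s))\<^sup>2)) t"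
      by (rule nconv_add) measurable
    also have "\<dots> = ennreal (1 / 2) * nconv \<kappa> (\<lambda>s. ennreal ((norm (G s))\<^sup>2)) t + ennreal (1 / 2) * nconv \<kappa> (\<lambda>s. ennreal ((norm (G' s))\<^sup>2)) t"
      by (intro arg_cong2[where f = "(+)"] nconv_cmult) measurable
    also have "\<dots> \<le> ennreal (1 / 2) * ennreal C1 + ennreal (1 / 2) * ennreal C1"
      by (intro add_mono mult_left_mono bd) auto
    also have "\<dots> = ennreal C1" by (rule half[OF C1_nonneg])
    finally show ?thesis .
  qed
  have m2: "norm (u0 + conv \<kappa> ?M t - U t) \<le> (1 / 2) ^ n" if t: "t \<in> I" for t
  proof -
    have i: "integrable lborel (\<lambda>s. \<kappa> (t - s) *\<^sub>R G s)" "integrable lborel (\<lambda>s. \<kappa> (t - s) *\<^sub>R G' s)"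
      using nconv_norm_finite[OF _ supp(1) bd(1)] nconv_norm_finite[OF _ supp(2) bd(2)] \<alpha> by (auto simp: integrable_conv_iff)
    have "conv \<kappa> ?M t = (LINT s|lborel. (1 / 2) *\<^sub>R (\<kappa> (t - s) *\<^sub>R G s + \<kappa> (t - s) *\<^sub>R G' s))"
      unfolding conv_def by (simp add: algebra_simps)
    also have "\<dots> = (1 / 2) *\<^sub>R (conv \<kappa> G t + conv \<kappa> G' t)"
      using i by (simp add: conv_def)
    finally have eq: "conv \<kappa> ?M t = (1 / 2) *\<^sub>R (conv \<kappa> G t + conv \<kappa> G' t)" .
    have av: "x + (1 / 2) *\<^sub>R (y + z) - w = (1 / 2) *\<^sub>R ((x + y - w) + (x + z - w))" for x y z w :: 'a
      by (simp add: algebra_simps) (simp add: scaleR_left_distrib[symmetric])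
    have "norm (u0 + conv \<kappa> ?M t - U t) \<le> (norm (u0 + conv \<kappa> G t - U t) + norm (u0 + conv \<kappa> G' t - U t)) / 2"
      unfolding eq av using norm_triangle_ineq[of "u0 + conv \<kappa> G t - U t" "u0 + conv \<kappa> G' t - U t"] by simp
    also have "\<dots> \<le> ((1 / 2) ^ n + (1 / 2) ^ n) / 2"
      by (intro divide_right_mono add_mono near t) simp
    finally show ?thesis by simp
  qed
  let ?V = "\<lambda>t. (1 - 1 / 2) *\<^sub>R V t + (1 / 2) *\<^sub>R V' t" and ?E = "\<lambda>t. (E t + E' t) / 2"
  have m3: "(\<integral>\<^sup>+ t. ennreal (?E t) * indicator I t \<partial>lborel) \<le> ennreal ((1 / 2) ^ n)"
  proof -
    have "(\<integral>\<^sup>+ t. ennreal (?E t) * indicator I t \<partial>lborel)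
      = (\<integral>\<^sup>+ t. ennreal (1 / 2) * (ennreal (E t) * indicator I t) + ennreal (1 / 2) * (ennreal (E' t) * indicator I t) \<partial>lborel)"
    proof (rule nn_integral_cong)
      fix t
      have "ennreal (?E t) = ennreal (1 / 2) * ennreal (E t) + ennreal (1 / 2) * ennreal (E' t)"
        by (rule ennreal_average[OF E(1) E'(1)])
      then show "ennreal (?E t) * indicator I t = ennreal (1 / 2) * (ennreal (E t) * indicator I t) + ennreal (1 / 2) * (ennreal (E' t) * indicator I t)"
        by (simp only: distrib_right mult.assoc)
    qed
    also have "\<dots> = (\<integral>\<^sup>+ t. ennreal (1 / 2) * (ennreal (E t) * indicator I t) \<partial>lborel) + (\<integral>\<^sup>+ t. ennreal (1 / 2) * (ennreal (E' t) * indicator I t) \<partial>lborel)"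
      by (rule nn_integral_add) measurable
    also have "\<dots> = ennreal (1 / 2) * (\<integral>\<^sup>+ t. ennreal (E t) * indicator I t \<partial>lborel) + ennreal (1 / 2) * (\<integral>\<^sup>+ t. ennreal (E' t) * indicator I t \<partial>lborel)"
      by (intro arg_cong2[where f = "(+)"] nn_integral_cmult) measurable
    also have "\<dots> \<le> ennreal (1 / 2) * ennreal ((1 / 2) ^ n) + ennreal (1 / 2) * ennreal ((1 / 2) ^ n)"
      by (intro add_mono mult_left_mono E E') auto
    also have "\<dots> = ennreal ((1 / 2) ^ n)" by (rule half) simp
    finally show ?thesis .
  qed
  have m4: "(norm (?V t - U t))\<^sup>2 \<le> ?E t" if t: "t \<in> I" for t
  proof -
    have "?V t - U t = (1 / 2) *\<^sub>R ((V t - U t) + (V' t - U t))"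
      by (simp add: algebra_simps) (simp add: scaleR_left_distrib[symmetric])
    then show ?thesis
      using norm_midpoint_square_le[of "V t - U t" "V' t - U t"] V(1)[OF t] V'(1)[OF t] by simp
  qed
  have m5: "\<Phi> (?V t) \<le> ereal (q - inner (\<Theta> t (U t) - ?M t) (v - U t) + ?E t * (1 + norm (v - U t)))"
    if t: "t \<in> I" and v: "\<Phi> v \<le> ereal q" for t v q
  proof -
    let ?a = "q - inner (\<Theta> t (U t) - G t) (v - U t) + E t * (1 + norm (v - U t))"
    let ?b = "q - inner (\<Theta> t (U t) - G' t) (v - U t) + E' t * (1 + norm (v - U t))"
    obtain p p' where p: "\<Phi> (V t) = ereal p" "\<Phi> (V' t) = ereal p'" "p \<le> ?a" "p' \<le> ?b"
      using V(2)[OF t v] V'(2)[OF t v] not_MInf[of "V t"] not_MInf[of "V' t"]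
      by (cases "\<Phi> (V t)"; cases "\<Phi> (V' t)") auto
    have "\<Phi> (?V t) \<le> ereal ((1 - 1 / 2) * p + 1 / 2 * p')"
      by (rule convex_real) (use p in auto)
    also have "\<dots> \<le> ereal ((?a + ?b) / 2)" using p by simp
    also have "(?a + ?b) / 2 = q - inner (\<Theta> t (U t) - ?M t) (v - U t) + ?E t * (1 + norm (v - U t))"
    proof -
      have "inner (\<Theta> t (U t) - ?M t) x = (inner (\<Theta> t (U t) - G t) x + inner (\<Theta> t (U t) - G' t) x) / 2" for x
        by (simp add: inner_diff_left inner_add_left add_divide_distrib diff_divide_distrib)
      then show ?thesis by (simp add: field_simps)
    qed
    finally show ?thesis .
  qed
  have Vm: "?V \<in> borel_measurable borel" and Em: "?E \<in> borel_measurable borel" by measurable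
  have E_nn: "0 \<le> ?E t" for t using E(1)[of t] E'(1)[of t] by simp
  show ?thesis
    unfolding approximants_def
  proof (intro CollectI conjI allI impI ballI)
    show "?M \<in> borel_measurable borel" by measurable
    show "\<exists>V E. V \<in> borel_measurable borel \<and> E \<in> borel_measurable borel \<and> (\<forall>t. 0 \<le> E t) \<and>
        (\<integral>\<^sup>+ t. ennreal (E t) * indicator I t \<partial>lborel) \<le> ennreal ((1 / 2) ^ n) \<and>
        (\<forall>t\<in>I. (norm (V t - U t))\<^sup>2 \<le> E t \<and>
           (\<forall>v q. \<Phi> v \<le> ereal q \<longrightarrow>
              \<Phi> (V t) \<le> ereal (q - inner (\<Theta> t (U t) - ?M t) (v - U t) + E t * (1 + norm (v - U t)))))"
    proof (rule exI[of _ ?V], rule exI[of _ ?E], intro conjI allI ballI impI)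
      show "?V \<in> borel_measurable borel" by (rule Vm)
      show "?E \<in> borel_measurable borel" by (rule Em)
      show "0 \<le> ?E t" for t by (rule E_nn)
      show "(\<integral>\<^sup>+ t. ennreal (?E t) * indicator I t \<partial>lborel) \<le> ennreal ((1 / 2) ^ n)" by (rule m3)
      show "(norm (?V t - U t))\<^sup>2 \<le> ?E t" if "t \<in> I" for t by (rule m4[OF that])
      show "\<Phi> (?V t) \<le> ereal (q - inner (\<Theta> t (U t) - ?M t) (v - U t) + ?E t * (1 + norm (v - U t)))"
        if "t \<in> I" "\<Phi> v \<le> ereal q" for t v q by (rule m5[OF that])
    qed
    show "?M t = 0" if "t \<notin> I" for t using supp that by simp
    show "nconv \<kappa> (\<lambda>s. ennreal ((norm (?M s))\<^sup>2)) t \<le> ennreal C1" for t by (rule m1)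
    show "norm (u0 + conv \<kappa> ?M t - U t) \<le> (1 / 2) ^ n" if "t \<in> I" for t by (rule m2[OF that])
  qed
qed

text \<open>The kernel decreases, so on (0,T) its weight seen from time T is at least its value at
  T.\<close>

lemma L2_le_nconv:
  fixes f :: "real \<Rightarrow> 'a"
  assumes [measurable]: "f \<in> borel_measurable borel" and supp: "\<And>s. s \<notin> I \<Longrightarrow> f s = 0"
    and K: "0 \<le> K" "nconv \<kappa> (\<lambda>s. ennreal ((norm (f s))\<^sup>2)) T \<le> ennreal K"
  shows "(\<integral>\<^sup>+ s. ennreal ((norm (f s))\<^sup>2) \<partial>lborel) \<le> ennreal (K / \<kappa> T)"
proof -
  have k: "0 < \<kappa> T" using T Gamma_real_pos[OF \<alpha>(1)] by (simp add: kern_def)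
  have "ennreal (\<kappa> T) * (\<integral>\<^sup>+ s. ennreal ((norm (f s))\<^sup>2) \<partial>lborel) = (\<integral>\<^sup>+ s. ennreal (\<kappa> T) * ennreal ((norm (f s))\<^sup>2) \<partial>lborel)"
    by (rule nn_integral_cmult[symmetric]) measurable
  also have "\<dots> \<le> nconv \<kappa> (\<lambda>s. ennreal ((norm (f s))\<^sup>2)) T"
    unfolding nconv_def
  proof (rule nn_integral_mono)
    fix s
    show "ennreal (\<kappa> T) * ennreal ((norm (f s))\<^sup>2) \<le> ennreal (\<kappa> (T - s)) * ennreal ((norm (f s))\<^sup>2)"
      using supp[of s] kern_antimono[of \<alpha> "T - s" T] \<alpha>
      by (cases "s \<in> I") (auto intro!: mult_right_mono ennreal_leI)
  qed
  also have "\<dots> \<le> ennreal K" by (rule K(2))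
  finally have "ennreal (1 / \<kappa> T) * (ennreal (\<kappa> T) * (\<integral>\<^sup>+ s. ennreal ((norm (f s))\<^sup>2) \<partial>lborel)) \<le> ennreal (1 / \<kappa> T) * ennreal K"
    by (rule mult_left_mono) simp
  then show ?thesis using k K(1) by (simp add: mult.assoc[symmetric] ennreal_mult[symmetric])
qed

end

section \<open>Limit theorems for convolutions and errors\<close>

lemma nconv_Fatou:
  fixes g :: "real \<Rightarrow> 'a::{real_normed_vector, second_countable_topology}"
  assumes [measurable]: "k \<in> borel_measurable borel" "\<And>n. G n \<in> borel_measurable borel"
    and lim: "AE s in lborel. (\<lambda>n. G n s) \<longlonglongrightarrow> g s"
    and C: "\<And>n. nconv k (\<lambda>s. ennreal ((norm (G n s))\<^sup>2)) t \<le> C"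
  shows "nconv k (\<lambda>s. ennreal ((norm (g s))\<^sup>2)) t \<le> C"
proof -
  have "nconv k (\<lambda>s. ennreal ((norm (g s))\<^sup>2)) t
      = (\<integral>\<^sup>+ s. liminf (\<lambda>n. ennreal (k (t - s)) * ennreal ((norm (G n s))\<^sup>2)) \<partial>lborel)"
    unfolding nconv_def
  proof (rule nn_integral_cong_AE)
    show "AE s in lborel. ennreal (k (t - s)) * ennreal ((norm (g s))\<^sup>2)
        = liminf (\<lambda>n. ennreal (k (t - s)) * ennreal ((norm (G n s))\<^sup>2))"
      using lim
    proof eventually_elim
      case (elim s)
      have "(\<lambda>n. ennreal (k (t - s)) * ennreal ((norm (G n s))\<^sup>2)) \<longlonglongrightarrow> ennreal (k (t - s)) * ennreal ((norm (g s))\<^sup>2)"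
        by (intro ennreal_tendsto_cmult tendsto_ennrealI tendsto_intros elim) simp
      from lim_imp_Liminf[OF _ this] show ?case by simp
    qed
  qed
  also have "\<dots> \<le> liminf (\<lambda>n. nconv k (\<lambda>s. ennreal ((norm (G n s))\<^sup>2)) t)"
    unfolding nconv_def by (rule nn_integral_liminf) measurable
  also have "\<dots> \<le> liminf (\<lambda>n. C)" by (intro Liminf_mono always_eventually allI C)
  also have "\<dots> = C" by (simp add: Liminf_const)
  finally show ?thesis .
qed

text \<open>The majorant is merely integrable, so its convolution with the kernel is finite for
  almost every t; dominated convergence applies at those t.\<close>

lemma AE_conv_dominated:
  fixes g :: "real \<Rightarrow> 'a::{banach, second_countable_topology}"
  assumes a: "0 < a" and G [measurable]: "\<And>n. G n \<in> borel_measurable borel" and g [measurable]: "g \<in> borel_measurable borel"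
    and H [measurable]: "H \<in> borel_measurable borel" and supp: "\<And>s. s \<le> 0 \<Longrightarrow> H s = 0" and fin: "(\<integral>\<^sup>+ s. H s \<partial>lborel) < \<infinity>"
    and lim: "AE s in lborel. (\<lambda>n. G n s) \<longlonglongrightarrow> g s" and bound: "\<And>n s. ennreal (norm (G n s)) \<le> H s"
  shows "AE t in lborel. (\<lambda>n. conv (kern a) (G n) t) \<longlonglongrightarrow> conv (kern a) g t"
proof -
  have "AE t in lborel. nconv (kern a) H t < \<infinity>"
    by (rule AE_nconv_kern_finite[OF a H _ fin]) (rule supp)
  then show ?thesis
proof eventually_elim
  case (elim t)
  have Hfin: "AE s in lborel. H s \<noteq> \<infinity>" using fin by (intro nn_integral_noteq_infinite) auto
  show ?case
    unfolding conv_def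
  proof (rule integral_dominated_convergence[where w = "\<lambda>s. kern a (t - s) *\<^sub>R enn2real (H s)"])
    have "nconv (kern a) (\<lambda>s. ennreal (norm (enn2real (H s)))) t \<le> nconv (kern a) H t"
      by (rule nconv_mono) (simp add: ennreal_enn2real_if)
    then show "integrable lborel (\<lambda>s. kern a (t - s) *\<^sub>R enn2real (H s))"
      using elim a by (subst integrable_conv_iff) (auto intro: le_less_trans)
    show "AE s in lborel. (\<lambda>n. kern a (t - s) *\<^sub>R G n s) \<longlonglongrightarrow> kern a (t - s) *\<^sub>R g s"
      using lim by eventually_elim (intro tendsto_intros)
    show "AE s in lborel. norm (kern a (t - s) *\<^sub>R G n s) \<le> kern a (t - s) *\<^sub>R enn2real (H s)" for n
      using Hfin
    proof eventually_elim
      case (elim s)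
      then have "norm (G n s) \<le> enn2real (H s)" using bound[of n s] by (cases "H s") auto
      then show ?case using a by (simp add: mult_left_mono)
    qed
  qed measurable
qed
qed

text \<open>Summable integrals make the sum of the functions finite almost everywhere, and the terms
  of a convergent series tend to 0.\<close>

lemma AE_tendsto_zero_of_summable_integrals:
  assumes [measurable]: "\<And>n. E n \<in> borel_measurable borel" and nn: "\<And>n t. 0 \<le> E n t"
    and int: "\<And>n. (\<integral>\<^sup>+ t. ennreal (E n t) * indicator S t \<partial>lborel) \<le> ennreal ((1 / 2) ^ n)" and S[measurable]: "S \<in> sets borel"
  shows "AE t in lborel. t \<in> S \<longrightarrow> (\<lambda>n. E n t) \<longlonglongrightarrow> (0::real)"
proof -
  have "(\<integral>\<^sup>+ t. (\<Sum>n. ennreal (E n t) * indicator S t) \<partial>lborel) = (\<Sum>n. \<integral>\<^sup>+ t. ennreal (E n t) * indicator S t \<partial>lborel)"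
    by (rule nn_integral_suminf) measurable
  also have "\<dots> \<le> (\<Sum>n. ennreal ((1 / 2) ^ n))" by (intro suminf_le int) auto
  also have "\<dots> < \<infinity>" by (subst suminf_ennreal2) (auto intro!: summable_geometric)
  finally have "AE t in lborel. (\<Sum>n. ennreal (E n t) * indicator S t) \<noteq> \<infinity>"
    by (intro nn_integral_noteq_infinite) auto
  then show ?thesis
  proof eventually_elim
    case (elim t)
    show ?case
    proof
      assume "t \<in> S"
      then have "(\<Sum>n. ennreal (E n t)) \<noteq> top" using elim by simp
      then have "summable (\<lambda>n. E n t)" using nn by (intro summable_suminf_not_top) auto
      then show "(\<lambda>n. E n t) \<longlonglongrightarrow> 0" by (rule summable_LIMSEQ_zero)
    qed
  qed
qed

section \<open>Existence for the abstract inclusion\<close>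

context gradient_flow
begin

text \<open>At V = u - \<mu> \<xi> the vector \<xi> is an exact subgradient. Replacing V by U as
  base point and \<Theta> t (u t) by \<Theta> t (U t) costs errors governed by \<delta>, \<mu> and
  |\<xi>|^2, and the integral of the latter is controlled by \<open>C2\<close>.\<close>

lemma regularized_solution_in_approximants:
  assumes sol: "regularized_solution \<mu> u g \<xi>" and \<mu>: "0 < \<mu>"
    and U: "\<And>t. t \<in> I \<Longrightarrow> norm (u t - U t) \<le> \<delta>" and \<delta>: "0 \<le> \<delta>" "\<delta> \<le> (1 / 2) ^ n"
    and e: "(\<delta> + 2 * \<delta>\<^sup>2 + L * \<delta>) * T + (\<delta> + \<mu> + 2 * \<mu>\<^sup>2) * (C2 / \<kappa> T) \<le> (1 / 2) ^ n"
  shows "g \<in> approximants U n"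
proof -
  have [measurable]: "u \<in> borel_measurable borel" "g \<in> borel_measurable borel" "\<xi> \<in> borel_measurable borel"
    and u_eq: "\<And>t. u t = u0 + conv \<kappa> g t" and supp: "\<And>t. t \<notin> I \<Longrightarrow> g t = 0" "\<And>t. t \<notin> I \<Longrightarrow> \<xi> t = 0"
    and eq: "\<And>t. t \<in> I \<Longrightarrow> g t + \<xi> t = \<Theta> t (u t)"
    and sub: "\<And>t. t \<in> I \<Longrightarrow> \<xi> t \<in> subdifferential \<Phi> (u t - \<mu> *\<^sub>R \<xi> t)"
    and C1: "\<And>t. nconv \<kappa> (\<lambda>s. ennreal ((norm (g s))\<^sup>2)) t \<le> ennreal C1"
    using sol unfolding regularized_solution_def by auto
  \<comment> \<open>The terms 2 \<delta>^2 and 2 \<mu>^2 account for the squared distance of V from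
    U, L \<delta> for the change in \<Theta>, and \<delta> (in both) with \<mu> for the product of
    |\<xi>| and that distance.\<close>
  define P R where "P = \<delta> + 2 * \<delta>\<^sup>2 + L * \<delta>" and "R = \<delta> + \<mu> + 2 * \<mu>\<^sup>2"
  have PR: "0 \<le> P" "0 \<le> R" using \<delta> \<mu> L by (simp_all add: P_def R_def)
  define V where "V t = u t - \<mu> *\<^sub>R \<xi> t" for t
  define E where "E t = P + R * (norm (\<xi> t))\<^sup>2" for t
  have [measurable]: "V \<in> borel_measurable borel" "E \<in> borel_measurable borel"
    unfolding V_def[abs_def] E_def[abs_def] by measurable
  have E_nn: "0 \<le> E t" for t using PR by (simp add: E_def)
  have k: "0 < \<kappa> T" using T Gamma_real_pos[OF \<alpha>(1)] by (simp add: kern_def)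
  have E_int: "(\<integral>\<^sup>+ t. ennreal (E t) * indicator I t \<partial>lborel) \<le> ennreal ((1 / 2) ^ n)"
  proof -
    have "(\<integral>\<^sup>+ t. ennreal (E t) * indicator I t \<partial>lborel)
      \<le> (\<integral>\<^sup>+ t. ennreal P * indicator I t + ennreal R * ennreal ((norm (\<xi> t))\<^sup>2) \<partial>lborel)"
      by (rule nn_integral_mono) (use PR in \<open>auto simp: E_def ennreal_mult split: split_indicator\<close>)
    also have "\<dots> = ennreal P * ennreal T + ennreal R * (\<integral>\<^sup>+ t. ennreal ((norm (\<xi> t))\<^sup>2) \<partial>lborel)"
      using T by (subst nn_integral_add) (auto simp: nn_integral_cmult)
    also have "\<dots> \<le> ennreal P * ennreal T + ennreal R * ennreal (C2 / \<kappa> T)"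
      by (intro add_left_mono mult_left_mono L2_le_nconv[OF _ supp(2) C2_nonneg regularized_solution_bounds(2)[OF sol]]) auto
    also have "\<dots> = ennreal (P * T + R * (C2 / \<kappa> T))"
      using PR T C2_nonneg k by (simp add: ennreal_mult[symmetric] ennreal_plus[symmetric] del: ennreal_plus)
    also have "\<dots> \<le> ennreal ((1 / 2) ^ n)" using e by (intro ennreal_leI) (simp add: P_def R_def)
    finally show ?thesis .
  qed
  have VU: "norm (V t - U t) \<le> \<delta> + \<mu> * norm (\<xi> t)" if t: "t \<in> I" for t
    using norm_triangle_ineq4[of "u t - U t" "\<mu> *\<^sub>R \<xi> t"] U[OF t] \<mu> by (simp add: V_def algebra_simps)
  have E1: "(norm (V t - U t))\<^sup>2 \<le> E t" if t: "t \<in> I" for t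
  proof -
    have "(norm (V t - U t))\<^sup>2 \<le> (\<delta> + \<mu> * norm (\<xi> t))\<^sup>2" by (rule power_mono[OF VU[OF t]]) simp
    also have "\<dots> \<le> 2 * \<delta>\<^sup>2 + 2 * \<mu>\<^sup>2 * (norm (\<xi> t))\<^sup>2"
      using norm_add_square_le[of \<delta> "\<mu> * norm (\<xi> t)"] by (simp add: power_mult_distrib)
    also have "\<dots> \<le> E t"
    proof -
      have "0 \<le> L * \<delta>" "0 \<le> (\<delta> + \<mu>) * (norm (\<xi> t))\<^sup>2" using L \<delta> \<mu> by auto
      then show ?thesis using \<delta>(1) by (simp add: E_def P_def R_def algebra_simps)
    qed
    finally show ?thesis .
  qed
  have E2: "L * \<delta> \<le> E t" for t
  proof -
    have "0 \<le> R * (norm (\<xi> t))\<^sup>2" using PR by simp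
    then show ?thesis using \<delta>(1) by (simp add: E_def P_def)
  qed
  have E3: "norm (\<xi> t) * norm (V t - U t) \<le> E t" if t: "t \<in> I" for t
  proof -
    let ?x = "norm (\<xi> t)"
    have "2 * ?x \<le> 1 + ?x\<^sup>2" using sum_squares_bound[of 1 ?x] by simp
    then have "?x \<le> 1 + ?x\<^sup>2" using norm_ge_zero[of "\<xi> t"] by linarith
    then have "\<delta> * ?x \<le> \<delta> * (1 + ?x\<^sup>2)" by (rule mult_left_mono[OF _ \<delta>(1)])
    moreover have "?x * norm (V t - U t) \<le> ?x * (\<delta> + \<mu> * ?x)" by (rule mult_left_mono[OF VU[OF t]]) simp
    moreover have "?x * (\<delta> + \<mu> * ?x) = \<delta> * ?x + \<mu> * ?x\<^sup>2" by (simp add: power2_eq_square algebra_simps)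
    moreover have "0 \<le> 2 * \<mu>\<^sup>2 * ?x\<^sup>2" "0 \<le> L * \<delta>" "0 \<le> 2 * \<delta>\<^sup>2" using L \<delta> by auto
    moreover have "E t = \<delta> * (1 + ?x\<^sup>2) + 2 * \<delta>\<^sup>2 + L * \<delta> + \<mu> * ?x\<^sup>2 + 2 * \<mu>\<^sup>2 * ?x\<^sup>2"
      by (simp add: E_def P_def R_def algebra_simps)
    ultimately show ?thesis by linarith
  qed
  have main: "\<Phi> (V t) \<le> ereal (q - inner (\<Theta> t (U t) - g t) (v - U t) + E t * (1 + norm (v - U t)))"
    if t: "t \<in> I" and v: "\<Phi> v \<le> ereal q" for t v q
  proof -
    obtain p where p: "\<Phi> (V t) = ereal p"
      using subdifferentialD(1)[OF sub[OF t]] not_MInf[of "V t"] by (cases "\<Phi> (V t)") (auto simp: V_def)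
    have "\<Phi> (V t) + ereal (inner (\<xi> t) (v - V t)) \<le> \<Phi> v"
      using subdifferentialD(2)[OF sub[OF t], of v] by (simp add: V_def)
    then have "\<Phi> (V t) + ereal (inner (\<xi> t) (v - V t)) \<le> ereal q" using v by (rule order_trans)
    then have pq: "p + inner (\<xi> t) (v - V t) \<le> q" using p by simp
    have \<xi>_eq: "\<xi> t = (\<Theta> t (U t) - g t) + (\<Theta> t (u t) - \<Theta> t (U t))"
      by (simp add: eq[OF t, symmetric])
    have "inner (\<xi> t) (v - V t) = inner (\<xi> t) (v - U t) - inner (\<xi> t) (V t - U t)"
      by (simp add: inner_diff_right)
    also have "inner (\<xi> t) (v - U t) = inner (\<Theta> t (U t) - g t) (v - U t) + inner (\<Theta> t (u t) - \<Theta> t (U t)) (v - U t)"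
      by (subst \<xi>_eq) (rule inner_add_left)
    finally have dec: "inner (\<xi> t) (v - V t) = inner (\<Theta> t (U t) - g t) (v - U t)
        + inner (\<Theta> t (u t) - \<Theta> t (U t)) (v - U t) - inner (\<xi> t) (V t - U t)" .
    have "- inner (\<Theta> t (u t) - \<Theta> t (U t)) (v - U t) \<le> norm (\<Theta> t (u t) - \<Theta> t (U t)) * norm (v - U t)"
      using Cauchy_Schwarz_ineq2[of "\<Theta> t (u t) - \<Theta> t (U t)" "v - U t"] by linarith
    also have "\<dots> \<le> (L * \<delta>) * norm (v - U t)"
      using \<Theta>_Lip[of t "u t" "U t"] mult_left_mono[OF U[OF t] L] by (intro mult_right_mono) auto
    also have "\<dots> \<le> E t * norm (v - U t)" by (rule mult_right_mono[OF E2]) simp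
    finally have b1: "- inner (\<Theta> t (u t) - \<Theta> t (U t)) (v - U t) \<le> E t * norm (v - U t)" .
    have b2: "inner (\<xi> t) (V t - U t) \<le> E t"
      using norm_cauchy_schwarz[of "\<xi> t" "V t - U t"] E3[OF t] by linarith
    have "E t * (1 + norm (v - U t)) = E t + E t * norm (v - U t)" by (simp add: algebra_simps)
    then have "p \<le> q - inner (\<Theta> t (U t) - g t) (v - U t) + E t * (1 + norm (v - U t))"
      using pq dec b1 b2 by linarith
    then show ?thesis by (simp add: p)
  qed
  show ?thesis
    unfolding approximants_def
  proof (intro CollectI conjI allI impI ballI)
    show "norm (u0 + conv \<kappa> g t - U t) \<le> (1 / 2) ^ n" if "t \<in> I" for t
      using U[OF that] \<delta>(2) by (simp add: u_eq)
    show "\<exists>V E. V \<in> borel_measurable borel \<and> E \<in> borel_measurable borel \<and> (\<forall>t. 0 \<le> E t) \<and>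
        (\<integral>\<^sup>+ t. ennreal (E t) * indicator I t \<partial>lborel) \<le> ennreal ((1 / 2) ^ n) \<and>
        (\<forall>t\<in>I. (norm (V t - U t))\<^sup>2 \<le> E t \<and>
           (\<forall>v q. \<Phi> v \<le> ereal q \<longrightarrow>
              \<Phi> (V t) \<le> ereal (q - inner (\<Theta> t (U t) - g t) (v - U t) + E t * (1 + norm (v - U t)))))"
      using E_nn E_int E1 main by (intro exI[of _ V] exI[of _ E]) auto
  qed (auto simp: supp C1)
qed

text \<open>U is the limit of the regularized solutions at each time of (0,T). Letting the second
  parameter vanish in the comparison gives the uniform rate sqrt (C3 \<mu>), which enters every
  smallness condition.\<close>

lemma regularized_limit:
  obtains U where "\<And>n. approximants U n \<noteq> {}"
proof -
  define \<mu> where "\<mu> k = 1 / real (Suc k)" for k :: nat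
  have \<mu>: "0 < \<mu> k" for k by (simp add: \<mu>_def)
  have \<mu>_lim: "\<mu> \<longlonglongrightarrow> 0" unfolding \<mu>_def[abs_def] by (rule LIMSEQ_Suc[OF lim_1_over_n])
  obtain u g \<xi> where sol: "\<And>k. regularized_solution (\<mu> k) (u k) (g k) (\<xi> k)"
    using regularized_solution_exists[OF \<mu>] by metis
  have diff: "(norm (u j t - u k t))\<^sup>2 \<le> C3 * (\<mu> j + \<mu> k)" if "t \<in> I" for j k t
    by (rule regularized_solution_difference[OF sol sol \<mu> \<mu> that])
  define \<delta> where "\<delta> k = sqrt (C3 * \<mu> k)" for k
  have \<delta>: "0 \<le> \<delta> k" for k using C3_nonneg \<mu>[of k] by (simp add: \<delta>_def)
  have "(\<lambda>k. sqrt (C3 * \<mu> k)) \<longlonglongrightarrow> sqrt (C3 * 0)" by (intro tendsto_intros \<mu>_lim)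
  then have \<delta>_lim: "\<delta> \<longlonglongrightarrow> 0" by (simp add: \<delta>_def[abs_def])
  have "\<exists>x. (\<lambda>k. u k t) \<longlonglongrightarrow> x" if t: "t \<in> I" for t
  proof -
    have "Cauchy (\<lambda>k. u k t)"
    proof (rule CauchyI)
      fix e :: real assume e: "0 < e"
      have "(\<lambda>k. C3 * \<mu> k) \<longlonglongrightarrow> C3 * 0" by (intro tendsto_intros \<mu>_lim)
      then have "\<forall>\<^sub>F k in sequentially. C3 * \<mu> k < e\<^sup>2 / 2"
        using e by (auto dest!: order_tendstoD(2)[where a = "e\<^sup>2 / 2"])
      then obtain N where N: "\<And>k. k \<ge> N \<Longrightarrow> C3 * \<mu> k < e\<^sup>2 / 2" by (auto simp: eventually_sequentially)
      have "norm (u j t - u k t) < e" if "N \<le> j" "N \<le> k" for j k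
      proof -
        have "(norm (u j t - u k t))\<^sup>2 \<le> C3 * \<mu> j + C3 * \<mu> k"
          using diff[OF t, of j k] by (simp add: distrib_left)
        then have "(norm (u j t - u k t))\<^sup>2 < e\<^sup>2" using N[OF that(1)] N[OF that(2)] by linarith
        then show ?thesis using e by (simp add: power2_less_imp_less)
      qed
      then show "\<exists>M. \<forall>m\<ge>M. \<forall>n\<ge>M. norm (u m t - u n t) < e" by blast
    qed
    then show ?thesis by (auto simp: Cauchy_convergent_iff convergent_def)
  qed
  then obtain U where U: "\<And>t. t \<in> I \<Longrightarrow> (\<lambda>k. u k t) \<longlonglongrightarrow> U t" by metis
  have uU: "norm (u k t - U t) \<le> \<delta> k" if t: "t \<in> I" for k t
  proof -
    have "(norm (u k t - U t))\<^sup>2 \<le> C3 * (\<mu> k + 0)"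
    proof (rule LIMSEQ_le)
      show "(\<lambda>j. (norm (u k t - u j t))\<^sup>2) \<longlonglongrightarrow> (norm (u k t - U t))\<^sup>2" by (intro tendsto_intros U t)
      show "(\<lambda>j. C3 * (\<mu> k + \<mu> j)) \<longlonglongrightarrow> C3 * (\<mu> k + 0)" by (intro tendsto_intros \<mu>_lim)
      show "\<exists>N. \<forall>j\<ge>N. (norm (u k t - u j t))\<^sup>2 \<le> C3 * (\<mu> k + \<mu> j)" using diff[OF t] by blast
    qed
    then show ?thesis unfolding \<delta>_def by (intro real_le_rsqrt) simp
  qed
  define e where "e k = (\<delta> k + 2 * (\<delta> k)\<^sup>2 + L * \<delta> k) * T + (\<delta> k + \<mu> k + 2 * (\<mu> k)\<^sup>2) * (C2 / \<kappa> T)" for k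
  have "e \<longlonglongrightarrow> (0 + 2 * 0\<^sup>2 + L * 0) * T + (0 + 0 + 2 * 0\<^sup>2) * (C2 / \<kappa> T)"
    unfolding e_def[abs_def] by (intro tendsto_intros \<delta>_lim \<mu>_lim)
  then have e_lim: "e \<longlonglongrightarrow> 0" by simp
  have "approximants U n \<noteq> {}" for n
  proof -
    have p: "0 < (1 / 2 :: real) ^ n" by simp
    have "\<forall>\<^sub>F k in sequentially. \<delta> k < (1 / 2) ^ n \<and> e k < (1 / 2) ^ n"
      using order_tendstoD(2)[OF \<delta>_lim p] order_tendstoD(2)[OF e_lim p] by (rule eventually_conj)
    then obtain k where k: "\<delta> k < (1 / 2) ^ n" "e k < (1 / 2) ^ n" by (auto dest: eventually_happens)
    have "g k \<in> approximants U n"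
      by (rule regularized_solution_in_approximants[OF sol \<mu> uU \<delta>]) (use k in \<open>auto simp: e_def\<close>)
    then show ?thesis by blast
  qed
  then show ?thesis by (rule that)
qed

text \<open>At almost every t the averaged derivatives and their convolutions converge and the
  errors vanish. Closeness to U then identifies U t with u0 plus the convolution of g, and lower
  semicontinuity along V turns the relaxed inequality into the exact one.\<close>

theorem solution_exists:
  "\<exists>g. g \<in> borel_measurable borel \<and> (\<forall>t. t \<notin> I \<longrightarrow> g t = 0) \<and>
     (\<forall>t. nconv \<kappa> (\<lambda>s. ennreal ((norm (g s))\<^sup>2)) t \<le> ennreal C1) \<and>
     (AE t in lborel. t \<in> I \<longrightarrow> \<Theta> t (u0 + conv \<kappa> g t) - g t \<in> subdifferential \<Phi> (u0 + conv \<kappa> g t))"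
proof -
  obtain U where ne: "\<And>n. approximants U n \<noteq> {}" using regularized_limit by blast
  have K: "(\<integral>\<^sup>+ s. ennreal ((norm (G s))\<^sup>2) \<partial>lborel) \<le> ennreal (C1 / \<kappa> T)" if "G \<in> approximants U n" for G n
    by (rule L2_le_nconv) (use that C1_nonneg in \<open>auto simp: approximants_def\<close>)
  have Qm: "G \<in> borel_measurable borel" if "G \<in> approximants U n" for G n
    using that by (simp add: approximants_def)
  have Qs: "G s = 0" if "G \<in> approximants U n" "s \<notin> I" for G n s
    using that unfolding approximants_def by blast
  obtain G g H where G: "\<And>n. G n \<in> approximants U n" and g[measurable]: "g \<in> borel_measurable borel"
    and g0: "\<And>s. s \<notin> I \<Longrightarrow> g s = 0"
    and H: "H \<in> borel_measurable borel" "\<And>s. s \<notin> I \<Longrightarrow> H s = 0" "(\<integral>\<^sup>+ s. H s \<partial>lborel) < \<infinity>"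
    and lim: "AE s in lborel. (\<lambda>n. G n s) \<longlonglongrightarrow> g s" and bound: "\<And>n s. ennreal (norm (G n s)) \<le> H s"
  proof (rule midpoint_closed_sets_limit[where Q = "approximants U" and T = T and K = "C1 / \<kappa> T"])
    show "G \<in> borel_measurable borel" if "G \<in> approximants U n" for G n by (rule Qm[OF that])
    show "G s = 0" if "G \<in> approximants U n" "s \<notin> I" for G n s by (rule Qs[OF that])
    show "(\<integral>\<^sup>+ s. ennreal ((norm (G s))\<^sup>2) \<partial>lborel) \<le> ennreal (C1 / \<kappa> T)" if "G \<in> approximants U n" for G n
      by (rule K[OF that])
    show "(\<lambda>s. (1 / 2) *\<^sub>R (G s + G' s)) \<in> approximants U n"
      if "G \<in> approximants U n" "G' \<in> approximants U n" for G G' n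
      by (rule approximants_midpoint[OF that])
  qed (rule T ne approximants_decreasing that; assumption?)+
  have Gm[measurable]: "G n \<in> borel_measurable borel" for n using G[of n] by (simp add: approximants_def)
  have gC1: "nconv \<kappa> (\<lambda>s. ennreal ((norm (g s))\<^sup>2)) t \<le> ennreal C1" for t
    by (rule nconv_Fatou[OF _ Gm lim]) (use G in \<open>auto simp: approximants_def\<close>)
  have convlim: "AE t in lborel. (\<lambda>n. conv \<kappa> (G n) t) \<longlonglongrightarrow> conv \<kappa> g t"
    by (rule AE_conv_dominated[OF \<alpha>(1) Gm g H(1) _ H(3) lim bound]) (use H(2) in auto)
  define R where "R n V E \<longleftrightarrow> V \<in> borel_measurable borel \<and> E \<in> borel_measurable borel \<and> (\<forall>t. 0 \<le> E t) \<and>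
        (\<integral>\<^sup>+ t. ennreal (E t) * indicator I t \<partial>lborel) \<le> ennreal ((1 / 2) ^ n) \<and>
        (\<forall>t\<in>I. (norm (V t - U t))\<^sup>2 \<le> E t \<and>
           (\<forall>v q. \<Phi> v \<le> ereal q \<longrightarrow>
              \<Phi> (V t) \<le> ereal (q - inner (\<Theta> t (U t) - G n t) (v - U t) + E t * (1 + norm (v - U t)))))"
    for n and V :: "real \<Rightarrow> 'a" and E :: "real \<Rightarrow> real"
  have "\<exists>V E. R n V E" for n using G[of n] unfolding approximants_def R_def by blast
  then obtain V E where VE: "\<And>n. R n (V n) (E n)" by metis
  have E: "E n \<in> borel_measurable borel" "0 \<le> E n t"
        "(\<integral>\<^sup>+ t. ennreal (E n t) * indicator I t \<partial>lborel) \<le> ennreal ((1 / 2) ^ n)" for n t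
    using VE[of n] unfolding R_def by blast+
  have V: "(norm (V n t - U t))\<^sup>2 \<le> E n t"
      "\<Phi> v \<le> ereal q \<Longrightarrow>
         \<Phi> (V n t) \<le> ereal (q - inner (\<Theta> t (U t) - G n t) (v - U t) + E n t * (1 + norm (v - U t)))"
    if "t \<in> I" for n t v q
    using VE[of n] that unfolding R_def by blast+
  have E_lim: "AE t in lborel. t \<in> I \<longrightarrow> (\<lambda>n. E n t) \<longlonglongrightarrow> 0"
    by (rule AE_tendsto_zero_of_summable_integrals[OF E]) simp
  have "AE t in lborel. t \<in> I \<longrightarrow> \<Theta> t (u0 + conv \<kappa> g t) - g t \<in> subdifferential \<Phi> (u0 + conv \<kappa> g t)"
    using lim convlim E_lim
  proof eventually_elim
    case (elim t)
    show ?case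
    proof
      assume t: "t \<in> I"
      have p: "(\<lambda>n. (1 / 2 :: real) ^ n) \<longlonglongrightarrow> 0" by (rule LIMSEQ_power_zero) simp
      have "norm (u0 + conv \<kappa> (G n) t - U t) \<le> (1 / 2) ^ n" for n
        using G[of n] t by (auto simp: approximants_def)
      then have "(\<lambda>n. u0 + conv \<kappa> (G n) t - U t) \<longlonglongrightarrow> 0"
        by (intro Lim_null_comparison[OF always_eventually p]) auto
      moreover have "(\<lambda>n. u0 + conv \<kappa> (G n) t - U t) \<longlonglongrightarrow> u0 + conv \<kappa> g t - U t"
        by (intro tendsto_intros elim(2))
      ultimately have "u0 + conv \<kappa> g t - U t = 0" by (rule LIMSEQ_unique[rotated])
      then have U_eq: "u0 + conv \<kappa> g t = U t" by simp
      have El: "(\<lambda>n. E n t) \<longlonglongrightarrow> 0" using elim(3) t by simp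
      have "(\<lambda>n. (norm (V n t - U t))\<^sup>2) \<longlonglongrightarrow> 0"
        by (rule Lim_null_comparison[OF always_eventually El]) (use V(1)[OF t] in auto)
      then have "(\<lambda>n. sqrt ((norm (V n t - U t))\<^sup>2)) \<longlonglongrightarrow> sqrt 0" by (rule tendsto_real_sqrt)
      then have "(\<lambda>n. V n t - U t) \<longlonglongrightarrow> 0" by (simp add: tendsto_norm_zero_iff)
      then have Vl: "(\<lambda>n. V n t) \<longlonglongrightarrow> U t" by (rule LIM_zero_cancel)
      have le: "\<Phi> (U t) \<le> ereal (q - inner (\<Theta> t (U t) - g t) (v - U t))" if v: "\<Phi> v \<le> ereal q" for v q
      proof (rule lower_semicontinuous_limit[OF lsc Vl _ V(2)[OF t v]])
        have "(\<lambda>n. q - inner (\<Theta> t (U t) - G n t) (v - U t) + E n t * (1 + norm (v - U t)))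
            \<longlonglongrightarrow> q - inner (\<Theta> t (U t) - g t) (v - U t) + 0 * (1 + norm (v - U t))"
          by (intro tendsto_intros elim(1) El)
        then show "(\<lambda>n. q - inner (\<Theta> t (U t) - G n t) (v - U t) + E n t * (1 + norm (v - U t)))
            \<longlonglongrightarrow> q - inner (\<Theta> t (U t) - g t) (v - U t)" by simp
      qed
      \<comment> \<open>Applied to u0, which has finite \<Phi>, the limiting inequality shows that
        \<Phi> (U t) is finite.\<close>
      obtain p where p: "\<Phi> (U t) = ereal p"
        using le[of u0 \<phi>0] \<phi>0 not_MInf[of "U t"] by (cases "\<Phi> (U t)") auto
      have "\<Theta> t (U t) - g t \<in> subdifferential \<Phi> (U t)"
      proof (rule subdifferentialI[OF p])
        fix v q assume "\<Phi> v = ereal q"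
        then show "inner (\<Theta> t (U t) - g t) (v - U t) \<le> q - p" using le[of v q] p by simp
      qed
      then show "\<Theta> t (u0 + conv \<kappa> g t) - g t \<in> subdifferential \<Phi> (u0 + conv \<kappa> g t)" by (simp add: U_eq)
    qed
  qed
  then show ?thesis using g g0 gC1 by (intro exI[of _ g]) auto
qed

end

section \<open>Distributional derivatives\<close>

text \<open>The definitions speak of Lebesgue measurable functions, the convolution calculus of
  Borel ones. Simple functions bridge the two off a null set.\<close>

lemma borel_version:
  fixes f :: "real \<Rightarrow> 'a::{banach, second_countable_topology}"
  assumes f: "f \<in> borel_measurable lebesgue"
  obtains f' where "f' \<in> borel_measurable borel" "AE x in lborel. f x = f' x"
proof -
  obtain s where s: "\<And>i. simple_function lebesgue (s i)" "\<And>x. (\<lambda>i. s i x) \<longlonglongrightarrow> f x"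
    using borel_measurable_implies_sequence_metric[OF f, of 0] by auto
  have "\<exists>s'. simple_function lborel s' \<and> (AE x in lborel. s i x = s' x)" for i
    by (rule completion_ex_simple_function[OF s(1)])
  then obtain s' where s': "\<And>i. simple_function lborel (s' i)" "\<And>i. AE x in lborel. s i x = s' i x" by metis
  have m[measurable]: "s' i \<in> borel_measurable borel" for i
    using borel_measurable_simple_function[OF s'(1)[of i]] by simp
  have "(\<lambda>x. lim (\<lambda>i. s' i x)) \<in> borel_measurable borel" by measurable
  moreover have "AE x in lborel. \<forall>i. s i x = s' i x" using s'(2) by (simp add: AE_all_countable)
  then have "AE x in lborel. f x = lim (\<lambda>i. s' i x)"
  proof eventually_elim
    case (elim x)
    then have "(\<lambda>i. s' i x) \<longlonglongrightarrow> f x" using s(2)[of x] by simp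
    then show ?case by (simp add: limI)
  qed
  ultimately show ?thesis by (rule that)
qed

text \<open>Closed half-lines form an intersection-stable generator of the Borel sets, so by
  Dynkin's argument all integrals over Borel sets vanish.\<close>

lemma AE_zero_of_integral_atMost:
  fixes f :: "real \<Rightarrow> 'a::{banach, second_countable_topology}"
  assumes f: "integrable lborel f" and z: "\<And>x. (LINT t:{..x}|lborel. f t) = 0"
  shows "AE t in lborel. f t = 0"
proof (rule sigma_finite_measure.density_zero[OF lborel.sigma_finite_measure_axioms f])
  have si: "set_integrable lborel A f" if "A \<in> sets borel" for A
    using that f unfolding set_integrable_def by (intro integrable_mult_indicator) auto
  \<comment> \<open>The complement step of the induction needs the integral over the whole
    line.\<close>
  have tot: "(LINT t|lborel. f t) = 0"
  proof -
    have "(\<lambda>n. LINT t:{..real n}|lborel. f t) \<longlonglongrightarrow> (LINT t|lborel. f t)"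
      unfolding set_lebesgue_integral_def
    proof (rule integral_dominated_convergence[where w = "\<lambda>t. norm (f t)"])
      show "AE t in lborel. (\<lambda>n. indicator {..real n} t *\<^sub>R f t) \<longlonglongrightarrow> f t"
      proof (rule AE_I2)
        fix t :: real
        obtain N :: nat where N: "t \<le> real N" using real_arch_simple by blast
        have "\<forall>\<^sub>F n in sequentially. indicator {..real n} t *\<^sub>R f t = f t"
          using eventually_ge_at_top[of N] by eventually_elim (use N in auto)
        then show "(\<lambda>n. indicator {..real n} t *\<^sub>R f t) \<longlonglongrightarrow> f t" by (rule tendsto_eventually)
      qed
    qed (use f in \<open>auto split: split_indicator\<close>)
    then show ?thesis using z by (simp add: LIMSEQ_const_iff)
  qed
  fix A :: "real set" assume "A \<in> sets lborel"
  then have A: "A \<in> sigma_sets UNIV (range (\<lambda>a::real. {..a}))"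
    by (simp add: borel_eq_atMost)
  have sets: "sigma_sets UNIV (range (\<lambda>a::real. {..a})) = sets borel"
    by (simp add: borel_eq_atMost)
  have "Int_stable (range (\<lambda>a::real. {..a}))"
    by (auto simp: Int_stable_def)
  moreover have "range (\<lambda>a::real. {..a}) \<subseteq> Pow UNIV" by simp
  ultimately show "(LINT t:A|lborel. f t) = 0" using A
  proof (induction rule: sigma_sets_induct_disjoint)
    case (basic A)
    then show ?case using z by auto
  next
    case empty
    then show ?case by (simp add: set_lebesgue_integral_def)
  next
    case (compl A)
    then have "A \<in> sets borel" using sets by blast
    then have "(LINT t:UNIV - A|lborel. f t) = (LINT t|lborel. f t) - (LINT t:A|lborel. f t)"
    proof -
      have eq: "indicator (UNIV - A) t *\<^sub>R f t = f t - indicator A t *\<^sub>R f t" for t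
        by (auto split: split_indicator)
      show ?thesis
        using si[OF \<open>A \<in> sets borel\<close>] f unfolding set_lebesgue_integral_def set_integrable_def eq
        by (intro Bochner_Integration.integral_diff)
    qed
    then show ?case using compl tot by simp
  next
    case (union A)
    then have A: "A i \<in> sets borel" for i using sets by blast
    have "(LINT t:(\<Union>i. A i)|lborel. f t) = (\<Sum>i. LINT t:A i|lborel. f t)"
      using A union(1) by (intro lebesgue_integral_countable_add si) (auto simp: disjoint_family_on_def)
    then show ?case using union by simp
  qed
qed

section \<open>Smooth functions of compact support\<close>

definition bump :: "nat \<Rightarrow> real \<Rightarrow> real" where
  "bump k y = (if 0 < y then (1 / y) ^ k * exp (- (1 / y)) else 0)"

lemma bump_tendsto_0: "(bump k \<longlongrightarrow> 0) (at_right 0)"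
proof -
  have "((\<lambda>y::real. (inverse y) ^ k / exp (inverse y)) \<longlongrightarrow> 0) (at_right 0)"
    by (rule filterlim_compose[OF tendsto_power_div_exp_0 filterlim_inverse_at_top_right])
  moreover have "\<forall>\<^sub>F y in at_right 0. (inverse y) ^ k / exp (inverse y) = bump k y"
    using eventually_at_right_less[of "0::real"]
    by eventually_elim (simp add: bump_def exp_minus divide_inverse)
  ultimately show ?thesis by (rule Lim_transform_eventually)
qed

text \<open>At 0 the right difference quotient of \<open>bump k\<close> is
  \<open>bump (k + 1)\<close>, which tends to 0 because the exponential beats every power.\<close>

lemma DERIV_bump: "(bump k has_real_derivative (bump (k + 2) y - real k * bump (k + 1) y)) (at y)"
proof (cases y "0::real" rule: linorder_cases)
  case less
  have "((\<lambda>_. 0) has_real_derivative 0) (at y)" by simp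
  then have "(bump k has_real_derivative 0) (at y)"
    by (rule has_field_derivative_transform_within_open[where S = "{..<0}"]) (use less in \<open>auto simp: bump_def\<close>)
  then show ?thesis using less by (simp add: bump_def)
next
  case greater
  have "((\<lambda>y. (1 / y) ^ k * exp (- (1 / y))) has_real_derivative
      (real k * (1 / y) ^ (k - 1) * (- 1 / y\<^sup>2)) * exp (- (1 / y)) + (1 / y) ^ k * (exp (- (1 / y)) * (1 / y\<^sup>2))) (at y)"
    using greater by (auto intro!: derivative_eq_intros simp: power2_eq_square)
  moreover have "(real k * (1 / y) ^ (k - 1) * (- 1 / y\<^sup>2)) * exp (- (1 / y)) + (1 / y) ^ k * (exp (- (1 / y)) * (1 / y\<^sup>2))
     = bump (k + 2) y - real k * bump (k + 1) y"
    using greater by (cases k) (auto simp: bump_def power2_eq_square field_simps)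
  ultimately have "((\<lambda>y. (1 / y) ^ k * exp (- (1 / y))) has_real_derivative (bump (k + 2) y - real k * bump (k + 1) y)) (at y)"
    by simp
  then show ?thesis
    by (rule has_field_derivative_transform_within_open[where S = "{0<..}"]) (use greater in \<open>auto simp: bump_def\<close>)
next
  case equal
  have "((\<lambda>h. (bump k (0 + h) - bump k 0) / h) \<longlongrightarrow> 0) (at 0)"
  proof (rule filterlim_split_at)
    have "\<forall>\<^sub>F h in at_left 0. (bump k (0 + h) - bump k 0) / h = 0"
      using eventually_at_left_real[of "-1" 0] by (auto elim!: eventually_mono simp: bump_def)
    then show "((\<lambda>h. (bump k (0 + h) - bump k 0) / h) \<longlongrightarrow> 0) (at_left 0)" by (rule tendsto_eventually)
    have "\<forall>\<^sub>F h in at_right 0. bump (k + 1) h = (bump k (0 + h) - bump k 0) / h"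
      using eventually_at_right_less[of "0::real"] by eventually_elim (simp add: bump_def)
    then show "((\<lambda>h. (bump k (0 + h) - bump k 0) / h) \<longlongrightarrow> 0) (at_right 0)"
      by (rule Lim_transform_eventually[OF bump_tendsto_0])
  qed
  then have "(bump k has_real_derivative 0) (at 0)" by (simp add: DERIV_def)
  then show ?thesis using equal by (simp add: bump_def)
qed

text \<open>Closed under differentiation, because \<open>bump k' = bump (k + 2) - k bump (k + 1)\<close>.\<close>

inductive_set smooth_class :: "(real \<Rightarrow> real) set" where
  affine_bump: "(\<lambda>x. bump k (c * x + d)) \<in> smooth_class"
| cmult: "f \<in> smooth_class \<Longrightarrow> (\<lambda>x. r * f x) \<in> smooth_class"
| add: "f \<in> smooth_class \<Longrightarrow> g \<in> smooth_class \<Longrightarrow> (\<lambda>x. f x + g x) \<in> smooth_class"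
| mult: "f \<in> smooth_class \<Longrightarrow> g \<in> smooth_class \<Longrightarrow> (\<lambda>x. f x * g x) \<in> smooth_class"

lemma smooth_class_derivative:
  "f \<in> smooth_class \<Longrightarrow> \<exists>f'\<in>smooth_class. \<forall>x. (f has_real_derivative f' x) (at x)"
proof (induction rule: smooth_class.induct)
  case (affine_bump k c d)
  define f' where "f' = (\<lambda>x. c * (bump (k + 2) (c * x + d) + (- real k) * bump (k + 1) (c * x + d)))"
  have "((\<lambda>x. bump k (c * x + d)) has_real_derivative f' x) (at x)" for x
  proof -
    have "((\<lambda>x. bump k (c * x + d)) has_real_derivative (bump (k + 2) (c * x + d) - real k * bump (k + 1) (c * x + d)) * c) (at x)"
      by (rule DERIV_chain2[OF DERIV_bump]) (auto intro!: derivative_eq_intros)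
    then show ?thesis by (simp add: f'_def algebra_simps)
  qed
  then have D: "\<forall>x. ((\<lambda>x. bump k (c * x + d)) has_real_derivative f' x) (at x)" by blast
  have "f' \<in> smooth_class" unfolding f'_def by (intro smooth_class.intros)
  then show ?case using D by (intro bexI[where x = f'])
next
  case (cmult f r)
  then obtain f' where "f' \<in> smooth_class" "\<And>x. (f has_real_derivative f' x) (at x)" by blast
  then show ?case
    by (intro bexI[of _ "\<lambda>x. r * f' x"]) (auto intro!: DERIV_cmult smooth_class.intros)
next
  case (add f g)
  then obtain f' g' where "f' \<in> smooth_class" "\<And>x. (f has_real_derivative f' x) (at x)"
    "g' \<in> smooth_class" "\<And>x. (g has_real_derivative g' x) (at x)" by blast
  then show ?case
    by (intro bexI[of _ "\<lambda>x. f' x + g' x"]) (auto intro!: DERIV_add smooth_class.intros)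
next
  case (mult f g)
  then obtain f' g' where "f' \<in> smooth_class" "\<And>x. (f has_real_derivative f' x) (at x)"
    "g' \<in> smooth_class" "\<And>x. (g has_real_derivative g' x) (at x)" by blast
  then show ?case using mult(1,2)
    by (intro bexI[of _ "\<lambda>x. f' x * g x + g' x * f x"]) (auto intro!: DERIV_mult smooth_class.intros)
qed

lemma smooth_class_deriv_funpow:
  assumes f: "f \<in> smooth_class"
  shows "(deriv ^^ n) f \<in> smooth_class"
proof (induction n)
  case (Suc n)
  obtain f' where f': "f' \<in> smooth_class" "\<And>x. ((deriv ^^ n) f has_real_derivative f' x) (at x)"
    using smooth_class_derivative[OF Suc] by blast
  have "deriv ((deriv ^^ n) f) = f'" using f'(2) by (auto intro: DERIV_imp_deriv)
  then show ?case using f'(1) by simp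
qed (use f in simp)

lemma smooth_class_differentiable: "f \<in> smooth_class \<Longrightarrow> f differentiable_on UNIV"
  using smooth_class_derivative unfolding differentiable_on_def
  by (meson differentiable_at_withinI real_differentiable_def)

lemma smooth_class_continuous: "f \<in> smooth_class \<Longrightarrow> continuous_on UNIV f"
  by (rule differentiable_imp_continuous_on[OF smooth_class_differentiable])

text \<open>Two flat steps at a and b, steepened by n so that the product tends to the indicator of
  the open interval. The arguments are spelled as the rule \<open>affine_bump\<close> expects
  them.\<close>

definition bump_on :: "real \<Rightarrow> real \<Rightarrow> nat \<Rightarrow> real \<Rightarrow> real" where
  "bump_on a b n x = bump 0 (real n * x + (- (real n * a))) * bump 0 ((- real n) * x + real n * b)"

lemma bump_on_smooth: "bump_on a b n \<in> smooth_class"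
  unfolding bump_on_def[abs_def] by (intro smooth_class.intros)

lemma bump_0: "0 \<le> bump 0 y" "bump 0 y \<le> 1" "y \<le> 0 \<Longrightarrow> bump 0 y = 0" "0 < y \<Longrightarrow> 0 < bump 0 y"
  by (auto simp: bump_def)

lemma bump_on_bounds: "0 \<le> bump_on a b n x" "bump_on a b n x \<le> 1"
  by (auto simp: bump_on_def bump_0 intro: mult_le_one)

lemma bump_on_eq_0: "x \<notin> {a<..<b} \<Longrightarrow> bump_on a b n x = 0"
proof -
  assume "x \<notin> {a<..<b}"
  then have "real n * (x - a) \<le> 0 \<or> real n * (b - x) \<le> 0" by (auto simp: mult_le_0_iff)
  then show ?thesis by (auto simp: bump_on_def bump_0(3) algebra_simps)
qed

lemma bump_on_pos: "x \<in> {a<..<b} \<Longrightarrow> 0 < n \<Longrightarrow> 0 < bump_on a b n x"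
proof -
  assume "x \<in> {a<..<b}" "0 < n"
  then have "0 < real n * (x - a)" "0 < real n * (b - x)" by auto
  then show ?thesis unfolding bump_on_def by (intro mult_pos_pos bump_0(4)) (auto simp: algebra_simps)
qed

lemma bump_on_tendsto: "(\<lambda>n. bump_on a b (Suc n) x) \<longlonglongrightarrow> indicator {a<..<b} x"
proof (cases "x \<in> {a<..<b}")
  case True
  have lim: "(\<lambda>n. bump 0 (real (Suc n) * c)) \<longlonglongrightarrow> 1" if c: "0 < c" for c
  proof -
    have "(\<lambda>n. exp (- (1 / c * (1 / real (Suc n))))) \<longlonglongrightarrow> exp (- (1 / c * 0))"
      by (intro tendsto_intros LIMSEQ_Suc[OF lim_1_over_n])
    moreover have "bump 0 (real (Suc n) * c) = exp (- (1 / c * (1 / real (Suc n))))" for n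
    proof -
      have "0 < real (Suc n) * c" using c by (intro mult_pos_pos) auto
      then show ?thesis by (simp add: bump_def mult.commute del: of_nat_Suc)
    qed
    ultimately show ?thesis by simp
  qed
  have "(\<lambda>n. bump 0 (real (Suc n) * (x - a)) * bump 0 (real (Suc n) * (b - x))) \<longlonglongrightarrow> 1 * 1"
    using True by (intro tendsto_mult lim) auto
  moreover have "bump_on a b (Suc n) x = bump 0 (real (Suc n) * (x - a)) * bump 0 (real (Suc n) * (b - x))" for n
    by (simp add: bump_on_def algebra_simps)
  ultimately show ?thesis using True by simp
qed (simp add: bump_on_eq_0)

lemma test_functionI:
  assumes smooth: "\<And>n. (deriv ^^ n) \<phi> differentiable_on UNIV" and z: "\<And>x. x \<notin> {lo..hi} \<Longrightarrow> \<phi> x = 0" and "hi < T"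
  shows "\<phi> \<in> test_functions T"
proof -
  have sub: "closure (support_on UNIV \<phi>) \<subseteq> {lo..hi}"
  proof (rule closure_minimal)
    show "support_on UNIV \<phi> \<subseteq> {lo..hi}" using z unfolding support_on_def by blast
  qed simp
  have "compact (closure (support_on UNIV \<phi>))"
    using sub compact_Int_closed[OF compact_Icc closed_closure, of lo hi "support_on UNIV \<phi>"] by (simp add: Int_absorb1)
  then show ?thesis using sub smooth \<open>hi < T\<close> by (auto simp: test_functions_def)
qed

lemma bump_on_test_function: "b < T \<Longrightarrow> bump_on a b n \<in> test_functions T"
  by (rule test_functionI[of _ a b])
    (auto intro: smooth_class_differentiable smooth_class_deriv_funpow[OF bump_on_smooth] bump_on_eq_0)

text \<open>Vanishing mean is what brings the primitive that starts with 0 at lo back to 0 at hi,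
  and so gives it compact support.\<close>

lemma test_function_antiderivative:
  assumes \<omega>: "\<omega> \<in> smooth_class" and z: "\<And>x. x \<notin> {lo..hi} \<Longrightarrow> \<omega> x = 0" and lohi: "lo \<le> hi" "hi < T"
    and int: "(LINT x|lborel. \<omega> x) = 0"
  shows "\<exists>\<phi>\<in>test_functions T. deriv \<phi> = \<omega>"
proof -
  have cont: "isCont \<omega> x" for x
    using smooth_class_continuous[OF \<omega>] by (simp add: continuous_on_eq_continuous_at)
  obtain F where F: "\<And>x. (F has_vector_derivative \<omega> x) (at x)"
    using einterval_antiderivative[of "-\<infinity>" "\<infinity>" \<omega>] cont by auto
  define \<phi> where "\<phi> x = F x - F lo" for x
  have D: "(\<phi> has_real_derivative \<omega> x) (at x)" for x
    unfolding \<phi>_def using F[of x] by (auto simp: has_real_derivative_iff_has_vector_derivative intro!: derivative_eq_intros)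
  have contF: "continuous_on S \<phi>" for S
    by (meson D DERIV_isCont continuous_at_imp_continuous_on)
  have left: "\<phi> x = 0" if "x \<le> lo" for x
  proof (cases "x = lo")
    case False
    then have "\<phi> lo = \<phi> x"
      using that D z by (intro DERIV_isconst_end contF) (auto, metis atLeastAtMost_iff not_le)
    then show ?thesis by (simp add: \<phi>_def)
  qed (simp add: \<phi>_def)
  have hi: "\<phi> hi = 0"
  proof -
    have "(LINT x|lborel. \<omega> x * indicator {lo..hi} x) = \<phi> hi - \<phi> lo"
      by (rule integral_FTC_Icc_real[OF lohi(1)]) (use D cont in auto)
    moreover have "(LINT x|lborel. \<omega> x * indicator {lo..hi} x) = (LINT x|lborel. \<omega> x)"
      using z by (intro Bochner_Integration.integral_cong) (auto split: split_indicator)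
    ultimately show ?thesis using int left[of lo] by simp
  qed
  have right: "\<phi> x = 0" if "hi \<le> x" for x
  proof (cases "x = hi")
    case False
    then have "\<phi> x = \<phi> hi"
      using that D z by (intro DERIV_isconst_end contF) (auto, metis atLeastAtMost_iff not_le)
    then show ?thesis by (simp add: hi)
  qed (simp add: hi)
  have deriv: "deriv \<phi> = \<omega>" using D by (auto intro: DERIV_imp_deriv)
  have "(deriv ^^ n) \<phi> differentiable_on UNIV" for n
  proof (cases n)
    case 0
    then show ?thesis using D unfolding differentiable_on_def
      by (auto intro: differentiable_at_withinI simp: real_differentiable_def)
  next
    case (Suc k)
    have "(deriv ^^ Suc k) \<phi> = (deriv ^^ k) \<omega>" by (simp only: funpow_Suc_right comp_def deriv)
    then show ?thesis using Suc smooth_class_differentiable[OF smooth_class_deriv_funpow[OF \<omega>]] by simp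
  qed
  then have "\<phi> \<in> test_functions T"
    using left right lohi by (intro test_functionI[of _ lo hi]) (auto simp: not_le)
  then show ?thesis using deriv by blast
qed

lemma borel_measurable_lebesgueI:
  "f \<in> borel_measurable borel \<Longrightarrow> f \<in> borel_measurable lebesgue"
  by (rule measurable_completion) simp

lemma test_functionD:
  assumes "\<phi> \<in> test_functions T"
  obtains K where "compact K" "K \<subseteq> {..<T}" "\<And>x. x \<notin> K \<Longrightarrow> \<phi> x = 0" "\<And>x. x \<notin> K \<Longrightarrow> deriv \<phi> x = 0"
    "continuous_on UNIV \<phi>" "continuous_on UNIV (deriv \<phi>)" "\<And>x. (\<phi> has_real_derivative deriv \<phi> x) (at x)"
proof -
  define K where "K = closure (support_on UNIV \<phi>)"
  have K: "compact K" "K \<subseteq> {..<T}" and smooth: "\<And>n. (deriv ^^ n) \<phi> differentiable_on UNIV"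
    using assms by (auto simp: test_functions_def K_def)
  have z: "\<phi> x = 0" if "x \<notin> K" for x
    using that closure_subset[of "support_on UNIV \<phi>"] by (auto simp: K_def support_on_def)
  have z': "deriv \<phi> x = 0" if x: "x \<notin> K" for x
  proof (rule DERIV_imp_deriv)
    have "((\<lambda>_. 0) has_real_derivative 0) (at x)" by simp
    then show "(\<phi> has_real_derivative 0) (at x)"
      by (rule has_field_derivative_transform_within_open[where S = "- K"])
        (use x z K in \<open>auto intro: open_Compl compact_imp_closed\<close>)
  qed
  have D: "(\<phi> has_real_derivative deriv \<phi> x) (at x)" for x
    using smooth[of 0] by (auto simp: differentiable_on_def DERIV_deriv_iff_real_differentiable)
  have c: "continuous_on UNIV \<phi>" "continuous_on UNIV (deriv \<phi>)"
    using differentiable_imp_continuous_on[OF smooth[of 0]] differentiable_imp_continuous_on[OF smooth[of 1]] by auto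
  show ?thesis by (rule that[OF K z z' c D])
qed

lemma scaleR_locally_integrable:
  fixes F :: "real \<Rightarrow> 'a::{banach, second_countable_topology}"
  assumes w: "continuous_on UNIV w" and z: "\<And>x. x \<notin> K \<Longrightarrow> w x = 0"
    and K: "compact K" "K \<subseteq> {..<T}" and F: "locally_integrable {..<T} F"
  shows "set_integrable lebesgue {..<T} (\<lambda>t. w t *\<^sub>R F t)"
proof -
  have FK: "integrable lebesgue (\<lambda>t. indicator K t *\<^sub>R F t)"
    using F K by (auto simp: locally_integrable_def set_integrable_def)
  have [measurable]: "w \<in> borel_measurable lebesgue"
    using borel_measurable_continuous_onI[OF w] by (rule borel_measurable_lebesgueI)
  obtain B where B: "\<And>x. x \<in> K \<Longrightarrow> norm (w x) \<le> B"
    using compact_imp_bounded[OF compact_continuous_image[OF continuous_on_subset[OF w] K(1)]]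
    by (auto simp: bounded_iff)
  have eq: "indicator {..<T} t *\<^sub>R (w t *\<^sub>R F t) = w t *\<^sub>R (indicator K t *\<^sub>R F t)" for t
    using K(2) z[of t] by (auto split: split_indicator)
  show ?thesis
    unfolding set_integrable_def eq
  proof (rule Bochner_Integration.integrable_bound)
    show "integrable lebesgue (\<lambda>t. B *\<^sub>R (indicator K t *\<^sub>R F t))" by (intro integrable_scaleR_right FK)
    show "(\<lambda>t. w t *\<^sub>R (indicator K t *\<^sub>R F t)) \<in> borel_measurable lebesgue"
      using borel_measurable_integrable[OF FK] by measurable
    show "AE t in lebesgue. norm (w t *\<^sub>R (indicator K t *\<^sub>R F t)) \<le> norm (B *\<^sub>R (indicator K t *\<^sub>R F t))"
    proof (rule AE_I2)
      fix t
      show "norm (w t *\<^sub>R (indicator K t *\<^sub>R F t)) \<le> norm (B *\<^sub>R (indicator K t *\<^sub>R F t))"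
        using B[of t] by (cases "t \<in> K") (auto intro!: mult_right_mono)
    qed
  qed
qed

section \<open>Uniqueness of distributional derivatives and primitives\<close>

lemma locally_integrable_diff:
  "locally_integrable S F \<Longrightarrow> locally_integrable S G \<Longrightarrow> locally_integrable S (\<lambda>t. F t - G t)"
  by (auto simp: locally_integrable_def intro!: set_integral_diff)

text \<open>Bumps tend to indicators of open intervals, inside a compact interval on which D is
  integrable, so D has zero integral over each of them. Compact intervals ending below T exhaust the
  half-line.\<close>

lemma AE_zero_of_bump_integrals:
  fixes D :: "real \<Rightarrow> 'a::{banach, second_countable_topology}"
  assumes D: "locally_integrable {..<T} D"
    and z: "\<And>a b n. a < b \<Longrightarrow> b < T \<Longrightarrow> (LINT t:{..<T}|lebesgue. bump_on a b (Suc n) t *\<^sub>R D t) = 0"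
  shows "AE t in lborel. t < T \<longrightarrow> D t = 0"
proof -
  have int: "integrable lebesgue (\<lambda>t. indicator {lo..hi} t *\<^sub>R D t)" if "hi < T" for lo hi
  proof -
    have "{lo..hi} \<subseteq> {..<T}" using that by auto
    then show ?thesis using D[unfolded locally_integrable_def set_integrable_def, rule_format, of "{lo..hi}"] by simp
  qed
  have zero: "(LINT t|lebesgue. indicator {lo<..<hi} t *\<^sub>R D t) = 0" if "hi < T" for lo hi
  proof (cases "lo < hi")
    case True
    have bm[measurable]: "bump_on lo hi n \<in> borel_measurable lebesgue" for n
      using borel_measurable_continuous_onI[OF smooth_class_continuous[OF bump_on_smooth]] by (rule borel_measurable_lebesgueI)
    define W where "W t = indicator {lo..hi} t *\<^sub>R D t" for t
    have Wi: "integrable lebesgue W" using int[OF that] by (simp add: W_def[abs_def])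
    have Wm[measurable]: "W \<in> borel_measurable lebesgue" by (rule borel_measurable_integrable[OF Wi])
    have norm_Wi: "integrable lebesgue (\<lambda>t. norm (W t))" by (rule integrable_norm[OF Wi])
    have eq: "indicator {..<T} t *\<^sub>R (bump_on lo hi n t *\<^sub>R D t) = bump_on lo hi n t *\<^sub>R W t" for n t
      using that bump_on_eq_0[of t lo hi n] by (auto simp: W_def split: split_indicator)
    have "(\<lambda>n. LINT t|lebesgue. bump_on lo hi (Suc n) t *\<^sub>R W t)
        \<longlonglongrightarrow> (LINT t|lebesgue. indicator {lo<..<hi} t *\<^sub>R W t)"
    proof (rule integral_dominated_convergence[where w = "\<lambda>t. norm (W t)"])
      show "AE t in lebesgue. (\<lambda>n. bump_on lo hi (Suc n) t *\<^sub>R W t)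
          \<longlonglongrightarrow> indicator {lo<..<hi} t *\<^sub>R W t"
        by (intro AE_I2 tendsto_scaleR tendsto_const bump_on_tendsto)
      show "AE t in lebesgue. norm (bump_on lo hi (Suc n) t *\<^sub>R W t) \<le> norm (W t)" for n
      proof (rule AE_I2)
        fix t
        have "bump_on lo hi (Suc n) t * norm (W t) \<le> 1 * norm (W t)"
          by (rule mult_right_mono[OF bump_on_bounds(2)]) simp
        then show "norm (bump_on lo hi (Suc n) t *\<^sub>R W t) \<le> norm (W t)"
          using bump_on_bounds(1)[of lo hi "Suc n" t] by (simp only: norm_scaleR abs_of_nonneg mult_1)
      qed
      show "integrable lebesgue (\<lambda>t. norm (W t))" by (rule norm_Wi)
      show "(\<lambda>t. indicator {lo<..<hi} t *\<^sub>R W t) \<in> borel_measurable lebesgue"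
        by (intro borel_measurable_scaleR borel_measurable_indicator Wm) simp
      show "(\<lambda>t. bump_on lo hi (Suc n) t *\<^sub>R W t) \<in> borel_measurable lebesgue" for n
        by (intro borel_measurable_scaleR bm Wm)
    qed
    moreover have "(LINT t|lebesgue. bump_on lo hi (Suc n) t *\<^sub>R W t) = 0" for n
      using z[OF True that, of n] unfolding set_lebesgue_integral_def eq .
    ultimately have "(LINT t|lebesgue. indicator {lo<..<hi} t *\<^sub>R W t) = 0"
      by (simp only: LIMSEQ_const_iff)
    moreover have eq2: "indicator {lo<..<hi} t *\<^sub>R W t = indicator {lo<..<hi} t *\<^sub>R D t" for t
      by (auto simp: W_def split: split_indicator)
    ultimately show ?thesis by (simp only: eq2)
  qed simp
  have loc: "AE t in lborel. t \<in> {lo..hi} \<longrightarrow> D t = 0" if hi: "hi < T" for lo hi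
  proof -
    obtain f where f[measurable]: "f \<in> borel_measurable borel" and eq: "AE t in lborel. indicator {lo..hi} t *\<^sub>R D t = f t"
      using borel_version[OF borel_measurable_integrable[OF int[OF hi]]] by blast
    have eq': "AE t in lebesgue. indicator {lo..hi} t *\<^sub>R D t = f t" using eq by (simp add: AE_completion_iff)
    have "integrable lebesgue f"
      by (rule integrable_cong_AE_imp[OF int[OF hi] borel_measurable_lebesgueI[OF f] eq'])
    then have fi: "integrable lborel f" by (simp add: integrable_completion)
    have "(LINT t:{..x}|lborel. f t) = 0" for x
    proof -
      have fm: "(\<lambda>t. indicator {..x} t *\<^sub>R f t) \<in> borel_measurable lborel" by measurable
      have "(LINT t:{..x}|lborel. f t) = (LINT t|lebesgue. indicator {..x} t *\<^sub>R f t)"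
        unfolding set_lebesgue_integral_def by (rule integral_completion[OF fm, symmetric])
      also have "\<dots> = (LINT t|lebesgue. indicator {lo<..<min x hi} t *\<^sub>R D t)"
      proof (rule integral_cong_AE)
        have "(\<lambda>t. indicator {lo<..<min x hi} t *\<^sub>R (indicator {lo..hi} t *\<^sub>R D t)) \<in> borel_measurable lebesgue"
          by (intro borel_measurable_scaleR borel_measurable_indicator borel_measurable_integrable[OF int[OF hi]]) simp
        moreover have eq3: "indicator {lo<..<min x hi} t *\<^sub>R (indicator {lo..hi} t *\<^sub>R D t) = indicator {lo<..<min x hi} t *\<^sub>R D t" for t
          by (auto split: split_indicator)
        ultimately show "(\<lambda>t. indicator {lo<..<min x hi} t *\<^sub>R D t) \<in> borel_measurable lebesgue" by (simp only: eq3)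
        have "AE t in lborel. t \<noteq> lo \<and> t \<noteq> min x hi"
          using AE_lborel_singleton[of lo] AE_lborel_singleton[of "min x hi"] by eventually_elim simp
        then have "AE t in lebesgue. t \<noteq> lo \<and> t \<noteq> min x hi" by (simp add: AE_completion_iff)
        with eq' show "AE t in lebesgue. indicator {..x} t *\<^sub>R f t = indicator {lo<..<min x hi} t *\<^sub>R D t"
        proof eventually_elim
          case (elim t)
          have "indicator {..x} t *\<^sub>R (indicator {lo..hi} t *\<^sub>R D t) = indicator {lo<..<min x hi} t *\<^sub>R D t"
            using elim(2) by (cases "t < lo"; cases "t < x"; cases "t < hi") (auto simp: min_def split: if_splits)
          then show ?case unfolding elim(1) .
        qed
      qed (use measurable_completion[OF fm] in simp)
      also have "\<dots> = 0" by (rule zero) (use hi in simp)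
      finally show ?thesis .
    qed
    then have "AE t in lborel. f t = 0" by (rule AE_zero_of_integral_atMost[OF fi])
    with eq show ?thesis by eventually_elim auto
  qed
  \<comment> \<open>Countably many intervals suffice, so their exceptional sets together still form
    a null set.\<close>
  have "AE t in lborel. \<forall>n. t \<in> {- real n..T - 1 / real (Suc n)} \<longrightarrow> D t = 0"
    unfolding AE_all_countable by (intro allI loc) simp
  then show ?thesis
  proof eventually_elim
    case (elim t)
    show ?case
    proof
      assume t: "t < T"
      obtain n1 :: nat where n1: "- t \<le> real n1" using real_arch_simple by blast
      obtain n2 where n2: "1 / real (Suc n2) < T - t" using nat_approx_posE[of "T - t"] t by auto
      let ?n = "max n1 n2"
      have "1 / real (Suc ?n) \<le> 1 / real (Suc n2)" by (intro divide_left_mono) auto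
      then have "t \<in> {- real ?n..T - 1 / real (Suc ?n)}" using n1 n2 by auto
      then show "D t = 0" using elim by blast
    qed
  qed
qed

lemma distributional_derivative_unique:
  fixes F G1 G2 :: "real \<Rightarrow> 'a::{banach, second_countable_topology}"
  assumes "has_distributional_derivative T F G1" "has_distributional_derivative T F G2"
  shows "AE t in lborel. t < T \<longrightarrow> G1 t = G2 t"
proof -
  have li: "locally_integrable {..<T} G1" "locally_integrable {..<T} G2"
    and eq: "\<And>\<phi>. \<phi> \<in> test_functions T \<Longrightarrow> (LINT t:{..<T}|lebesgue. \<phi> t *\<^sub>R G1 t) = (LINT t:{..<T}|lebesgue. \<phi> t *\<^sub>R G2 t)"
    using assms by (auto simp: has_distributional_derivative_def)
  have "AE t in lborel. t < T \<longrightarrow> G1 t - G2 t = 0"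
  proof (rule AE_zero_of_bump_integrals[OF locally_integrable_diff[OF li]])
    fix a b :: real and n
    assume b: "b < T"
    let ?\<phi> = "bump_on a b (Suc n)"
    have i: "set_integrable lebesgue {..<T} (\<lambda>t. ?\<phi> t *\<^sub>R G t)" if "locally_integrable {..<T} G" for G :: "real \<Rightarrow> 'a"
      by (rule scaleR_locally_integrable[OF smooth_class_continuous[OF bump_on_smooth], where K = "{a..b}"])
        (use b that in \<open>auto intro: bump_on_eq_0\<close>)
    show "(LINT t:{..<T}|lebesgue. ?\<phi> t *\<^sub>R (G1 t - G2 t)) = 0"
      using eq[OF bump_on_test_function[OF b]] set_integral_diff(2)[OF i[OF li(1)] i[OF li(2)]]
      by (simp add: scaleR_diff_right)
  qed
  then show ?thesis by simp
qed

text \<open>There is no constant of integration because both primitives agree for \<open>t < 0\<close>: the mean of a test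
  function is corrected by a bump supported in \<open>(-2,-1)\<close>.\<close>

lemma distributional_primitive_unique:
  fixes F1 F2 G1 G2 :: "real \<Rightarrow> 'a::{banach, second_countable_topology}"
  assumes dd: "has_distributional_derivative T F1 G1" "has_distributional_derivative T F2 G2"
    and G: "AE t in lborel. t < T \<longrightarrow> G1 t = G2 t" and F: "\<And>t. t < 0 \<Longrightarrow> F1 t = F2 t" and T: "0 < T"
  shows "AE t in lborel. t < T \<longrightarrow> F1 t = F2 t"
proof -
  have li: "locally_integrable {..<T} F1" "locally_integrable {..<T} F2" and lg: "locally_integrable {..<T} G1" "locally_integrable {..<T} G2"
    and e1: "\<And>\<phi>. \<phi> \<in> test_functions T \<Longrightarrow> - (LINT t:{..<T}|lebesgue. deriv \<phi> t *\<^sub>R F1 t) = (LINT t:{..<T}|lebesgue. \<phi> t *\<^sub>R G1 t)"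
    and e2: "\<And>\<phi>. \<phi> \<in> test_functions T \<Longrightarrow> - (LINT t:{..<T}|lebesgue. deriv \<phi> t *\<^sub>R F2 t) = (LINT t:{..<T}|lebesgue. \<phi> t *\<^sub>R G2 t)"
    using dd by (auto simp: has_distributional_derivative_def)
  define D where "D t = F1 t - F2 t" for t
  have lD: "locally_integrable {..<T} D" unfolding D_def[abs_def] by (rule locally_integrable_diff[OF li])
  have D0: "t < 0 \<Longrightarrow> D t = 0" for t by (simp add: D_def F)
  have test: "(LINT t:{..<T}|lebesgue. deriv \<phi> t *\<^sub>R D t) = 0" if \<phi>: "\<phi> \<in> test_functions T" for \<phi>
  proof -
    obtain K where K: "compact K" "K \<subseteq> {..<T}" "\<And>x. x \<notin> K \<Longrightarrow> \<phi> x = 0" "\<And>x. x \<notin> K \<Longrightarrow> deriv \<phi> x = 0"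
      "continuous_on UNIV \<phi>" "continuous_on UNIV (deriv \<phi>)"
      using test_functionD[OF \<phi>] by metis
    have i: "set_integrable lebesgue {..<T} (\<lambda>t. deriv \<phi> t *\<^sub>R F t)" if "locally_integrable {..<T} F" for F :: "real \<Rightarrow> 'a"
      by (rule scaleR_locally_integrable[OF K(6) K(4) K(1,2) that])
    have j: "set_integrable lebesgue {..<T} (\<lambda>t. \<phi> t *\<^sub>R G t)" if "locally_integrable {..<T} G" for G :: "real \<Rightarrow> 'a"
      by (rule scaleR_locally_integrable[OF K(5) K(3) K(1,2) that])
    have "(LINT t:{..<T}|lebesgue. \<phi> t *\<^sub>R G1 t) = (LINT t:{..<T}|lebesgue. \<phi> t *\<^sub>R G2 t)"
      unfolding set_lebesgue_integral_def
    proof (rule integral_cong_AE)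
      have "AE t in lebesgue. t < T \<longrightarrow> G1 t = G2 t" using G by (simp add: AE_completion_iff)
      then show "AE t in lebesgue. indicator {..<T} t *\<^sub>R (\<phi> t *\<^sub>R G1 t) = indicator {..<T} t *\<^sub>R (\<phi> t *\<^sub>R G2 t)"
        by eventually_elim (auto split: split_indicator)
    qed (use j[OF lg(1)] j[OF lg(2)] in \<open>auto simp: set_integrable_def dest: borel_measurable_integrable\<close>)
    then have "(LINT t:{..<T}|lebesgue. deriv \<phi> t *\<^sub>R F1 t) = (LINT t:{..<T}|lebesgue. deriv \<phi> t *\<^sub>R F2 t)"
      using e1[OF \<phi>] e2[OF \<phi>] by (metis neg_equal_iff_equal)
    then show ?thesis
      using set_integral_diff(2)[OF i[OF li(1)] i[OF li(2)]] by (simp add: D_def scaleR_diff_right)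
  qed
  define \<rho> where "\<rho> = bump_on (- 2) (- 1) (Suc 0)"
  have \<rho>_int: "integrable lborel (bump_on a b n)" for a b n
  proof -
    have "integrable lborel (\<lambda>x. indicator {a..b} x *\<^sub>R bump_on a b n x)"
      by (intro borel_integrable_compact compact_Icc continuous_on_subset[OF smooth_class_continuous[OF bump_on_smooth]]) auto
    moreover have eq: "indicator {a..b} x *\<^sub>R bump_on a b n x = bump_on a b n x" for x
      using bump_on_eq_0[of x a b n] by (auto split: split_indicator)
    ultimately show ?thesis by (simp only: eq)
  qed
  have \<rho>_pos: "0 < (LINT x|lborel. \<rho> x)"
  proof -
    have "(LINT x|lborel. \<rho> x) \<noteq> 0"
    proof
      assume "(LINT x|lborel. \<rho> x) = 0"
      then have "AE x in lborel. \<rho> x = 0"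
        using integral_nonneg_eq_0_iff_AE[OF \<rho>_int] bump_on_bounds(1) by (simp add: \<rho>_def)
      then have "AE x in lborel. x \<notin> {- 2<..<- 1::real}"
      proof eventually_elim
        case (elim x)
        then show ?case using bump_on_pos[of x "- 2" "- 1" "Suc 0"] by (auto simp: \<rho>_def)
      qed
      then have "{- 2<..<- 1::real} \<in> null_sets lborel" by (subst AE_iff_null_sets) auto
      then show False by (simp add: null_sets_def)
    qed
    moreover have "0 \<le> (LINT x|lborel. \<rho> x)" by (simp add: \<rho>_def bump_on_bounds(1))
    ultimately show ?thesis by simp
  qed
  have "AE t in lborel. t < T \<longrightarrow> D t = 0"
  proof (rule AE_zero_of_bump_integrals[OF lD])
    fix a b :: real and n
    assume ab: "a < b" "b < T"
    \<comment> \<open>Makes \<omega> mean-free, hence the derivative of a test function.\<close>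
    define c where "c = (LINT x|lborel. bump_on a b (Suc n) x) / (LINT x|lborel. \<rho> x)"
    define \<omega> where "\<omega> x = bump_on a b (Suc n) x + (- c) * \<rho> x" for x
    have "\<omega> \<in> smooth_class"
      unfolding \<omega>_def[abs_def] \<rho>_def by (intro smooth_class.add smooth_class.cmult bump_on_smooth)
    moreover have "\<omega> x = 0" if "x \<notin> {min a (- 2)..max b (- 1)}" for x
    proof -
      have h: "x \<notin> {a<..<b}" "x \<notin> {- 2<..<- 1}" using that by auto
      show ?thesis by (simp add: \<omega>_def \<rho>_def bump_on_eq_0[OF h(1)] bump_on_eq_0[OF h(2)])
    qed
    moreover have "(LINT x|lborel. \<omega> x) = 0"
    proof -
      have "(LINT x|lborel. \<omega> x) = (LINT x|lborel. bump_on a b (Suc n) x) + (- c) * (LINT x|lborel. \<rho> x)"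
        unfolding \<omega>_def using \<rho>_int by (subst Bochner_Integration.integral_add) (auto simp: \<rho>_def)
      then show ?thesis using \<rho>_pos by (simp add: c_def)
    qed
    moreover have "min a (- 2) \<le> max b (- 1)" by linarith
    moreover have "max b (- 1) < T" using ab T by simp
    ultimately have "\<exists>\<phi>\<in>test_functions T. deriv \<phi> = \<omega>"
      by (intro test_function_antiderivative)
    then obtain \<phi> where \<phi>: "\<phi> \<in> test_functions T" "deriv \<phi> = \<omega>" by blast
    have eq: "indicator {..<T} t *\<^sub>R (bump_on a b (Suc n) t *\<^sub>R D t) = indicator {..<T} t *\<^sub>R (deriv \<phi> t *\<^sub>R D t)" for t
    proof (cases "t < 0")
      case False
      then have "\<rho> t = 0" unfolding \<rho>_def by (intro bump_on_eq_0) auto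
      then show ?thesis by (simp add: \<phi>(2) \<omega>_def)
    qed (simp add: D0)
    show "(LINT t:{..<T}|lebesgue. bump_on a b (Suc n) t *\<^sub>R D t) = 0"
      using test[OF \<phi>(1)] unfolding set_lebesgue_integral_def by (simp only: eq)
  qed
  then show ?thesis by (simp add: D_def)
qed

section \<open>Primitives as convolutions with the Heaviside function\<close>

lemma kern_1: "kern 1 x = (if 0 < x then 1 else 0)"
  by (simp add: kern_def)

lemma nconv_kern_1_le:
  "nconv (kern 1) h t \<le> (\<integral>\<^sup>+ s. h s \<partial>lborel)"
  unfolding nconv_def by (intro nn_integral_mono) (simp add: kern_1)

text \<open>After Fubini's theorem the inner integral runs over the derivative of the test function
  on (s, \<infinity>), which is - \<phi> s by compactness of the support.\<close>

lemma has_distributional_derivative_primitive: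
  fixes \<gamma> :: "real \<Rightarrow> 'a::{banach, second_countable_topology}"
  assumes \<gamma>: "integrable lborel \<gamma>"
  shows "has_distributional_derivative T (conv (kern 1) \<gamma>) \<gamma>"
proof -
  have gm[measurable]: "\<gamma> \<in> borel_measurable borel" using borel_measurable_integrable[OF \<gamma>] by simp
  let ?P = "conv (kern 1) \<gamma>"
  have Pm: "?P \<in> borel_measurable borel" by measurable
  have P_bound: "norm (?P t) \<le> (LINT s|lborel. norm (\<gamma> s))" for t
  proof -
    have "ennreal (norm (?P t)) \<le> (\<integral>\<^sup>+ s. ennreal (norm (\<gamma> s)) \<partial>lborel)"
      by (rule order_trans[OF norm_conv_le nconv_kern_1_le]) auto
    also have "\<dots> = ennreal (LINT s|lborel. norm (\<gamma> s))"
      using \<gamma> by (intro nn_integral_eq_integral) auto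
    finally show ?thesis by simp
  qed
  have "locally_integrable {..<T} \<gamma>"
    unfolding locally_integrable_def set_integrable_def
    using \<gamma> by (auto intro!: integrable_mult_indicator dest: lmeasurable_compact simp: integrable_completion)
  moreover have "locally_integrable {..<T} ?P"
    unfolding locally_integrable_def
  proof (intro allI impI)
    fix K :: "real set" assume "compact K \<and> K \<subseteq> {..<T}"
    then have K: "compact K" by simp
    have [measurable]: "K \<in> sets borel" using K by (simp add: borel_compact)
    have "integrable lborel (\<lambda>t. indicator K t *\<^sub>R ?P t)"
    proof (rule Bochner_Integration.integrable_bound[where f = "\<lambda>t. indicator K t *\<^sub>R (LINT s|lborel. norm (\<gamma> s))"])
      show "integrable lborel (\<lambda>t. indicator K t *\<^sub>R (LINT s|lborel. norm (\<gamma> s)))"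
        using emeasure_lborel_cbox_finite K by (intro borel_integrable_compact K continuous_intros)
      show "AE t in lborel. norm (indicator K t *\<^sub>R ?P t) \<le> norm (indicator K t *\<^sub>R (LINT s|lborel. norm (\<gamma> s)))"
        using P_bound by (intro AE_I2) (auto split: split_indicator intro: order_trans)
    qed measurable
    then show "set_integrable lebesgue K ?P"
      unfolding set_integrable_def by (subst integrable_completion) auto
  qed
  moreover have "- (LINT t:{..<T}|lebesgue. deriv \<phi> t *\<^sub>R ?P t) = (LINT t:{..<T}|lebesgue. \<phi> t *\<^sub>R \<gamma> t)"
    if \<phi>: "\<phi> \<in> test_functions T" for \<phi>
  proof -
    obtain K where K: "compact K" "K \<subseteq> {..<T}" "\<And>x. x \<notin> K \<Longrightarrow> \<phi> x = 0" "\<And>x. x \<notin> K \<Longrightarrow> deriv \<phi> x = 0"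
      "continuous_on UNIV \<phi>" "continuous_on UNIV (deriv \<phi>)" and D: "\<And>x. (\<phi> has_real_derivative deriv \<phi> x) (at x)"
      using test_functionD[OF \<phi>] by metis
    have [measurable]: "\<phi> \<in> borel_measurable borel" "deriv \<phi> \<in> borel_measurable borel"
      using K(5,6) by (auto intro: borel_measurable_continuous_onI)
    have \<phi>'_int: "integrable lborel (deriv \<phi>)"
    proof -
      have "integrable lborel (\<lambda>x. indicator K x *\<^sub>R deriv \<phi> x)"
        by (intro borel_integrable_compact K continuous_on_subset[OF K(6)]) auto
      moreover have eq: "indicator K x *\<^sub>R deriv \<phi> x = deriv \<phi> x" for x using K(4)[of x] by (auto split: split_indicator)
      ultimately show ?thesis by (simp only: eq)
    qed
    have inner: "(LINT t|lborel. deriv \<phi> t * kern 1 (t - s)) = - \<phi> s" for s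
    proof -
      \<comment> \<open>A point beyond both s and the support, where \<phi> vanishes.\<close>
      obtain R where R: "K \<subseteq> {..<R}" "s < R"
      proof -
        obtain B where "\<And>x. x \<in> K \<Longrightarrow> norm x \<le> B" using compact_imp_bounded[OF K(1)] by (auto simp: bounded_iff)
        then show ?thesis by (intro that[of "max B \<bar>s\<bar> + 1"]) force+
      qed
      have "(LINT t|lborel. deriv \<phi> t * kern 1 (t - s)) = (LINT t|lborel. deriv \<phi> t * indicator {s..R} t)"
      proof (rule integral_cong_AE)
        show "AE t in lborel. deriv \<phi> t * kern 1 (t - s) = deriv \<phi> t * indicator {s..R} t"
          using AE_lborel_singleton[of s]
        proof eventually_elim
          case (elim t)
          show ?case
          proof (cases "t \<in> K")
            case True
            then have "t < R" using R by auto
            then show ?thesis using elim by (auto simp: kern_1 split: split_indicator)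
          qed (simp add: K(4))
        qed
      qed measurable
      also have "\<dots> = \<phi> R - \<phi> s"
        by (rule integral_FTC_Icc_real) (use R D K(6) in \<open>auto simp: continuous_on_eq_continuous_at\<close>)
      also have "\<phi> R = 0" using R K(3) by blast
      finally show ?thesis by simp
    qed
    have int: "integrable (lborel \<Otimes>\<^sub>M lborel) (\<lambda>(t, s). (deriv \<phi> t * kern 1 (t - s)) *\<^sub>R \<gamma> s)"
    proof (rule integrableI_bounded)
      have "(\<integral>\<^sup>+ p. ennreal (norm (case p of (t, s) \<Rightarrow> (deriv \<phi> t * kern 1 (t - s)) *\<^sub>R \<gamma> s)) \<partial>(lborel \<Otimes>\<^sub>M lborel))
        \<le> (\<integral>\<^sup>+ p. (case p of (t, s) \<Rightarrow> ennreal (norm (deriv \<phi> t)) * ennreal (norm (\<gamma> s))) \<partial>(lborel \<Otimes>\<^sub>M lborel))"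
        by (intro nn_integral_mono) (auto simp: kern_1 ennreal_mult[symmetric] split: prod.split)
      also have "\<dots> = (\<integral>\<^sup>+ t. \<integral>\<^sup>+ s. ennreal (norm (deriv \<phi> t)) * ennreal (norm (\<gamma> s)) \<partial>lborel \<partial>lborel)"
        by (subst lborel.nn_integral_fst[symmetric]) auto
      also have "\<dots> = (\<integral>\<^sup>+ t. ennreal (norm (deriv \<phi> t)) \<partial>lborel) * (\<integral>\<^sup>+ s. ennreal (norm (\<gamma> s)) \<partial>lborel)"
        by (simp add: nn_integral_cmult nn_integral_multc)
      also have "\<dots> < \<infinity>" using \<phi>'_int \<gamma> by (auto simp: ennreal_mult_less_top integrable_iff_bounded)
      finally show "(\<integral>\<^sup>+ p. ennreal (norm (case p of (t, s) \<Rightarrow> (deriv \<phi> t * kern 1 (t - s)) *\<^sub>R \<gamma> s)) \<partial>(lborel \<Otimes>\<^sub>M lborel)) < \<infinity>" .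
    qed measurable
    have "(LINT t:{..<T}|lebesgue. deriv \<phi> t *\<^sub>R ?P t) = (LINT t|lborel. deriv \<phi> t *\<^sub>R ?P t)"
    proof -
      have eq: "indicator {..<T} t *\<^sub>R (deriv \<phi> t *\<^sub>R ?P t) = deriv \<phi> t *\<^sub>R ?P t" for t
        using K(2) K(4)[of t] by (auto split: split_indicator)
      show ?thesis unfolding set_lebesgue_integral_def eq by (rule integral_completion) measurable
    qed
    also have "\<dots> = (LINT t|lborel. LINT s|lborel. (deriv \<phi> t * kern 1 (t - s)) *\<^sub>R \<gamma> s)"
      unfolding conv_def by (simp flip: scaleR_scaleR)
    also have "\<dots> = (LINT s|lborel. LINT t|lborel. (deriv \<phi> t * kern 1 (t - s)) *\<^sub>R \<gamma> s)"
      by (rule lborel_pair.Fubini_integral[symmetric]) (rule int)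
    also have "\<dots> = (LINT s|lborel. - (\<phi> s *\<^sub>R \<gamma> s))"
    proof (rule Bochner_Integration.integral_cong[OF refl])
      fix s
      have i: "integrable lborel (\<lambda>t. deriv \<phi> t * kern 1 (t - s))"
        by (rule Bochner_Integration.integrable_bound[OF \<phi>'_int]) (auto simp: kern_1)
      show "(LINT t|lborel. (deriv \<phi> t * kern 1 (t - s)) *\<^sub>R \<gamma> s) = - (\<phi> s *\<^sub>R \<gamma> s)"
        using i by (subst integral_scaleR_left) (auto simp: inner)
    qed
    also have "\<dots> = - (LINT t:{..<T}|lebesgue. \<phi> t *\<^sub>R \<gamma> t)"
    proof -
      have eq: "indicator {..<T} t *\<^sub>R (\<phi> t *\<^sub>R \<gamma> t) = \<phi> t *\<^sub>R \<gamma> t" for t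
        using K(2) K(3)[of t] by (auto split: split_indicator)
      have "(LINT t:{..<T}|lebesgue. \<phi> t *\<^sub>R \<gamma> t) = (LINT t|lborel. \<phi> t *\<^sub>R \<gamma> t)"
        unfolding set_lebesgue_integral_def eq by (rule integral_completion) measurable
      then show ?thesis by simp
    qed
    finally show ?thesis by simp
  qed
  ultimately show ?thesis by (simp add: has_distributional_derivative_def)
qed

section \<open>The Caputo derivative and Abel inversion\<close>

text \<open>Below T the weight exp(T - s) is at least 1, which reduces integrability up to T to the
  Laplace transform identity.\<close>

lemma nn_integral_nconv_kern_finite:
  assumes a: "0 < a" and [measurable]: "h \<in> borel_measurable borel"
    and supp: "\<And>s. s \<le> 0 \<Longrightarrow> h s = 0" and fin: "(\<integral>\<^sup>+ s. h s \<partial>lborel) < \<infinity>"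
  shows "(\<integral>\<^sup>+ s. indicator {..<T} s * nconv (kern a) h s \<partial>lborel) < \<infinity>"
proof -
  have "(\<integral>\<^sup>+ s. indicator {..<T} s * nconv (kern a) h s \<partial>lborel)
    \<le> (\<integral>\<^sup>+ s. ennreal (exp T) * (ennreal (exp (- 1 * s)) * nconv (kern a) h s) \<partial>lborel)"
  proof (rule nn_integral_mono)
    fix s
    have "indicator {..<T} s \<le> ennreal (exp T) * ennreal (exp (- 1 * s))"
      by (auto simp: ennreal_mult[symmetric] exp_add[symmetric] split: split_indicator)
    then show "indicator {..<T} s * nconv (kern a) h s
      \<le> ennreal (exp T) * (ennreal (exp (- 1 * s)) * nconv (kern a) h s)"
      unfolding mult.assoc[symmetric] by (rule mult_right_mono) simp
  qed
  also have "\<dots> = ennreal (exp T) * (\<integral>\<^sup>+ s. ennreal (exp (- 1 * s)) * nconv (kern a) h s \<partial>lborel)"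
    by (rule nn_integral_cmult) measurable
  also have "\<dots> = ennreal (exp T) * (\<integral>\<^sup>+ s. ennreal (exp (- 1 * s)) * h s \<partial>lborel)"
    by (subst nn_integral_exp_nconv_kern) (use a in auto)
  also have "\<dots> < \<infinity>"
    using le_less_trans[OF nn_integral_exp_le[of h 1, OF supp] fin] by (simp add: ennreal_mult_less_top)
  finally show ?thesis .
qed

lemma has_distributional_derivative_cong:
  assumes F: "\<And>t. t < T \<Longrightarrow> F t = F' t" and d: "has_distributional_derivative T F G"
  shows "has_distributional_derivative T F' G"
proof -
  have eq: "indicator K t *\<^sub>R F t = indicator K t *\<^sub>R F' t" if "K \<subseteq> {..<T}" for K t
    using F[of t] that by (auto split: split_indicator)
  have eq': "indicator {..<T} t *\<^sub>R (r *\<^sub>R F t) = indicator {..<T} t *\<^sub>R (r *\<^sub>R F' t)" for t r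
    using F[of t] by (auto split: split_indicator)
  have "set_integrable lebesgue K F = set_integrable lebesgue K F'" if "K \<subseteq> {..<T}" for K
    unfolding set_integrable_def by (simp only: eq[OF that])
  moreover have "(LINT t:{..<T}|lebesgue. deriv \<phi> t *\<^sub>R F t) = (LINT t:{..<T}|lebesgue. deriv \<phi> t *\<^sub>R F' t)" for \<phi>
    unfolding set_lebesgue_integral_def by (simp only: eq')
  ultimately show ?thesis using d by (simp add: has_distributional_derivative_def locally_integrable_def)
qed

text \<open>Passes from the Lebesgue integral of the definition, whose integrand is known almost
  everywhere on (0,T), to a Borel convolution. The kernel of exponent 1 - a is r^(-a) / Gamma(1 -
  a).\<close>

lemma caputo_primitive_eq_conv:
  fixes w :: "real \<Rightarrow> 'a::{banach, second_countable_topology}"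
  assumes a: "0 < a" "a < 1" and t: "t < T"
    and W: "(\<lambda>s. indicator {0<..<T} s *\<^sub>R (w s - w0)) \<in> borel_measurable lebesgue"
    and h[measurable]: "h \<in> borel_measurable borel" and supp: "\<And>s. s \<le> 0 \<Longrightarrow> h s = 0"
    and eq: "AE s in lborel. s \<in> {0<..<T} \<longrightarrow> w s - w0 = h s"
  shows "caputo_primitive a w w0 t = conv (kern (1 - a)) h t"
proof (cases "t < 0")
  case True
  then show ?thesis using conv_kern_eq_0[of h t "1 - a", OF supp] by (simp add: caputo_primitive_def)
next
  case False
  let ?r = "\<lambda>s. indicator {0..t} s * (t - s) powr (- a)"
  have G: "0 < Gamma (1 - a)" using a by simp
  have rm: "?r \<in> borel_measurable lebesgue" by (rule borel_measurable_lebesgueI) measurable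
  \<comment> \<open>Measurability is known on the open interval (0,T); the endpoint 0 of the domain
    of integration becomes a separate term.\<close>
  have split: "(\<lambda>s. ?r s *\<^sub>R (w s - w0)) = (\<lambda>s. ?r s *\<^sub>R (indicator {0<..<T} s *\<^sub>R (w s - w0)) + indicator {0} s *\<^sub>R (?r 0 *\<^sub>R (w 0 - w0)))"
    using t False by (intro ext) (auto split: split_indicator)
  have hm: "(\<lambda>s. Gamma (1 - a) *\<^sub>R (kern (1 - a) (t - s) *\<^sub>R h s)) \<in> borel_measurable borel" by measurable
  have "(LINT s:{0..t}|lebesgue. (t - s) powr (- a) *\<^sub>R (w s - w0)) = (LINT s|lebesgue. ?r s *\<^sub>R (w s - w0))"
    unfolding set_lebesgue_integral_def by simp
  also have "\<dots> = (LINT s|lebesgue. Gamma (1 - a) *\<^sub>R (kern (1 - a) (t - s) *\<^sub>R h s))"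
  proof (rule integral_cong_AE)
    show "(\<lambda>s. ?r s *\<^sub>R (w s - w0)) \<in> borel_measurable lebesgue"
      unfolding split by (intro borel_measurable_add borel_measurable_scaleR rm W borel_measurable_const borel_measurable_indicator) simp
    have "AE s in lborel. (s \<in> {0<..<T} \<longrightarrow> w s - w0 = h s) \<and> s \<noteq> 0"
      using eq AE_lborel_singleton[of "0::real"] by eventually_elim auto
    then have "AE s in lebesgue. (s \<in> {0<..<T} \<longrightarrow> w s - w0 = h s) \<and> s \<noteq> 0" by (simp add: AE_completion_iff)
    then show "AE s in lebesgue. ?r s *\<^sub>R (w s - w0) = Gamma (1 - a) *\<^sub>R (kern (1 - a) (t - s) *\<^sub>R h s)"
    proof eventually_elim
      case (elim s)
      consider "s < 0" | "t \<le> s" | "0 < s" "s < t" using elim by linarith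
      then show ?case
      proof cases
        case 3
        then have "w s - w0 = h s" using elim t by auto
        then show ?thesis using 3 G by (simp add: kern_def)
      qed (use supp[of s] in \<open>auto split: split_indicator\<close>)
    qed
  qed (rule borel_measurable_lebesgueI[OF hm])
  also have "\<dots> = (LINT s|lborel. Gamma (1 - a) *\<^sub>R (kern (1 - a) (t - s) *\<^sub>R h s))"
    by (rule integral_completion) (use hm in simp)
  also have "\<dots> = Gamma (1 - a) *\<^sub>R conv (kern (1 - a)) h t"
    unfolding conv_def by (rule integral_scaleR_right)
  finally show ?thesis using False G by (simp add: caputo_primitive_def)
qed

text \<open>The kernel identity \<open>nconv_kern_conjugate\<close> inserted into associativity.
  Convolution of an integrable function with \<open>kern 1\<close> is finite everywhere, so both
  claims hold at every t.\<close>

lemma conv_kern_conjugate: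
  fixes \<gamma> :: "real \<Rightarrow> 'a::{banach, second_countable_topology}"
  assumes a: "0 < a" "a < 1" and \<gamma>: "integrable lborel \<gamma>"
  shows "conv (kern (1 - a)) (conv (kern a) \<gamma>) t = conv (kern 1) \<gamma> t"
    and "nconv (kern (1 - a)) (\<lambda>s. ennreal (norm (conv (kern a) \<gamma> s))) t < \<infinity>"
proof -
  have [measurable]: "\<gamma> \<in> borel_measurable borel" using borel_measurable_integrable[OF \<gamma>] by simp
  have "(\<integral>\<^sup>+ s. ennreal (norm (\<gamma> s)) \<partial>lborel) < \<infinity>" using \<gamma> by (simp add: integrable_iff_bounded)
  then have fin: "nconv (kern 1) (\<lambda>s. ennreal (norm (\<gamma> s))) t < \<infinity>" by (rule le_less_trans[OF nconv_kern_1_le])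
  show "conv (kern (1 - a)) (conv (kern a) \<gamma>) t = conv (kern 1) \<gamma> t"
    by (rule conv_assoc) (use a fin nconv_kern_conjugate in auto)
  have "nconv (kern (1 - a)) (\<lambda>s. ennreal (norm (conv (kern a) \<gamma> s))) t
    \<le> nconv (kern (1 - a)) (nconv (kern a) (\<lambda>s. ennreal (norm (\<gamma> s)))) t"
    by (intro nconv_mono norm_conv_le) (use a in auto)
  also have "\<dots> = nconv (kern 1) (\<lambda>s. ennreal (norm (\<gamma> s))) t"
    by (rule nconv_assoc) (use a nconv_kern_conjugate in auto)
  finally show "nconv (kern (1 - a)) (\<lambda>s. ennreal (norm (conv (kern a) \<gamma> s))) t < \<infinity>" using fin by simp
qed

text \<open>Convolving with the conjugate kernel turns the fractional integral of g into its
  ordinary primitive, which starts from 0, so no atom arises there.\<close>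

lemma has_caputo_derivative_conv:
  fixes g :: "real \<Rightarrow> 'a::{banach, second_countable_topology}"
  assumes a: "0 < a" "a < 1" and g: "integrable lborel g" and supp: "\<And>s. s \<le> 0 \<Longrightarrow> g s = 0"
    and loc: "locally_integrable {0..<T} (\<lambda>t. u0 + conv (kern a) g t)"
  shows "has_caputo_derivative a T (\<lambda>t. u0 + conv (kern a) g t) u0 g"
proof -
  have [measurable]: "g \<in> borel_measurable borel" using borel_measurable_integrable[OF g] by simp
  have "conv (kern 1) g t = caputo_primitive a (\<lambda>t. u0 + conv (kern a) g t) u0 t" if "t < T" for t
  proof -
    have "caputo_primitive a (\<lambda>t. u0 + conv (kern a) g t) u0 t = conv (kern (1 - a)) (conv (kern a) g) t"
    proof (rule caputo_primitive_eq_conv[OF a that])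
      show "(\<lambda>s. indicator {0<..<T} s *\<^sub>R (u0 + conv (kern a) g s - u0)) \<in> borel_measurable lebesgue"
        by (rule borel_measurable_lebesgueI) measurable
    qed (use conv_kern_eq_0[OF supp] in auto)
    then show ?thesis using conv_kern_conjugate(1)[OF a g] by simp
  qed
  from has_distributional_derivative_cong[OF this has_distributional_derivative_primitive[OF g]]
  have "has_distributional_derivative T (caputo_primitive a (\<lambda>t. u0 + conv (kern a) g t) u0) g" .
  moreover have "(\<lambda>t. if t < 0 then 0 else g t) = g" using supp by auto
  ultimately show ?thesis using loc by (simp add: has_caputo_derivative_def)
qed

lemma has_caputo_derivative_unique:
  assumes "has_caputo_derivative a T w w0 g1" "has_caputo_derivative a T w w0 g2"
  shows "AE t in lborel. t \<in> {0<..<T} \<longrightarrow> g1 t = g2 t"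
proof -
  have "AE t in lborel. t < T \<longrightarrow> (if t < 0 then 0 else g1 t) = (if t < 0 then 0 else g2 t)"
    using assms unfolding has_caputo_derivative_def by (intro distributional_derivative_unique) blast+
  then show ?thesis by eventually_elim auto
qed

text \<open>One more convolution, with the conjugate kernel, turns the hypothesis into vanishing
  integrals of p over all half-lines.\<close>

lemma AE_zero_of_conv_kern:
  fixes p :: "real \<Rightarrow> 'a::{banach, second_countable_topology}"
  assumes a: "0 < a" "a < 1" and p: "integrable lborel p" and supp: "\<And>s. T \<le> s \<Longrightarrow> p s = 0"
    and z: "AE t in lborel. t < T \<longrightarrow> conv (kern a) p t = 0"
  shows "AE t in lborel. p t = 0"
proof (rule AE_zero_of_integral_atMost[OF p])
  fix x
  have pm[measurable]: "p \<in> borel_measurable borel" using borel_measurable_integrable[OF p] by simp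
  have "(\<integral>\<^sup>+ s. ennreal (norm (p s)) \<partial>lborel) < \<infinity>" using p by (simp add: integrable_iff_bounded)
  then have fin: "nconv (kern 1) (\<lambda>s. ennreal (norm (p s))) t < \<infinity>" for t by (rule le_less_trans[OF nconv_kern_1_le])
  have c: "nconv (kern (1 - a)) (\<lambda>s. ennreal (kern a s)) y = ennreal (kern 1 y)" for y by (rule nconv_kern_conjugate[OF a])
  \<comment> \<open>The hypothesis reaches up to T, and beyond T the integral of p no longer
    changes.\<close>
  let ?y = "min x T"
  have "(LINT t:{..x}|lborel. p t) = conv (kern 1) p ?y"
    unfolding conv_def set_lebesgue_integral_def
  proof (rule integral_cong_AE)
    show "AE t in lborel. indicator {..x} t *\<^sub>R p t = kern 1 (?y - t) *\<^sub>R p t"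
      using AE_lborel_singleton[of x] by eventually_elim (auto simp: kern_1 supp min_def split: split_indicator if_splits)
  qed measurable
  also have "\<dots> = conv (kern (1 - a)) (conv (kern a) p) ?y"
    by (rule conv_assoc[symmetric]) (use a fin c in auto)
  also have "\<dots> = 0"
    unfolding conv_def[of "kern (1 - a)"]
  proof (rule integral_eq_zero_AE)
    show "AE s in lborel. kern (1 - a) (?y - s) *\<^sub>R conv (kern a) p s = 0"
      using z by eventually_elim (use a in auto)
  qed
  finally show "(LINT t:{..x}|lborel. p t) = 0" .
qed

section \<open>Borel versions and the convolution form of a Caputo derivative\<close>

lemma borel_version_on:
  fixes w :: "real \<Rightarrow> 'a::{banach, second_countable_topology}"
  assumes w: "w \<in> borel_measurable (lebesgue_on {0<..<T})"
  obtains w' where "w' \<in> borel_measurable borel" "\<And>s. s \<notin> {0<..<T} \<Longrightarrow> w' s = 0"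
    "AE s in lborel. s \<in> {0<..<T} \<longrightarrow> w s = w' s"
proof -
  have "(\<lambda>s. indicator {0<..<T} s *\<^sub>R w s) \<in> borel_measurable lebesgue"
    using w by (subst (asm) borel_measurable_restrict_space_iff) auto
  then obtain f where f[measurable]: "f \<in> borel_measurable borel" and eq: "AE s in lborel. indicator {0<..<T} s *\<^sub>R w s = f s"
    by (rule borel_version)
  show ?thesis
  proof (rule that[of "\<lambda>s. indicator {0<..<T} s *\<^sub>R f s"])
    show "AE s in lborel. s \<in> {0<..<T} \<longrightarrow> w s = indicator {0<..<T} s *\<^sub>R f s"
      using eq by eventually_elim auto
  qed auto
qed

lemma nn_integral_L1_of_L2:
  fixes h :: "real \<Rightarrow> 'a::{banach, second_countable_topology}"
  assumes [measurable]: "h \<in> borel_measurable borel" and supp: "\<And>s. s \<notin> {0<..<T} \<Longrightarrow> h s = 0"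
    and fin: "(\<integral>\<^sup>+ s. ennreal ((norm (h s))\<^sup>2) \<partial>lborel) < \<infinity>"
  shows "(\<integral>\<^sup>+ s. ennreal (norm (h s)) \<partial>lborel) < \<infinity>"
proof -
  have "(\<integral>\<^sup>+ s. ennreal (norm (h s)) \<partial>lborel)
    \<le> (\<integral>\<^sup>+ s. indicator {0<..<T} s + ennreal ((norm (h s))\<^sup>2) \<partial>lborel)"
  proof (rule nn_integral_mono)
    fix s
    have "norm (h s) \<le> 1 + (norm (h s))\<^sup>2"
      using zero_le_power2[of "norm (h s) - 1 / 2"] by (simp add: power2_eq_square algebra_simps)
    then have "ennreal (norm (h s)) \<le> 1 + ennreal ((norm (h s))\<^sup>2)"
      by (simp flip: ennreal_1 ennreal_plus)
    then show "ennreal (norm (h s)) \<le> indicator {0<..<T} s + ennreal ((norm (h s))\<^sup>2)"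
      using supp[of s] by (auto split: split_indicator)
  qed
  also have "\<dots> = emeasure lborel {0<..<T} + (\<integral>\<^sup>+ s. ennreal ((norm (h s))\<^sup>2) \<partial>lborel)"
    by (subst nn_integral_add) auto
  also have "\<dots> < \<infinity>" using fin emeasure_bounded_finite[of "{0<..<T}"] by simp
  finally show ?thesis .
qed

lemma L2_space_borel_version:
  fixes w :: "real \<Rightarrow> 'a::{banach, second_countable_topology}"
  assumes w: "w \<in> L2_space T"
  obtains w' where "w' \<in> borel_measurable borel" "\<And>s. s \<notin> {0<..<T} \<Longrightarrow> w' s = 0"
    "AE s in lborel. s \<in> {0<..<T} \<longrightarrow> w s = w' s" "(\<integral>\<^sup>+ s. ennreal ((norm (w' s))\<^sup>2) \<partial>lborel) < \<infinity>"
    "integrable lborel w'"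
proof -
  have wm: "w \<in> borel_measurable (lebesgue_on {0<..<T})" using w by (simp add: L2_space_def)
  obtain w' where w': "w' \<in> borel_measurable borel" "\<And>s. s \<notin> {0<..<T} \<Longrightarrow> w' s = 0"
    "AE s in lborel. s \<in> {0<..<T} \<longrightarrow> w s = w' s"
    using borel_version_on[OF wm] by metis
  have int: "integrable lebesgue (\<lambda>t. indicator {0<..<T} t *\<^sub>R (norm (w t))\<^sup>2)"
    using w by (simp add: L2_space_def integrable_restrict_space)
  have "(\<integral>\<^sup>+ s. ennreal ((norm (w' s))\<^sup>2) \<partial>lborel) = (\<integral>\<^sup>+ s. ennreal ((norm (w' s))\<^sup>2) \<partial>lebesgue)"
    using w'(1) by (simp add: nn_integral_completion)
  also have "\<dots> = (\<integral>\<^sup>+ s. ennreal (norm (indicator {0<..<T} s *\<^sub>R (norm (w s))\<^sup>2)) \<partial>lebesgue)"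
  proof (rule nn_integral_cong_AE)
    have "AE s in lebesgue. s \<in> {0<..<T} \<longrightarrow> w s = w' s" using w'(3) by (simp add: AE_completion_iff)
    then show "AE s in lebesgue. ennreal ((norm (w' s))\<^sup>2) = ennreal (norm (indicator {0<..<T} s *\<^sub>R (norm (w s))\<^sup>2))"
      by eventually_elim (use w'(2) in \<open>auto split: split_indicator\<close>)
  qed
  also have "\<dots> < \<infinity>" using int by (simp add: integrable_iff_bounded)
  finally have fin: "(\<integral>\<^sup>+ s. ennreal ((norm (w' s))\<^sup>2) \<partial>lborel) < \<infinity>" .
  have "integrable lborel w'"
    unfolding integrable_iff_bounded using nn_integral_L1_of_L2[OF w'(1,2) fin] w'(1) by simp
  with w' fin show ?thesis by (rule that)
qed

text \<open>Equal distributional derivatives give equal primitives, that is, v - u0 and the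
  fractional integral of \<gamma> have the same convolution with the kernel of exponent 1 - a.
  Injectivity of that convolution removes it.\<close>

lemma caputo_derivative_representation:
  fixes v :: "real \<Rightarrow> 'a::{banach, second_countable_topology}"
  assumes a: "0 < a" "a < 1" and T: "0 < T" and v: "v \<in> L2_space T" and g: "g \<in> L2_space T"
    and d: "has_caputo_derivative a T v u0 g"
  obtains \<gamma> where "\<gamma> \<in> borel_measurable borel" "\<And>s. s \<notin> {0<..<T} \<Longrightarrow> \<gamma> s = 0"
    "(\<integral>\<^sup>+ s. ennreal ((norm (\<gamma> s))\<^sup>2) \<partial>lborel) < \<infinity>"
    "AE s in lborel. s \<in> {0<..<T} \<longrightarrow> g s = \<gamma> s"
    "AE s in lborel. s \<in> {0<..<T} \<longrightarrow> v s = u0 + conv (kern a) \<gamma> s"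
proof -
  obtain \<gamma> where \<gamma>: "\<gamma> \<in> borel_measurable borel" "\<And>s. s \<notin> {0<..<T} \<Longrightarrow> \<gamma> s = 0"
    "AE s in lborel. s \<in> {0<..<T} \<longrightarrow> g s = \<gamma> s" "(\<integral>\<^sup>+ s. ennreal ((norm (\<gamma> s))\<^sup>2) \<partial>lborel) < \<infinity>"
    "integrable lborel \<gamma>"
    by (rule L2_space_borel_version[OF g]) (rule that)
  obtain v' where v': "v' \<in> borel_measurable borel" "\<And>s. s \<notin> {0<..<T} \<Longrightarrow> v' s = 0"
    "AE s in lborel. s \<in> {0<..<T} \<longrightarrow> v s = v' s" "integrable lborel v'"
    by (rule L2_space_borel_version[OF v]) (rule that)
  note [measurable] = \<gamma>(1) v'(1)
  define h where "h s = v' s - indicator {0<..<T} s *\<^sub>R u0" for s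
  have h[measurable]: "h \<in> borel_measurable borel" unfolding h_def[abs_def] by measurable
  have hi: "integrable lborel h" unfolding h_def[abs_def]
    by (intro Bochner_Integration.integrable_diff v'(4) integrable_scaleR_left integrable_real_indicator)
      (use emeasure_bounded_finite[of "{0<..<T}"] in auto)
  have hs: "h s = 0" if "s \<notin> {0<..<T}" for s using that v'(2) by (simp add: h_def)
  have b: "0 < 1 - a" "1 - a < 1" using a by auto
  let ?q = "conv (kern a) \<gamma>"
  have W: "(\<lambda>s. indicator {0<..<T} s *\<^sub>R (v s - u0)) \<in> borel_measurable lebesgue"
  proof -
    have "(\<lambda>s. v s - u0) \<in> borel_measurable (lebesgue_on {0<..<T})"
      using v by (auto simp: L2_space_def)
    then show ?thesis by (subst (asm) borel_measurable_restrict_space_iff) auto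
  qed
  have "AE t in lborel. t < T \<longrightarrow> caputo_primitive a v u0 t = conv (kern 1) \<gamma> t"
  proof (rule distributional_primitive_unique[OF _ has_distributional_derivative_primitive[OF \<gamma>(5)] _ _ T])
    show "has_distributional_derivative T (caputo_primitive a v u0) (\<lambda>t. if t < 0 then 0 else g t)"
      using d by (simp add: has_caputo_derivative_def)
    show "AE t in lborel. t < T \<longrightarrow> (if t < 0 then 0 else g t) = \<gamma> t"
      using \<gamma>(3) AE_lborel_singleton[of "0::real"] by eventually_elim (use \<gamma>(2) in auto)
    show "caputo_primitive a v u0 t = conv (kern 1) \<gamma> t" if "t < 0" for t
      using conv_kern_eq_0[of \<gamma> t 1] \<gamma>(2) that by (simp add: caputo_primitive_def)
  qed
  moreover have prim: "caputo_primitive a v u0 t = conv (kern (1 - a)) h t" if "t < T" for t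
  proof (rule caputo_primitive_eq_conv[OF a that W h])
    show "AE s in lborel. s \<in> {0<..<T} \<longrightarrow> v s - u0 = h s"
      using v'(3) by eventually_elim (auto simp: h_def)
  qed (use hs in auto)
  ultimately have e: "AE t in lborel. t < T \<longrightarrow> conv (kern (1 - a)) h t = conv (kern (1 - a)) ?q t"
    by (auto elim!: eventually_mono simp: conv_kern_conjugate(1)[OF a \<gamma>(5)])
  \<comment> \<open>The fractional integral of \<gamma> does not stop at T and need not be
    integrable at infinity, hence the cutoff; by causality it does not affect convolutions at times
    below T.\<close>
  define p where "p s = h s - indicator {..<T} s *\<^sub>R ?q s" for s
  have qi: "integrable lborel (\<lambda>s. indicator {..<T} s *\<^sub>R ?q s)"
  proof (rule integrableI_bounded)
    have "(\<integral>\<^sup>+ s. ennreal (norm (indicator {..<T} s *\<^sub>R ?q s)) \<partial>lborel)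
      \<le> (\<integral>\<^sup>+ s. indicator {..<T} s * nconv (kern a) (\<lambda>s. ennreal (norm (\<gamma> s))) s \<partial>lborel)"
    proof (rule nn_integral_mono)
      fix s
      show "ennreal (norm (indicator {..<T} s *\<^sub>R ?q s)) \<le> indicator {..<T} s * nconv (kern a) (\<lambda>s. ennreal (norm (\<gamma> s))) s"
        using norm_conv_le[OF kern_measurable \<gamma>(1), of a s] a by (auto split: split_indicator)
    qed
    also have "\<dots> < \<infinity>"
      by (rule nn_integral_nconv_kern_finite) (use a \<gamma>(2,5) in \<open>auto simp: integrable_iff_bounded\<close>)
    finally show "(\<integral>\<^sup>+ s. ennreal (norm (indicator {..<T} s *\<^sub>R ?q s)) \<partial>lborel) < \<infinity>" .
  qed measurable
  have "AE t in lborel. p t = 0"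
  proof (rule AE_zero_of_conv_kern[OF b])
    show "integrable lborel p" unfolding p_def[abs_def] by (intro Bochner_Integration.integrable_diff hi qi)
    show "T \<le> s \<Longrightarrow> p s = 0" for s by (simp add: p_def hs)
    have "AE t in lborel. nconv (kern (1 - a)) (\<lambda>s. ennreal (norm (h s))) t < \<infinity>"
      by (rule AE_nconv_kern_finite) (use b hs hi in \<open>auto simp: integrable_iff_bounded\<close>)
    with e show "AE t in lborel. t < T \<longrightarrow> conv (kern (1 - a)) p t = 0"
    proof eventually_elim
      case (elim t)
      show ?case
      proof
        assume t: "t < T"
        have "conv (kern (1 - a)) p t = conv (kern (1 - a)) (\<lambda>s. h s - ?q s) t"
          unfolding conv_def[of "kern (1 - a)"]
        proof (rule Bochner_Integration.integral_cong[OF refl])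
          fix s
          show "kern (1 - a) (t - s) *\<^sub>R p s = kern (1 - a) (t - s) *\<^sub>R (h s - ?q s)"
            using t by (cases "s < t") (auto simp: p_def)
        qed
        also have "\<dots> = conv (kern (1 - a)) h t - conv (kern (1 - a)) ?q t"
          by (rule conv_diff) (use b elim conv_kern_conjugate(2)[OF a \<gamma>(5)] in auto)
        finally show "conv (kern (1 - a)) p t = 0" using elim t by simp
      qed
    qed
  qed
  with v'(3) have "AE s in lborel. s \<in> {0<..<T} \<longrightarrow> v s = u0 + ?q s"
    by eventually_elim (auto simp: p_def h_def algebra_simps)
  then show ?thesis using \<gamma> by (intro that[of \<gamma>]) auto
qed

section \<open>Uniqueness for the abstract inclusion\<close>

context gradient_flow
begin

text \<open>An arbitrary energy solution has a derivative in L^2 only, so the chain inequality is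
  available at almost every time and no supremum is known to be finite. The Laplace-weighted
  integral Y of the squared difference is finite and satisfies Y \<le> Y / 2.\<close>

lemma solution_unique:
  assumes [measurable]: "\<gamma>1 \<in> borel_measurable borel" "\<gamma>2 \<in> borel_measurable borel"
    and supp: "\<And>s. s \<notin> I \<Longrightarrow> \<gamma>1 s = 0" "\<And>s. s \<notin> I \<Longrightarrow> \<gamma>2 s = 0"
    and fin: "(\<integral>\<^sup>+ s. ennreal ((norm (\<gamma>1 s))\<^sup>2) \<partial>lborel) < \<infinity>" "(\<integral>\<^sup>+ s. ennreal ((norm (\<gamma>2 s))\<^sup>2) \<partial>lborel) < \<infinity>"
    and incl: "AE t in lborel. t \<in> I \<longrightarrow> \<Theta> t (u0 + conv \<kappa> \<gamma>1 t) - \<gamma>1 t \<in> subdifferential \<Phi> (u0 + conv \<kappa> \<gamma>1 t)"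
      "AE t in lborel. t \<in> I \<longrightarrow> \<Theta> t (u0 + conv \<kappa> \<gamma>2 t) - \<gamma>2 t \<in> subdifferential \<Phi> (u0 + conv \<kappa> \<gamma>2 t)"
  shows "AE t in lborel. t \<in> I \<longrightarrow> conv \<kappa> \<gamma>1 t = conv \<kappa> \<gamma>2 t"
proof -
  define p where "p s = \<gamma>1 s - \<gamma>2 s" for s
  define w where "w = conv \<kappa> p"
  define y where "y s = ennreal ((norm (w s))\<^sup>2) * indicator I s" for s
  have p[measurable]: "p \<in> borel_measurable borel" unfolding p_def[abs_def] by measurable
  have w[measurable]: "w \<in> borel_measurable borel" unfolding w_def by measurable
  have y[measurable]: "y \<in> borel_measurable borel" unfolding y_def[abs_def] by measurable
  have ps: "p s = 0" if "s \<notin> I" for s using that supp by (simp add: p_def)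
  let ?P = "\<lambda>s. ennreal ((norm (p s))\<^sup>2)"
  have pfin: "(\<integral>\<^sup>+ s. ?P s \<partial>lborel) < \<infinity>"
  proof -
    have "(\<integral>\<^sup>+ s. ?P s \<partial>lborel)
      \<le> (\<integral>\<^sup>+ s. ennreal 2 * ennreal ((norm (\<gamma>1 s))\<^sup>2) + ennreal 2 * ennreal ((norm (\<gamma>2 s))\<^sup>2) \<partial>lborel)"
      by (intro nn_integral_mono)
        (simp only: p_def ennreal_mult'[symmetric] ennreal_plus[symmetric] zero_le_numeral zero_le_power2 mult_nonneg_nonneg ennreal_leI norm_diff_square_le)
    also have "\<dots> = ennreal 2 * (\<integral>\<^sup>+ s. ennreal ((norm (\<gamma>1 s))\<^sup>2) \<partial>lborel) + ennreal 2 * (\<integral>\<^sup>+ s. ennreal ((norm (\<gamma>2 s))\<^sup>2) \<partial>lborel)"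
      by (simp add: nn_integral_add nn_integral_cmult)
    also have "\<dots> < \<infinity>" using fin by (simp add: ennreal_mult_less_top)
    finally show ?thesis .
  qed
  have P0: "?P s = 0" if "s \<le> 0" for s using ps[of s] that by simp
  have expfin: "(\<integral>\<^sup>+ s. ennreal (exp (- \<mu> * s)) * ?P s \<partial>lborel) < \<infinity>" if "0 \<le> \<mu>" for \<mu>
    by (rule le_less_trans[OF nn_integral_exp_le pfin]) (use P0 that in auto)
  have g1: "AE t in lborel. nconv \<kappa> (\<lambda>s. ennreal (norm (\<gamma>1 s))) t < \<infinity>"
    by (rule AE_nconv_kern_finite) (use \<alpha> supp nn_integral_L1_of_L2[OF _ supp(1) fin(1)] in auto)
  have g2: "AE t in lborel. nconv \<kappa> (\<lambda>s. ennreal (norm (\<gamma>2 s))) t < \<infinity>"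
    by (rule AE_nconv_kern_finite) (use \<alpha> supp nn_integral_L1_of_L2[OF _ supp(2) fin(2)] in auto)
  have w_eq: "AE t in lborel. w t = conv \<kappa> \<gamma>1 t - conv \<kappa> \<gamma>2 t"
    using g1 g2
  proof eventually_elim
    case (elim t)
    then show ?case unfolding w_def p_def[abs_def] by (intro conv_diff) (use \<alpha> in auto)
  qed
  \<comment> \<open>Monotonicity removes the subgradients and leaves the Lipschitz term.\<close>
  have pw: "AE s in lborel. ennreal (inner (p s) (w s)) \<le> ennreal L * y s"
    using incl w_eq
  proof eventually_elim
    case (elim s)
    show ?case
    proof (cases "s \<in> I")
      case True
      let ?x1 = "u0 + conv \<kappa> \<gamma>1 s" and ?x2 = "u0 + conv \<kappa> \<gamma>2 s"
      have d: "?x1 - ?x2 = w s" using elim by simp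
      have "0 \<le> inner ((\<Theta> s ?x1 - \<gamma>1 s) - (\<Theta> s ?x2 - \<gamma>2 s)) (?x1 - ?x2)"
        using elim True by (intro subdifferential_monotone) auto
      also have "(\<Theta> s ?x1 - \<gamma>1 s) - (\<Theta> s ?x2 - \<gamma>2 s) = (\<Theta> s ?x1 - \<Theta> s ?x2) - p s" by (simp add: p_def)
      finally have "inner (p s) (w s) \<le> inner (\<Theta> s ?x1 - \<Theta> s ?x2) (w s)" unfolding d by (simp add: inner_diff_left)
      also have "\<dots> \<le> norm (\<Theta> s ?x1 - \<Theta> s ?x2) * norm (w s)" by (rule norm_cauchy_schwarz)
      also have "\<dots> \<le> (L * norm (w s)) * norm (w s)"
        by (rule mult_right_mono) (use \<Theta>_Lip[of s ?x1 ?x2] in \<open>simp_all only: d norm_ge_zero\<close>)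
      finally have "inner (p s) (w s) \<le> L * (norm (w s))\<^sup>2" by (simp add: power2_eq_square mult.assoc)
      then show ?thesis using True L by (simp add: y_def ennreal_mult[symmetric] ennreal_leI)
    qed (simp add: ps)
  qed
  have f1: "AE t in lborel. nconv \<kappa> ?P t < \<infinity>"
    by (rule AE_nconv_kern_finite) (use \<alpha> P0 pfin in auto)
  have f2: "AE t in lborel. nconv \<kappa> (nconv \<kappa> ?P) t < \<infinity>"
  proof (rule AE_nconv_kern_finite_weighted)
    have "(\<integral>\<^sup>+ s. ennreal (exp (- 1 * s)) * nconv \<kappa> ?P s \<partial>lborel) = ennreal (1 powr (- \<alpha>)) * (\<integral>\<^sup>+ s. ennreal (exp (- 1 * s)) * ?P s \<partial>lborel)"
      by (rule nn_integral_exp_nconv_kern) (use \<alpha> in auto)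
    also have "\<dots> < \<infinity>" using expfin[of 1] by (simp add: ennreal_mult_less_top)
    finally show "(\<integral>\<^sup>+ s. ennreal (exp (- 1 * s)) * nconv \<kappa> ?P s \<partial>lborel) < \<infinity>" .
  qed (use \<alpha> in measurable)
  have ineq: "AE t in lborel. y t \<le> ennreal (2 * L) * nconv \<kappa> y t"
    using f1 f2
  proof eventually_elim
    case (elim t)
    let ?F = "\<lambda>x::'a. (norm x)\<^sup>2 / 2"
    have grad: "?F x + inner x (z - x) \<le> ?F z" for x z :: 'a
      using zero_le_power2[of "norm (x - z)"] by (simp add: power2_norm_eq_inner inner_diff inner_commute field_simps)
    have e: "(\<lambda>s. (ennreal (norm (p s)))\<^sup>2) = ?P" by (simp add: ennreal_power)
    note fc = fractional_chain[where a = \<alpha> and T = T and g = p and F = ?F and A = "\<lambda>x. x" and \<Lambda> = 1 and t = t and ?u0.0 = "0::'a",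
        OF \<alpha> T p ps grad, unfolded e]
    have int: "integrable lborel (\<lambda>s. \<kappa> (t - s) *\<^sub>R inner (p s) (w s))"
      using fc(1) elim by (simp add: w_def)
    have "(norm (w t))\<^sup>2 / 2 \<le> conv \<kappa> (\<lambda>s. inner (p s) (w s)) t"
      using fc(2) elim by (simp add: w_def)
    then have "ennreal ((norm (w t))\<^sup>2 / 2) \<le> ennreal (conv \<kappa> (\<lambda>s. inner (p s) (w s)) t)" by (rule ennreal_leI)
    also have "\<dots> \<le> nconv \<kappa> (\<lambda>s. ennreal (inner (p s) (w s))) t"
      by (rule conv_le_nconv[OF _ _ int]) (use \<alpha> in auto)
    also have "\<dots> \<le> nconv \<kappa> (\<lambda>s. ennreal L * y s) t" by (rule nconv_mono_AE[OF pw])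
    also have "\<dots> = ennreal L * nconv \<kappa> y t" by (rule nconv_cmult) measurable
    finally have h: "ennreal ((norm (w t))\<^sup>2 / 2) \<le> ennreal L * nconv \<kappa> y t" .
    have "y t \<le> ennreal ((norm (w t))\<^sup>2)" by (auto simp: y_def split: split_indicator)
    also have "\<dots> = ennreal (2 * ((norm (w t))\<^sup>2 / 2))" by simp
    also have "\<dots> = ennreal 2 * ennreal ((norm (w t))\<^sup>2 / 2)" by (rule ennreal_mult) auto
    also have "\<dots> \<le> ennreal 2 * (ennreal L * nconv \<kappa> y t)" by (rule mult_left_mono[OF h]) simp
    also have "\<dots> = ennreal (2 * L) * nconv \<kappa> y t" using L by (simp only: ennreal_mult[of 2 L] zero_le_numeral mult.assoc)
    finally show ?case .
  qed
  obtain \<mu> where \<mu>: "0 < \<mu>" "(2 * L) * \<mu> powr (- \<alpha>) \<le> 1 / 2"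
    using exists_exponent[OF \<alpha>(1), of "2 * L"] L by auto
  define Y where "Y = (\<integral>\<^sup>+ t. ennreal (exp (- \<mu> * t)) * y t \<partial>lborel)"
  \<comment> \<open>Needed for the absorption, since Y = \<infinity> would satisfy Y \<le> Y / 2 as
    well.\<close>
  have Yfin: "Y < \<infinity>"
  proof -
    have "Y \<le> (\<integral>\<^sup>+ t. ennreal c * (ennreal (exp (- \<mu> * t)) * nconv \<kappa> ?P t) \<partial>lborel)"
      unfolding Y_def
    proof (rule nn_integral_mono)
      fix t
      have "y t \<le> ennreal ((norm (w t))\<^sup>2)" by (auto simp: y_def split: split_indicator)
      also have "\<dots> \<le> ennreal c * nconv \<kappa> ?P t"
        unfolding w_def c_def by (rule norm_conv_kern_square_le) (use \<alpha> T ps in auto)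
      finally have "ennreal (exp (- \<mu> * t)) * y t \<le> ennreal (exp (- \<mu> * t)) * (ennreal c * nconv \<kappa> ?P t)"
        by (rule mult_left_mono) simp
      then show "ennreal (exp (- \<mu> * t)) * y t \<le> ennreal c * (ennreal (exp (- \<mu> * t)) * nconv \<kappa> ?P t)"
        by (simp only: mult.left_commute)
    qed
    also have "\<dots> = ennreal c * (\<integral>\<^sup>+ t. ennreal (exp (- \<mu> * t)) * nconv \<kappa> ?P t \<partial>lborel)"
      by (rule nn_integral_cmult) measurable
    also have "\<dots> = ennreal c * (ennreal (\<mu> powr (- \<alpha>)) * (\<integral>\<^sup>+ t. ennreal (exp (- \<mu> * t)) * ?P t \<partial>lborel))"
      by (subst nn_integral_exp_nconv_kern) (use \<alpha> \<mu> in auto)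
    also have "\<dots> < \<infinity>" using expfin[of \<mu>] \<mu> by (simp add: ennreal_mult_less_top)
    finally show ?thesis .
  qed
  have "Y \<le> (\<integral>\<^sup>+ t. ennreal (2 * L) * (ennreal (exp (- \<mu> * t)) * nconv \<kappa> y t) \<partial>lborel)"
    unfolding Y_def
  proof (rule nn_integral_mono_AE)
    show "AE t in lborel. ennreal (exp (- \<mu> * t)) * y t \<le> ennreal (2 * L) * (ennreal (exp (- \<mu> * t)) * nconv \<kappa> y t)"
      using ineq
    proof eventually_elim
      case (elim t)
      then have "ennreal (exp (- \<mu> * t)) * y t \<le> ennreal (exp (- \<mu> * t)) * (ennreal (2 * L) * nconv \<kappa> y t)"
        by (rule mult_left_mono) simp
      then show ?case by (simp only: mult.left_commute)
    qed
  qed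
  also have "\<dots> = ennreal (2 * L) * (\<integral>\<^sup>+ t. ennreal (exp (- \<mu> * t)) * nconv \<kappa> y t \<partial>lborel)"
    by (rule nn_integral_cmult) measurable
  also have "\<dots> = ennreal (2 * L) * (ennreal (\<mu> powr (- \<alpha>)) * Y)"
    unfolding Y_def by (subst nn_integral_exp_nconv_kern) (use \<alpha> \<mu> in auto)
  also have "\<dots> = ennreal ((2 * L) * \<mu> powr (- \<alpha>)) * Y"
    using L by (subst ennreal_mult) (auto simp: mult.assoc)
  also have "\<dots> \<le> ennreal (1 / 2) * Y" by (intro mult_right_mono ennreal_leI \<mu>) simp
  finally have Yle: "Y \<le> ennreal (1 / 2) * Y" .
  obtain r where r: "Y = ennreal r" "0 \<le> r" using Yfin by (cases Y) auto
  then have "ennreal r \<le> ennreal (1 / 2 * r)" using Yle by (simp only: ennreal_mult'[symmetric] r(2))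
  then have "r \<le> 1 / 2 * r" using r(2) by (subst (asm) ennreal_le_iff) auto
  then have "Y = 0" using r by simp
  then have "AE t in lborel. ennreal (exp (- \<mu> * t)) * y t = 0"
    unfolding Y_def by (subst (asm) nn_integral_0_iff_AE) auto
  with w_eq show ?thesis
    by eventually_elim (auto simp: y_def)
qed

end

section \<open>The perturbed problem\<close>

lemma AE_lebesgue_on_Ioo_iff:
  fixes T :: real
  shows "(AE t in lebesgue_on {0<..<T}. P t) \<longleftrightarrow> (AE t in lborel. t \<in> {0<..<T} \<longrightarrow> P t)"
proof -
  have "(AE t in lebesgue_on {0<..<T}. P t) \<longleftrightarrow> (AE t in lebesgue. t \<in> {0<..<T} \<longrightarrow> P t)"
    by (rule AE_restrict_space_iff) simp
  then show ?thesis by (simp only: AE_completion_iff)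
qed

lemma set_integrable_bounded:
  fixes f :: "real \<Rightarrow> 'a::{banach, second_countable_topology}"
  assumes [measurable]: "f \<in> borel_measurable borel" and f: "\<And>s. norm (f s) \<le> R" and K: "K \<in> lmeasurable"
  shows "set_integrable lebesgue K f"
  unfolding set_integrable_def
proof (rule Bochner_Integration.integrable_bound)
  show "integrable lebesgue (\<lambda>s. indicator K s *\<^sub>R R)"
    using K by (intro integrable_scaleR_left integrable_real_indicator) (auto simp: fmeasurable_def)
  show "(\<lambda>s. indicator K s *\<^sub>R f s) \<in> borel_measurable lebesgue"
    using K by (intro borel_measurable_scaleR borel_measurable_indicator borel_measurable_lebesgueI) auto
  show "AE s in lebesgue. norm (indicator K s *\<^sub>R f s) \<le> norm (indicator K s *\<^sub>R R)"
    by (rule AE_I2) (use order_trans[OF f abs_ge_self] in \<open>auto split: split_indicator\<close>)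
qed

text \<open>Translates the integral inside the norm into the convolution calculus; the factor
  \<open>Gamma a\<close> undoes the normalization of the kernel.\<close>

lemma Lp_alpha_integral_eq:
  fixes w w' :: "real \<Rightarrow> 'a::{banach, second_countable_topology}"
  assumes a: "0 < a" and t: "t \<le> T" and [measurable]: "w' \<in> borel_measurable borel"
    and supp: "\<And>s. s \<notin> {0<..<T} \<Longrightarrow> w' s = 0" and eq: "AE s in lborel. s \<in> {0<..<T} \<longrightarrow> w s = w' s"
  shows "(\<integral>\<^sup>+ s\<in>{0..t}. ennreal ((t - s) powr (a - 1) * norm (w s) powr 2) \<partial>lebesgue)
    = ennreal (Gamma a) * nconv (kern a) (\<lambda>s. ennreal ((norm (w' s))\<^sup>2)) t"
proof -
  have G: "0 < Gamma a" using a by simp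
  have "AE s in lborel. (s \<in> {0<..<T} \<longrightarrow> w s = w' s) \<and> s \<noteq> 0 \<and> s \<noteq> t"
    using eq AE_lborel_singleton[of "0::real"] AE_lborel_singleton[of t] by eventually_elim auto
  then have ae: "AE s in lebesgue. (s \<in> {0<..<T} \<longrightarrow> w s = w' s) \<and> s \<noteq> 0 \<and> s \<noteq> t" by (simp add: AE_completion_iff)
  have m: "(\<lambda>s. ennreal (Gamma a) * (ennreal (kern a (t - s)) * ennreal ((norm (w' s))\<^sup>2))) \<in> borel_measurable borel"
    by measurable
  have "(\<integral>\<^sup>+ s\<in>{0..t}. ennreal ((t - s) powr (a - 1) * norm (w s) powr 2) \<partial>lebesgue)
    = (\<integral>\<^sup>+ s. ennreal (Gamma a) * (ennreal (kern a (t - s)) * ennreal ((norm (w' s))\<^sup>2)) \<partial>lebesgue)"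
  proof (rule nn_integral_cong_AE)
    show "AE s in lebesgue. ennreal ((t - s) powr (a - 1) * norm (w s) powr 2) * indicator {0..t} s
      = ennreal (Gamma a) * (ennreal (kern a (t - s)) * ennreal ((norm (w' s))\<^sup>2))"
      using ae
    proof eventually_elim
      case (elim s)
      consider "s < 0" | "t < s" | "0 < s" "s < t" using elim by linarith
      then show ?case
      proof cases
        case 3
        then have "w s = w' s" using elim t by auto
        moreover have e: "Gamma a * (kern a (t - s) * (norm (w' s))\<^sup>2) = (t - s) powr (a - 1) * (norm (w' s))\<^sup>2"
          using 3 G by (simp add: kern_def)
        ultimately show ?thesis using 3 G a by (simp add: ennreal_mult[symmetric] e)
      qed (use supp[of s] in auto)
    qed
  qed
  also have "\<dots> = (\<integral>\<^sup>+ s. ennreal (Gamma a) * (ennreal (kern a (t - s)) * ennreal ((norm (w' s))\<^sup>2)) \<partial>lborel)"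
    using m by (simp add: nn_integral_completion)
  also have "\<dots> = ennreal (Gamma a) * nconv (kern a) (\<lambda>s. ennreal ((norm (w' s))\<^sup>2)) t"
    unfolding nconv_def by (rule nn_integral_cmult) measurable
  finally show ?thesis .
qed

lemma ennreal_powr_half_le_iff:
  assumes "0 \<le> K"
  shows "ennreal_powr x (1 / 2) \<le> ennreal K \<longleftrightarrow> x \<le> ennreal (K\<^sup>2)"
proof (cases x)
  case (real r)
  have "sqrt r \<le> K \<longleftrightarrow> r \<le> K\<^sup>2"
    using assms by (metis real_sqrt_le_iff real_sqrt_unique)
  with real assms show ?thesis by (simp add: ennreal_powr_def powr_half_sqrt ennreal_le_iff)
qed (use assms in \<open>auto simp: ennreal_powr_def top_unique\<close>)

lemma Lp_alpha_norm_le: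
  fixes w w' :: "real \<Rightarrow> 'a::{banach, second_countable_topology}"
  assumes a: "0 < a" and w': "w' \<in> borel_measurable borel" "\<And>s. s \<notin> {0<..<T} \<Longrightarrow> w' s = 0"
    "AE s in lborel. s \<in> {0<..<T} \<longrightarrow> w s = w' s"
    and B: "0 \<le> B" "\<And>t. nconv (kern a) (\<lambda>s. ennreal ((norm (w' s))\<^sup>2)) t \<le> ennreal B"
  shows "Lp_alpha_norm 2 a T w \<le> ennreal (sqrt (Gamma a * B))"
  unfolding Lp_alpha_norm_def
proof (rule SUP_least)
  fix t assume "t \<in> {0..T}"
  then have t: "t \<le> T" by simp
  have eq: "(\<integral>\<^sup>+ s\<in>{0..t}. ennreal ((t - s) powr (a - 1) * norm (w s) powr 2) \<partial>lebesgue)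
      = ennreal (Gamma a) * nconv (kern a) (\<lambda>s. ennreal ((norm (w' s))\<^sup>2)) t"
    by (rule Lp_alpha_integral_eq[OF a t w'])
  have G: "0 < Gamma a" using a by simp
  have "ennreal (Gamma a) * nconv (kern a) (\<lambda>s. ennreal ((norm (w' s))\<^sup>2)) t \<le> ennreal (Gamma a) * ennreal B"
    by (rule mult_left_mono[OF B(2)]) simp
  also have "\<dots> = ennreal ((sqrt (Gamma a * B))\<^sup>2)" using G B by (simp add: ennreal_mult[symmetric])
  finally show "ennreal_powr (\<integral>\<^sup>+ s\<in>{0..t}. ennreal ((t - s) powr (a - 1) * norm (w s) powr 2) \<partial>lebesgue) (1 / 2)
    \<le> ennreal (sqrt (Gamma a * B))"
    unfolding eq using G B by (subst ennreal_powr_half_le_iff) auto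
qed

text \<open>The norm controls times in [0,T]; causality covers earlier times and decay of the kernel
  later ones.\<close>

lemma Lp_alpha_borel_version:
  fixes w :: "real \<Rightarrow> 'a::{banach, second_countable_topology}"
  assumes a: "0 < a" "a \<le> 1" and T: "0 < T" and w: "w \<in> Lp_alpha 2 a T"
  obtains w' B where "w' \<in> borel_measurable borel" "\<And>s. s \<notin> {0<..<T} \<Longrightarrow> w' s = 0"
    "AE s in lborel. s \<in> {0<..<T} \<longrightarrow> w s = w' s" "0 \<le> B"
    "\<And>t. nconv (kern a) (\<lambda>s. ennreal ((norm (w' s))\<^sup>2)) t \<le> ennreal B"
proof -
  have wm: "w \<in> borel_measurable (lebesgue_on {0<..<T})" and fin: "Lp_alpha_norm 2 a T w < \<infinity>"
    using w by (simp_all add: Lp_alpha_def)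
  obtain w' where w': "w' \<in> borel_measurable borel" "\<And>s. s \<notin> {0<..<T} \<Longrightarrow> w' s = 0"
    "AE s in lborel. s \<in> {0<..<T} \<longrightarrow> w s = w' s"
    using borel_version_on[OF wm] by metis
  have G: "0 < Gamma a" using a by simp
  obtain K where K: "Lp_alpha_norm 2 a T w = ennreal K" "0 \<le> K" using fin by (cases "Lp_alpha_norm 2 a T w") auto
  let ?B = "K\<^sup>2 / Gamma a"
  have inside: "nconv (kern a) (\<lambda>s. ennreal ((norm (w' s))\<^sup>2)) t \<le> ennreal ?B" if t: "t \<in> {0..T}" for t
  proof -
    have eq: "(\<integral>\<^sup>+ s\<in>{0..t}. ennreal ((t - s) powr (a - 1) * norm (w s) powr 2) \<partial>lebesgue)
      = ennreal (Gamma a) * nconv (kern a) (\<lambda>s. ennreal ((norm (w' s))\<^sup>2)) t"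
      by (rule Lp_alpha_integral_eq[OF a(1) _ w']) (use t in auto)
    have "ennreal_powr (\<integral>\<^sup>+ s\<in>{0..t}. ennreal ((t - s) powr (a - 1) * norm (w s) powr 2) \<partial>lebesgue) (1 / 2) \<le> ennreal K"
      unfolding K(1)[symmetric] Lp_alpha_norm_def by (rule SUP_upper[OF t])
    then have "ennreal (Gamma a) * nconv (kern a) (\<lambda>s. ennreal ((norm (w' s))\<^sup>2)) t \<le> ennreal (K\<^sup>2)"
      unfolding ennreal_powr_half_le_iff[OF K(2)] eq .
    then have "ennreal (1 / Gamma a) * (ennreal (Gamma a) * nconv (kern a) (\<lambda>s. ennreal ((norm (w' s))\<^sup>2)) t)
      \<le> ennreal (1 / Gamma a) * ennreal (K\<^sup>2)" by (rule mult_left_mono) simp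
    then show ?thesis using G by (simp add: mult.assoc[symmetric] ennreal_mult[symmetric])
  qed
  have "nconv (kern a) (\<lambda>s. ennreal ((norm (w' s))\<^sup>2)) t \<le> ennreal ?B" for t
  proof -
    consider "t \<le> 0" | "t \<in> {0..T}" | "T \<le> t" by fastforce
    then show ?thesis
    proof cases
      case 1
      then have "nconv (kern a) (\<lambda>s. ennreal ((norm (w' s))\<^sup>2)) t = 0"
        by (intro nconv_kern_eq_0) (use w'(2) in auto)
      then show ?thesis by simp
    next
      case 3
      have "nconv (kern a) (\<lambda>s. ennreal ((norm (w' s))\<^sup>2)) t \<le> nconv (kern a) (\<lambda>s. ennreal ((norm (w' s))\<^sup>2)) T"
        by (rule nconv_kern_le_right[OF a _ 3]) (use w'(2) in auto)
      also have "\<dots> \<le> ennreal ?B" by (rule inside) (use T in auto)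
      finally show ?thesis .
    qed (rule inside)
  qed
  then show ?thesis using w' G by (intro that[of w' ?B]) auto
qed

text \<open>A Borel version in t for fixed x has an exceptional set that depends on x. Versions for
  a countable dense set of x give one null set N; off N the function is kept, on N it is set to 0,
  and the Lipschitz condition carries measurability from the dense set to all x.\<close>

lemma caratheodory_lipschitz_borel_version:
  fixes \<Psi> :: "real \<Rightarrow> 'a::{banach, second_countable_topology} \<Rightarrow> 'a"
  assumes \<Psi>: "caratheodory_lipschitz T \<Psi>"
  obtains L \<Psi>' where "0 \<le> L" "\<And>x. (\<lambda>t. \<Psi>' t x) \<in> borel_measurable borel" "\<And>t x. t \<notin> {0<..<T} \<Longrightarrow> \<Psi>' t x = 0"
    "\<And>t x y. norm (\<Psi>' t x - \<Psi>' t y) \<le> L * norm (x - y)"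
    "AE t in lborel. t \<in> {0<..<T} \<longrightarrow> (\<forall>x. \<Psi> t x = \<Psi>' t x)"
proof -
  obtain L where L: "L > 0" and Lip: "AE t in lebesgue_on {0<..<T}. \<forall>x y. norm (\<Psi> t x - \<Psi> t y) \<le> L * norm (x - y)"
    and meas: "\<And>x. (\<lambda>t. \<Psi> t x) \<in> borel_measurable (lebesgue_on {0<..<T})"
    using \<Psi> by (auto simp: caratheodory_lipschitz_def)
  obtain D :: "'a set" where D: "countable D" "\<And>X. open X \<Longrightarrow> X \<noteq> {} \<Longrightarrow> \<exists>d\<in>D. d \<in> X"
    using countable_dense_exists by blast
  have "\<exists>h. h \<in> borel_measurable borel \<and> (AE t in lborel. t \<in> {0<..<T} \<longrightarrow> \<Psi> t d = h t)" for d
    using borel_version_on[OF meas[of d]] by metis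
  then obtain h where h[measurable]: "\<And>d. h d \<in> borel_measurable borel"
    and heq: "\<And>d. AE t in lborel. t \<in> {0<..<T} \<longrightarrow> \<Psi> t d = h d t" by metis
  define Q where "Q t \<longleftrightarrow> t \<in> {0<..<T} \<longrightarrow>
    (\<forall>x y. norm (\<Psi> t x - \<Psi> t y) \<le> L * norm (x - y)) \<and> (\<forall>d\<in>D. \<Psi> t d = h d t)" for t
  have "AE t in lborel. \<forall>d\<in>D. t \<in> {0<..<T} \<longrightarrow> \<Psi> t d = h d t" by (subst AE_ball_countable[OF D(1)]) (use heq in blast)
  with Lip[unfolded AE_lebesgue_on_Ioo_iff] have "AE t in lborel. Q t"
    unfolding Q_def by eventually_elim blast
  then obtain N where N: "{t \<in> space lborel. \<not> Q t} \<subseteq> N" "emeasure lborel N = 0" "N \<in> sets lborel" by (rule AE_E)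
  have [measurable]: "N \<in> sets borel" using N(3) by simp
  define S where "S = {0<..<T} - N"
  have S[measurable]: "S \<in> sets borel" unfolding S_def by measurable
  have SQ: "Q t" "t \<in> {0<..<T}" if "t \<in> S" for t using that N(1) by (auto simp: S_def)
  define \<Psi>' where "\<Psi>' t x = (if t \<in> S then \<Psi> t x else 0)" for t x
  have Lip': "norm (\<Psi>' t x - \<Psi>' t y) \<le> L * norm (x - y)" for t x y
    using SQ[of t] L by (auto simp: \<Psi>'_def Q_def)
  show ?thesis
  proof (rule that[of L \<Psi>'])
    show "(\<lambda>t. \<Psi>' t x) \<in> borel_measurable borel" for x
    proof -
      have "\<exists>d\<in>D. d \<in> ball x (inverse (real (Suc n)))" for n by (rule D(2)) auto
      then obtain d where d: "\<And>n. d n \<in> D" "\<And>n. d n \<in> ball x (inverse (real (Suc n)))" by metis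
      have lim: "d \<longlonglongrightarrow> x"
      proof (subst tendsto_dist_iff, rule tendsto_sandwich[OF _ _ tendsto_const LIMSEQ_inverse_real_of_nat])
        show "\<forall>\<^sub>F n in sequentially. dist (d n) x \<le> inverse (real (Suc n))"
          using d(2) by (intro always_eventually) (auto simp: dist_commute less_imp_le)
      qed simp
      have "(\<lambda>t. indicator S t *\<^sub>R h (d n) t) \<in> borel_measurable borel" for n by measurable
      moreover have "(\<lambda>t. indicator S t *\<^sub>R h (d n) t) = (\<lambda>t. \<Psi>' t (d n))" for n
        using SQ d(1)[of n] by (intro ext) (auto simp: \<Psi>'_def Q_def split: split_indicator)
      ultimately have "(\<lambda>t. \<Psi>' t (d n)) \<in> borel_measurable borel" for n by simp
      then show ?thesis
        by (rule borel_measurable_LIMSEQ_metric) (rule Lipschitz_tendsto[OF Lip' lim])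
    qed
    have "AE t in lborel. t \<notin> N" using N by (intro AE_not_in) (auto simp: null_sets_def)
    then show "AE t in lborel. t \<in> {0<..<T} \<longrightarrow> (\<forall>x. \<Psi> t x = \<Psi>' t x)"
      by eventually_elim (auto simp: \<Psi>'_def S_def)
  qed (use L Lip' in \<open>auto simp: \<Psi>'_def S_def\<close>)
qed

section \<open>Energy solutions of the abstract problem\<close>

context gradient_flow
begin

text \<open>Cauchy-Schwarz on (0,t) instead of (0,T) retains the factor t^\<alpha>, whose decay at 0
  gives the initial condition.\<close>

lemma conv_initial_bound:
  assumes [measurable]: "g \<in> borel_measurable borel" and supp: "\<And>s. s \<notin> I \<Longrightarrow> g s = 0" and t: "0 \<le> t"
    and K: "0 \<le> K" "\<And>t. nconv \<kappa> (\<lambda>s. ennreal ((norm (g s))\<^sup>2)) t \<le> ennreal K"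
  shows "(norm (conv \<kappa> g t))\<^sup>2 \<le> exp 1 * t powr \<alpha> * K"
proof (cases "t = 0")
  case True
  then show ?thesis using conv_kern_eq_0[of g t \<alpha>] supp by simp
next
  case False
  have "ennreal ((norm (conv \<kappa> g t))\<^sup>2) \<le> (nconv \<kappa> (\<lambda>s. ennreal (norm (g s))) t)\<^sup>2"
    using norm_conv_le[of \<kappa> g t] \<alpha> by (simp add: ennreal_power[symmetric] power_mono)
  also have "\<dots> \<le> nconv \<kappa> (indicator {0<..}) t * nconv \<kappa> (\<lambda>s. (ennreal (norm (g s)))\<^sup>2) t"
    by (rule nconv_Cauchy_Schwarz) (use \<alpha> supp in auto)
  also have "\<dots> \<le> ennreal (exp 1 * t powr \<alpha>) * ennreal K"
    by (intro mult_mono nconv_kern_indicator_le) (use \<alpha> t False K(2) in \<open>auto simp: ennreal_power\<close>)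
  also have "\<dots> = ennreal (exp 1 * t powr \<alpha> * K)" by (rule ennreal_mult[symmetric]) (use K in auto)
  finally show ?thesis using K by (subst (asm) ennreal_le_iff) auto
qed

lemma initial_value_attained:
  fixes w :: "real \<Rightarrow> 'a"
  assumes [measurable]: "w \<in> borel_measurable borel" and K: "0 \<le> K"
    and w: "\<And>t. 0 \<le> t \<Longrightarrow> (norm (w t))\<^sup>2 \<le> exp 1 * t powr \<alpha> * K"
  shows "((\<lambda>t. (1 / t) * (LINT s:{0..t}|lebesgue. (norm (w s))\<^sup>2)) \<longlongrightarrow> 0) (at_right 0)"
proof (rule tendsto_sandwich[where f = "\<lambda>_. 0" and h = "\<lambda>t. exp 1 * t powr \<alpha> * K"])
  have ev: "\<forall>\<^sub>F t in at_right 0. 0 < (t::real)" by (simp add: eventually_at_filter)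
  show "\<forall>\<^sub>F t in at_right 0. 0 \<le> (1 / t) * (LINT s:{0..t}|lebesgue. (norm (w s))\<^sup>2)"
    using ev
  proof eventually_elim
    case (elim t)
    have "0 \<le> (LINT s:{0..t}|lebesgue. (norm (w s))\<^sup>2)"
      unfolding set_lebesgue_integral_def by (rule Bochner_Integration.integral_nonneg) simp
    then show ?case using elim by simp
  qed
  show "\<forall>\<^sub>F t in at_right 0. (1 / t) * (LINT s:{0..t}|lebesgue. (norm (w s))\<^sup>2) \<le> exp 1 * t powr \<alpha> * K"
    using ev
  proof eventually_elim
    case (elim t)
    let ?M = "exp 1 * t powr \<alpha> * K"
    have le: "(norm (w s))\<^sup>2 \<le> ?M" if "s \<in> {0..t}" for s
    proof -
      have "(norm (w s))\<^sup>2 \<le> exp 1 * s powr \<alpha> * K" using that by (intro w) auto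
      also have "\<dots> \<le> ?M" using that K \<alpha> by (intro mult_right_mono mult_left_mono powr_mono2) auto
      finally show ?thesis .
    qed
    have i2: "set_integrable lebesgue {0..t} (\<lambda>s. ?M)"
      unfolding set_integrable_def using elim by (intro integrable_scaleR_left integrable_real_indicator) auto
    have i1: "set_integrable lebesgue {0..t} (\<lambda>s. (norm (w s))\<^sup>2)"
      unfolding set_integrable_def
    proof (rule Bochner_Integration.integrable_bound[OF i2[unfolded set_integrable_def]])
      show "(\<lambda>s. indicator {0..t} s *\<^sub>R (norm (w s))\<^sup>2) \<in> borel_measurable lebesgue"
        by (rule borel_measurable_lebesgueI) measurable
      show "AE s in lebesgue. norm (indicator {0..t} s *\<^sub>R (norm (w s))\<^sup>2) \<le> norm (indicator {0..t} s *\<^sub>R ?M)"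
        using le K by (intro AE_I2) (auto split: split_indicator)
    qed
    have "(LINT s:{0..t}|lebesgue. (norm (w s))\<^sup>2) \<le> (LINT s:{0..t}|lebesgue. ?M)"
      by (rule set_integral_mono[OF i1 i2 le])
    also have "\<dots> = t * ?M" using elim by (simp add: set_lebesgue_integral_def)
    finally show ?case using elim by (simp add: field_simps)
  qed
  have "((\<lambda>t. t powr \<alpha>) \<longlongrightarrow> 0 powr \<alpha>) (at_right 0)"
    by (rule tendsto_powr2) (use \<alpha> in \<open>auto simp: eventually_at_filter\<close>)
  from tendsto_mult_right[OF tendsto_mult_left[OF this]]
  have "((\<lambda>t. exp 1 * t powr \<alpha> * K) \<longlongrightarrow> exp 1 * 0 powr \<alpha> * K) (at_right 0)" .
  then show "((\<lambda>t. exp 1 * t powr \<alpha> * K) \<longlongrightarrow> 0) (at_right 0)" by simp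
qed simp

theorem energy_solution_exists_unique:
  assumes data: "AE t in lborel. t \<in> I \<longrightarrow> (\<forall>x. f t - \<Psi> t x = \<Theta> t x)"
  shows "\<exists>u. energy_solution \<alpha> T \<Phi> \<Psi> f u0 u \<and>
    (\<forall>v. energy_solution \<alpha> T \<Phi> \<Psi> f u0 v \<longrightarrow> (AE t in lebesgue_on I. v t = u t)) \<and>
    (\<forall>g. has_caputo_derivative \<alpha> T u u0 g \<longrightarrow> Lp_alpha_norm 2 \<alpha> T g \<le> ennreal (sqrt (Gamma \<alpha> * C1)))"
proof -
  obtain g where g[measurable]: "g \<in> borel_measurable borel" and supp: "\<And>t. t \<notin> I \<Longrightarrow> g t = 0"
    and gC: "\<And>t. nconv \<kappa> (\<lambda>s. ennreal ((norm (g s))\<^sup>2)) t \<le> ennreal C1"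
    and incl: "AE t in lborel. t \<in> I \<longrightarrow> \<Theta> t (u0 + conv \<kappa> g t) - g t \<in> subdifferential \<Phi> (u0 + conv \<kappa> g t)"
    using solution_exists by blast
  have g2: "(\<integral>\<^sup>+ s. ennreal ((norm (g s))\<^sup>2) \<partial>lborel) < \<infinity>"
    by (rule le_less_trans[OF L2_le_nconv[OF g supp C1_nonneg gC]]) auto
  have gi: "integrable lborel g"
    unfolding integrable_iff_bounded using nn_integral_L1_of_L2[OF g supp g2] by simp
  define u where "u t = u0 + conv \<kappa> g t" for t
  have u[measurable]: "u \<in> borel_measurable borel" unfolding u_def[abs_def] by measurable
  define R where "R = norm u0 + sqrt (c * C1)"
  have u_bound: "norm (u t) \<le> R" for t
  proof -
    have "ennreal ((norm (conv \<kappa> g t))\<^sup>2) \<le> ennreal c * nconv \<kappa> (\<lambda>s. ennreal ((norm (g s))\<^sup>2)) t"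
      unfolding c_def by (rule norm_conv_kern_square_le) (use \<alpha> T supp in auto)
    also have "\<dots> \<le> ennreal c * ennreal C1" by (rule mult_left_mono[OF gC]) simp
    also have "\<dots> = ennreal (c * C1)" by (rule ennreal_mult[symmetric]) (rule c_nonneg C1_nonneg)+
    finally have "(norm (conv \<kappa> g t))\<^sup>2 \<le> c * C1"
      using c_nonneg C1_nonneg by (subst (asm) ennreal_le_iff) auto
    then have "norm (conv \<kappa> g t) \<le> sqrt (c * C1)" by (rule real_le_rsqrt)
    then show ?thesis unfolding u_def R_def by (rule order_trans[OF norm_triangle_ineq add_left_mono])
  qed
  have L2: "w \<in> L2_space T" if w[measurable]: "w \<in> borel_measurable borel"
    and i: "set_integrable lebesgue I (\<lambda>t. (norm (w t))\<^sup>2)" for w :: "real \<Rightarrow> 'a"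
  proof -
    have "w \<in> borel_measurable (lebesgue_on I)"
      by (rule measurable_restrict_space1) (rule borel_measurable_lebesgueI[OF w])
    then show ?thesis using i by (simp add: L2_space_def integrable_restrict_space set_integrable_def)
  qed
  have uL2: "u \<in> L2_space T"
  proof (rule L2[OF u])
    show "set_integrable lebesgue I (\<lambda>t. (norm (u t))\<^sup>2)"
      by (rule set_integrable_bounded[where R = "R\<^sup>2"]) (use u_bound in \<open>auto intro!: power_mono\<close>)
  qed
  have gL2: "g \<in> L2_space T"
  proof (rule L2[OF g])
    have "integrable lborel (\<lambda>t. (norm (g t))\<^sup>2)" unfolding integrable_iff_bounded using g2 by simp
    then have "integrable lebesgue (\<lambda>t. (norm (g t))\<^sup>2)" by (simp add: integrable_completion)
    then show "set_integrable lebesgue I (\<lambda>t. (norm (g t))\<^sup>2)"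
      unfolding set_integrable_def by (intro integrable_mult_indicator) auto
  qed
  have "locally_integrable {0..<T} u"
    unfolding locally_integrable_def using u_bound
    by (auto intro!: set_integrable_bounded[where R = R] lmeasurable_compact)
  then have caputo: "has_caputo_derivative \<alpha> T u u0 g"
    unfolding u_def[abs_def] by (intro has_caputo_derivative_conv \<alpha> gi) (auto intro: supp)
  have sol: "energy_solution \<alpha> T \<Phi> \<Psi> f u0 u"
    unfolding energy_solution_def
  proof (intro conjI exI[of _ g])
    show "((\<lambda>t. (1 / t) * (LINT s:{0..t}|lebesgue. (norm (u s - u0))\<^sup>2)) \<longlongrightarrow> 0) (at_right 0)"
      by (rule initial_value_attained[OF _ C1_nonneg])
        (use conv_initial_bound[OF g supp _ C1_nonneg gC] in \<open>auto simp: u_def\<close>)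
    show "AE t in lebesgue_on I. \<exists>\<xi>\<in>subdifferential \<Phi> (u t). g t + \<xi> + \<Psi> t (u t) = f t"
      unfolding AE_lebesgue_on_Ioo_iff using incl data
    proof eventually_elim
      case (elim t)
      show ?case
      proof
        assume t: "t \<in> I"
        have "g t + (\<Theta> t (u t) - g t) + \<Psi> t (u t) = f t" using elim(2) t by (metis add_diff_cancel_left' add.commute diff_add_cancel)
        then show "\<exists>\<xi>\<in>subdifferential \<Phi> (u t). g t + \<xi> + \<Psi> t (u t) = f t"
          using elim(1) t unfolding u_def by blast
      qed
    qed
  qed (use uL2 gL2 caputo in auto)
  have uniq: "AE t in lebesgue_on I. v t = u t" if v: "energy_solution \<alpha> T \<Phi> \<Psi> f u0 v" for v
  proof -
    obtain gv where vL2: "v \<in> L2_space T" and gv: "has_caputo_derivative \<alpha> T v u0 gv" "gv \<in> L2_space T"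
      and vi: "AE t in lebesgue_on I. \<exists>\<xi>\<in>subdifferential \<Phi> (v t). gv t + \<xi> + \<Psi> t (v t) = f t"
      using v unfolding energy_solution_def by blast
    obtain \<gamma> where \<gamma>: "\<gamma> \<in> borel_measurable borel" "\<And>s. s \<notin> I \<Longrightarrow> \<gamma> s = 0"
      "(\<integral>\<^sup>+ s. ennreal ((norm (\<gamma> s))\<^sup>2) \<partial>lborel) < \<infinity>"
      and \<gamma>g: "AE s in lborel. s \<in> I \<longrightarrow> gv s = \<gamma> s"
      and \<gamma>v: "AE s in lborel. s \<in> I \<longrightarrow> v s = u0 + conv \<kappa> \<gamma> s"
      by (rule caputo_derivative_representation[OF \<alpha> T vL2 gv(2,1)]) (rule that)
    have "AE t in lborel. t \<in> I \<longrightarrow> \<Theta> t (u0 + conv \<kappa> \<gamma> t) - \<gamma> t \<in> subdifferential \<Phi> (u0 + conv \<kappa> \<gamma> t)"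
      using vi[unfolded AE_lebesgue_on_Ioo_iff] \<gamma>g \<gamma>v data
    proof eventually_elim
      case (elim t)
      show ?case
      proof
        assume t: "t \<in> I"
        then obtain \<xi> where \<xi>: "\<xi> \<in> subdifferential \<Phi> (v t)" "gv t + \<xi> + \<Psi> t (v t) = f t" using elim(1) by blast
        have "\<Theta> t (v t) = f t - \<Psi> t (v t)" using elim(4) t by simp
        moreover have "f t = \<gamma> t + \<xi> + \<Psi> t (v t)" using \<xi>(2) elim(2) t by simp
        ultimately have "\<Theta> t (v t) - \<gamma> t = \<xi>" by simp
        then show "\<Theta> t (u0 + conv \<kappa> \<gamma> t) - \<gamma> t \<in> subdifferential \<Phi> (u0 + conv \<kappa> \<gamma> t)"
          using \<xi>(1) elim(3) t by simp
      qed
    qed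
    then have "AE t in lborel. t \<in> I \<longrightarrow> conv \<kappa> \<gamma> t = conv \<kappa> g t"
      by (intro solution_unique[OF \<gamma>(1) g] \<gamma> supp g2 incl)
    with \<gamma>v show ?thesis unfolding AE_lebesgue_on_Ioo_iff by eventually_elim (simp add: u_def)
  qed
  \<comment> \<open>Every representative of the Caputo derivative agrees with g almost everywhere on
    (0,T), so the energy bound of g applies to it.\<close>
  have "Lp_alpha_norm 2 \<alpha> T g' \<le> ennreal (sqrt (Gamma \<alpha> * C1))" if "has_caputo_derivative \<alpha> T u u0 g'" for g'
    by (rule Lp_alpha_norm_le[OF \<alpha>(1) g supp has_caputo_derivative_unique[OF that caputo] C1_nonneg gC])
  with sol uniq show ?thesis by blast
qed

end

section \<open>Reduction of the perturbed problem to the abstract one\<close>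

lemma sum4_square_le:
  fixes a b c d :: real
  shows "(a + b + c + d)\<^sup>2 \<le> 4 * (a\<^sup>2 + b\<^sup>2 + c\<^sup>2 + d\<^sup>2)"
proof -
  have "0 \<le> (a - b)\<^sup>2 + (a - c)\<^sup>2 + (a - d)\<^sup>2 + (b - c)\<^sup>2 + (b - d)\<^sup>2 + (c - d)\<^sup>2" by simp
  then show ?thesis by (simp add: power2_eq_square algebra_simps)
qed

lemma perturbed_gradient_flow_well_posed:
  fixes \<Phi> :: "'a::{real_inner, banach, second_countable_topology} \<Rightarrow> ereal"
  assumes T: "0 < T" and \<alpha>: "0 < \<alpha>" "\<alpha> < 1"
    and \<Phi>: "\<And>w. \<Phi> w \<noteq> -\<infinity>" "ereal_convex \<Phi>" "lower_semicontinuous \<Phi>" "effective_domain \<Phi> \<noteq> {}" "\<And>w. ereal m \<le> \<Phi> w"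
    and \<Psi>: "caratheodory_lipschitz T \<Psi>" and w0: "w0 \<in> Lp_alpha 2 \<alpha> T" "(\<lambda>t. \<Psi> t (w0 t)) \<in> Lp_alpha 2 \<alpha> T"
    and u0: "u0 \<in> effective_domain \<Phi>" and f: "f \<in> Lp_alpha 2 \<alpha> T"
  shows "\<exists>C u. energy_solution \<alpha> T \<Phi> \<Psi> f u0 u \<and>
    (\<forall>v. energy_solution \<alpha> T \<Phi> \<Psi> f u0 v \<longrightarrow> (AE t in lebesgue_on {0<..<T}. v t = u t)) \<and>
    (\<forall>g. has_caputo_derivative \<alpha> T u u0 g \<longrightarrow> Lp_alpha_norm 2 \<alpha> T g \<le> ennreal C)"
proof -
  have \<alpha>1: "\<alpha> \<le> 1" using \<alpha> by simp
  obtain \<phi>0 where \<phi>0: "\<Phi> u0 = ereal \<phi>0"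
    using u0 \<Phi>(1)[of u0] by (cases "\<Phi> u0") (auto simp: effective_domain_def)
  obtain L \<Psi>' where L: "0 \<le> L" and \<Psi>'m: "\<And>x. (\<lambda>t. \<Psi>' t x) \<in> borel_measurable borel"
    and \<Psi>'s: "\<And>t x. t \<notin> {0<..<T} \<Longrightarrow> \<Psi>' t x = 0" and \<Psi>'L: "\<And>t x y. norm (\<Psi>' t x - \<Psi>' t y) \<le> L * norm (x - y)"
    and \<Psi>'eq: "AE t in lborel. t \<in> {0<..<T} \<longrightarrow> (\<forall>x. \<Psi> t x = \<Psi>' t x)"
    by (rule caratheodory_lipschitz_borel_version[OF \<Psi>]) (rule that)
  obtain f' Bf where f'm[measurable]: "f' \<in> borel_measurable borel" and f's: "\<And>s. s \<notin> {0<..<T} \<Longrightarrow> f' s = 0"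
    and f'eq: "AE s in lborel. s \<in> {0<..<T} \<longrightarrow> f s = f' s" and Bf: "0 \<le> Bf" "\<And>t. nconv (kern \<alpha>) (\<lambda>s. ennreal ((norm (f' s))\<^sup>2)) t \<le> ennreal Bf"
    by (rule Lp_alpha_borel_version[OF \<alpha>(1) \<alpha>1 T f]) (rule that)
  obtain w Bw where wm[measurable]: "w \<in> borel_measurable borel" and ws: "\<And>s. s \<notin> {0<..<T} \<Longrightarrow> w s = 0"
    and weq: "AE s in lborel. s \<in> {0<..<T} \<longrightarrow> w0 s = w s" and Bw: "0 \<le> Bw" "\<And>t. nconv (kern \<alpha>) (\<lambda>s. ennreal ((norm (w s))\<^sup>2)) t \<le> ennreal Bw"
    by (rule Lp_alpha_borel_version[OF \<alpha>(1) \<alpha>1 T w0(1)]) (rule that)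
  obtain z Bz where zm[measurable]: "z \<in> borel_measurable borel" and zs: "\<And>s. s \<notin> {0<..<T} \<Longrightarrow> z s = 0"
    and zeq: "AE s in lborel. s \<in> {0<..<T} \<longrightarrow> \<Psi> s (w0 s) = z s" and Bz: "0 \<le> Bz" "\<And>t. nconv (kern \<alpha>) (\<lambda>s. ennreal ((norm (z s))\<^sup>2)) t \<le> ennreal Bz"
    by (rule Lp_alpha_borel_version[OF \<alpha>(1) \<alpha>1 T w0(2)]) (rule that)
  define \<Theta> where "\<Theta> t x = f' t - \<Psi>' t x" for t x
  \<comment> \<open>To bound \<Theta> at u0, it is split into f, \<Psi> along w0, a Lipschitz term
    in w0 and one in u0; \<open>b\<close> is the contribution of the constant L norm u0. The factor
    4 in \<open>B\<close> comes from squaring a sum of four terms.\<close>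
  define b where "b = (L * norm u0)\<^sup>2 * (exp 1 * T powr \<alpha>)"
  define B where "B = 4 * (Bf + Bz + L\<^sup>2 * Bw + b)"
  have b: "0 \<le> b" by (simp add: b_def)
  have B: "0 \<le> B" unfolding B_def using Bf(1) Bz(1) Bw(1) b by simp
  have pointwise: "AE s in lborel. ennreal ((norm (\<Theta> s u0))\<^sup>2)
    \<le> ennreal 4 * (ennreal ((norm (f' s))\<^sup>2) + (ennreal ((norm (z s))\<^sup>2) + (ennreal (L\<^sup>2) * ennreal ((norm (w s))\<^sup>2) + ennreal ((L * norm u0)\<^sup>2) * indicator {0<..<T} s)))"
    using \<Psi>'eq weq zeq
  proof eventually_elim
    case (elim s)
    show ?case
    proof (cases "s \<in> {0<..<T}")
      case True
      have "\<Psi>' s (w s) = z s" using elim True by metis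
      then have "\<Theta> s u0 = f' s - z s + (\<Psi>' s (w s) - \<Psi>' s u0)" by (simp add: \<Theta>_def)
      then have "norm (\<Theta> s u0) \<le> norm (f' s) + norm (z s) + norm (\<Psi>' s (w s) - \<Psi>' s u0)"
        by (metis norm_triangle_ineq norm_triangle_ineq4 add_right_mono order_trans)
      also have "\<dots> \<le> norm (f' s) + norm (z s) + L * norm (w s - u0)" using \<Psi>'L by simp
      also have "\<dots> \<le> norm (f' s) + norm (z s) + L * (norm (w s) + norm u0)"
        by (intro add_left_mono mult_left_mono norm_triangle_ineq4 L)
      finally have "norm (\<Theta> s u0) \<le> norm (f' s) + norm (z s) + L * norm (w s) + L * norm u0" by (simp add: algebra_simps)
      then have "(norm (\<Theta> s u0))\<^sup>2 \<le> (norm (f' s) + norm (z s) + L * norm (w s) + L * norm u0)\<^sup>2"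
        by (rule power_mono) simp
      also have "\<dots> \<le> 4 * ((norm (f' s))\<^sup>2 + (norm (z s))\<^sup>2 + (L * norm (w s))\<^sup>2 + (L * norm u0)\<^sup>2)" by (rule sum4_square_le)
      also have "\<dots> = 4 * ((norm (f' s))\<^sup>2 + ((norm (z s))\<^sup>2 + (L\<^sup>2 * (norm (w s))\<^sup>2 + (L * norm u0)\<^sup>2)))"
        by (simp add: power_mult_distrib)
      finally have "ennreal ((norm (\<Theta> s u0))\<^sup>2) \<le> ennreal (4 * ((norm (f' s))\<^sup>2 + ((norm (z s))\<^sup>2 + (L\<^sup>2 * (norm (w s))\<^sup>2 + (L * norm u0)\<^sup>2))))"
        by (rule ennreal_leI)
      also have "\<dots> = ennreal 4 * (ennreal ((norm (f' s))\<^sup>2) + (ennreal ((norm (z s))\<^sup>2) + (ennreal (L\<^sup>2) * ennreal ((norm (w s))\<^sup>2) + ennreal ((L * norm u0)\<^sup>2))))"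
        by (simp only: ennreal_mult ennreal_plus zero_le_power2 zero_le_numeral add_nonneg_nonneg mult_nonneg_nonneg)
      finally show ?thesis using True by simp
    qed (simp add: \<Theta>_def f's \<Psi>'s)
  qed
  have \<Theta>_bound: "nconv (kern \<alpha>) (\<lambda>s. ennreal ((norm (\<Theta> s u0))\<^sup>2)) t \<le> ennreal B" for t
  proof -
    have "nconv (kern \<alpha>) (\<lambda>s. ennreal ((norm (\<Theta> s u0))\<^sup>2)) t
      \<le> nconv (kern \<alpha>) (\<lambda>s. ennreal 4 * (ennreal ((norm (f' s))\<^sup>2) + (ennreal ((norm (z s))\<^sup>2) + (ennreal (L\<^sup>2) * ennreal ((norm (w s))\<^sup>2) + ennreal ((L * norm u0)\<^sup>2) * indicator {0<..<T} s)))) t"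
      by (rule nconv_mono_AE[OF pointwise])
    also have "\<dots> = ennreal 4 * (nconv (kern \<alpha>) (\<lambda>s. ennreal ((norm (f' s))\<^sup>2)) t + (nconv (kern \<alpha>) (\<lambda>s. ennreal ((norm (z s))\<^sup>2)) t
        + (ennreal (L\<^sup>2) * nconv (kern \<alpha>) (\<lambda>s. ennreal ((norm (w s))\<^sup>2)) t + ennreal ((L * norm u0)\<^sup>2) * nconv (kern \<alpha>) (indicator {0<..<T}) t)))"
      by (subst nconv_cmult; measurable?; (subst nconv_add; measurable?)+) (simp add: nconv_cmult)
    also have "\<dots> \<le> ennreal 4 * (ennreal Bf + (ennreal Bz + (ennreal (L\<^sup>2) * ennreal Bw + ennreal ((L * norm u0)\<^sup>2) * ennreal (exp 1 * T powr \<alpha>))))"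
      by (intro mult_left_mono add_mono Bf Bz Bw nconv_kern_Ioo_le \<alpha> \<alpha>1 T) auto
    also have "\<dots> = ennreal (4 * (Bf + (Bz + (L\<^sup>2 * Bw + b))))"
      unfolding b_def using Bf(1) Bz(1) Bw(1)
      by (simp only: ennreal_mult ennreal_plus zero_le_power2 zero_le_numeral add_nonneg_nonneg mult_nonneg_nonneg exp_ge_zero powr_ge_zero)
    also have "\<dots> = ennreal B" by (simp add: B_def add.assoc)
    finally show ?thesis .
  qed
  interpret gradient_flow \<Phi> m \<alpha> T L B \<phi>0 u0 \<Theta>
  proof unfold_locales
    show "(\<lambda>t. \<Theta> t x) \<in> borel_measurable borel" for x
      unfolding \<Theta>_def by (intro borel_measurable_diff f'm \<Psi>'m)
    show "norm (\<Theta> t x - \<Theta> t y) \<le> L * norm (x - y)" for t x y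
      using \<Psi>'L[of t y x] by (simp add: \<Theta>_def norm_minus_commute)
    show "\<Theta> t x = 0" if "t \<notin> {0<..<T}" for t x using that by (simp add: \<Theta>_def f's \<Psi>'s)
  qed (use T \<alpha> \<Phi> L B \<phi>0 \<Theta>_bound in auto)
  have "AE t in lborel. t \<in> {0<..<T} \<longrightarrow> (\<forall>x. f t - \<Psi> t x = \<Theta> t x)"
    using f'eq \<Psi>'eq by eventually_elim (simp add: \<Theta>_def)
  from energy_solution_exists_unique[OF this] show ?thesis by (rule exI)
qed

theorem theorem6p2:
  "\<exists>C :: real \<Rightarrow> real \<Rightarrow> 'a \<Rightarrow> (real \<Rightarrow> 'a) \<Rightarrow> ('a \<Rightarrow> ereal) \<Rightarrow> (real \<Rightarrow> 'a \<Rightarrow> 'a) \<Rightarrow> real.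
     \<forall>(\<alpha>::real) (T::real) (u0::'a::{real_inner, banach, second_countable_topology})
      (f::real \<Rightarrow> 'a) (\<Phi>::'a \<Rightarrow> ereal) (\<Psi>::real \<Rightarrow> 'a \<Rightarrow> 'a).
       0 < T \<and> 0 < \<alpha> \<and> \<alpha> < 1 \<and>
       (\<forall>w. \<Phi> w \<noteq> -\<infinity>) \<and> ereal_convex \<Phi> \<and> lower_semicontinuous \<Phi> \<and>
       effective_domain \<Phi> \<noteq> {} \<and> (\<exists>m::real. \<forall>w. ereal m \<le> \<Phi> w) \<and>
       caratheodory_lipschitz T \<Psi> \<and>
       (\<exists>w0\<in>Lp_alpha 2 \<alpha> T. (\<lambda>t. \<Psi> t (w0 t)) \<in> Lp_alpha 2 \<alpha> T) \<and>
       u0 \<in> effective_domain \<Phi> \<and> f \<in> Lp_alpha 2 \<alpha> T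
       \<longrightarrow>
       (\<exists>u. energy_solution \<alpha> T \<Phi> \<Psi> f u0 u \<and>
            (\<forall>v. energy_solution \<alpha> T \<Phi> \<Psi> f u0 v \<longrightarrow>
                 (AE t in lebesgue_on {0<..<T}. v t = u t)) \<and>
            (\<forall>g. has_caputo_derivative \<alpha> T u u0 g \<longrightarrow>
                 Lp_alpha_norm 2 \<alpha> T g \<le> ennreal (C \<alpha> T u0 f \<Phi> \<Psi>)))"
proof (rule exI, intro allI impI)
  fix \<alpha> T :: real and u0 :: 'a and f :: "real \<Rightarrow> 'a" and \<Phi> :: "'a \<Rightarrow> ereal" and \<Psi> :: "real \<Rightarrow> 'a \<Rightarrow> 'a"
  let ?Q = "\<lambda>\<alpha> T u0 f \<Phi> \<Psi> c. \<exists>u. energy_solution \<alpha> T \<Phi> \<Psi> f u0 u \<and>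
            (\<forall>v. energy_solution \<alpha> T \<Phi> \<Psi> f u0 v \<longrightarrow>
                 (AE t in lebesgue_on {0<..<T}. v t = u t)) \<and>
            (\<forall>g. has_caputo_derivative \<alpha> T u u0 g \<longrightarrow>
                 Lp_alpha_norm 2 \<alpha> T g \<le> ennreal c)"
  assume "0 < T \<and> 0 < \<alpha> \<and> \<alpha> < 1 \<and>
       (\<forall>w. \<Phi> w \<noteq> -\<infinity>) \<and> ereal_convex \<Phi> \<and> lower_semicontinuous \<Phi> \<and>
       effective_domain \<Phi> \<noteq> {} \<and> (\<exists>m::real. \<forall>w. ereal m \<le> \<Phi> w) \<and>
       caratheodory_lipschitz T \<Psi> \<and>
       (\<exists>w0\<in>Lp_alpha 2 \<alpha> T. (\<lambda>t. \<Psi> t (w0 t)) \<in> Lp_alpha 2 \<alpha> T) \<and>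
       u0 \<in> effective_domain \<Phi> \<and> f \<in> Lp_alpha 2 \<alpha> T"
  then have "\<exists>c. ?Q \<alpha> T u0 f \<Phi> \<Psi> c"
    by (elim conjE exE bexE) (rule perturbed_gradient_flow_well_posed, auto)
  \<comment> \<open>The bound is chosen separately for each tuple of data. The property ?Q refers to
    nothing beyond these data, so the choice is a function of them.\<close>
  then show "?Q \<alpha> T u0 f \<Phi> \<Psi> ((\<lambda>\<alpha> T u0 f \<Phi> \<Psi>. SOME c. ?Q \<alpha> T u0 f \<Phi> \<Psi> c) \<alpha> T u0 f \<Phi> \<Psi>)"
    by (rule someI_ex)
qed

end
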